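(* Let $(R,\mathfrak m,\mathbb K=R/\mathfrak m)$ be a regular local ring with regular system of parameters $(x)=(x_1,\ldots,x_n)$, and let $\widehat R$ be its $\mathfrak m$-adic completion. Let $f\in R$ be an element whose Newton polyhedron $\operatorname{NP}(f)$ (with respect to $(x)$) has a loose edge $\mathcal E$. Suppose that the initial form $\operatorname{in}_{\mathcal E}(f)\in\mathbb K[X_1,\ldots,X_n]$ of $f$ along $\mathcal E$ is a product $\operatorname{in}_{\mathcal E}(f)=G\cdot H$ of two coprime polynomials $G,H\in\mathbb K[X_1,\ldots,X_n]$, where $G$ is not divisible by any of the variables $X_1,\ldots,X_n$. Then there exist elements $\widehat g,\widehat h\in\widehat R$ such that $$f=\widehat g\cdot\widehat h\quad\text{in }\widehat R,$$ and there exist compact faces $\mathcal E_1$ of $\operatorname{NP}(\widehat g)$ and $\mathcal E_2$ of $\operatorname{NP}(\widehat h)$, each of dimension at most one, such that $\mathcal E=\mathcal E_1+\mathcal E_2$ (Minkowski sum), $\operatorname{in}_{\mathcal E_1}(\widehat g)=G$ and $\operatorname{in}_{\mathcal E_2}(\widehat h)=H$.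
   Context: Multi-index notation: $x^A=x_1^{A_1}\cdots x_n^{A_n}$ for $A\in\mathbb Z_{\ge0}^n$. The ring $R$ need not be complete and may have mixed characteristic. Newton polyhedron. Every $f\in R\setminus\{0\}$ has a finite expansion $f=\sum_A\rho_A x^A$ with $\rho_A\in R^\times\cup\{0\}$. The Newton polyhedron $\operatorname{NP}(f)\subset\mathbb R^n_{\ge0}$ is the smallest closed convex subset containing $\{A\in\mathbb Z^n_{\ge0}\mid\rho_A\ne0\}+\mathbb R^n_{\ge0}$ (it does not depend on the chosen expansion). Since $\widehat R$ is again a regular local ring with regular system of parameters $(x)$ and residue field $\mathbb K$, the same definitions apply to elements of $\widehat R$. Faces. A linear form $L:\mathbb R^n\to\mathbb R$ is a map $L(v)=\lambda_1v_1+\cdots+\lambda_nv_n$ with fixed $\lambda\in\mathbb R^n_{\ge0}$; it is positive if all $\lambda_i>0$. A compact face of $\operatorname{NP}(f)$ is a set $\mathcal F$ of all points of $\operatorname{NP}(f)$ at which some positive linear form $L$ attains its minimum on $\operatorname{NP}(f)$; one says that $L$ determines $\mathcal F$. A vertex (resp. edge) is a compact face of dimension $0$ (resp. $1$). A loose edge is a compact edge that is not contained in any compact face of dimension $\ge2$. Initial form. Let $\mathcal F$ be a compact face of $\operatorname{NP}(f)$, determined by the positive linear form $L$, and let $f=\sum_A\rho_Ax^A$ be a finite expansion with $A\in\mathbb Z^n_{\ge0}$ and $\rho_A\in R^\times\cup\{0\}$. The initial form of $f$ along $\mathcal F$ is $\operatorname{in}_{\mathcal F}(f)=\sum_{A:\,L(A)=\nu_L(f)}\overline{\rho_A}\,X^A$,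 where $\nu_L(f)=\min\{L(A)\mid\rho_A\neq0\}$ and $\overline{\rho_A}=\rho_A\bmod\mathfrak m\in\mathbb K$; equivalently, the sum is over all $A\in\mathcal F$. It lies in the graded ring of $R$ associated to the monomial valuation $\nu_L$, which is identified with the polynomial ring $\mathbb K[X_1,\ldots,X_n]$ ($X_i$ being the image of $x_i$). It depends only on $f$, $(x)$ and $\mathcal F$. *)

theory Defs
  imports
    "HOL-Analysis.Analysis"
    "HOL-Algebra.Ring_Divisibility"
    "HOL-Algebra.Ideal_Product"
begin

section \<open>Regular local rings\<close>

definition max_ideal :: "('a, 'b) ring_scheme \<Rightarrow> 'a set" where
  "max_ideal R = (THE I. maximalideal I R)"

definition residue_field :: "('a, 'b) ring_scheme \<Rightarrow> 'a set ring" where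
  "residue_field R = R Quot max_ideal R"

definition krull_dim :: "('a, 'b) ring_scheme \<Rightarrow> enat" where
  "krull_dim R = (SUP k \<in> {k. \<exists>P :: nat \<Rightarrow> 'a set.
      (\<forall>i\<le>k. primeideal (P i) R) \<and> (\<forall>i<k. P i \<subset> P (Suc i))}. enat k)"

definition noetherian_local_ring :: "('a, 'b) ring_scheme \<Rightarrow> bool" where
  "noetherian_local_ring R \<longleftrightarrow>
     cring R \<and> noetherian_ring R \<and> (\<exists>!I. maximalideal I R)"

definition regular_local_ring :: "('a, 'b) ring_scheme \<Rightarrow> bool" where
  "regular_local_ring R \<longleftrightarrow> noetherian_local_ring R \<and>
     (\<exists>S \<subseteq> carrier R. finite S \<and> Idl\<^bsub>R\<^esub> S = max_ideal R \<and> enat (card S) = krull_dim R)"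

definition regular_system_of_parameters ::
  "('a, 'b) ring_scheme \<Rightarrow> ('n::finite \<Rightarrow> 'a) \<Rightarrow> bool" where
  "regular_system_of_parameters R x \<longleftrightarrow>
     range x \<subseteq> carrier R \<and> Idl\<^bsub>R\<^esub> (range x) = max_ideal R \<and> enat CARD('n) = krull_dim R"


section \<open>The completion of a local ring at its maximal ideal\<close>

abbreviation max_ideal_pow :: "('a, 'b) ring_scheme \<Rightarrow> nat \<Rightarrow> 'a set" where
  "max_ideal_pow R k \<equiv> max_ideal R [^]\<^bsub>ideals_set R\<^esub> k"

text \<open>The inverse limit of the rings \<open>R / m ^ k\<close>.  An element is a sequence of cosets;
  compatibility with the projections \<open>R / m ^ (k + 1) \<rightarrow> R / m ^ k\<close> says that each coset
  of \<open>m ^ (k + 1)\<close> lies inside the preceding coset of \<open>m ^ k\<close>.\<close>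

definition adic_completion :: "('a, 'b) ring_scheme \<Rightarrow> (nat \<Rightarrow> 'a set) ring" where
  "adic_completion R =
     \<lparr>carrier = {s. \<forall>k. s k \<in> carrier (R Quot max_ideal_pow R k) \<and> s (Suc k) \<subseteq> s k},
      mult = (\<lambda>s t k. s k \<otimes>\<^bsub>R Quot max_ideal_pow R k\<^esub> t k),
      one = (\<lambda>k. \<one>\<^bsub>R Quot max_ideal_pow R k\<^esub>),
      zero = (\<lambda>k. \<zero>\<^bsub>R Quot max_ideal_pow R k\<^esub>),
      add = (\<lambda>s t k. s k \<oplus>\<^bsub>R Quot max_ideal_pow R k\<^esub> t k)\<rparr>"

definition to_completion :: "('a, 'b) ring_scheme \<Rightarrow> 'a \<Rightarrow> nat \<Rightarrow> 'a set" where
  "to_completion R r = (\<lambda>k. max_ideal_pow R k +>\<^bsub>R\<^esub> r)"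

text \<open>The canonical identification of the residue field of \<open>R\<close> with that of its completion,
  induced by \<^const>\<open>to_completion\<close>: the image of a coset under the composite map to the
  residue field of the completion is a singleton.\<close>

definition residue_to_completion :: "('a, 'b) ring_scheme \<Rightarrow> 'a set \<Rightarrow> (nat \<Rightarrow> 'a set) set" where
  "residue_to_completion R C =
     the_elem ((\<lambda>r. max_ideal (adic_completion R) +>\<^bsub>adic_completion R\<^esub> to_completion R r) ` C)"


section \<open>Polynomials in finitely many variables\<close>

text \<open>A polynomial in the variables \<open>X i\<close>, with \<open>i\<close> ranging over a finite type, is its
  finitely supported coefficient function on exponent vectors.\<close>

definition mpoly_ring :: "('k, 'b) ring_scheme \<Rightarrow> (nat ^ 'n::finite \<Rightarrow> 'k) ring" where
  "mpoly_ring K =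
     \<lparr>carrier = {p. (\<forall>A. p A \<in> carrier K) \<and> finite {A. p A \<noteq> \<zero>\<^bsub>K\<^esub>}},
      mult = (\<lambda>p q A. \<Oplus>\<^bsub>K\<^esub>BC\<in>{(B, C). B + C = A}. p (fst BC) \<otimes>\<^bsub>K\<^esub> q (snd BC)),
      one = (\<lambda>A. if A = 0 then \<one>\<^bsub>K\<^esub> else \<zero>\<^bsub>K\<^esub>),
      zero = (\<lambda>A. \<zero>\<^bsub>K\<^esub>),
      add = (\<lambda>p q A. p A \<oplus>\<^bsub>K\<^esub> q A)\<rparr>"

definition mpoly_var :: "('k, 'b) ring_scheme \<Rightarrow> 'n::finite \<Rightarrow> nat ^ 'n \<Rightarrow> 'k" where
  "mpoly_var K i = (\<lambda>A. if A = axis i 1 then \<one>\<^bsub>K\<^esub> else \<zero>\<^bsub>K\<^esub>)"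

definition coprime_elements :: "('a, 'b) ring_scheme \<Rightarrow> 'a \<Rightarrow> 'a \<Rightarrow> bool" where
  "coprime_elements P a b \<longleftrightarrow>
     (\<forall>d \<in> carrier P. d divides\<^bsub>P\<^esub> a \<longrightarrow> d divides\<^bsub>P\<^esub> b \<longrightarrow> d \<in> Units P)"


section \<open>Newton polyhedra and initial forms\<close>

definition power_product ::
  "('a, 'b) ring_scheme \<Rightarrow> ('n::finite \<Rightarrow> 'a) \<Rightarrow> nat ^ 'n \<Rightarrow> 'a" where
  "power_product R x A = (\<Otimes>\<^bsub>R\<^esub>i\<in>UNIV. x i [^]\<^bsub>R\<^esub> (A $ i))"

definition is_expansion ::
  "('a, 'b) ring_scheme \<Rightarrow> ('n::finite \<Rightarrow> 'a) \<Rightarrow> 'a \<Rightarrow> (nat ^ 'n \<Rightarrow> 'a) \<Rightarrow> bool" where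
  "is_expansion R x f \<rho> \<longleftrightarrow>
     (\<forall>A. \<rho> A \<in> Units R \<union> {\<zero>\<^bsub>R\<^esub>}) \<and> finite {A. \<rho> A \<noteq> \<zero>\<^bsub>R\<^esub>} \<and>
     f = (\<Oplus>\<^bsub>R\<^esub>A\<in>{A. \<rho> A \<noteq> \<zero>\<^bsub>R\<^esub>}. \<rho> A \<otimes>\<^bsub>R\<^esub> power_product R x A)"

text \<open>Expansions are not unique, but for a regular system of parameters neither the Newton
  polyhedron nor the initial forms below depend on the one chosen here.\<close>

definition expansion ::
  "('a, 'b) ring_scheme \<Rightarrow> ('n::finite \<Rightarrow> 'a) \<Rightarrow> 'a \<Rightarrow> nat ^ 'n \<Rightarrow> 'a" where
  "expansion R x f = (SOME \<rho>. is_expansion R x f \<rho>)"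

definition real_exponent :: "nat ^ 'n::finite \<Rightarrow> real ^ 'n" where
  "real_exponent A = (\<chi> i. real (A $ i))"

definition newton_polyhedron ::
  "('a, 'b) ring_scheme \<Rightarrow> ('n::finite \<Rightarrow> 'a) \<Rightarrow> 'a \<Rightarrow> (real ^ 'n) set" where
  "newton_polyhedron R x f =
     (\<lambda>C. closed C \<and> convex C) hull
       {real_exponent A + v | A v. expansion R x f A \<noteq> \<zero>\<^bsub>R\<^esub> \<and> (\<forall>i. 0 \<le> v $ i)}"

text \<open>The linear form with coefficient vector \<open>l\<close> is \<open>v \<mapsto> l \<bullet> v\<close>.\<close>

definition compact_face :: "(real ^ 'n::finite) set \<Rightarrow> (real ^ 'n) set \<Rightarrow> bool" where
  "compact_face N F \<longleftrightarrow> F \<noteq> {} \<and>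
     (\<exists>l :: real ^ 'n. (\<forall>i. 0 < l $ i) \<and> F = {v \<in> N. \<forall>w\<in>N. l \<bullet> v \<le> l \<bullet> w})"

definition loose_edge :: "(real ^ 'n::finite) set \<Rightarrow> (real ^ 'n) set \<Rightarrow> bool" where
  "loose_edge N E \<longleftrightarrow> compact_face N E \<and> aff_dim E = 1 \<and>
     \<not> (\<exists>F. compact_face N F \<and> 2 \<le> aff_dim F \<and> E \<subseteq> F)"

text \<open>If the positive linear form \<open>L\<close> determines the compact face \<open>F\<close>, then the exponents of
  an expansion at which \<open>L\<close> is minimal are exactly those lying in \<open>F\<close>.\<close>

definition initial_form ::
  "('a, 'b) ring_scheme \<Rightarrow> ('n::finite \<Rightarrow> 'a) \<Rightarrow> 'a \<Rightarrow> (real ^ 'n) set \<Rightarrow> nat ^ 'n \<Rightarrow> 'a set" where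
  "initial_form R x f F =
     (\<lambda>A. if real_exponent A \<in> F then max_ideal R +>\<^bsub>R\<^esub> expansion R x f A
          else \<zero>\<^bsub>residue_field R\<^esub>)"

end

(* Looseness of the edge E means that every nonnegative linear form constant along E attains
   its minimum over the support of f on E.  So this support lies in a cone that is graded by
   one positive integral weight constant on E.  The supports of G and H lie on lines parallel to
   E, hence G and H are univariate polynomials up to a monomial factor and satisfy a Bezout
   identity; because no variable divides G, the identity can be shifted to
   X^gamma = G U + H V with nonnegative exponents for every gamma in the cone.  Therefore
   each error term z of positive relative weight has the form g u + h v modulo higher weight,
   where g and h lift G and H, and a Hensel iteration converges in the completion.  The
   initial forms of the limits are read off from the lifts because the parameters are
   algebraically independent (Krull's height theorem), which makes the lowest-weight part of
   an expansion unique. *)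


theory Submission
  imports
    Defs
    "HOL-Computational_Algebra.Polynomial"
    "HOL-Algebra.UnivPoly"
begin

section \<open>Prime ideals in Noetherian rings\<close>

text \<open>The ring need not contain a field, so coefficients cannot be compared one by one: a sum
  of two units may fall into the maximal ideal and dissolve into higher monomials. Every identity is
  therefore stated as membership of a difference in an ideal generated by monomials, and a
  coefficient from the maximal ideal is traded for monomials of larger weight. Weight alone does not
  drive the iteration. A monomial of large weight outside the cone need not be reachable with
  nonnegative exponents, so errors are kept in ideals generated by monomials inside a cone. Separate
  cones belong to the two factors and to their product, and they add up under multiplication.
  Corrections are computed from the initial lifts, never from the current factors: the accumulated
  changes have positive relative weight, so the discrepancy is of higher order. Newton polyhedra
  need finite expansions, also in the completion. They come from infinite ones by grouping terms
  over the finitely many minimal exponents; only lowest-weight parts are ever compared.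
  Localisations are replaced by saturated ideals.\<close>

locale noetherian_cring = noetherian_ring R + cring R for R (structure)

section \<open>Ideals: closure rules, adjoining an element, saturation at a prime\<close>

context cring
begin

lemma ideal_facts:
  assumes "ideal I R"
  shows "I \<subseteq> carrier R" "\<zero> \<in> I"
    "\<And>a. a \<in> I \<Longrightarrow> a \<in> carrier R"
    "\<And>a b. a \<in> I \<Longrightarrow> b \<in> I \<Longrightarrow> a \<oplus> b \<in> I"
    "\<And>a. a \<in> I \<Longrightarrow> \<ominus> a \<in> I"
    "\<And>a b. a \<in> I \<Longrightarrow> b \<in> I \<Longrightarrow> a \<ominus> b \<in> I"
    "\<And>a r. a \<in> I \<Longrightarrow> r \<in> carrier R \<Longrightarrow> r \<otimes> a \<in> I"
    "\<And>a r. a \<in> I \<Longrightarrow> r \<in> carrier R \<Longrightarrow> a \<otimes> r \<in> I"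
proof -
  interpret I: ideal I R by fact
  show "I \<subseteq> carrier R" "\<zero> \<in> I" "\<And>a. a \<in> I \<Longrightarrow> a \<in> carrier R"
    "\<And>a b. a \<in> I \<Longrightarrow> b \<in> I \<Longrightarrow> a \<oplus> b \<in> I"
    "\<And>a. a \<in> I \<Longrightarrow> \<ominus> a \<in> I"
    "\<And>a r. a \<in> I \<Longrightarrow> r \<in> carrier R \<Longrightarrow> r \<otimes> a \<in> I"
    "\<And>a r. a \<in> I \<Longrightarrow> r \<in> carrier R \<Longrightarrow> a \<otimes> r \<in> I"
    using I.a_subset I.Icarr I.I_l_closed I.I_r_closed by auto
  show "\<And>a b. a \<in> I \<Longrightarrow> b \<in> I \<Longrightarrow> a \<ominus> b \<in> I"
    unfolding a_minus_def by auto
qed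

lemma ideal_finsum:
  assumes "ideal I R" "\<And>i. i \<in> F \<Longrightarrow> r i \<in> I"
  shows "(\<Oplus>i\<in>F. r i) \<in> I"
proof (cases "finite F")
  case True
  then show ?thesis using assms(2)
  proof (induction F)
    case empty
    then show ?case using ideal_facts(2)[OF assms(1)] by simp
  next
    case (insert i F)
    have "r \<in> F \<rightarrow> carrier R" "r i \<in> carrier R"
      using insert.prems ideal_facts(1)[OF assms(1)] by auto
    then show ?case
      using insert ideal_facts(4)[OF assms(1)] by (simp add: finsum_insert)
  qed
next
  case False
  then show ?thesis using ideal_facts(2)[OF assms(1)] by (simp add: finsum_infinite)
qed

lemma ideal_intro:
  assumes "I \<subseteq> carrier R" "\<zero> \<in> I"
    "\<And>a b. a \<in> I \<Longrightarrow> b \<in> I \<Longrightarrow> a \<oplus> b \<in> I"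
    "\<And>a r. a \<in> I \<Longrightarrow> r \<in> carrier R \<Longrightarrow> r \<otimes> a \<in> I"
  shows "ideal I R"
proof (rule idealI)
  show "ring R" ..
  have neg: "\<ominus> a \<in> I" if "a \<in> I" for a
  proof -
    have "\<ominus> a = (\<ominus> \<one>) \<otimes> a" using that assms(1) by (simp add: l_minus subset_iff)
    then show ?thesis using assms(4)[OF that, of "\<ominus> \<one>"] by simp
  qed
  show "subgroup I (add_monoid R)"
    by (rule subgroup.intro) (use assms neg in \<open>auto simp: a_inv_def[symmetric]\<close>)
  show "\<And>a x. a \<in> I \<Longrightarrow> x \<in> carrier R \<Longrightarrow> x \<otimes> a \<in> I" by (rule assms)
  show "a \<otimes> x \<in> I" if "a \<in> I" "x \<in> carrier R" for a x
    using assms(4)[OF that] that assms(1) m_comm[of a x] by auto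
qed

text \<open>For an ideal \<open>I\<close> this is \<open>I\<close> + R \<open>b\<close>. Membership
  is phrased so that a coefficient \<open>t\<close> of \<open>b\<close> can be extracted
  directly.\<close>

definition extend_ideal :: "'a set \<Rightarrow> 'a \<Rightarrow> 'a set" where
  "extend_ideal I b = {z \<in> carrier R. \<exists>t\<in>carrier R. z \<ominus> t \<otimes> b \<in> I}"

text \<open>For a prime \<open>P\<close> and an ideal \<open>J\<close> this is the preimage of the
  extension of \<open>J\<close> under the map from the ring to its localisation at \<open>P\<close>.
  Ideals of the localisation correspond to the ideals fixed by this operation, so local arguments
  stay inside the ring and no fractions are formed.\<close>

definition saturation :: "'a set \<Rightarrow> 'a set \<Rightarrow> 'a set" where
  "saturation P J = {r \<in> carrier R. \<exists>s\<in>carrier R - P. s \<otimes> r \<in> J}"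

lemma extend_idealI:
  "z \<in> carrier R \<Longrightarrow> t \<in> carrier R \<Longrightarrow> z \<ominus> t \<otimes> b \<in> I \<Longrightarrow> z \<in> extend_ideal I b"
  by (auto simp: extend_ideal_def)

lemma extend_ideal_is_ideal:
  assumes "ideal I R" "b \<in> carrier R"
  shows "ideal (extend_ideal I b) R"
proof (rule ideal_intro)
  note I = ideal_facts[OF assms(1)]
  show "extend_ideal I b \<subseteq> carrier R" by (auto simp: extend_ideal_def)
  show "\<zero> \<in> extend_ideal I b" unfolding extend_ideal_def
    by (auto intro!: bexI[of _ \<zero>] simp: assms I)
  fix x assume "x \<in> extend_ideal I b"
  then obtain t where t: "x \<in> carrier R" "t \<in> carrier R" "x \<ominus> t \<otimes> b \<in> I"
    by (auto simp: extend_ideal_def)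
  show "r \<otimes> x \<in> extend_ideal I b" if r: "r \<in> carrier R" for r
  proof -
    have "r \<otimes> x \<ominus> (r \<otimes> t) \<otimes> b = r \<otimes> (x \<ominus> t \<otimes> b)"
      using t r assms(2) by algebra
    then show ?thesis
      using I(7)[OF t(3) r] t r by (intro extend_idealI[of _ "r \<otimes> t"]) auto
  qed
  fix y assume "y \<in> extend_ideal I b"
  then obtain u where u: "y \<in> carrier R" "u \<in> carrier R" "y \<ominus> u \<otimes> b \<in> I"
    by (auto simp: extend_ideal_def)
  have "x \<oplus> y \<ominus> (t \<oplus> u) \<otimes> b = (x \<ominus> t \<otimes> b) \<oplus> (y \<ominus> u \<otimes> b)"
    using t u assms(2) by algebra
  then show "x \<oplus> y \<in> extend_ideal I b"
    using I(4)[OF t(3) u(3)] t u by (intro extend_idealI[of _ "t \<oplus> u"]) auto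
qed

lemma extend_ideal_superset:
  assumes "ideal I R" "b \<in> carrier R"
  shows "I \<subseteq> extend_ideal I b" "b \<in> extend_ideal I b"
proof -
  note I = ideal_facts[OF assms(1)]
  show "I \<subseteq> extend_ideal I b"
  proof
    fix z assume z: "z \<in> I"
    have "z \<ominus> \<zero> \<otimes> b = z" using I(3)[OF z] assms(2) by algebra
    then show "z \<in> extend_ideal I b" using z I(3)[OF z] by (intro extend_idealI[of _ \<zero>]) auto
  qed
  have "b \<ominus> \<one> \<otimes> b = \<zero>" using assms(2) by algebra
  then have "b \<ominus> \<one> \<otimes> b \<in> I" using I(2) by (simp only:)
  then show "b \<in> extend_ideal I b" using extend_idealI[of b \<one>] assms(2) by blast
qed

lemma extend_ideal_least:
  assumes "ideal J R" "I \<subseteq> J" "b \<in> J"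
  shows "extend_ideal I b \<subseteq> J"
proof
  note J = ideal_facts[OF assms(1)]
  fix z assume "z \<in> extend_ideal I b"
  then obtain t where t: "z \<in> carrier R" "t \<in> carrier R" "z \<ominus> t \<otimes> b \<in> J"
    using assms by (auto simp: extend_ideal_def)
  have "z = (z \<ominus> t \<otimes> b) \<oplus> t \<otimes> b" using t J(3)[OF assms(3)] by algebra
  then show "z \<in> J" using J(4)[OF t(3) J(7)[OF assms(3) t(2)]] by simp
qed

lemma extend_ideal_mono: "I \<subseteq> J \<Longrightarrow> extend_ideal I b \<subseteq> extend_ideal J b"
  by (auto simp: extend_ideal_def)

text \<open>The ideal quotient of \<open>L\<close> by \<open>B\<close>. Being an ideal, it reduces
  claims about products to claims about generators; for a single element it records which multiples
  of that element already lie in \<open>L\<close>.\<close>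

lemma colon_ideal:
  assumes "ideal L R" "B \<subseteq> carrier R"
  shows "ideal {a \<in> carrier R. \<forall>b\<in>B. a \<otimes> b \<in> L} R"
proof (rule ideal_intro)
  note L = ideal_facts[OF assms(1)]
  show "\<zero> \<in> {a \<in> carrier R. \<forall>b\<in>B. a \<otimes> b \<in> L}" using assms(2) L(2) by auto
  fix a assume a: "a \<in> {a \<in> carrier R. \<forall>b\<in>B. a \<otimes> b \<in> L}"
  show "r \<otimes> a \<in> {a \<in> carrier R. \<forall>b\<in>B. a \<otimes> b \<in> L}" if r: "r \<in> carrier R" for r
  proof -
    have "r \<otimes> a \<otimes> b \<in> L" if b: "b \<in> B" for b
    proof -
      have "r \<otimes> a \<otimes> b = r \<otimes> (a \<otimes> b)" using a b r assms(2) by (intro m_assoc) auto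
      then show ?thesis using L(7)[OF _ r] a b by auto
    qed
    then show ?thesis using a r by simp
  qed
  fix a' assume a': "a' \<in> {a \<in> carrier R. \<forall>b\<in>B. a \<otimes> b \<in> L}"
  have "(a \<oplus> a') \<otimes> b \<in> L" if b: "b \<in> B" for b
  proof -
    have "(a \<oplus> a') \<otimes> b = a \<otimes> b \<oplus> a' \<otimes> b" using a b a' assms(2) by (intro l_distr) auto
    then show ?thesis using L(4) a a' b by auto
  qed
  then show "a \<oplus> a' \<in> {a \<in> carrier R. \<forall>b\<in>B. a \<otimes> b \<in> L}" using a a' by simp
qed auto

lemma prime_facts:
  assumes "primeideal P R"
  shows "ideal P R" "\<one> \<notin> P" "P \<noteq> carrier R"
    "\<And>a b. a \<in> carrier R \<Longrightarrow> b \<in> carrier R \<Longrightarrow> a \<otimes> b \<in> P \<Longrightarrow> a \<notin> P \<Longrightarrow> b \<in> P"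
    "\<And>a n. a \<in> carrier R \<Longrightarrow> a [^] (n::nat) \<in> P \<Longrightarrow> a \<in> P"
proof -
  interpret P: primeideal P R by fact
  show "ideal P R" ..
  show 1: "\<one> \<notin> P" using P.I_notcarr P.one_imp_carrier by auto
  show "P \<noteq> carrier R" using P.I_notcarr by auto
  show 2: "\<And>a b. a \<in> carrier R \<Longrightarrow> b \<in> carrier R \<Longrightarrow> a \<otimes> b \<in> P \<Longrightarrow> a \<notin> P \<Longrightarrow> b \<in> P"
    using P.I_prime by blast
  show "a \<in> P" if "a \<in> carrier R" "a [^] (n::nat) \<in> P" for a n
    using that(2)
  proof (induction n)
    case 0
    then show ?case using 1 by simp
  next
    case (Suc n)
    then have "a [^] n \<otimes> a \<in> P" by simp
    with 2[OF _ that(1) this] Suc.IH show ?case using that(1) by blast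
  qed
qed

lemma saturationI:
  "r \<in> carrier R \<Longrightarrow> s \<in> carrier R \<Longrightarrow> s \<notin> P \<Longrightarrow> s \<otimes> r \<in> J \<Longrightarrow> r \<in> saturation P J"
  by (auto simp: saturation_def)

text \<open>Closure under sums comes from multiplying the two denominators, whose product stays
  outside \<open>P\<close> because \<open>P\<close> is prime.\<close>

lemma saturation_ideal:
  assumes "primeideal P R" "ideal J R"
  shows "ideal (saturation P J) R"
proof (rule ideal_intro)
  note P = prime_facts[OF assms(1)] and J = ideal_facts[OF assms(2)]
  show "saturation P J \<subseteq> carrier R" by (auto simp: saturation_def)
  show "\<zero> \<in> saturation P J" using P(2) J(2) by (auto simp: saturation_def intro!: bexI[of _ \<one>])
  fix a assume "a \<in> saturation P J"
  then obtain s where s: "a \<in> carrier R" "s \<in> carrier R" "s \<notin> P" "s \<otimes> a \<in> J"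
    by (auto simp: saturation_def)
  show "r \<otimes> a \<in> saturation P J" if r: "r \<in> carrier R" for r
  proof -
    have "s \<otimes> (r \<otimes> a) = r \<otimes> (s \<otimes> a)" using s r by algebra
    then show ?thesis using s r J(7)[OF s(4) r] by (intro saturationI[of _ s]) auto
  qed
  fix b assume "b \<in> saturation P J"
  then obtain u where u: "b \<in> carrier R" "u \<in> carrier R" "u \<notin> P" "u \<otimes> b \<in> J"
    by (auto simp: saturation_def)
  have "(s \<otimes> u) \<otimes> (a \<oplus> b) = u \<otimes> (s \<otimes> a) \<oplus> s \<otimes> (u \<otimes> b)" using s u by algebra
  moreover have "s \<otimes> u \<notin> P" using P(4) s u by blast
  ultimately show "a \<oplus> b \<in> saturation P J"
    using s u J(4)[OF J(7)[OF s(4) u(2)] J(7)[OF u(4) s(2)]]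
    by (intro saturationI[of _ "s \<otimes> u"]) auto
qed

lemma saturation_superset:
  assumes "primeideal P R" "ideal J R"
  shows "J \<subseteq> saturation P J"
  using prime_facts(2)[OF assms(1)] ideal_facts(1)[OF assms(2)]
  by (intro subsetI saturationI[of _ \<one>]) auto

lemma saturation_mono: "I \<subseteq> J \<Longrightarrow> saturation P I \<subseteq> saturation P J"
  by (auto simp: saturation_def)

lemma saturation_idem:
  assumes "primeideal P R"
  shows "saturation P (saturation P J) \<subseteq> saturation P J"
proof
  note P = prime_facts[OF assms(1)]
  fix r assume "r \<in> saturation P (saturation P J)"
  then obtain s u where s: "r \<in> carrier R" "s \<in> carrier R" "s \<notin> P" "u \<in> carrier R" "u \<notin> P" "u \<otimes> (s \<otimes> r) \<in> J"
    by (auto simp: saturation_def)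
  have "(u \<otimes> s) \<otimes> r \<in> J" using s by (simp add: m_assoc)
  moreover have "u \<otimes> s \<notin> P" using P(4) s by blast
  ultimately show "r \<in> saturation P J" using s by (intro saturationI[of _ "u \<otimes> s"]) auto
qed

text \<open>The descending chain condition for the localisation of \<open>R / J\<close> at \<open>P\<close>, expressed
  through saturated ideals of \<open>R\<close>.\<close>

definition saturated_dcc :: "'a set \<Rightarrow> 'a set \<Rightarrow> bool" where
  "saturated_dcc P J \<longleftrightarrow> (\<forall>C :: nat \<Rightarrow> 'a set.
     (\<forall>n. ideal (C n) R \<and> saturation P (C n) \<subseteq> C n \<and> C (Suc n) \<subseteq> C n \<and> J \<subseteq> C n) \<longrightarrow>
     (\<exists>N. \<forall>n\<ge>N. C (Suc n) = C n))"

lemma saturated_dccD: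
  assumes "saturated_dcc P J"
    "\<And>n. ideal (C n) R \<and> saturation P (C n) \<subseteq> C n \<and> C (Suc n) \<subseteq> C n \<and> J \<subseteq> C n"
  shows "\<exists>N. \<forall>n\<ge>N. C (Suc n) = C n"
  using assms unfolding saturated_dcc_def by blast

end

section \<open>Krull's principal ideal theorem and height theorem\<close>

context noetherian_cring
begin

text \<open>Noetherian induction as existence of a maximal element: a nonempty chain of ideals
  contains its own union, so Zorn's lemma applies to every nonempty family.\<close>

lemma maximal_element:
  assumes "\<S> \<noteq> {}" "\<And>I. I \<in> \<S> \<Longrightarrow> ideal I R"
  obtains M where "M \<in> \<S>" "\<And>I. I \<in> \<S> \<Longrightarrow> M \<subseteq> I \<Longrightarrow> I = M"
proof -
  have "\<exists>M\<in>\<S>. \<forall>X\<in>\<S>. M \<subseteq> X \<longrightarrow> X = M"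
  proof (rule subset_Zorn_nonempty[OF assms(1)])
    fix C assume C: "C \<noteq> {}" "subset.chain \<S> C"
    have "subset.chain {I. ideal I R} C"
      using C(2) assms(2) unfolding pred_on.chain_def by blast
    from ideal_chain_is_trivial[OF C(1) this] show "\<Union> C \<in> \<S>"
      using C(2) unfolding pred_on.chain_def by blast
  qed
  then show ?thesis using that by blast
qed

text \<open>A Noetherian local ring with a single prime is Artinian. Let \<open>M\<close> be maximal
  among the ideals for which the chain condition fails. Apart from degenerate cases it is not prime;
  with \<open>a \<otimes> b\<close> in \<open>M\<close> and neither factor in it, a chain above
  \<open>M\<close> is controlled by its traces on the larger ideals \<open>M\<close> + R
  \<open>b\<close> and (\<open>M\<close> : \<open>b\<close>), as in the exact sequence 0 -> R/(M :
  b) -> R/M -> R/(M + R b) -> 0, and both traces become stationary.\<close>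

lemma saturated_dcc_of_unique_prime:
  assumes P: "primeideal P R" and J: "ideal J R" "J \<subseteq> P"
    and uniq: "\<And>Q. primeideal Q R \<Longrightarrow> J \<subseteq> Q \<Longrightarrow> Q \<subseteq> P \<Longrightarrow> Q = P"
  shows "saturated_dcc P J"
proof (rule ccontr)
  note Pf = prime_facts[OF P]
  assume neg: "\<not> saturated_dcc P J"
  define \<S> where "\<S> = {I. ideal I R \<and> J \<subseteq> I \<and> \<not> saturated_dcc P I}"
  have "J \<in> \<S>" using neg J by (auto simp: \<S>_def)
  then obtain M where M: "M \<in> \<S>" and Mmax: "\<And>I. I \<in> \<S> \<Longrightarrow> M \<subseteq> I \<Longrightarrow> I = M"
    using maximal_element[of \<S>] unfolding \<S>_def by blast
  have Mi: "ideal M R" "J \<subseteq> M" "\<not> saturated_dcc P M" using M by (auto simp: \<S>_def)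
  note Mf = ideal_facts[OF Mi(1)]
  have bigger: "saturated_dcc P I" if "ideal I R" "M \<subset> I" for I
    using that Mmax[of I] Mi(2) unfolding \<S>_def by auto
  \<comment> \<open>An element outside \<open>P\<close> is invertible in the localisation, so a
    saturated ideal containing one is the whole ring.\<close>
  have full: "I = carrier R" if I: "ideal I R" "saturation P I \<subseteq> I" "\<not> I \<subseteq> P" for I
  proof -
    obtain s where s: "s \<in> I" "s \<notin> P" using I(3) by auto
    note If = ideal_facts[OF I(1)]
    have "r \<in> I" if r: "r \<in> carrier R" for r
    proof -
      have "r \<in> saturation P I" using s r If(3)[OF s(1)] If(8)[OF s(1) r]
        unfolding saturation_def by auto
      then show ?thesis using \<open>saturation P I \<subseteq> I\<close> by auto
    qed
    then show ?thesis using If(1) by auto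
  qed
  have "saturated_dcc P M" unfolding saturated_dcc_def
  proof (intro allI impI)
    fix C :: "nat \<Rightarrow> 'a set"
    assume C: "\<forall>n. ideal (C n) R \<and> saturation P (C n) \<subseteq> C n \<and> C (Suc n) \<subseteq> C n \<and> M \<subseteq> C n"
    have anti: "C n \<subseteq> C m" if "m \<le> n" for m n
      using that C by (induction rule: dec_induct) auto
    show "\<exists>N. \<forall>n\<ge>N. C (Suc n) = C n"
    \<comment> \<open>Degenerate cases: once a member of the chain lies in \<open>P\<close>, it and
      all later ones equal \<open>P\<close>; if no member lies in \<open>P\<close>, all of them are
      the whole ring.\<close>
    proof (cases "P \<subseteq> M \<or> \<not> M \<subseteq> P")
      case True
      show ?thesis
      proof (cases "\<exists>N. C N \<subseteq> P")
        case True': True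
        then obtain N where N: "C N \<subseteq> P" by auto
        have "P \<subseteq> M" using True C N by blast
        then have "C n = P" if "n \<ge> N" for n using anti[OF that] N C by blast
        then show ?thesis by (metis le_SucI)
      next
        case False
        then show ?thesis using full C by metis
      qed
    next
      case False
      then have "M \<subset> P" by auto
      then have "\<not> primeideal M R" using uniq[of M] Mi by auto
      moreover have "M \<noteq> carrier R" using \<open>M \<subset> P\<close> Pf ideal_facts(1)[OF Pf(1)] by auto
      ultimately obtain a b where ab: "a \<in> carrier R" "b \<in> carrier R" "a \<otimes> b \<in> M" "a \<notin> M" "b \<notin> M"
        using ideal.primeidealCD[OF Mi(1) is_cring] by auto
      \<comment> \<open>The ideal quotient of \<open>I\<close> by \<open>b\<close>. For
        \<open>I\<close> = \<open>M\<close> it contains \<open>M\<close> and also \<open>a\<close>,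
        hence is strictly larger than \<open>M\<close>.\<close>
      define cln where "cln I = {r \<in> carrier R. \<forall>c\<in>{b}. r \<otimes> c \<in> I}" for I
      have cln: "ideal (cln I) R" if "ideal I R" for I
        unfolding cln_def by (rule colon_ideal[OF that]) (use ab in auto)
      have M1: "M \<subset> extend_ideal M b" using extend_ideal_superset[OF Mi(1) ab(2)] ab(5) by auto
      have M2: "M \<subset> cln M" using ab Mf by (auto simp: cln_def)
      have "\<exists>N. \<forall>n\<ge>N. saturation P (extend_ideal (C (Suc n)) b) = saturation P (extend_ideal (C n) b)"
      proof -
        have "ideal (saturation P (extend_ideal (C n) b)) R \<and>
          saturation P (saturation P (extend_ideal (C n) b)) \<subseteq> saturation P (extend_ideal (C n) b) \<and>
          saturation P (extend_ideal (C (Suc n)) b) \<subseteq> saturation P (extend_ideal (C n) b) \<and>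
          extend_ideal M b \<subseteq> saturation P (extend_ideal (C n) b)" for n
        proof (intro conjI)
          have e: "ideal (extend_ideal (C n) b) R" using C ab extend_ideal_is_ideal by blast
          show "ideal (saturation P (extend_ideal (C n) b)) R" by (rule saturation_ideal[OF P e])
          show "saturation P (saturation P (extend_ideal (C n) b)) \<subseteq> saturation P (extend_ideal (C n) b)"
            by (rule saturation_idem[OF P])
          show "saturation P (extend_ideal (C (Suc n)) b) \<subseteq> saturation P (extend_ideal (C n) b)"
            using C by (intro saturation_mono extend_ideal_mono) auto
          show "extend_ideal M b \<subseteq> saturation P (extend_ideal (C n) b)"
            using saturation_superset[OF P e] extend_ideal_mono[of M "C n" b] C by blast
        qed
        then show ?thesis
          by (rule saturated_dccD[OF bigger[OF extend_ideal_is_ideal[OF Mi(1) ab(2)] M1]])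
      qed
      then obtain N1 where N1: "\<And>n. n \<ge> N1 \<Longrightarrow>
        saturation P (extend_ideal (C (Suc n)) b) = saturation P (extend_ideal (C n) b)" by blast
      have "\<exists>N. \<forall>n\<ge>N. cln (C (Suc n)) = cln (C n)"
      proof -
        have "ideal (cln (C n)) R \<and> saturation P (cln (C n)) \<subseteq> cln (C n) \<and>
          cln (C (Suc n)) \<subseteq> cln (C n) \<and> cln M \<subseteq> cln (C n)" for n
        proof (intro conjI)
          show "ideal (cln (C n)) R" using cln C by blast
          show "saturation P (cln (C n)) \<subseteq> cln (C n)"
          proof
            fix r assume "r \<in> saturation P (cln (C n))"
            then obtain s where s: "r \<in> carrier R" "s \<in> carrier R" "s \<notin> P" "s \<otimes> r \<otimes> b \<in> C n"
              by (auto simp: saturation_def cln_def)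
            then have "r \<otimes> b \<in> saturation P (C n)" using ab by (auto simp: saturation_def m_assoc)
            then show "r \<in> cln (C n)" using C s by (auto simp: cln_def)
          qed
          show "cln (C (Suc n)) \<subseteq> cln (C n)" "cln M \<subseteq> cln (C n)" using C by (auto simp: cln_def)
        qed
        then show ?thesis
          by (rule saturated_dccD[OF bigger[OF cln[OF Mi(1)] M2]])
      qed
      then obtain N2 where N2: "\<And>n. n \<ge> N2 \<Longrightarrow> cln (C (Suc n)) = cln (C n)" by blast
      \<comment> \<open>Stationarity of the extended ideals gives \<open>s \<otimes> r\<close>
        congruent to \<open>t \<otimes> b\<close> modulo the smaller ideal, so
        \<open>t \<otimes> b\<close> lies in \<open>C n\<close>. Stationarity of the quotients moves
        it into the smaller ideal, hence also \<open>s \<otimes> r\<close>, and saturation removes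
        \<open>s\<close>.\<close>
      have "C (Suc n) = C n" if n: "n \<ge> max N1 N2" for n
      proof
        show "C (Suc n) \<subseteq> C n" using C by blast
        show "C n \<subseteq> C (Suc n)"
        proof
          have idn: "ideal (C n) R" "ideal (C (Suc n)) R" using C by auto
          note Cn = ideal_facts[OF idn(1)] and Cs = ideal_facts[OF idn(2)]
          fix r assume r: "r \<in> C n"
          have "r \<in> saturation P (extend_ideal (C n) b)"
            using extend_ideal_superset[OF idn(1) ab(2)]
              saturation_superset[OF P extend_ideal_is_ideal[OF idn(1) ab(2)]] r by auto
          then have "r \<in> saturation P (extend_ideal (C (Suc n)) b)" using N1 n by auto
          then obtain s t where st: "r \<in> carrier R" "s \<in> carrier R" "s \<notin> P" "t \<in> carrier R"
            "s \<otimes> r \<ominus> t \<otimes> b \<in> C (Suc n)"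
            by (auto simp: saturation_def extend_ideal_def)
          have "t \<otimes> b = s \<otimes> r \<ominus> (s \<otimes> r \<ominus> t \<otimes> b)" using st ab by algebra
          also have "\<dots> \<in> C n" using Cn(6)[OF Cn(7)[OF r st(2)]] st(5) C by blast
          finally have "t \<in> cln (C n)" using st by (auto simp: cln_def)
          then have "t \<otimes> b \<in> C (Suc n)" using N2 n by (auto simp: cln_def)
          from Cs(4)[OF st(5) this] have "s \<otimes> r \<ominus> t \<otimes> b \<oplus> t \<otimes> b \<in> C (Suc n)" .
          moreover have "s \<otimes> r \<ominus> t \<otimes> b \<oplus> t \<otimes> b = s \<otimes> r" using st ab by algebra
          ultimately have "r \<in> saturation P (C (Suc n))" using st by (auto simp: saturation_def)
          then show "r \<in> C (Suc n)" using C by blast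
        qed
      qed
      then show ?thesis by blast
    qed
  qed
  then show False using Mi by blast
qed

text \<open>Nakayama's lemma for the localised module \<open>B\<close> / \<open>A\<close>:
  \<open>gen\<close> says that it equals \<open>y\<close> times itself, with \<open>y\<close> in the
  maximal ideal. Instead of a determinant, \<open>W\<close> is taken maximal among the proper
  intermediate ideals saturated inside \<open>B\<close>, so that \<open>B\<close> / \<open>W\<close>
  is locally simple. If \<open>y\<close> annihilates it, \<open>gen\<close> puts \<open>B\<close>
  inside \<open>W\<close>. Otherwise \<open>r \<otimes> y\<close> generates it, and a multiple of
  \<open>r\<close> by an element outside \<open>P\<close> lies in \<open>W\<close>.\<close>

lemma local_nakayama:
  assumes P: "primeideal P R" and A: "ideal A R" "saturation P A \<subseteq> A"
    and B: "ideal B R" "A \<subseteq> B" and y: "y \<in> P"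
    and gen: "\<And>r. r \<in> B \<Longrightarrow> \<exists>s\<in>carrier R - P. \<exists>t\<in>B. s \<otimes> r \<ominus> t \<otimes> y \<in> A"
  shows "B = A"
proof (rule ccontr)
  note Pf = prime_facts[OF P]
  note Bf = ideal_facts[OF B(1)] and Pi = ideal_facts[OF Pf(1)]
  have yc: "y \<in> carrier R" using y Pi by auto
  assume "B \<noteq> A"
  define \<S> where "\<S> = {W. ideal W R \<and> A \<subseteq> W \<and> W \<subseteq> B \<and> W \<noteq> B \<and> saturation P W \<inter> B \<subseteq> W}"
  have "A \<in> \<S>" using A B \<open>B \<noteq> A\<close> by (auto simp: \<S>_def)
  then obtain W where W: "W \<in> \<S>" and Wmax: "\<And>I. I \<in> \<S> \<Longrightarrow> W \<subseteq> I \<Longrightarrow> I = W"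
    using maximal_element[of \<S>] unfolding \<S>_def by blast
  have Wi: "ideal W R" "A \<subseteq> W" "W \<subseteq> B" "W \<noteq> B" "saturation P W \<inter> B \<subseteq> W"
    using W by (auto simp: \<S>_def)
  note Wf = ideal_facts[OF Wi(1)]
  have sat: "z \<in> W" if "s \<in> carrier R" "s \<notin> P" "z \<in> B" "s \<otimes> z \<in> W" for s z
    using that Wi(5) Bf(3) by (auto simp: saturation_def)
  \<comment> \<open>Simplicity: adjoining to \<open>W\<close> any element of \<open>B\<close>
    outside it and saturating inside \<open>B\<close> gives all of \<open>B\<close>, by maximality
    of \<open>W\<close>.\<close>
  have ext: "\<exists>s\<in>carrier R - P. \<exists>t\<in>carrier R. s \<otimes> z \<ominus> t \<otimes> q \<in> W"
    if q: "q \<in> B" "q \<notin> W" and z: "z \<in> B" for q z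
  proof -
    have qc: "q \<in> carrier R" using q Bf by auto
    define V where "V = saturation P (extend_ideal W q) \<inter> B"
    note e = extend_ideal_is_ideal[OF Wi(1) qc]
    have V: "ideal V R" unfolding V_def by (intro i_intersect saturation_ideal P e B)
    have sub: "W \<subseteq> V" "q \<in> V"
      using saturation_superset[OF P e] extend_ideal_superset[OF Wi(1) qc] Wi(3) q by (auto simp: V_def)
    have "V \<notin> \<S>" using Wmax[of V] sub q by auto
    moreover have "saturation P V \<inter> B \<subseteq> V"
    proof -
      have "saturation P V \<subseteq> saturation P (saturation P (extend_ideal W q))"
        by (rule saturation_mono) (auto simp: V_def)
      then show ?thesis using saturation_idem[OF P] by (auto simp: V_def)
    qed
    ultimately have "V = B" using V sub Wi(2) unfolding \<S>_def by (auto simp: V_def)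
    then have "z \<in> saturation P (extend_ideal W q)" using z by (auto simp: V_def)
    then show ?thesis by (auto simp: saturation_def extend_ideal_def)
  qed
  obtain r where r: "r \<in> B" "r \<notin> W" using Wi by auto
  have rc: "r \<in> carrier R" using r Bf by auto
  show False
  proof (cases "r \<otimes> y \<in> W")
    case True
    have *: "z \<otimes> y \<in> W" if z: "z \<in> B" for z
    proof -
      obtain s t where st: "s \<in> carrier R" "s \<notin> P" "t \<in> carrier R" "s \<otimes> z \<ominus> t \<otimes> r \<in> W"
        using ext[OF r z] by auto
      have zc: "z \<in> carrier R" using z Bf by auto
      have "s \<otimes> (z \<otimes> y) = y \<otimes> (s \<otimes> z \<ominus> t \<otimes> r) \<oplus> t \<otimes> (r \<otimes> y)"
        using st yc zc rc by algebra
      also have "\<dots> \<in> W" by (intro Wf(4) Wf(7) st True yc)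
      finally show ?thesis using sat[OF st(1,2) Bf(8)[OF z yc]] by simp
    qed
    have "z \<in> W" if z: "z \<in> B" for z
    proof -
      obtain s t where st: "s \<in> carrier R" "s \<notin> P" "t \<in> B" "s \<otimes> z \<ominus> t \<otimes> y \<in> A"
        using gen[OF z] by auto
      have zc: "z \<in> carrier R" "t \<in> carrier R" using z st Bf by auto
      have "s \<otimes> z = (s \<otimes> z \<ominus> t \<otimes> y) \<oplus> t \<otimes> y" using st yc zc by algebra
      also have "\<dots> \<in> W" using Wf(4) st Wi(2) *[OF st(3)] by blast
      finally show ?thesis using sat[OF st(1,2) z] by simp
    qed
    then show False using Wi by auto
  next
    case False
    obtain s t where st: "s \<in> carrier R" "s \<notin> P" "t \<in> carrier R" "s \<otimes> r \<ominus> t \<otimes> (r \<otimes> y) \<in> W"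
      using ext[OF Bf(8)[OF r(1) yc] False r(1)] by auto
    have "s \<otimes> r \<ominus> t \<otimes> (r \<otimes> y) = (s \<ominus> t \<otimes> y) \<otimes> r" using st yc rc by algebra
    moreover have "s \<ominus> t \<otimes> y \<notin> P"
    proof
      assume "s \<ominus> t \<otimes> y \<in> P"
      then have "(s \<ominus> t \<otimes> y) \<oplus> t \<otimes> y \<in> P" using Pi y st by auto
      moreover have "(s \<ominus> t \<otimes> y) \<oplus> t \<otimes> y = s" using st yc by algebra
      ultimately show False using st by auto
    qed
    ultimately show False using sat[of "s \<ominus> t \<otimes> y" r] st yc r by auto
  qed
qed

text \<open>Krull's principal ideal theorem, for a prime of height at least two over another one.\<close>

lemma intermediate_prime:
  assumes P0: "primeideal P0 R" and Q: "primeideal Q R" and P: "primeideal P R"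
    and sub: "P0 \<subset> Q" "Q \<subset> P" and y: "y \<in> P"
  obtains P' where "primeideal P' R" "P0 \<subset> P'" "P' \<subset> P" "y \<in> P'"
proof (rule ccontr)
  note P0f = prime_facts[OF P0] and Qf = prime_facts[OF Q] and Pf = prime_facts[OF P]
  note P0i = ideal_facts[OF P0f(1)] and Qi = ideal_facts[OF Qf(1)] and Pi = ideal_facts[OF Pf(1)]
  assume "\<not> thesis"
  then have no: "\<And>P'. primeideal P' R \<Longrightarrow> P0 \<subset> P' \<Longrightarrow> P' \<subset> P \<Longrightarrow> y \<notin> P'" using that by blast
  have yQ: "y \<notin> Q" using no[OF Q] sub by auto
  have yc: "y \<in> carrier R" using y Pi by auto
  define J where "J = extend_ideal P0 y"
  have Ji: "ideal J R" unfolding J_def by (rule extend_ideal_is_ideal[OF P0f(1) yc])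
  have J0: "P0 \<subseteq> J" "y \<in> J" using extend_ideal_superset[OF P0f(1) yc] by (auto simp: J_def)
  \<comment> \<open>Under the negated conclusion \<open>P\<close> is the only prime between
    \<open>J\<close> and \<open>P\<close>: such a prime contains \<open>y\<close>, which is not in
    \<open>Q\<close>, so it is strictly larger than \<open>P0\<close>.\<close>
  have "saturated_dcc P J"
  proof (rule saturated_dcc_of_unique_prime[OF P Ji])
    show "J \<subseteq> P" unfolding J_def using extend_ideal_least[OF Pf(1)] sub y by auto
    show "Q' = P" if "primeideal Q' R" "J \<subseteq> Q'" "Q' \<subseteq> P" for Q'
      using no[OF that(1)] that J0 yQ sub by blast
  qed
  obtain a where a: "a \<in> Q" "a \<notin> P0" using sub by auto
  have ac: "a \<in> carrier R" using a Qi by auto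
  have e: "ideal (extend_ideal P0 (a [^] n)) R" for n :: nat
    by (rule extend_ideal_is_ideal[OF P0f(1)]) (use ac in auto)
  \<comment> \<open>Counterparts of the symbolic powers of \<open>Q\<close>, formed modulo
    \<open>P0\<close> from the powers of a single element \<open>a\<close> of \<open>Q\<close>
    outside \<open>P0\<close>.\<close>
  define I where "I n = saturation Q (extend_ideal P0 (a [^] n))" for n :: nat
  have Ii: "ideal (I n) R" for n unfolding I_def by (rule saturation_ideal[OF Q e])
  have Isat: "saturation Q (I n) \<subseteq> I n" for n unfolding I_def by (rule saturation_idem[OF Q])
  have Idec: "I (Suc n) \<subseteq> I n" for n unfolding I_def
  proof (intro saturation_mono extend_ideal_least[OF e])
    show "P0 \<subseteq> extend_ideal P0 (a [^] n)"
      by (rule extend_ideal_superset[OF P0f(1)]) (use ac in auto)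
    have "a [^] n \<in> extend_ideal P0 (a [^] n)"
      by (rule extend_ideal_superset[OF P0f(1)]) (use ac in auto)
    then show "a [^] Suc n \<in> extend_ideal P0 (a [^] n)"
      using ideal_facts(8)[OF e] ac by (simp add: nat_pow_Suc)
  qed
  have P0I: "P0 \<subseteq> I n" for n
    using extend_ideal_superset(1)[OF P0f(1), of "a [^] n"] saturation_superset[OF Q e, of n] ac
    unfolding I_def by auto
  define D where "D n = saturation P (extend_ideal (I n) y)" for n
  have eI: "ideal (extend_ideal (I n) y) R" for n by (rule extend_ideal_is_ideal[OF Ii yc])
  have "\<exists>N. \<forall>n\<ge>N. D (Suc n) = D n"
  proof -
    have "ideal (D n) R \<and> saturation P (D n) \<subseteq> D n \<and> D (Suc n) \<subseteq> D n \<and> J \<subseteq> D n" for n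
    proof (intro conjI)
      show "ideal (D n) R" unfolding D_def by (rule saturation_ideal[OF P eI])
      show "saturation P (D n) \<subseteq> D n" unfolding D_def by (rule saturation_idem[OF P])
      show "D (Suc n) \<subseteq> D n" unfolding D_def
        by (intro saturation_mono extend_ideal_mono Idec)
      show "J \<subseteq> D n"
        using saturation_superset[OF P eI, of n] extend_ideal_mono[OF P0I, of y n] unfolding D_def J_def by blast
    qed
    then show ?thesis by (rule saturated_dccD[OF \<open>saturated_dcc P J\<close>])
  qed
  then obtain n where Dn: "D (Suc n) = D n" by blast
  \<comment> \<open>Stationarity of \<open>D\<close> writes an element of \<open>I n\<close>, up to
    a factor outside \<open>P\<close>, as an element of \<open>I (Suc n)\<close> plus a multiple
    \<open>t \<otimes> y\<close>. Since \<open>y\<close> is outside \<open>Q\<close> and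
    \<open>I n\<close> is saturated at \<open>Q\<close>, the coefficient \<open>t\<close> lies in
    \<open>I n\<close> again, which is the hypothesis of Nakayama.\<close>
  have "I n = I (Suc n)"
  proof (rule local_nakayama[OF P Ii _ Ii Idec y])
    show "saturation P (I (Suc n)) \<subseteq> I (Suc n)"
      using Isat[of "Suc n"] sub unfolding saturation_def by blast
    fix r assume r: "r \<in> I n"
    have "r \<in> D n"
      using saturation_superset[OF P eI, of n] extend_ideal_superset[OF Ii yc, of n] r
      unfolding D_def by auto
    then have "r \<in> D (Suc n)" using Dn by simp
    then obtain s t where st: "r \<in> carrier R" "s \<in> carrier R" "s \<notin> P" "t \<in> carrier R"
      "s \<otimes> r \<ominus> t \<otimes> y \<in> I (Suc n)"
      by (auto simp: D_def saturation_def extend_ideal_def)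
    note In = ideal_facts[OF Ii[of n]]
    have "y \<otimes> t = s \<otimes> r \<ominus> (s \<otimes> r \<ominus> t \<otimes> y)" using st yc by algebra
    also have "\<dots> \<in> I n" using In(6)[OF In(7)[OF r st(2)]] st(5) Idec by blast
    finally have "t \<in> saturation Q (I n)" using st yc yQ by (auto simp: saturation_def)
    then have "t \<in> I n" using Isat by auto
    then show "\<exists>s\<in>carrier R - P. \<exists>t\<in>I n. s \<otimes> r \<ominus> t \<otimes> y \<in> I (Suc n)" using st by auto
  qed
  moreover have "a [^] n \<in> I n"
    using extend_ideal_superset(2)[OF P0f(1), of "a [^] n"] saturation_superset[OF Q e, of n] ac
    unfolding I_def by auto
  ultimately have "a [^] n \<in> I (Suc n)" by simp
  then obtain s t where st: "s \<in> carrier R" "s \<notin> Q" "t \<in> carrier R"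
    "s \<otimes> a [^] n \<ominus> t \<otimes> a [^] Suc n \<in> P0"
    by (auto simp: I_def saturation_def extend_ideal_def)
  have "s \<otimes> a [^] n \<ominus> t \<otimes> (a [^] n \<otimes> a) = a [^] n \<otimes> (s \<ominus> t \<otimes> a)"
  proof -
    have "a [^] n \<in> carrier R" using ac by auto
    then show ?thesis using st ac by algebra
  qed
  then have "a [^] n \<otimes> (s \<ominus> t \<otimes> a) \<in> P0" using st(4) by (simp add: nat_pow_Suc)
  \<comment> \<open>Cancelling the power of \<open>a\<close> is legitimate modulo the prime
    \<open>P0\<close>. The result puts \<open>s\<close> into \<open>Q\<close>, because
    \<open>a\<close> lies there, against the choice of \<open>s\<close>.\<close>
  then have "s \<ominus> t \<otimes> a \<in> P0" using P0f(4)[of "a [^] n" "s \<ominus> t \<otimes> a"] P0f(5)[of a n] a ac st by auto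
  then have "(s \<ominus> t \<otimes> a) \<oplus> t \<otimes> a \<in> Q" using sub Qi(4,7) a st by blast
  moreover have "(s \<ominus> t \<otimes> a) \<oplus> t \<otimes> a = s" using st ac by algebra
  ultimately show False using st by auto
qed

text \<open>Forcing \<open>y\<close> into the bottom of a chain costs one step. The work goes from
  the top downwards: the prime below the top is exchanged for one containing \<open>y\<close>, which
  serves as the top of the shorter chain in the induction hypothesis.\<close>

lemma prime_chain_through:
  assumes "\<And>i. i \<le> Suc k \<Longrightarrow> primeideal (P i) R" "\<And>i. i \<le> k \<Longrightarrow> P i \<subset> P (Suc i)" "y \<in> P (Suc k)"
  shows "\<exists>Q. (\<forall>i\<le>k. primeideal (Q i) R) \<and> (\<forall>i<k. Q i \<subset> Q (Suc i)) \<and>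
    P 0 \<subseteq> Q 0 \<and> y \<in> Q 0 \<and> Q k \<subseteq> P (Suc k)"
  using assms
proof (induction k arbitrary: P)
  case 0
  show ?case by (rule exI[of _ "\<lambda>_. P 1"]) (use 0(1)[of 1] 0(2)[of 0] 0(3) in auto)
next
  case (Suc k)
  have "\<exists>P'. primeideal P' R \<and> P k \<subset> P' \<and> P' \<subset> P (Suc (Suc k)) \<and> y \<in> P'"
    using intermediate_prime[of "P k" "P (Suc k)" "P (Suc (Suc k))" y] Suc.prems by (metis le_SucI le_refl)
  then obtain P' where P': "primeideal P' R" "P k \<subset> P'" "P' \<subset> P (Suc (Suc k))" "y \<in> P'" by blast
  define P'' where "P'' i = (if i = Suc k then P' else P i)" for i
  have "\<exists>Q. (\<forall>i\<le>k. primeideal (Q i) R) \<and> (\<forall>i<k. Q i \<subset> Q (Suc i)) \<and>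
    P'' 0 \<subseteq> Q 0 \<and> y \<in> Q 0 \<and> Q k \<subseteq> P'' (Suc k)"
    by (rule Suc.IH) (use P' Suc.prems in \<open>auto simp: P''_def le_Suc_eq\<close>)
  then obtain Q where Q: "\<forall>i\<le>k. primeideal (Q i) R" "\<forall>i<k. Q i \<subset> Q (Suc i)"
    "P 0 \<subseteq> Q 0" "y \<in> Q 0" "Q k \<subseteq> P'" by (auto simp: P''_def)
  show ?case
    by (rule exI[of _ "\<lambda>i. if i \<le> k then Q i else P (Suc (Suc k))"])
      (use Q P' Suc.prems(1) in \<open>auto simp: less_Suc_eq\<close>)
qed

text \<open>Krull's height theorem.\<close>

lemma prime_below_chain_top:
  assumes "\<And>i. i \<le> d \<Longrightarrow> primeideal (P i) R" "\<And>i. i < d \<Longrightarrow> P i \<subset> P (Suc i)"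
    "set ys \<subseteq> P d" "length ys < d"
  shows "\<exists>Q. primeideal Q R \<and> set ys \<subseteq> Q \<and> Q \<subset> P d"
proof -
  \<comment> \<open>Each element of \<open>ys\<close> shortens the chain by one, and the new bottom
    contains the old one, so elements treated earlier are kept. As \<open>ys\<close> is shorter than
    \<open>d\<close>, a strict inclusion remains at the end.\<close>
  have "\<exists>Q. (\<forall>i\<le>d - length ys. primeideal (Q i) R) \<and> (\<forall>i<d - length ys. Q i \<subset> Q (Suc i)) \<and>
    set ys \<subseteq> Q 0 \<and> Q (d - length ys) \<subseteq> P d"
    using assms(3,4)
  proof (induction ys)
    case Nil
    then show ?case using assms(1,2) by (intro exI[of _ P]) auto
  next
    case (Cons y ys)
    then obtain Q where Q: "\<forall>i\<le>d - length ys. primeideal (Q i) R"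
      "\<forall>i<d - length ys. Q i \<subset> Q (Suc i)" "set ys \<subseteq> Q 0" "Q (d - length ys) \<subseteq> P d" by auto
    define k where "k = d - length (y # ys)"
    have k: "d - length ys = Suc k" using Cons.prems by (auto simp: k_def)
    define Q' where "Q' i = (if i = Suc k then P d else Q i)" for i
    have "\<exists>T. (\<forall>i\<le>k. primeideal (T i) R) \<and> (\<forall>i<k. T i \<subset> T (Suc i)) \<and>
      Q' 0 \<subseteq> T 0 \<and> y \<in> T 0 \<and> T k \<subseteq> Q' (Suc k)"
    proof (rule prime_chain_through)
      show "primeideal (Q' i) R" if "i \<le> Suc k" for i
        using Q(1) that k assms(1)[of d] by (auto simp: Q'_def)
      show "Q' i \<subset> Q' (Suc i)" if "i \<le> k" for i
        using Q(2) that k Q(4) by (auto simp: Q'_def)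
    qed (use Cons.prems in \<open>auto simp: Q'_def\<close>)
    then obtain T where "\<forall>i\<le>k. primeideal (T i) R" "\<forall>i<k. T i \<subset> T (Suc i)"
      "Q 0 \<subseteq> T 0" "y \<in> T 0" "T k \<subseteq> P d" by (auto simp: Q'_def)
    then show ?case using Q(3) unfolding k_def[symmetric] by (intro exI[of _ T]) auto
  qed
  then obtain Q where Q: "\<forall>i\<le>d - length ys. primeideal (Q i) R" "\<forall>i<d - length ys. Q i \<subset> Q (Suc i)"
    "set ys \<subseteq> Q 0" "Q (d - length ys) \<subseteq> P d" by blast
  have "Q 0 \<subset> Q 1" using Q(2) assms(4) by auto
  moreover have "Q 1 \<subseteq> Q i" if "1 \<le> i" "i \<le> d - length ys" for i
    using that Q(2) by (induction i rule: dec_induct) (auto simp: Suc_le_eq)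
  ultimately have "Q 0 \<subset> P d" using Q(4) assms(4) by (metis Suc_leI One_nat_def le_refl psubset_subset_trans zero_less_diff)
  then show ?thesis using Q by blast
qed

end

section \<open>Linear combinations of power products\<close>

lemma (in abelian_monoid) finsum_fibres:
  assumes "finite S" "finite W" "h ` S \<subseteq> W" "\<And>s. s \<in> S \<Longrightarrow> g s \<in> carrier G"
  shows "(\<Oplus>s\<in>S. g s) = (\<Oplus>w\<in>W. \<Oplus>s\<in>{s \<in> S. h s = w}. g s)"
proof -
  have "S = (\<Union>w\<in>W. {s \<in> S. h s = w})" using assms(3) by auto
  then have "(\<Oplus>s\<in>S. g s) = finsum G g (\<Union>w\<in>W. {s \<in> S. h s = w})" by simp
  also have "\<dots> = (\<Oplus>w\<in>W. finsum G g {s \<in> S. h s = w})"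
    by (rule add.finprod_UN_disjoint) (use assms in \<open>auto simp: pairwise_def disjnt_def\<close>)
  finally show ?thesis .
qed

lemma (in cring) finsum_Times:
  assumes "finite S" "finite T" "\<And>s. s \<in> S \<Longrightarrow> f s \<in> carrier R" "\<And>t. t \<in> T \<Longrightarrow> g t \<in> carrier R"
  shows "(\<Oplus>s\<in>S. f s) \<otimes> (\<Oplus>t\<in>T. g t) = (\<Oplus>z\<in>S \<times> T. f (fst z) \<otimes> g (snd z))"
proof -
  have "(\<Oplus>z\<in>S \<times> T. f (fst z) \<otimes> g (snd z)) =
      (\<Oplus>s\<in>S. \<Oplus>z\<in>{z \<in> S \<times> T. fst z = s}. f (fst z) \<otimes> g (snd z))"
    by (rule finsum_fibres) (use assms in auto)
  also have "\<dots> = (\<Oplus>s\<in>S. f s \<otimes> (\<Oplus>t\<in>T. g t))"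
  proof (rule finsum_cong')
    fix s assume s: "s \<in> S"
    have "{z \<in> S \<times> T. fst z = s} = Pair s ` T" using s by auto
    then have "(\<Oplus>z\<in>{z \<in> S \<times> T. fst z = s}. f (fst z) \<otimes> g (snd z)) =
        (\<Oplus>z\<in>Pair s ` T. f (fst z) \<otimes> g (snd z))" by simp
    also have "\<dots> = (\<Oplus>t\<in>T. f s \<otimes> g t)"
      by (subst finsum_reindex) (use assms s in \<open>auto simp: inj_on_def\<close>)
    also have "\<dots> = f s \<otimes> (\<Oplus>t\<in>T. g t)"
      by (rule finsum_rdistr[symmetric]) (use assms s in auto)
    finally show "(\<Oplus>z\<in>{z \<in> S \<times> T. fst z = s}. f (fst z) \<otimes> g (snd z)) = f s \<otimes> (\<Oplus>t\<in>T. g t)" .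
  qed (use assms in auto)
  also have "\<dots> = (\<Oplus>s\<in>S. f s) \<otimes> (\<Oplus>t\<in>T. g t)"
    by (rule finsum_ldistr[symmetric]) (use assms in auto)
  finally show ?thesis by simp
qed

lemma finite_vec_nat_le: "finite {B :: nat ^ 'n::finite. \<forall>i. B $ i \<le> m i}"
proof (rule finite_subset)
  show "{B :: nat ^ 'n. \<forall>i. B $ i \<le> m i} \<subseteq> vec_lambda ` (\<Pi>\<^sub>E i\<in>UNIV. {..m i})"
    by (auto intro!: image_eqI[where x="\<lambda>i. _ $ i"] simp: PiE_def)
  show "finite (vec_lambda ` (\<Pi>\<^sub>E i\<in>(UNIV :: 'n set). {..m i}))"
    by (intro finite_imageI finite_PiE) auto
qed

lemma finite_sum_decompositions: "finite {(B, C). B + C = (A :: nat ^ 'n::finite)}"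
proof (rule finite_subset)
  show "{(B, C). B + C = A} \<subseteq> {B. \<forall>i. B $ i \<le> A $ i} \<times> {B. \<forall>i. B $ i \<le> A $ i}"
    by auto
qed (intro finite_cartesian_product finite_vec_nat_le)

section \<open>Finite sums of monomials with ring coefficients, and monomial ideals\<close>

locale cring_vars = cring R for R (structure) +
  fixes x :: "'n::finite \<Rightarrow> 'a"
  assumes x_closed [simp, intro]: "x i \<in> carrier R"
begin

abbreviation pp :: "nat ^ 'n \<Rightarrow> 'a" where
  "pp \<equiv> power_product R x"

text \<open>The index set is explicit because the coefficient function may be nonzero outside it;
  infinite expansions are handled through such truncations.\<close>

definition lincomb :: "(nat ^ 'n \<Rightarrow> 'a) \<Rightarrow> (nat ^ 'n) set \<Rightarrow> 'a" where
  "lincomb r F = (\<Oplus>A\<in>F. r A \<otimes> pp A)"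

definition monomial_ideal :: "(nat ^ 'n) set \<Rightarrow> 'a set" where
  "monomial_ideal X = Idl (pp ` X)"

lemma pp_closed [simp, intro]: "pp A \<in> carrier R"
  unfolding power_product_def by (intro finprod_closed) auto

lemma pp_zero: "pp 0 = \<one>"
  unfolding power_product_def by (intro finprod_one_eqI) auto

lemma pp_add: "pp (A + B) = pp A \<otimes> pp B"
proof -
  have "pp A \<otimes> pp B = (\<Otimes>i\<in>UNIV. x i [^] (A $ i) \<otimes> x i [^] (B $ i))"
    unfolding power_product_def by (rule finprod_multf[symmetric]) auto
  also have "\<dots> = pp (A + B)"
    unfolding power_product_def by (rule finprod_cong') (auto simp: nat_pow_mult)
  finally show ?thesis by simp
qed

lemma pp_axis: "pp (axis i 1) = x i"
proof -
  have "pp (axis i 1) = (\<Otimes>j\<in>UNIV. if i = j then x j else \<one>)"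
    unfolding power_product_def
    by (rule finprod_cong') (auto simp: axis_def split: if_splits)
  also have "\<dots> = x i" by (rule finprod_singleton) auto
  finally show ?thesis .
qed

lemma lincomb_closed [simp]: "(\<And>A. A \<in> F \<Longrightarrow> r A \<in> carrier R) \<Longrightarrow> lincomb r F \<in> carrier R"
  unfolding lincomb_def by (intro finsum_closed) auto

lemma lincomb_cong:
  "F = F' \<Longrightarrow> (\<And>A. A \<in> F' \<Longrightarrow> r' A \<in> carrier R) \<Longrightarrow> (\<And>A. A \<in> F' \<Longrightarrow> r A = r' A) \<Longrightarrow>
    lincomb r F = lincomb r' F'"
  unfolding lincomb_def by (intro finsum_cong') auto

lemma lincomb_empty [simp]: "lincomb r {} = \<zero>"
  by (simp add: lincomb_def)

lemma lincomb_add: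
  assumes "\<And>A. A \<in> F \<Longrightarrow> r A \<in> carrier R" "\<And>A. A \<in> F \<Longrightarrow> r' A \<in> carrier R"
  shows "lincomb (\<lambda>A. r A \<oplus> r' A) F = lincomb r F \<oplus> lincomb r' F"
proof -
  have "lincomb r F \<oplus> lincomb r' F = (\<Oplus>A\<in>F. r A \<otimes> pp A \<oplus> r' A \<otimes> pp A)"
    unfolding lincomb_def by (rule finsum_addf[symmetric]) (use assms in auto)
  also have "\<dots> = lincomb (\<lambda>A. r A \<oplus> r' A) F"
    unfolding lincomb_def by (rule finsum_cong') (use assms in \<open>auto simp: l_distr\<close>)
  finally show ?thesis by simp
qed

lemma lincomb_scale:
  assumes "finite F" "\<And>A. A \<in> F \<Longrightarrow> r A \<in> carrier R" "c \<in> carrier R"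
  shows "lincomb (\<lambda>A. c \<otimes> r A) F = c \<otimes> lincomb r F"
proof -
  have "c \<otimes> lincomb r F = (\<Oplus>A\<in>F. c \<otimes> (r A \<otimes> pp A))"
    unfolding lincomb_def by (rule finsum_rdistr) (use assms in auto)
  also have "\<dots> = lincomb (\<lambda>A. c \<otimes> r A) F"
    unfolding lincomb_def by (rule finsum_cong') (use assms in \<open>auto simp: m_assoc\<close>)
  finally show ?thesis by simp
qed

lemma lincomb_uminus:
  assumes "finite F" "\<And>A. A \<in> F \<Longrightarrow> r A \<in> carrier R"
  shows "lincomb (\<lambda>A. \<ominus> r A) F = \<ominus> lincomb r F"
proof -
  have "lincomb (\<lambda>A. \<ominus> r A) F = lincomb (\<lambda>A. (\<ominus> \<one>) \<otimes> r A) F"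
    by (rule lincomb_cong) (use assms in \<open>auto simp: l_minus\<close>)
  also have "\<dots> = (\<ominus> \<one>) \<otimes> lincomb r F" by (rule lincomb_scale) (use assms in auto)
  finally show ?thesis using assms by (simp add: l_minus)
qed

lemma lincomb_diff:
  assumes "finite F" "\<And>A. A \<in> F \<Longrightarrow> r A \<in> carrier R" "\<And>A. A \<in> F \<Longrightarrow> r' A \<in> carrier R"
  shows "lincomb (\<lambda>A. r A \<ominus> r' A) F = lincomb r F \<ominus> lincomb r' F"
  unfolding a_minus_def using assms by (simp add: lincomb_add lincomb_uminus)

lemma lincomb_insert:
  assumes "finite F" "A \<notin> F" "\<And>B. B \<in> insert A F \<Longrightarrow> r B \<in> carrier R"
  shows "lincomb r (insert A F) = r A \<otimes> pp A \<oplus> lincomb r F"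
  unfolding lincomb_def by (rule finsum_insert) (use assms in auto)

lemma lincomb_singleton: "r A \<in> carrier R \<Longrightarrow> lincomb r {A} = r A \<otimes> pp A"
  by (subst lincomb_insert) auto

lemma lincomb_Un:
  assumes "finite F" "finite F'" "F \<inter> F' = {}" "\<And>B. B \<in> F \<union> F' \<Longrightarrow> r B \<in> carrier R"
  shows "lincomb r (F \<union> F') = lincomb r F \<oplus> lincomb r F'"
  unfolding lincomb_def by (rule finsum_Un_disjoint) (use assms in auto)

lemma lincomb_neutral:
  assumes "finite F'" "F \<subseteq> F'" "\<And>A. A \<in> F' - F \<Longrightarrow> r A = \<zero>" "\<And>A. A \<in> F \<Longrightarrow> r A \<in> carrier R"
  shows "lincomb r F' = lincomb r F"
  unfolding lincomb_def
proof (rule add.finprod_mono_neutral_cong_right)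
  show "(\<lambda>A. r A \<otimes> pp A) \<in> F' \<rightarrow> carrier R"
  proof
    fix A assume "A \<in> F'"
    then show "r A \<otimes> pp A \<in> carrier R" using assms(3,4) by (cases "A \<in> F") auto
  qed
qed (use assms in auto)

lemma lincomb_in_ideal:
  assumes "ideal I R" "\<And>A. A \<in> F \<Longrightarrow> r A \<otimes> pp A \<in> I"
  shows "lincomb r F \<in> I"
  unfolding lincomb_def by (rule ideal_finsum) (use assms in auto)

text \<open>Evaluating at the parameters turns convolution of coefficient functions into the product
  of the ring. \<open>W\<close> may be any finite set containing all sums of exponents, since the
  convolution vanishes elsewhere; later it is the set of lattice points of a line.\<close>

lemma lincomb_mult:
  assumes "finite S" "finite T" "finite W" "\<And>B C. B \<in> S \<Longrightarrow> C \<in> T \<Longrightarrow> B + C \<in> W"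
    and p: "\<And>A. p A \<in> carrier R" "\<And>A. A \<notin> S \<Longrightarrow> p A = \<zero>"
    and q: "\<And>A. q A \<in> carrier R" "\<And>A. A \<notin> T \<Longrightarrow> q A = \<zero>"
  shows "lincomb p S \<otimes> lincomb q T = lincomb (p \<otimes>\<^bsub>mpoly_ring R\<^esub> q) W"
proof -
  have "lincomb p S \<otimes> lincomb q T =
      (\<Oplus>z\<in>S \<times> T. (p (fst z) \<otimes> pp (fst z)) \<otimes> (q (snd z) \<otimes> pp (snd z)))"
    unfolding lincomb_def by (rule finsum_Times) (use assms in auto)
  also have "\<dots> = (\<Oplus>z\<in>S \<times> T. (p (fst z) \<otimes> q (snd z)) \<otimes> pp (fst z + snd z))"
  proof (rule finsum_cong')
    fix z
    have "pp (fst z) \<in> carrier R" "pp (snd z) \<in> carrier R" "p (fst z) \<in> carrier R" "q (snd z) \<in> carrier R"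
      using p q by auto
    then show "(p (fst z) \<otimes> pp (fst z)) \<otimes> (q (snd z) \<otimes> pp (snd z)) =
        (p (fst z) \<otimes> q (snd z)) \<otimes> pp (fst z + snd z)"
      unfolding pp_add by algebra
  qed (use p q in auto)
  also have "\<dots> = (\<Oplus>A\<in>W. \<Oplus>z\<in>{z \<in> S \<times> T. fst z + snd z = A}. (p (fst z) \<otimes> q (snd z)) \<otimes> pp (fst z + snd z))"
    by (rule finsum_fibres) (use assms in auto)
  also have "\<dots> = lincomb (p \<otimes>\<^bsub>mpoly_ring R\<^esub> q) W" unfolding lincomb_def
  proof (rule finsum_cong')
    fix A
    have fin: "finite {z \<in> S \<times> T. fst z + snd z = A}" using assms by auto
    have "(p \<otimes>\<^bsub>mpoly_ring R\<^esub> q) A = (\<Oplus>z\<in>{z \<in> S \<times> T. fst z + snd z = A}. p (fst z) \<otimes> q (snd z))"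
      unfolding mpoly_ring_def monoid.simps
    proof (rule add.finprod_mono_neutral_cong_right)
      show "p (fst z) \<otimes> q (snd z) = \<zero>"
        if "z \<in> {(B, C). B + C = A} - {z \<in> S \<times> T. fst z + snd z = A}" for z
        using that p q by (cases z) (auto simp: mem_Times_iff)
    qed (use finite_sum_decompositions p q in auto)
    then have "(p \<otimes>\<^bsub>mpoly_ring R\<^esub> q) A \<otimes> pp A =
        (\<Oplus>z\<in>{z \<in> S \<times> T. fst z + snd z = A}. (p (fst z) \<otimes> q (snd z)) \<otimes> pp A)"
      using fin p q by (simp add: finsum_ldistr)
    also have "\<dots> = (\<Oplus>z\<in>{z \<in> S \<times> T. fst z + snd z = A}. (p (fst z) \<otimes> q (snd z)) \<otimes> pp (fst z + snd z))"
      by (rule finsum_cong') (use p q in auto)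
    finally show "(\<Oplus>z\<in>{z \<in> S \<times> T. fst z + snd z = A}. (p (fst z) \<otimes> q (snd z)) \<otimes> pp (fst z + snd z)) =
        (p \<otimes>\<^bsub>mpoly_ring R\<^esub> q) A \<otimes> pp A" by simp
  next
    show "(\<lambda>A. (p \<otimes>\<^bsub>mpoly_ring R\<^esub> q) A \<otimes> pp A) \<in> W \<rightarrow> carrier R"
      unfolding mpoly_ring_def monoid.simps using p q by (auto intro!: finsum_closed)
  qed simp
  finally show ?thesis .
qed

lemma monomial_ideal_is_ideal: "ideal (monomial_ideal X) R"
  unfolding monomial_ideal_def by (rule genideal_ideal) auto

lemma pp_in_monomial_ideal: "A \<in> X \<Longrightarrow> pp A \<in> monomial_ideal X"
  unfolding monomial_ideal_def using genideal_self[of "pp ` X"] by auto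

lemma monomial_ideal_least: "ideal J R \<Longrightarrow> (\<And>A. A \<in> X \<Longrightarrow> pp A \<in> J) \<Longrightarrow> monomial_ideal X \<subseteq> J"
  unfolding monomial_ideal_def by (rule genideal_minimal) auto

lemma monomial_ideal_mono: "X \<subseteq> Y \<Longrightarrow> monomial_ideal X \<subseteq> monomial_ideal Y"
  by (rule monomial_ideal_least[OF monomial_ideal_is_ideal]) (auto intro: pp_in_monomial_ideal)

lemma pp_add_in_ideal: "ideal J R \<Longrightarrow> pp A \<in> J \<Longrightarrow> pp (A + B) \<in> J"
  unfolding pp_add by (rule ideal_facts(8)) auto

lemma lincomb_in_monomial_ideal:
  assumes "\<And>A. A \<in> F \<Longrightarrow> r A \<in> carrier R" "F \<subseteq> X"
  shows "lincomb r F \<in> monomial_ideal X"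
proof (rule lincomb_in_ideal[OF monomial_ideal_is_ideal])
  fix A assume "A \<in> F"
  then show "r A \<otimes> pp A \<in> monomial_ideal X"
    using assms by (intro ideal_facts(7)[OF monomial_ideal_is_ideal] pp_in_monomial_ideal) auto
qed

text \<open>Two passages through ideal quotients, one for each factor, reduce the claim to products
  of generators.\<close>

lemma ideal_mult_genideal:
  assumes "S \<subseteq> carrier R" "T \<subseteq> carrier R" "ideal L R" "\<And>s t. s \<in> S \<Longrightarrow> t \<in> T \<Longrightarrow> s \<otimes> t \<in> L"
    "a \<in> Idl S" "b \<in> Idl T"
  shows "a \<otimes> b \<in> L"
proof -
  have "Idl S \<subseteq> {a \<in> carrier R. \<forall>t\<in>T. a \<otimes> t \<in> L}"
    by (rule genideal_minimal[OF colon_ideal]) (use assms in auto)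
  moreover have aS: "Idl S \<subseteq> carrier R" using ideal_facts(1)[OF genideal_ideal[OF assms(1)]] .
  ultimately have "Idl T \<subseteq> {b \<in> carrier R. \<forall>a\<in>{a}. b \<otimes> a \<in> L}" using assms(5)
    by (intro genideal_minimal[OF colon_ideal]) (use assms m_comm in \<open>auto simp: subset_iff\<close>)
  then have "b \<otimes> a \<in> L" "b \<in> carrier R" using assms(6) by auto
  then show ?thesis using m_comm[of a b] aS assms(5) by auto
qed

lemma monomial_ideal_mult:
  assumes "ideal L R" "\<And>A B. A \<in> X \<Longrightarrow> B \<in> Y \<Longrightarrow> pp (A + B) \<in> L"
    "a \<in> monomial_ideal X" "b \<in> monomial_ideal Y"
  shows "a \<otimes> b \<in> L"
  by (rule ideal_mult_genideal[of "pp ` X" "pp ` Y"])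
    (use assms in \<open>auto simp: pp_add monomial_ideal_def\<close>)

text \<open>That these elements form an ideal allows a normal form modulo \<open>J\<close> to be
  checked on generators only. It is used with all coefficients allowed, and with coefficients in the
  maximal ideal and \<open>J\<close> zero.\<close>

lemma lincomb_mod_ideal:
  assumes "finite F" "ideal \<aa> R" "ideal J R"
  shows "ideal {z \<in> carrier R. \<exists>r. (\<forall>A. r A \<in> \<aa>) \<and> z \<ominus> lincomb r F \<in> J} R" (is "ideal ?I R")
proof (rule ideal_intro)
  note a = ideal_facts[OF assms(2)] and J = ideal_facts[OF assms(3)]
  show "\<zero> \<in> ?I"
  proof -
    have "lincomb (\<lambda>_. \<zero>) F = \<zero>"
      using lincomb_neutral[of F "{}" "\<lambda>_. \<zero>"] assms by auto
    then show ?thesis using a(2) J(2) by (auto intro!: exI[of _ "\<lambda>_. \<zero>"] simp: a_minus_def)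
  qed
  fix z assume "z \<in> ?I"
  then obtain r where z: "z \<in> carrier R" and r: "\<And>A. r A \<in> \<aa>" "z \<ominus> lincomb r F \<in> J" by auto
  have rc: "r A \<in> carrier R" for A using a r by auto
  have lc: "lincomb r F \<in> carrier R" using rc by auto
  show "c \<otimes> z \<in> ?I" if c: "c \<in> carrier R" for c
  proof -
    have "c \<otimes> z \<ominus> lincomb (\<lambda>A. c \<otimes> r A) F = c \<otimes> (z \<ominus> lincomb r F)"
      unfolding lincomb_scale[OF assms(1) rc c] using z lc c by algebra
    then show ?thesis using J(7)[OF r(2) c] a(7)[OF r(1) c] z c
      by (intro CollectI conjI exI[of _ "\<lambda>A. c \<otimes> r A"]) auto
  qed
  fix w assume "w \<in> ?I"
  then obtain s where w: "w \<in> carrier R" and s: "\<And>A. s A \<in> \<aa>" "w \<ominus> lincomb s F \<in> J" by auto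
  have sc: "s A \<in> carrier R" for A using a s by auto
  have ls: "lincomb s F \<in> carrier R" using sc by auto
  have "z \<oplus> w \<ominus> lincomb (\<lambda>A. r A \<oplus> s A) F = (z \<ominus> lincomb r F) \<oplus> (w \<ominus> lincomb s F)"
    unfolding lincomb_add[OF rc sc] using z w lc ls by algebra
  then show "z \<oplus> w \<in> ?I" using J(4)[OF r(2) s(2)] a(4)[OF r(1) s(1)] z w
    by (intro CollectI conjI exI[of _ "\<lambda>A. r A \<oplus> s A"]) auto
qed auto

lemma lincomb_indicator:
  assumes "finite F" "A \<in> F" "c \<in> carrier R"
  shows "lincomb (\<lambda>B. if B = A then c else \<zero>) F = c \<otimes> pp A"
proof -
  have "lincomb (\<lambda>B. if B = A then c else \<zero>) F = lincomb (\<lambda>B. if B = A then c else \<zero>) {A}"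
    by (rule lincomb_neutral) (use assms in auto)
  then show ?thesis using assms(3) by (simp add: lincomb_singleton)
qed

lemma monomial_ideal_decomp:
  assumes "finite F" "X \<subseteq> F \<union> Y" "z \<in> monomial_ideal X"
  obtains r where "\<And>A. r A \<in> carrier R" "z \<ominus> lincomb r F \<in> monomial_ideal Y"
proof -
  note J = ideal_facts[OF monomial_ideal_is_ideal[of Y]]
  have "monomial_ideal X \<subseteq>
      {z \<in> carrier R. \<exists>r. (\<forall>A. r A \<in> carrier R) \<and> z \<ominus> lincomb r F \<in> monomial_ideal Y}"
  proof (rule monomial_ideal_least[OF lincomb_mod_ideal])
    fix A assume A: "A \<in> X"
    show "pp A \<in> {z \<in> carrier R. \<exists>r. (\<forall>A. r A \<in> carrier R) \<and> z \<ominus> lincomb r F \<in> monomial_ideal Y}"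
    proof (cases "A \<in> F")
      case True
      have "pp A \<ominus> lincomb (\<lambda>B. if B = A then \<one> else \<zero>) F \<in> monomial_ideal Y"
        using lincomb_indicator[OF assms(1) True, of \<one>] J(2) by (simp add: a_minus_def r_neg)
      then show ?thesis by (intro CollectI conjI exI[of _ "\<lambda>B. if B = A then \<one> else \<zero>"]) auto
    next
      case False
      then have "pp A \<in> monomial_ideal Y" using A assms by (intro pp_in_monomial_ideal) auto
      moreover have "lincomb (\<lambda>_. \<zero>) F = \<zero>"
        using lincomb_neutral[of F "{}" "\<lambda>_. \<zero>"] assms by auto
      ultimately show ?thesis by (auto intro!: exI[of _ "\<lambda>_. \<zero>"] simp: a_minus_def)
    qed
  qed (use assms oneideal monomial_ideal_is_ideal in auto)
  then show ?thesis using assms(3) that by blast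
qed

lemma genideal_range_x: "Idl (range x) = monomial_ideal (range (\<lambda>i. axis i 1))"
  unfolding monomial_ideal_def image_image pp_axis ..

text \<open>A coefficient from the ideal of the parameters can be traded for one more variable in
  the monomial. This replaces reduction of coefficients to the residue field, which is not a subring
  here.\<close>

lemma scaled_pp_in_ideal:
  assumes "ideal L R" "m \<in> Idl (range x)" "\<And>i. pp (A + axis i 1) \<in> L"
  shows "m \<otimes> pp A \<in> L"
proof -
  have "pp A \<otimes> m \<in> L"
    by (rule monomial_ideal_mult[OF assms(1), of "{A}" "range (\<lambda>i. axis i 1)"])
      (use assms in \<open>auto simp: genideal_range_x intro: pp_in_monomial_ideal\<close>)
  moreover have "m \<in> carrier R"
    using assms(2) ideal_facts(1)[OF genideal_ideal, of "range x"] by blast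
  ultimately show ?thesis by (simp add: m_comm)
qed

text \<open>For positive weights this is the filtration belonging to the monomial valuation with
  value \<open>l i\<close> at the parameter \<open>x i\<close>.\<close>

definition weight_ideal :: "('n \<Rightarrow> nat) \<Rightarrow> nat \<Rightarrow> 'a set" where
  "weight_ideal l w = monomial_ideal {A. w \<le> (\<Sum>i\<in>UNIV. l i * A $ i)}"

end

section \<open>Weights of exponent vectors\<close>

abbreviation weight :: "('n::finite \<Rightarrow> nat) \<Rightarrow> nat ^ 'n \<Rightarrow> nat" where
  "weight l A \<equiv> (\<Sum>i\<in>UNIV. l i * A $ i)"

lemma weight_add: "weight l (A + B) = weight l A + weight l B"
  by (simp add: algebra_simps sum.distrib)

lemma weight_axis: "weight l (axis i 1) = l i"
proof -
  have "weight l (axis i 1) = (\<Sum>j\<in>UNIV. if j = i then l i else 0)"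
    by (rule sum.cong) (auto simp: axis_def)
  then show ?thesis by simp
qed

lemma component_le_weight:
  assumes "0 < l i"
  shows "A $ i \<le> weight l A"
proof -
  have "A $ i \<le> l i * A $ i" using assms by simp
  also have "\<dots> \<le> weight l A" by (rule member_le_sum) auto
  finally show ?thesis .
qed

lemma finite_weight_le:
  assumes "\<And>i. 0 < l i"
  shows "finite {A. weight l A \<le> w}"
  by (rule finite_subset[OF _ finite_vec_nat_le[of "\<lambda>_. w"]])
    (use component_le_weight[of l] assms in \<open>auto intro: order_trans\<close>)

section \<open>Dickson's lemma\<close>

lemma nat_seq_incseq_subseq:
  fixes s :: "nat \<Rightarrow> nat"
  shows "\<exists>r :: nat \<Rightarrow> nat. strict_mono r \<and> (\<forall>m n. m \<le> n \<longrightarrow> s (r m) \<le> s (r n))"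
proof -
  obtain f where f: "strict_mono f" "monoseq (\<lambda>n. s (f n))" using seq_monosub[of s] by blast
  from f(2) consider (inc) "\<forall>m. \<forall>n\<ge>m. s (f m) \<le> s (f n)" | (dec) "\<forall>m. \<forall>n\<ge>m. s (f n) \<le> s (f m)"
    unfolding monoseq_def by blast
  then show ?thesis
  proof cases
    case inc
    then show ?thesis using f(1) by blast
  next
    case dec
    define v where "v = (LEAST v. \<exists>n. v = s (f n))"
    have "\<exists>n. v = s (f n)" unfolding v_def by (rule LeastI_ex) blast
    then obtain N where N: "v = s (f N)" by blast
    have le: "v \<le> s (f n)" for n unfolding v_def by (rule Least_le) blast
    have "s (f (N + n)) = v" for n using dec N le[of "N + n"] by (metis le_add1 le_antisym)
    moreover have "strict_mono (\<lambda>n. f (N + n))" using f(1) by (auto simp: strict_mono_def)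
    ultimately show ?thesis by (intro exI[of _ "\<lambda>n. f (N + n)"]) auto
  qed
qed

text \<open>The subsequence is refined one coordinate at a time; a nondecreasing coordinate stays
  nondecreasing under further refinement.\<close>

lemma vec_nat_seq_incseq_subseq:
  fixes s :: "nat \<Rightarrow> nat ^ 'n::finite"
  shows "\<exists>r :: nat \<Rightarrow> nat. strict_mono r \<and> (\<forall>m n. m \<le> n \<longrightarrow> s (r m) \<le> s (r n))"
proof -
  have "\<exists>r :: nat \<Rightarrow> nat. strict_mono r \<and> (\<forall>i\<in>I. \<forall>m n. m \<le> n \<longrightarrow> s (r m) $ i \<le> s (r n) $ i)"
    if "finite I" for I :: "'n set"
    using that
  proof (induction I)
    case empty
    show ?case by (rule exI[of _ id]) (auto simp: strict_mono_def)
  next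
    case (insert i I)
    from insert.IH obtain r :: "nat \<Rightarrow> nat"
      where r: "strict_mono r" "\<forall>i\<in>I. \<forall>m n. m \<le> n \<longrightarrow> s (r m) $ i \<le> s (r n) $ i"
      by (elim exE conjE)
    obtain q :: "nat \<Rightarrow> nat" where q: "strict_mono q" "\<forall>m n. m \<le> n \<longrightarrow> s (r (q m)) $ i \<le> s (r (q n)) $ i"
      using nat_seq_incseq_subseq[of "\<lambda>n. s (r n) $ i"] by (elim exE conjE)
    have "strict_mono (r \<circ> q)" using r(1) q(1) by (rule strict_mono_o)
    moreover have "s ((r \<circ> q) m) $ j \<le> s ((r \<circ> q) n) $ j" if "j \<in> insert i I" "m \<le> n" for j m n
    proof (cases "j = i")
      case True
      then show ?thesis using q(2) that(2) by simp
    next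
      case False
      moreover have "q m \<le> q n" using strict_mono_less_eq[OF q(1)] that(2) by simp
      ultimately show ?thesis using r(2) that(1) by simp
    qed
    ultimately show ?case by (intro exI[of _ "r \<circ> q"] conjI ballI allI impI)
  qed
  from this[of UNIV] show ?thesis by (auto simp: less_eq_vec_def)
qed

definition minimal_exponents :: "(nat ^ 'n::finite) set \<Rightarrow> (nat ^ 'n) set" where
  "minimal_exponents S = {A \<in> S. \<forall>B\<in>S. B \<le> A \<longrightarrow> B = A}"

lemma finite_minimal_exponents: "finite (minimal_exponents S)"
proof (rule ccontr)
  assume "infinite (minimal_exponents S)"
  then obtain s :: "nat \<Rightarrow> _" where s: "inj s" "range s \<subseteq> minimal_exponents S"
    using infinite_countable_subset by blast
  obtain r :: "nat \<Rightarrow> nat" where r: "strict_mono r" "\<forall>m n. m \<le> n \<longrightarrow> s (r m) \<le> s (r n)"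
    using vec_nat_seq_incseq_subseq[of s] by blast
  have "s (r 0) \<le> s (r 1)" using r(2) by simp
  moreover have "s (r 0) \<in> minimal_exponents S" "s (r 1) \<in> minimal_exponents S" using s(2) by auto
  ultimately have "s (r 0) = s (r 1)" by (auto simp: minimal_exponents_def)
  then have "r 0 = r 1" using s(1) by (auto dest: injD)
  then show False using strict_monoD[OF r(1), of 0 1] by simp
qed

lemma minimal_exponent_below:
  assumes "A \<in> S"
  shows "\<exists>B\<in>minimal_exponents S. B \<le> A"
  using assms
proof (induction "weight (\<lambda>_. 1) A" arbitrary: A rule: less_induct)
  case less
  show ?case
  proof (cases "A \<in> minimal_exponents S")
    case False
    then obtain B where B: "B \<in> S" "B \<le> A" "B \<noteq> A" using less.prems by (auto simp: minimal_exponents_def)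
    then obtain i where "B $ i \<noteq> A $ i" by (auto simp: vec_eq_iff)
    then have "weight (\<lambda>_. 1) B < weight (\<lambda>_. 1) A"
      using B(2) by (intro sum_strict_mono_ex1) (auto simp: less_eq_vec_def order.strict_iff_order)
    from less.hyps[OF this B(1)] show ?thesis using B(2) order_trans by blast
  qed auto
qed

section \<open>Noetherian local rings with a system of parameters\<close>

text \<open>The weights are powers of one integer \<open>M\<close>. The weight of an exponent is
  then the value at \<open>M\<close> of a polynomial with the entries of the exponent as
  coefficients, so only finitely many \<open>M\<close> fail to separate a finite set. The coordinate
  of index 0 has weight 1 and can play the role of a curve parameter.\<close>

lemma separating_weight:
  fixes F :: "(nat ^ 'n::finite) set"
  assumes "finite F"
  obtains N :: "'n \<Rightarrow> nat" and i0 where "N i0 = 1" "\<And>i. 0 < N i"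
    "inj_on (weight N) F"
proof -
  obtain idx :: "'n \<Rightarrow> nat" where idx: "bij_betw idx UNIV {0..<CARD('n)}"
    using ex_bij_betw_finite_nat[of "UNIV :: 'n set"] by auto
  then have inj: "inj idx" by (auto simp: bij_betw_def)
  obtain i0 where i0: "idx i0 = 0"
    using idx zero_less_card_finite[where ?'a='n] by (metis UNIV_I atLeastLessThan_iff bij_betw_imp_surj_on imageE le0)
  define p where "p A = (\<Sum>i\<in>UNIV. Polynomial.monom (int (A $ i)) (idx i))" for A :: "nat ^ 'n"
  have pinj: "p A \<noteq> p B" if "A \<noteq> B" for A B
  proof -
    have co: "Polynomial.coeff (p A) (idx i) = int (A $ i)" for A i
    proof -
      have "Polynomial.coeff (p A) (idx i) = (\<Sum>j\<in>UNIV. if j = i then int (A $ i) else 0)"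
        unfolding p_def coeff_sum by (rule sum.cong) (use inj in \<open>auto simp: inj_def\<close>)
      then show ?thesis by simp
    qed
    obtain i where "A $ i \<noteq> B $ i" using \<open>A \<noteq> B\<close> by (auto simp: vec_eq_iff)
    then show ?thesis using co[of A i] co[of B i] by auto
  qed
  \<comment> \<open>Besides the roots of all differences, 0 is excluded, so that every weight is
    positive.\<close>
  define bad where "bad = insert 0 (\<Union>A\<in>F. \<Union>B\<in>F - {A}. {m. poly (p A - p B) m = 0})"
  have "finite {m. poly (p A - p B) m = 0}" if "B \<in> F - {A}" for A B
    by (rule poly_roots_finite) (use pinj[of A B] that in auto)
  then have "finite bad" unfolding bad_def using assms by blast
  then have "finite (int -` bad)" by (rule finite_vimageI) auto
  then obtain M where M: "int M \<notin> bad" using ex_new_if_finite[OF infinite_UNIV_nat] by blast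
  have poly_p: "poly (p A) (int M) = int (weight (\<lambda>i. M ^ idx i) A)" for A
    unfolding p_def poly_sum by (simp add: poly_monom mult.commute)
  have "inj_on (weight (\<lambda>i. M ^ idx i)) F"
  proof (rule inj_onI, rule ccontr)
    fix A B assume AB: "A \<in> F" "B \<in> F" "weight (\<lambda>i. M ^ idx i) A = weight (\<lambda>i. M ^ idx i) B" "A \<noteq> B"
    then have "poly (p A - p B) (int M) = 0" by (simp only: poly_diff poly_p)
    then show False using M AB(1,2,4) unfolding bad_def by blast
  qed
  moreover have "0 < M" using M by (auto simp: bad_def intro!: Nat.gr0I)
  ultimately show ?thesis using i0 by (intro that[of "\<lambda>i. M ^ idx i" i0]) auto
qed

lemma (in cring) diff_add_cancel':
  "a \<in> carrier R \<Longrightarrow> b \<in> carrier R \<Longrightarrow> (a \<ominus> b) \<oplus> b = a"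
  by algebra

lemma (in cring) cong_mult:
  assumes "ideal Q R" "a \<ominus> b \<in> Q" "c \<ominus> d \<in> Q"
    "a \<in> carrier R" "b \<in> carrier R" "c \<in> carrier R" "d \<in> carrier R"
  shows "a \<otimes> c \<ominus> b \<otimes> d \<in> Q"
proof -
  note Q = ideal_facts[OF assms(1)]
  have "a \<otimes> c \<ominus> b \<otimes> d = (a \<ominus> b) \<otimes> c \<oplus> b \<otimes> (c \<ominus> d)" using assms(4-7) by algebra
  then show ?thesis using Q(4)[OF Q(8)[OF assms(2,6)] Q(7)[OF assms(3,5)]] by simp
qed

lemma (in cring) cong_pow:
  assumes "ideal Q R" "a \<ominus> b \<in> Q" "a \<in> carrier R" "b \<in> carrier R"
  shows "a [^] (k::nat) \<ominus> b [^] k \<in> Q"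
proof (induction k)
  case 0
  show ?case using ideal_facts(2)[OF assms(1)] by (simp add: a_minus_def r_neg)
next
  case (Suc k)
  then show ?case using cong_mult[OF assms(1) Suc assms(2)] assms by simp
qed

text \<open>Of regularity two consequences are kept: the parameters generate the only maximal ideal,
  and there is a chain of primes with as many steps as parameters. Nothing is said about the top of
  the chain, which can always be replaced by the maximal ideal.\<close>

locale parameter_ring = cring_vars R x + noetherian_cring R
  for R (structure) and x :: "'n::finite \<Rightarrow> 'a" +
  assumes maximal_iff: "maximalideal M R \<longleftrightarrow> M = Idl (range x)"
    and prime_chain: "\<exists>P. (\<forall>i\<le>CARD('n). primeideal (P i) R) \<and> (\<forall>i<CARD('n). P i \<subset> P (Suc i))"
begin

abbreviation mm :: "'a set" where "mm \<equiv> Idl (range x)"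

lemma maximal_mm: "maximalideal mm R"
  using maximal_iff by simp

lemma ideal_mm: "ideal mm R"
  by (rule genideal_ideal) auto

lemma prime_mm: "primeideal mm R"
  by (rule maximalideal_prime[OF maximal_mm])

lemma x_in_mm: "x i \<in> mm"
  using genideal_self[of "range x"] by auto

lemma proper_ideal_subset_mm:
  assumes "ideal I R" "I \<noteq> carrier R"
  shows "I \<subseteq> mm"
proof -
  define \<S> where "\<S> = {J. ideal J R \<and> I \<subseteq> J \<and> J \<noteq> carrier R}"
  have "\<S> \<noteq> {}" using assms by (auto simp: \<S>_def)
  then obtain M where M: "M \<in> \<S>" "\<And>J. J \<in> \<S> \<Longrightarrow> M \<subseteq> J \<Longrightarrow> J = M"
    using maximal_element[of \<S>] unfolding \<S>_def by blast
  have "maximalideal M R"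
  proof (rule maximalidealI)
    show "ideal M R" "carrier R \<noteq> M" using M by (auto simp: \<S>_def)
    show "J = M \<or> J = carrier R" if "ideal J R" "M \<subseteq> J" for J
      using M(2)[of J] that M(1) unfolding \<S>_def by blast
  qed
  then show ?thesis using M(1) maximal_iff by (auto simp: \<S>_def)
qed

lemma Units_iff: "a \<in> Units R \<longleftrightarrow> a \<in> carrier R \<and> a \<notin> mm"
proof
  assume a: "a \<in> Units R"
  have "a \<notin> mm"
  proof
    assume "a \<in> mm"
    then have "inv a \<otimes> a \<in> mm" by (rule ideal_facts(7)[OF ideal_mm]) (use a in auto)
    then show False using prime_facts(2)[OF prime_mm] Units_l_inv[OF a] by (simp only:)
  qed
  then show "a \<in> carrier R \<and> a \<notin> mm" using a by auto
next
  assume a: "a \<in> carrier R \<and> a \<notin> mm"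
  then have "PIdl a = carrier R"
    using proper_ideal_subset_mm[OF cgenideal_ideal, of a] cgenideal_self[of a] by auto
  then have "\<one> \<in> PIdl a" by simp
  then obtain b where "b \<in> carrier R" "\<one> = b \<otimes> a" by (auto simp: cgenideal_def)
  then show "a \<in> Units R" using a m_comm[of a b] by (auto simp: Units_def)
qed

lemma Units_add_mm:
  assumes "u \<in> Units R" "m \<in> mm"
  shows "u \<oplus> m \<in> Units R"
proof -
  note I = ideal_facts[OF ideal_mm]
  have c: "u \<in> carrier R" "m \<in> carrier R" using assms I by auto
  have "u \<oplus> m \<notin> mm"
  proof
    assume "u \<oplus> m \<in> mm"
    from I(6)[OF this assms(2)] have "u \<oplus> m \<ominus> m \<in> mm" .
    moreover have "u \<oplus> m \<ominus> m = u" using c by algebra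
    ultimately show False using assms Units_iff by auto
  qed
  then show ?thesis using c Units_iff by auto
qed

subsection \<open>Algebraic independence of the parameters\<close>

text \<open>Restrict to the curve on which \<open>x i\<close> becomes the power \<open>N i\<close>
  of one parameter \<open>t\<close>. Its equations are one fewer than the dimension, so by the
  height theorem a prime \<open>Q\<close> strictly below the maximal ideal contains them, and
  \<open>t\<close> survives modulo \<open>Q\<close>. With separating weights the monomials become
  distinct powers of \<open>t\<close>, and the lowest one, having a unit coefficient, cannot
  cancel.\<close>

lemma lincomb_units_eq_zero:
  assumes "finite F" "\<And>A. A \<in> F \<Longrightarrow> r A \<in> Units R" "lincomb r F = \<zero>"
  shows "F = {}"
proof (rule ccontr)
  assume ne: "F \<noteq> {}"
  obtain N :: "'n \<Rightarrow> nat" and i0 where N: "N i0 = 1" "\<And>i. 0 < N i" and inj: "inj_on (weight N) F"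
    using separating_weight[OF assms(1)] by blast
  define t where "t = x i0"
  have t: "t \<in> carrier R" by (simp add: t_def)
  obtain P where P: "\<forall>i\<le>CARD('n). primeideal (P i) R" "\<forall>i<CARD('n). P i \<subset> P (Suc i)"
    using prime_chain by blast
  \<comment> \<open>The given chain may end below the maximal ideal; raising its top keeps it
    strict.\<close>
  define P' where "P' i = (if i = CARD('n) then mm else P i)" for i
  obtain js where js: "set js = UNIV - {i0}" "distinct js"
    using finite_distinct_list[of "UNIV - {i0}"] by auto
  define ys where "ys = map (\<lambda>i. x i \<ominus> t [^] N i) js"
  have "length js = CARD('n) - 1" using distinct_card[OF js(2)] js(1) by (simp add: card_Diff_singleton)
  then have len: "length ys < CARD('n)" by (simp add: ys_def)
  have tm: "t [^] N i \<in> mm" for i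
  proof -
    have "N i = (N i - 1) + 1" using N(2)[of i] by simp
    then have "t [^] N i = t [^] (N i - 1) \<otimes> t" using t by (metis nat_pow_Suc Suc_eq_plus1)
    then show ?thesis using ideal_facts(7)[OF ideal_mm x_in_mm[of i0]] t unfolding t_def by simp
  qed
  have "\<exists>Q. primeideal Q R \<and> set ys \<subseteq> Q \<and> Q \<subset> P' (CARD('n))"
  proof (rule prime_below_chain_top[OF _ _ _ len])
    show "primeideal (P' i) R" if "i \<le> CARD('n)" for i
      using P(1) that prime_mm by (auto simp: P'_def)
    show "P' i \<subset> P' (Suc i)" if i: "i < CARD('n)" for i
    proof -
      have "P (Suc i) \<subseteq> mm" using P(1) i prime_facts(1,3) proper_ideal_subset_mm by (metis Suc_leI)
      then show ?thesis using P(2) i by (auto simp: P'_def)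
    qed
    show "set ys \<subseteq> P' (CARD('n))"
      using tm x_in_mm ideal_facts(6)[OF ideal_mm] by (auto simp: ys_def P'_def)
  qed
  then obtain Q where Q: "primeideal Q R" "set ys \<subseteq> Q" "Q \<subset> mm" by (auto simp: P'_def)
  note Qf = prime_facts[OF Q(1)]
  note Qi = ideal_facts[OF Qf(1)]
  have xy: "x i \<ominus> t [^] N i \<in> Q" for i
  proof (cases "i = i0")
    case True
    then show ?thesis using Qi(2) t N(1) by (simp add: t_def nat_pow_eone a_minus_def r_neg)
  qed (use Q(2) js in \<open>auto simp: ys_def\<close>)
  \<comment> \<open>If \<open>t\<close> were in \<open>Q\<close>, the congruences would put every
    parameter into \<open>Q\<close>, which is strictly smaller than the maximal ideal.\<close>
  have tQ: "t \<notin> Q"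
  proof
    assume "t \<in> Q"
    have "x i \<in> Q" for i
    proof -
      have "N i = (N i - 1) + 1" using N(2)[of i] by simp
      then have "t [^] N i = t [^] (N i - 1) \<otimes> t" using t by (metis nat_pow_Suc Suc_eq_plus1)
      then have "t [^] N i \<in> Q" using Qi(7)[OF \<open>t \<in> Q\<close>] t by simp
      from Qi(4)[OF xy[of i] this] have "(x i \<ominus> t [^] N i) \<oplus> t [^] N i \<in> Q" .
      moreover have "(x i \<ominus> t [^] N i) \<oplus> t [^] N i = x i"
      proof -
        have "t [^] N i \<in> carrier R" using t by simp
        then show ?thesis using x_closed[of i] by algebra
      qed
      ultimately show ?thesis by simp
    qed
    then have "mm \<subseteq> Q" by (intro genideal_minimal Qf(1)) auto
    then show False using Q(3) by auto
  qed
  have cong: "pp A \<ominus> t [^] weight N A \<in> Q" for A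
  proof -
    have "(\<Otimes>i\<in>S. x i [^] (A $ i)) \<ominus> t [^] (\<Sum>i\<in>S. N i * A $ i) \<in> Q" if "finite S" for S
      using that
    proof (induction S)
      case empty
      then show ?case using Qi(2) by (simp add: a_minus_def r_neg)
    next
      case (insert i S)
      have "x i [^] (A $ i) \<otimes> (\<Otimes>i\<in>S. x i [^] (A $ i)) \<ominus>
          t [^] (N i * A $ i) \<otimes> t [^] (\<Sum>i\<in>S. N i * A $ i) \<in> Q"
        by (rule cong_mult[OF Qf(1)])
          (use insert cong_pow[OF Qf(1) xy, of i "A $ i"] t in \<open>auto simp: nat_pow_pow intro!: finprod_closed\<close>)
      then show ?case using insert t by (subst finprod_insert) (auto simp: nat_pow_mult)
    qed
    from this[of UNIV] show ?thesis by (simp add: power_product_def)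
  qed
  define A where "A = arg_min_on (weight N) F"
  have A: "A \<in> F" "\<And>B. B \<in> F \<Longrightarrow> weight N A \<le> weight N B"
    using arg_min_if_finite(1)[OF assms(1) ne] arg_min_least[OF assms(1) ne] by (auto simp: A_def)
  define e where "e = weight N A"
  \<comment> \<open>Modulo this ideal all monomials of the relation vanish except the one of least
    weight \<open>e\<close>.\<close>
  define I where "I = extend_ideal Q (t [^] Suc e)"
  have I: "ideal I R" unfolding I_def by (rule extend_ideal_is_ideal[OF Qf(1)]) (use t in auto)
  have QI: "Q \<subseteq> I" "t [^] Suc e \<in> I" unfolding I_def
    by (rule extend_ideal_superset[OF Qf(1)], use t in auto)+
  have rc: "r B \<in> carrier R" if "B \<in> F" for B using assms(2)[OF that] by auto
  have "lincomb r (F - {A}) \<in> I"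
  proof (rule lincomb_in_ideal[OF I])
    fix B assume B: "B \<in> F - {A}"
    then have "weight N B \<noteq> e" using inj A(1) unfolding e_def inj_on_def by blast
    then have "Suc e \<le> weight N B" using A(2)[of B] B by (auto simp: e_def)
    then obtain k where "weight N B = k + Suc e" using le_Suc_ex by (metis add.commute)
    then have "t [^] weight N B = t [^] k \<otimes> t [^] Suc e" using nat_pow_mult[OF t, of k "Suc e"] by (simp only:)
    then have "t [^] weight N B \<in> I" using ideal_facts(7)[OF I QI(2)] t by simp
    moreover have "pp B \<ominus> t [^] weight N B \<in> I" using cong QI by auto
    ultimately have "(pp B \<ominus> t [^] weight N B) \<oplus> t [^] weight N B \<in> I"
      using ideal_facts(4)[OF I] by blast
    moreover have "(pp B \<ominus> t [^] weight N B) \<oplus> t [^] weight N B = pp B"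
      using t by (intro diff_add_cancel') auto
    ultimately have "pp B \<in> I" by simp
    then show "r B \<otimes> pp B \<in> I" using ideal_facts(7)[OF I] rc B by auto
  qed
  moreover have "lincomb r F = r A \<otimes> pp A \<oplus> lincomb r (F - {A})"
    using lincomb_insert[of "F - {A}" A r] assms(1) A(1) rc by (simp add: insert_absorb)
  ultimately have "r A \<otimes> pp A \<in> I"
  proof -
    assume a: "lincomb r (F - {A}) \<in> I" "lincomb r F = r A \<otimes> pp A \<oplus> lincomb r (F - {A})"
    have "r A \<otimes> pp A = \<ominus> lincomb r (F - {A})"
      using a(2) assms(3) rc[OF A(1)] ideal_facts(3)[OF I a(1)] by (metis m_closed minus_equality pp_closed)
    then show ?thesis using ideal_facts(5)[OF I a(1)] by simp
  qed
  moreover have "r A \<otimes> (pp A \<ominus> t [^] e) \<in> I"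
    using cong[of A] QI ideal_facts(7)[OF I] rc[OF A(1)] unfolding e_def by blast
  ultimately have "r A \<otimes> pp A \<ominus> r A \<otimes> (pp A \<ominus> t [^] e) \<in> I" using ideal_facts(6)[OF I] by blast
  moreover have te: "t [^] e \<in> carrier R" using t by simp
  then have "r A \<otimes> pp A \<ominus> r A \<otimes> (pp A \<ominus> t [^] e) = r A \<otimes> t [^] e"
    using rc[OF A(1)] pp_closed[of A] by algebra
  ultimately obtain s where s: "s \<in> carrier R" "r A \<otimes> t [^] e \<ominus> s \<otimes> (t [^] e \<otimes> t) \<in> Q"
    by (auto simp: I_def extend_ideal_def)
  have "r A \<otimes> t [^] e \<ominus> s \<otimes> (t [^] e \<otimes> t) = t [^] e \<otimes> (r A \<ominus> s \<otimes> t)"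
    using rc[OF A(1)] s(1) te t by algebra
  then have "r A \<ominus> s \<otimes> t \<in> Q"
    using Qf(4)[of "t [^] e" "r A \<ominus> s \<otimes> t"] Qf(5)[OF t] tQ te s rc[OF A(1)] t by auto
  moreover have "s \<otimes> t \<in> mm" using ideal_facts(7)[OF ideal_mm x_in_mm s(1)] by (simp add: t_def)
  ultimately have "(r A \<ominus> s \<otimes> t) \<oplus> s \<otimes> t \<in> mm" using Q(3) ideal_facts(4)[OF ideal_mm] by blast
  moreover have "(r A \<ominus> s \<otimes> t) \<oplus> s \<otimes> t = r A" using rc[OF A(1)] s(1) t by algebra
  ultimately show False using assms(2)[OF A(1)] Units_iff by auto
qed

end

lemma (in cring_vars) pp_axis_pow: "pp (axis i k) = x i [^] k"
proof (induction k)
  case 0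
  have z: "axis i 0 = (0 :: nat ^ 'n)" by (simp add: vec_eq_iff axis_def)
  show ?case unfolding z pp_zero by simp
next
  case (Suc k)
  have "axis i (Suc k) = axis i k + (axis i 1 :: nat ^ 'n)" by (simp add: vec_eq_iff axis_def)
  then have "pp (axis i (Suc k)) = pp (axis i k) \<otimes> pp (axis i 1)" by (simp only: pp_add)
  then show ?case using Suc unfolding pp_axis by simp
qed

lemma exponent_split:
  fixes A B :: "nat ^ 'n::finite"
  assumes "B \<le> A"
  shows "A = B + (\<chi> i. A $ i - B $ i)"
  using assms by (auto simp: vec_eq_iff less_eq_vec_def)

context cring
begin

lemma diff_trans:
  "a \<in> carrier R \<Longrightarrow> b \<in> carrier R \<Longrightarrow> c \<in> carrier R \<Longrightarrow> (a \<ominus> b) \<oplus> (b \<ominus> c) = a \<ominus> c"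
  by algebra

lemma diff_add_eq_diff_diff:
  "a \<in> carrier R \<Longrightarrow> b \<in> carrier R \<Longrightarrow> c \<in> carrier R \<Longrightarrow> a \<ominus> (b \<oplus> c) = (a \<ominus> b) \<ominus> c"
  by algebra

lemma diff_self: "a \<in> carrier R \<Longrightarrow> a \<ominus> a = \<zero>"
  by algebra

lemma diff_zero: "a \<in> carrier R \<Longrightarrow> a \<ominus> \<zero> = a"
  by algebra

end

section \<open>The filtration by a monomial weight\<close>

context cring_vars
begin

lemma pp_in_ideal_of_le: "ideal J R \<Longrightarrow> pp B \<in> J \<Longrightarrow> B \<le> A \<Longrightarrow> pp A \<in> J"
  by (subst exponent_split[of B A]) (auto intro: pp_add_in_ideal)

lemma weight_ideal_is_ideal: "ideal (weight_ideal l w) R"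
  unfolding weight_ideal_def by (rule monomial_ideal_is_ideal)

lemma weight_ideal_antimono: "w \<le> w' \<Longrightarrow> weight_ideal l w' \<subseteq> weight_ideal l w"
  unfolding weight_ideal_def by (rule monomial_ideal_mono) auto

lemma weight_ideal_zero: "weight_ideal l 0 = carrier R"
proof -
  have "\<one> \<in> weight_ideal l 0"
    using pp_in_monomial_ideal[of 0 "{A. 0 \<le> weight l A}"] by (simp add: weight_ideal_def pp_zero)
  then show ?thesis using ideal.one_imp_carrier[OF weight_ideal_is_ideal] by simp
qed

lemma pp_in_weight_ideal: "w \<le> weight l A \<Longrightarrow> pp A \<in> weight_ideal l w"
  unfolding weight_ideal_def by (rule pp_in_monomial_ideal) simp

lemma lincomb_in_weight_ideal:
  assumes "\<And>A. A \<in> F \<Longrightarrow> r A \<in> carrier R" "\<And>A. A \<in> F \<Longrightarrow> w \<le> weight l A"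
  shows "lincomb r F \<in> weight_ideal l w"
  unfolding weight_ideal_def using assms by (intro lincomb_in_monomial_ideal) auto

lemma weight_ideal_mult:
  "a \<in> weight_ideal l v \<Longrightarrow> b \<in> weight_ideal l w \<Longrightarrow> a \<otimes> b \<in> weight_ideal l (v + w)"
  by (rule monomial_ideal_mult[OF weight_ideal_is_ideal, of "{A. v \<le> weight l A}" "{A. w \<le> weight l A}"])
    (auto simp only: weight_ideal_def[of l v] weight_ideal_def[of l w] weight_add mem_Collect_eq
      intro!: pp_in_weight_ideal add_mono)

end

lemma (in noetherian_cring) maximal_element_ex:
  assumes "\<S> \<noteq> {}" "\<And>I. I \<in> \<S> \<Longrightarrow> ideal I R"
  shows "\<exists>M\<in>\<S>. \<forall>I\<in>\<S>. M \<subseteq> I \<longrightarrow> I = M"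
proof -
  obtain M where "M \<in> \<S>" "\<And>I. I \<in> \<S> \<Longrightarrow> M \<subseteq> I \<Longrightarrow> I = M"
    using maximal_element[of \<S>] assms by metis
  then show ?thesis by blast
qed

context parameter_ring
begin

subsection \<open>Krull's intersection theorem\<close>

text \<open>A monomial of large weight must be divisible by a high power of some variable.\<close>

lemma weight_ideal_subset:
  assumes "ideal C R" "\<And>i. \<exists>k::nat. x i [^] k \<in> C"
  shows "\<exists>w. weight_ideal l w \<subseteq> C"
proof -
  obtain k where k: "\<And>i. x i [^] (k i :: nat) \<in> C" using assms(2) by metis
  have "weight_ideal l (Suc (\<Sum>i\<in>UNIV. l i * k i)) \<subseteq> C" unfolding weight_ideal_def
  proof (rule monomial_ideal_least[OF assms(1)])
    fix A :: "nat ^ 'n"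
    assume "A \<in> {A. Suc (\<Sum>i\<in>UNIV. l i * k i) \<le> weight l A}"
    then have "\<not> weight l A \<le> (\<Sum>i\<in>UNIV. l i * k i)" by auto
    have "\<exists>i. \<not> l i * A $ i \<le> l i * k i"
    proof (rule ccontr)
      assume "\<nexists>i. \<not> l i * A $ i \<le> l i * k i"
      then have "weight l A \<le> (\<Sum>i\<in>UNIV. l i * k i)" by (intro sum_mono) blast
      with \<open>\<not> weight l A \<le> (\<Sum>i\<in>UNIV. l i * k i)\<close> show False by simp
    qed
    then obtain i where "\<not> l i * A $ i \<le> l i * k i" by blast
    then have "k i \<le> A $ i" by auto
    then have "axis i (k i) \<le> A" by (auto simp: less_eq_vec_def axis_def)
    moreover have "pp (axis i (k i)) \<in> C" using k by (simp add: pp_axis_pow)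
    ultimately show "pp A \<in> C" using pp_in_ideal_of_le[OF assms(1)] by blast
  qed
  then show ?thesis by blast
qed

text \<open>\<open>B\<close> is the closure of \<open>J\<close> for the weight filtration. If it
  were larger than \<open>J\<close>, a maximal proper intermediate ideal \<open>W\<close> would
  satisfy \<open>mm\<close> \<open>B\<close> \<subseteq> \<open>W\<close>. An ideal \<open>C\<close>
  maximal with intersection \<open>W\<close> with \<open>B\<close> then contains a power of every
  parameter, hence a member of the filtration, and so contains the closure \<open>B\<close>, a
  contradiction. No Artin-Rees estimate is involved.\<close>

lemma krull_intersection:
  assumes J: "ideal J R" and z: "z \<in> carrier R" "\<And>w. \<exists>j\<in>J. z \<ominus> j \<in> weight_ideal l w"
  shows "z \<in> J"
proof (rule ccontr)
  assume zJ: "z \<notin> J"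
  note Jf = ideal_facts[OF J] and Wf = ideal_facts[OF weight_ideal_is_ideal[of l]]
  define B where "B = {b \<in> carrier R. \<forall>w. \<exists>j\<in>J. b \<ominus> j \<in> weight_ideal l w}"
  have B: "ideal B R"
  proof (rule ideal_intro)
    have "\<exists>j\<in>J. \<zero> \<ominus> j \<in> weight_ideal l w" for w
      using Jf(2) Wf(2) by (intro bexI[of _ \<zero>]) (simp_all add: diff_self)
    then show "\<zero> \<in> B" by (simp add: B_def)
    fix a assume "a \<in> B"
    then have a: "a \<in> carrier R" "\<And>w. \<exists>j\<in>J. a \<ominus> j \<in> weight_ideal l w" by (auto simp: B_def)
    show "r \<otimes> a \<in> B" if r: "r \<in> carrier R" for r
    proof -
      have "\<exists>j\<in>J. r \<otimes> a \<ominus> j \<in> weight_ideal l w" for w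
      proof -
        obtain j where j: "j \<in> J" "a \<ominus> j \<in> weight_ideal l w" using a(2) by blast
        have "r \<otimes> a \<ominus> r \<otimes> j = r \<otimes> (a \<ominus> j)" using a(1) r Jf(3)[OF j(1)] by algebra
        then show ?thesis using Wf(7)[OF j(2) r] Jf(7)[OF j(1) r]
          by (intro bexI[of _ "r \<otimes> j"]) simp_all
      qed
      then show ?thesis using a r by (auto simp: B_def)
    qed
    fix b assume "b \<in> B"
    then have b: "b \<in> carrier R" "\<And>w. \<exists>j\<in>J. b \<ominus> j \<in> weight_ideal l w" by (auto simp: B_def)
    have "\<exists>j\<in>J. a \<oplus> b \<ominus> j \<in> weight_ideal l w" for w
    proof -
      obtain i j where j: "i \<in> J" "a \<ominus> i \<in> weight_ideal l w" "j \<in> J" "b \<ominus> j \<in> weight_ideal l w"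
        using a(2) b(2) by blast
      have "a \<oplus> b \<ominus> (i \<oplus> j) = (a \<ominus> i) \<oplus> (b \<ominus> j)"
        using a(1) b(1) Jf(3)[OF j(1)] Jf(3)[OF j(3)] by algebra
      then show ?thesis using Wf(4)[OF j(2,4)] Jf(4)[OF j(1,3)]
        by (intro bexI[of _ "i \<oplus> j"]) simp_all
    qed
    then show "a \<oplus> b \<in> B" using a b by (auto simp: B_def)
  qed (auto simp: B_def)
  note Bf = ideal_facts[OF B]
  have JB: "J \<subseteq> B"
  proof
    fix j assume j: "j \<in> J"
    then have "\<exists>j'\<in>J. j \<ominus> j' \<in> weight_ideal l w" for w
      using Jf(3) Wf(2) by (intro bexI[of _ j]) (simp_all add: diff_self)
    then show "j \<in> B" using Jf(3)[OF j] by (simp add: B_def)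
  qed
  have zB: "z \<in> B" using z by (auto simp: B_def)
  define \<S> where "\<S> = {W. ideal W R \<and> J \<subseteq> W \<and> W \<subseteq> B \<and> W \<noteq> B}"
  have "J \<in> \<S>" using J JB zB zJ by (auto simp: \<S>_def)
  then obtain W where W: "W \<in> \<S>" and Wmax: "\<And>I. I \<in> \<S> \<Longrightarrow> W \<subseteq> I \<Longrightarrow> I = W"
    using maximal_element[of \<S>] unfolding \<S>_def by blast
  have Wi: "ideal W R" "J \<subseteq> W" "W \<subseteq> B" "W \<noteq> B" using W by (auto simp: \<S>_def)
  note Wg = ideal_facts[OF Wi(1)]
  obtain r where r: "r \<in> B" "r \<notin> W" using Wi by auto
  have rc: "r \<in> carrier R" using r Bf by auto
  have ext: "extend_ideal W q = B" if q: "q \<in> B" "q \<notin> W" for q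
  proof -
    have qc: "q \<in> carrier R" using q Bf by auto
    have s: "W \<subseteq> extend_ideal W q" "q \<in> extend_ideal W q" using extend_ideal_superset[OF Wi(1) qc] by auto
    have "extend_ideal W q \<notin> \<S>" using Wmax[of "extend_ideal W q"] s q by auto
    moreover have "extend_ideal W q \<subseteq> B" by (rule extend_ideal_least[OF B]) (use Wi q in auto)
    ultimately show ?thesis using extend_ideal_is_ideal[OF Wi(1) qc] s Wi(2) by (auto simp: \<S>_def)
  qed
  \<comment> \<open>Otherwise \<open>t \<otimes> r\<close> generates \<open>B\<close> modulo
    \<open>W\<close>, and \<open>r\<close> times the unit 1 - s t would lie in
    \<open>W\<close>.\<close>
  have mr: "t \<otimes> r \<in> W" if t: "t \<in> mm" for t
  proof (rule ccontr)
    assume n: "t \<otimes> r \<notin> W"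
    have tc: "t \<in> carrier R" using t ideal_facts(3)[OF ideal_mm] by auto
    have "r \<in> extend_ideal W (t \<otimes> r)" using ext[OF Bf(7)[OF r(1) tc] n] r by simp
    then obtain s where s: "s \<in> carrier R" "r \<ominus> s \<otimes> (t \<otimes> r) \<in> W" by (auto simp: extend_ideal_def)
    define u where "u = \<one> \<oplus> (\<ominus> (s \<otimes> t))"
    have u: "u \<in> Units R" unfolding u_def
      by (rule Units_add_mm) (use s t ideal_facts(5,7)[OF ideal_mm] in auto)
    have uc: "u \<in> carrier R" "inv u \<in> carrier R" using u by auto
    have "r \<ominus> s \<otimes> (t \<otimes> r) = u \<otimes> r" unfolding u_def using s tc rc by algebra
    then have "inv u \<otimes> (u \<otimes> r) \<in> W" using Wg(7)[OF s(2) uc(2)] by simp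
    moreover have "inv u \<otimes> (u \<otimes> r) = r" using u uc rc by (simp add: m_assoc[symmetric])
    ultimately show False using r by simp
  qed
  have mB: "t \<otimes> b \<in> W" if t: "t \<in> mm" and b: "b \<in> B" for t b
  proof -
    have c: "t \<in> carrier R" "b \<in> carrier R" using t b ideal_facts(3)[OF ideal_mm] Bf by auto
    have "b \<in> extend_ideal W r" using ext[OF r] b by simp
    then obtain s where s: "s \<in> carrier R" "b \<ominus> s \<otimes> r \<in> W" by (auto simp: extend_ideal_def)
    have "t \<otimes> b = t \<otimes> (b \<ominus> s \<otimes> r) \<oplus> s \<otimes> (t \<otimes> r)" using c s rc by algebra
    then show ?thesis using Wg(4)[OF Wg(7)[OF s(2) c(1)] Wg(7)[OF mr[OF t] s(1)]] by simp
  qed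
  define \<T> where "\<T> = {C. ideal C R \<and> W \<subseteq> C \<and> C \<inter> B = W}"
  have "W \<in> \<T>" using Wi by (auto simp: \<T>_def)
  then have Tne: "\<T> \<noteq> {}" by auto
  have Tid: "\<And>I. I \<in> \<T> \<Longrightarrow> ideal I R" by (simp add: \<T>_def)
  have "\<exists>M\<in>\<T>. \<forall>I\<in>\<T>. M \<subseteq> I \<longrightarrow> I = M" by (rule maximal_element_ex[OF Tne Tid])
  then obtain C where C: "C \<in> \<T>" and Cmax: "\<And>I. I \<in> \<T> \<Longrightarrow> C \<subseteq> I \<Longrightarrow> I = C" by (elim bexE) blast
  have Ci: "ideal C R" "W \<subseteq> C" "C \<inter> B = W" using C by (auto simp: \<T>_def)
  note Cf = ideal_facts[OF Ci(1)]
  \<comment> \<open>The quotients of \<open>C\<close> by powers of \<open>x i\<close> become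
    stationary at some \<open>k\<close>. Then adjoining that power to \<open>C\<close> does not
    enlarge the intersection with \<open>B\<close>, because \<open>x i\<close> already carries
    \<open>B\<close> into \<open>C\<close>; maximality of \<open>C\<close> puts the power into
    \<open>C\<close>.\<close>
  have pow: "\<exists>k::nat. x i [^] k \<in> C" for i
  proof -
    define D where "D k = {a \<in> carrier R. \<forall>b\<in>{x i [^] k}. a \<otimes> b \<in> C}" for k :: nat
    have D: "ideal (D k) R" for k unfolding D_def by (rule colon_ideal[OF Ci(1)]) auto
    have Did: "\<And>I. I \<in> range D \<Longrightarrow> ideal I R" using D by auto
    have "\<exists>M\<in>range D. \<forall>I\<in>range D. M \<subseteq> I \<longrightarrow> I = M" by (rule maximal_element_ex[OF _ Did]) auto
    then obtain M where M: "M \<in> range D" "\<And>I. I \<in> range D \<Longrightarrow> M \<subseteq> I \<Longrightarrow> I = M" by (elim bexE) blast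
    then obtain k where k: "M = D k" by auto
    have "D k \<subseteq> D (Suc k)"
    proof
      fix a assume a: "a \<in> D k"
      then have ac: "a \<in> carrier R" "a \<otimes> x i [^] k \<in> C" by (auto simp: D_def)
      have "(a \<otimes> x i [^] k) \<otimes> x i \<in> C" using Cf(8)[OF ac(2)] by auto
      then show "a \<in> D (Suc k)" using ac by (auto simp: D_def m_assoc)
    qed
    then have DS: "D (Suc k) = D k" using M k by auto
    define y where "y = x i [^] k"
    have yc: "y \<in> carrier R" by (simp add: y_def)
    have "extend_ideal C y \<inter> B \<subseteq> W"
    proof
      fix b assume "b \<in> extend_ideal C y \<inter> B"
      then obtain t where t: "b \<in> B" "t \<in> carrier R" "b \<ominus> t \<otimes> y \<in> C" by (auto simp: extend_ideal_def)
      have bc: "b \<in> carrier R" using t Bf by auto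
      have xb: "x i \<otimes> b \<in> C" using mB[OF x_in_mm t(1)] Ci(2) by auto
      have "t \<otimes> (y \<otimes> x i) = x i \<otimes> b \<ominus> x i \<otimes> (b \<ominus> t \<otimes> y)" using bc t yc x_closed[of i] by algebra
      also have "\<dots> \<in> C" using Cf(6)[OF xb Cf(7)[OF t(3)]] by auto
      finally have "t \<in> D (Suc k)" using t by (simp add: D_def y_def)
      then have "t \<otimes> y \<in> C" unfolding DS by (simp add: D_def y_def)
      from Cf(4)[OF t(3) this] have "b \<in> C" using diff_add_cancel'[of b "t \<otimes> y"] bc t yc by simp
      then show "b \<in> W" using t Ci(3) by auto
    qed
    then have "extend_ideal C y \<in> \<T>"
      using extend_ideal_is_ideal[OF Ci(1) yc] extend_ideal_superset[OF Ci(1) yc] Ci Wi by (auto simp: \<T>_def)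
    then have "extend_ideal C y = C" using Cmax extend_ideal_superset[OF Ci(1) yc] by auto
    then have "y \<in> C" using extend_ideal_superset[OF Ci(1) yc] by auto
    then show ?thesis unfolding y_def by blast
  qed
  obtain w where w: "weight_ideal l w \<subseteq> C" using weight_ideal_subset[OF Ci(1) pow] by blast
  have "B \<subseteq> C"
  proof
    fix b assume b: "b \<in> B"
    then obtain j where j: "j \<in> J" "b \<ominus> j \<in> weight_ideal l w" by (auto simp: B_def)
    have "j \<in> C" using j Wi(2) Ci(2) by auto
    then have "(b \<ominus> j) \<oplus> j \<in> C" using Cf(4) j w by blast
    then show "b \<in> C" using diff_add_cancel'[of b j] b Bf Jf j by simp
  qed
  then show False using Ci(3) Wi(3,4) by auto
qed

subsection \<open>Expansions with unit coefficients\<close>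

text \<open>Nonunit coefficients at weight \<open>w\<close> are dropped: they lie in the maximal
  ideal, so their terms belong to the next step of the filtration, all weights being
  positive.\<close>

lemma weight_block:
  assumes l: "\<And>i. 0 < l i" and z: "z \<in> weight_ideal l w"
  shows "\<exists>u. (\<forall>A. u A \<in> Units R \<union> {\<zero>}) \<and>
    z \<ominus> lincomb u {A. weight l A = w} \<in> weight_ideal l (Suc w)"
proof -
  note Wf = ideal_facts[OF weight_ideal_is_ideal[of l]]
  define F where "F = {A. weight l A = w}"
  have fin: "finite F" unfolding F_def
    by (rule finite_subset[OF _ finite_weight_le[of l w]]) (use l in auto)
  have "{A. w \<le> weight l A} \<subseteq> F \<union> {A. Suc w \<le> weight l A}" by (auto simp: F_def)
  from monomial_ideal_decomp[OF fin this z[unfolded weight_ideal_def]]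
  obtain r where r: "\<And>A. r A \<in> carrier R" "z \<ominus> lincomb r F \<in> weight_ideal l (Suc w)"
    unfolding weight_ideal_def by metis
  define u where "u A = (if r A \<in> mm then \<zero> else r A)" for A
  have u: "u A \<in> Units R \<union> {\<zero>}" for A using r(1) Units_iff by (auto simp: u_def)
  then have uc: "u A \<in> carrier R" for A by (metis UnE Units_closed singletonD zero_closed)
  have ru: "r A \<ominus> u A \<in> mm" for A
    using r(1)[of A] ideal_facts(2)[OF ideal_mm] by (auto simp: u_def a_minus_def r_neg)
  have "lincomb (\<lambda>A. r A \<ominus> u A) F \<in> weight_ideal l (Suc w)"
  proof (rule lincomb_in_ideal[OF weight_ideal_is_ideal])
    fix A assume A: "A \<in> F"
    show "(r A \<ominus> u A) \<otimes> pp A \<in> weight_ideal l (Suc w)"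
    proof (rule scaled_pp_in_ideal[OF weight_ideal_is_ideal ru])
      fix i
      have "Suc w \<le> weight l (A + axis i 1)"
        using A l[of i] unfolding weight_add weight_axis F_def by auto
      then show "pp (A + axis i 1) \<in> weight_ideal l (Suc w)" by (rule pp_in_weight_ideal)
    qed
  qed
  then have "lincomb r F \<ominus> lincomb u F \<in> weight_ideal l (Suc w)"
    using lincomb_diff[OF fin, of r u] r(1) uc by simp
  from Wf(4)[OF r(2) this] have "(z \<ominus> lincomb r F) \<oplus> (lincomb r F \<ominus> lincomb u F) \<in> weight_ideal l (Suc w)" .
  moreover have "(z \<ominus> lincomb r F) \<oplus> (lincomb r F \<ominus> lincomb u F) = z \<ominus> lincomb u F"
    using Wf(3)[OF z] r(1) uc by (intro diff_trans) auto
  ultimately show ?thesis using u unfolding F_def by (intro exI[of _ u]) simp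
qed

text \<open>Coefficients are fixed weight by weight. The statement concerns a sequence rather than
  one element so that it serves both for elements of the ring and for representatives of an element
  of the completion. The resulting support may be infinite.\<close>

lemma weight_expansion_sequence:
  assumes l: "\<And>i. 0 < l i"
    and g: "\<And>k. g k \<in> carrier R" "\<And>k. w0 \<le> k \<Longrightarrow> g (Suc k) \<ominus> g k \<in> weight_ideal l k"
    and g0: "g w0 \<in> weight_ideal l w0"
  shows "\<exists>u. (\<forall>A. u A \<in> Units R \<union> {\<zero>}) \<and> (\<forall>A. weight l A < w0 \<longrightarrow> u A = \<zero>) \<and>
    (\<forall>w\<ge>w0. g w \<ominus> lincomb u {A. weight l A < w} \<in> weight_ideal l w)"
proof -
  note Wf = ideal_facts[OF weight_ideal_is_ideal[of l]]
  have fin: "finite {A. weight l A < w}" for w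
    by (rule finite_subset[OF _ finite_weight_le[of l w]]) (use l in auto)
  have fin': "finite {A. weight l A = w}" for w
    by (rule finite_subset[OF _ finite_weight_le[of l w]]) (use l in auto)
  define P where "P n u \<longleftrightarrow> (\<forall>A. u A \<in> Units R \<union> {\<zero>}) \<and> (\<forall>A. weight l A < w0 \<longrightarrow> u A = \<zero>) \<and>
    g (w0 + n) \<ominus> lincomb u {A. weight l A < w0 + n} \<in> weight_ideal l (w0 + n)" for n u
  have "\<exists>U. \<forall>n. P n (U n) \<and> (\<forall>A. weight l A < w0 + n \<longrightarrow> U (Suc n) A = U n A)"
  proof (rule dependent_nat_choice)
    have "lincomb (\<lambda>_. \<zero>) {A. weight l A < w0} = \<zero>"
      using lincomb_neutral[OF fin, of "{}" w0 "\<lambda>_. \<zero>"] by simp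
    then show "\<exists>u. P 0 u" unfolding P_def using g0 g(1)[of w0] by (intro exI[of _ "\<lambda>_. \<zero>"]) (simp add: a_minus_def)
    fix u n assume u: "P n u"
    define w where "w = w0 + n"
    define z where "z = g (Suc w) \<ominus> lincomb u {A. weight l A < w}"
    have uc: "u A \<in> carrier R" for A using u unfolding P_def by (metis UnE Units_closed singletonD zero_closed)
    have lc: "lincomb u {A. weight l A < w} \<in> carrier R" using uc by simp
    have "z = (g (Suc w) \<ominus> g w) \<oplus> (g w \<ominus> lincomb u {A. weight l A < w})"
      unfolding z_def using g(1)[of w] g(1)[of "Suc w"] lc by (simp add: diff_trans)
    also have "\<dots> \<in> weight_ideal l w" using Wf(4) g(2)[of w] u unfolding P_def w_def by simp
    finally have "\<exists>v. (\<forall>A. v A \<in> Units R \<union> {\<zero>}) \<and>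
        z \<ominus> lincomb v {A. weight l A = w} \<in> weight_ideal l (Suc w)" by (rule weight_block[OF l])
    then obtain v where v: "\<And>A. v A \<in> Units R \<union> {\<zero>}"
      "z \<ominus> lincomb v {A. weight l A = w} \<in> weight_ideal l (Suc w)" by (elim exE conjE) blast
    have vc: "v A \<in> carrier R" for A using v(1) by (metis UnE Units_closed singletonD zero_closed)
    define u' where "u' A = (if weight l A = w then v A else u A)" for A
    have u'c: "u' A \<in> carrier R" for A using uc vc by (simp add: u'_def)
    have "lincomb u' {A. weight l A < Suc w} = lincomb u' ({A. weight l A < w} \<union> {A. weight l A = w})"
      by (rule lincomb_cong) (use u'c in auto)
    also have "\<dots> = lincomb u' {A. weight l A < w} \<oplus> lincomb u' {A. weight l A = w}"
      by (rule lincomb_Un[OF fin fin']) (use u'c in auto)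
    also have "lincomb u' {A. weight l A < w} = lincomb u {A. weight l A < w}"
      by (rule lincomb_cong) (use uc in \<open>auto simp: u'_def\<close>)
    also have "lincomb u' {A. weight l A = w} = lincomb v {A. weight l A = w}"
      by (rule lincomb_cong) (use vc in \<open>auto simp: u'_def\<close>)
    finally have eq: "lincomb u' {A. weight l A < Suc w} = lincomb u {A. weight l A < w} \<oplus> lincomb v {A. weight l A = w}" .
    have lv: "lincomb v {A. weight l A = w} \<in> carrier R" using vc by simp
    have "g (Suc w) \<ominus> lincomb u' {A. weight l A < Suc w} = z \<ominus> lincomb v {A. weight l A = w}"
      unfolding eq z_def using g(1)[of "Suc w"] lc lv by (rule diff_add_eq_diff_diff)
    then have "P (Suc n) u'" using v u unfolding P_def u'_def by (auto simp: w_def)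
    then show "\<exists>u'. P (Suc n) u' \<and> (\<forall>A. weight l A < w0 + n \<longrightarrow> u' A = u A)"
      by (intro exI[of _ u']) (auto simp: u'_def w_def)
  qed
  then obtain U where U: "\<And>n. P n (U n)" "\<And>n A. weight l A < w0 + n \<Longrightarrow> U (Suc n) A = U n A" by blast
  \<comment> \<open>The coefficient at \<open>A\<close> is read at the stage just after its weight
    has been treated; later stages do not change it.\<close>
  define u where "u A = U (Suc (weight l A) - w0) A" for A
  have stable: "U n A = U m A" if "m \<le> n" "weight l A < w0 + m" for m n A
    using that by (induction n rule: dec_induct) (use U(2) in auto)
  have Uu: "U n A = u A" if "weight l A < w0 + n" for n A
  proof (cases "weight l A < w0")
    case True
    then show ?thesis using U(1) by (auto simp: P_def u_def)
  next
    case False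
    then show ?thesis unfolding u_def using that by (intro stable) auto
  qed
  have uu: "u A \<in> Units R \<union> {\<zero>}" for A using U(1) unfolding u_def P_def by blast
  then have uc: "u A \<in> carrier R" for A by (metis UnE Units_closed singletonD zero_closed)
  show ?thesis
  proof (intro exI[of _ u] conjI allI impI uu)
    show "u A = \<zero>" if "weight l A < w0" for A using U(1) that by (auto simp: P_def u_def)
    fix w assume "w0 \<le> w"
    then obtain n where n: "w = w0 + n" using le_Suc_ex by blast
    have "lincomb (U n) {A. weight l A < w} = lincomb u {A. weight l A < w}"
      by (rule lincomb_cong) (use uc Uu n in auto)
    then show "g w \<ominus> lincomb u {A. weight l A < w} \<in> weight_ideal l w"
      using U(1)[of n] unfolding P_def n by simp
  qed
qed

end

lemma (in cring) add_diff_add_eq_zero: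
  "a \<in> carrier R \<Longrightarrow> b \<in> carrier R \<Longrightarrow> a \<oplus> (b \<ominus> (a \<oplus> b)) = \<zero>"
  by algebra

context parameter_ring
begin

lemma Units_nonzero: "u \<in> Units R \<Longrightarrow> u \<noteq> \<zero>"
  using Units_iff ideal_facts(2)[OF ideal_mm] by auto

text \<open>An infinite expansion is cut down to its minimal exponents, finite in number by Dickson.
  The remainder is approximated to every order by multiples of the monomials one step above these,
  so by Krull's intersection theorem it lies in the ideal they generate. It is absorbed by changing
  the coefficients by elements of the maximal ideal, which leaves them units.\<close>

lemma unit_expansion_in_weight_ideal:
  assumes l: "\<And>i. 0 < l i" and z: "z \<in> weight_ideal l w"
  shows "\<exists>U u. finite U \<and> (\<forall>A\<in>U. u A \<in> Units R \<and> w \<le> weight l A) \<and> z = lincomb u U"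
proof -
  note Wf = ideal_facts[OF weight_ideal_is_ideal[of l]]
  have zc: "z \<in> carrier R" using Wf(3)[OF z] .
  \<comment> \<open>Zero up to index \<open>w\<close>: the starting condition is trivial, and the
    only nonzero difference is \<open>z\<close> itself, at index \<open>w\<close>.\<close>
  define g where "g k = (if k \<le> w then \<zero> else z)" for k :: nat
  have "\<exists>u. (\<forall>A. u A \<in> Units R \<union> {\<zero>}) \<and> (\<forall>A. weight l A < w \<longrightarrow> u A = \<zero>) \<and>
    (\<forall>w'\<ge>w. g w' \<ominus> lincomb u {A. weight l A < w'} \<in> weight_ideal l w')"
  proof (rule weight_expansion_sequence[OF l])
    show "g k \<in> carrier R" for k using zc by (simp add: g_def)
    show "g (Suc k) \<ominus> g k \<in> weight_ideal l k" if "w \<le> k" for k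
      using that z zc Wf(2) by (auto simp: g_def diff_zero diff_self le_antisym)
    show "g w \<in> weight_ideal l w" using Wf(2) by (simp add: g_def)
  qed
  then obtain u where u: "\<And>A. u A \<in> Units R \<union> {\<zero>}" "\<And>A. weight l A < w \<Longrightarrow> u A = \<zero>"
    "\<And>w'. w \<le> w' \<Longrightarrow> g w' \<ominus> lincomb u {A. weight l A < w'} \<in> weight_ideal l w'"
    by (elim exE conjE) blast
  have uc: "u A \<in> carrier R" for A using u(1) by (metis UnE Units_closed singletonD zero_closed)
  define S where "S = {A. u A \<noteq> \<zero>}"
  define U where "U = minimal_exponents S"
  have finU: "finite U" unfolding U_def by (rule finite_minimal_exponents)
  have US: "U \<subseteq> S" by (auto simp: U_def minimal_exponents_def)
  define X where "X = {A + axis i 1 | A i. A \<in> U}"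
  note bf = ideal_facts[OF monomial_ideal_is_ideal[of X]]
  have fin: "finite {A. weight l A < w}" for w
    by (rule finite_subset[OF _ finite_weight_le[of l w]]) (use l in auto)
  have lU: "lincomb u U \<in> carrier R" using uc by simp
  have "z \<ominus> lincomb u U \<in> monomial_ideal X"
  proof (rule krull_intersection[OF monomial_ideal_is_ideal])
    show "z \<ominus> lincomb u U \<in> carrier R" using zc lU by simp
    fix w'
    \<comment> \<open>Large enough for the required precision \<open>w'\<close>, beyond the jump of
      \<open>g\<close>, and above the weight of every exponent in \<open>U\<close>.\<close>
    define W where "W = Suc (w' + w + (\<Sum>A\<in>U. weight l A))"
    define T where "T = {A. weight l A < W}"
    have finT: "finite T" unfolding T_def by (rule fin)
    have UT: "U \<subseteq> T"
    proof
      fix A assume "A \<in> U"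
      then have "weight l A \<le> (\<Sum>A\<in>U. weight l A)"
        using finU member_le_sum[of A U "weight l"] by auto
      then show "A \<in> T" by (simp add: T_def W_def)
    qed
    have "lincomb u T = lincomb u (U \<union> (T - U))" using UT by (simp add: Un_absorb1)
    also have "\<dots> = lincomb u U \<oplus> lincomb u (T - U)"
      by (rule lincomb_Un) (use finU finT uc in auto)
    finally have lT: "lincomb u T = lincomb u U \<oplus> lincomb u (T - U)" .
    have "lincomb u (T - U) \<in> monomial_ideal X"
    proof (rule lincomb_in_ideal[OF monomial_ideal_is_ideal])
      fix A assume A: "A \<in> T - U"
      show "u A \<otimes> pp A \<in> monomial_ideal X"
      proof (cases "A \<in> S")
        case True
        then obtain B where B: "B \<in> U" "B \<le> A" using minimal_exponent_below[of A S] by (auto simp: U_def)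
        then have "B \<noteq> A" using A by auto
        then obtain i where "B $ i \<noteq> A $ i" by (auto simp: vec_eq_iff)
        then have "B $ i < A $ i" using B(2) by (simp add: less_eq_vec_def order.strict_iff_order)
        then have "B + axis i 1 \<le> A" using B(2) by (auto simp: less_eq_vec_def axis_def)
        moreover have "pp (B + axis i 1) \<in> monomial_ideal X"
          by (rule pp_in_monomial_ideal) (use B in \<open>auto simp: X_def\<close>)
        ultimately have "pp A \<in> monomial_ideal X"
          using pp_in_ideal_of_le[OF monomial_ideal_is_ideal] by blast
        then show ?thesis using bf(7) uc by blast
      next
        case False
        then show ?thesis using bf(2) by (simp add: S_def)
      qed
    qed
    moreover have "(z \<ominus> lincomb u U) \<ominus> lincomb u (T - U) \<in> weight_ideal l w'"
    proof -
      have "z \<ominus> lincomb u T \<in> weight_ideal l W"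
        using u(3)[of W] by (simp add: g_def W_def T_def)
      moreover have "weight_ideal l W \<subseteq> weight_ideal l w'"
        by (rule weight_ideal_antimono) (simp add: W_def)
      moreover have "z \<ominus> lincomb u T = (z \<ominus> lincomb u U) \<ominus> lincomb u (T - U)"
        unfolding lT using zc uc by (intro diff_add_eq_diff_diff) auto
      ultimately show ?thesis by auto
    qed
    ultimately show "\<exists>j\<in>monomial_ideal X. z \<ominus> lincomb u U \<ominus> j \<in> weight_ideal l w'" by blast
  qed
  moreover have "monomial_ideal X \<subseteq>
      {z \<in> carrier R. \<exists>r. (\<forall>A. r A \<in> mm) \<and> z \<ominus> lincomb r U \<in> {\<zero>}}"
  proof (rule monomial_ideal_least[OF lincomb_mod_ideal[OF finU ideal_mm zeroideal]])
    fix C assume "C \<in> X"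
    then obtain A i where C: "C = A + axis i 1" "A \<in> U" by (auto simp: X_def)
    have "lincomb (\<lambda>B. if B = A then x i else \<zero>) U = x i \<otimes> pp A"
      by (rule lincomb_indicator[OF finU C(2)]) simp
    also have "\<dots> = pp C" unfolding C(1) pp_add pp_axis by (simp add: m_comm)
    finally have "pp C \<ominus> lincomb (\<lambda>B. if B = A then x i else \<zero>) U \<in> {\<zero>}" by (simp add: diff_self)
    moreover have "\<forall>B. (if B = A then x i else \<zero>) \<in> mm" using x_in_mm ideal_facts(2)[OF ideal_mm] by auto
    ultimately show "pp C \<in> {z \<in> carrier R. \<exists>r. (\<forall>A. r A \<in> mm) \<and> z \<ominus> lincomb r U \<in> {\<zero>}}"
      by (intro CollectI conjI exI[of _ "\<lambda>B. if B = A then x i else \<zero>"]) auto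
  qed
  ultimately obtain r where r: "\<And>A. r A \<in> mm" "z \<ominus> lincomb u U \<ominus> lincomb r U = \<zero>" by blast
  have rc: "r A \<in> carrier R" for A using r(1) ideal_facts(3)[OF ideal_mm] by blast
  have "z \<ominus> lincomb (\<lambda>A. u A \<oplus> r A) U = \<zero>"
    using r(2) diff_add_eq_diff_diff[of z "lincomb u U" "lincomb r U"] zc uc rc by (simp add: lincomb_add)
  then have "z = lincomb (\<lambda>A. u A \<oplus> r A) U" using zc uc rc by simp
  moreover have "u A \<oplus> r A \<in> Units R \<and> w \<le> weight l A" if "A \<in> U" for A
  proof
    have nz: "u A \<noteq> \<zero>" using that US by (auto simp: S_def)
    then show "u A \<oplus> r A \<in> Units R" using u(1)[of A] Units_add_mm r(1) by auto
    show "w \<le> weight l A" using u(2)[of A] nz by (meson not_le)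
  qed
  ultimately show ?thesis using finU by (intro exI[of _ U] exI[of _ "\<lambda>A. u A \<oplus> r A"]) simp
qed

lemma is_expansion_lincomb:
  assumes "finite U" "\<And>A. A \<in> U \<Longrightarrow> u A \<in> Units R" "f = lincomb u U"
  shows "is_expansion R x f (\<lambda>A. if A \<in> U then u A else \<zero>)"
proof -
  have U: "{A. (if A \<in> U then u A else \<zero>) \<noteq> \<zero>} = U" using Units_nonzero assms(2) by auto
  have "f = lincomb (\<lambda>A. if A \<in> U then u A else \<zero>) U" unfolding assms(3)
    by (rule lincomb_cong) (use assms(2) in auto)
  then show ?thesis unfolding is_expansion_def U using assms by (simp add: lincomb_def)
qed

lemma is_expansion_expansion:
  assumes "f \<in> carrier R"
  shows "is_expansion R x f (expansion R x f)"
proof -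
  have "f \<in> weight_ideal (\<lambda>_. 1) 0" using assms weight_ideal_zero by simp
  then obtain U u where "finite U" "\<forall>A\<in>U. u A \<in> Units R \<and> 0 \<le> weight (\<lambda>_. 1) A" "f = lincomb u U"
    using unit_expansion_in_weight_ideal[of "\<lambda>_. 1" f 0] by auto
  then have "\<exists>\<rho>. is_expansion R x f \<rho>" using is_expansion_lincomb[of U u f] by blast
  then show ?thesis unfolding expansion_def by (rule someI_ex)
qed

text \<open>In other words, the graded ring of \<open>R\<close> for a positive monomial weight is a polynomial
  ring over the residue field.\<close>

lemma leading_coefficients_in_mm:
  assumes l: "\<And>i. 0 < l i" and F: "finite F" "\<And>A. A \<in> F \<Longrightarrow> r A \<in> carrier R"
    and low: "\<And>A. A \<in> F \<Longrightarrow> weight l A < w \<Longrightarrow> r A \<in> Units R \<union> {\<zero>}"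
    and z: "lincomb r F \<in> weight_ideal l (Suc w)"
    and A: "A \<in> F" "weight l A \<le> w"
  shows "r A \<in> mm"
proof (rule ccontr)
  assume rA: "r A \<notin> mm"
  note Wf = ideal_facts[OF weight_ideal_is_ideal[of l]]
  define G where "G = {B \<in> F. weight l B \<le> w \<and> r B \<notin> mm}"
  have G: "finite G" "G \<noteq> {}" using F(1) A rA by (auto simp: G_def)
  define A0 where "A0 = arg_min_on (weight l) G"
  have A0: "A0 \<in> G" "\<And>B. B \<in> G \<Longrightarrow> weight l A0 \<le> weight l B"
    using arg_min_if_finite(1)[OF G] arg_min_least[OF G] by (auto simp: A0_def)
  define v where "v = weight l A0"
  have vw: "v \<le> w" using A0(1) by (simp add: G_def v_def)
  define F1 where "F1 = {B \<in> F. weight l B = v \<and> r B \<notin> mm}"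
  have F1: "finite F1" "A0 \<in> F1" "F1 \<subseteq> F" using F(1) A0(1) by (auto simp: F1_def G_def v_def)
  have unit: "r B \<in> Units R" if "B \<in> F1" for B using that F(2) Units_iff by (auto simp: F1_def)
  have c1: "lincomb r F1 \<in> carrier R" by (rule lincomb_closed) (use F(2) F1(3) in blast)
  have rest: "lincomb r (F - F1) \<in> weight_ideal l (Suc v)"
  proof (rule lincomb_in_ideal[OF weight_ideal_is_ideal])
    fix B assume B: "B \<in> F - F1"
    consider "v < weight l B" | "weight l B = v" "r B \<in> mm" | "weight l B < v" "r B = \<zero>"
    proof -
      \<comment> \<open>Below the least weight \<open>v\<close> of a unit coefficient all
        coefficients are in the maximal ideal. The assumption \<open>low\<close> then makes them
        zero; an arbitrary nonunit there could contribute at weight \<open>v\<close>.\<close>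
      have "r B = \<zero>" if lt: "weight l B < v"
      proof -
        have "B \<notin> G" using A0(2)[of B] lt by (auto simp: v_def)
        then have "r B \<in> mm" using B lt vw by (auto simp: G_def)
        then show ?thesis using low[of B] B lt vw Units_iff by auto
      qed
      then show ?thesis
        using that B linorder_less_linear[of "weight l B" v] unfolding F1_def by blast
    qed
    then show "r B \<otimes> pp B \<in> weight_ideal l (Suc v)"
    proof cases
      case 1
      then show ?thesis using Wf(7)[OF pp_in_weight_ideal] F(2) B by auto
    next
      case 2
      show ?thesis
      proof (rule scaled_pp_in_ideal[OF weight_ideal_is_ideal 2(2)])
        fix i
        have "Suc v \<le> weight l (B + axis i 1)"
          using 2(1) l[of i] unfolding weight_add weight_axis by auto
        then show "pp (B + axis i 1) \<in> weight_ideal l (Suc v)" by (rule pp_in_weight_ideal)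
      qed
    next
      case 3
      then show ?thesis using Wf(2) by simp
    qed
  qed
  have c2: "lincomb r (F - F1) \<in> carrier R" using Wf(3)[OF rest] .
  have "F = F1 \<union> (F - F1)" using F1(3) by auto
  then have "lincomb r F = lincomb r (F1 \<union> (F - F1))" by simp
  also have "\<dots> = lincomb r F1 \<oplus> lincomb r (F - F1)"
    by (rule lincomb_Un) (use F F1 in auto)
  finally have eq: "lincomb r F = lincomb r F1 \<oplus> lincomb r (F - F1)" .
  have "lincomb r F \<in> weight_ideal l (Suc v)" using z weight_ideal_antimono[of "Suc v" "Suc w" l] vw by auto
  from Wf(6)[OF rest this] have "lincomb r (F - F1) \<ominus> lincomb r F \<in> weight_ideal l (Suc v)" .
  \<comment> \<open>The remainder has weight above \<open>v\<close> and is rewritten with unit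
    coefficients. Its exponents are disjoint from those of weight \<open>v\<close>, so a relation
    with only unit coefficients results, contradicting algebraic independence.\<close>
  then obtain U u where U: "finite U" "\<And>A. A \<in> U \<Longrightarrow> u A \<in> Units R" "\<And>A. A \<in> U \<Longrightarrow> Suc v \<le> weight l A"
    "lincomb r (F - F1) \<ominus> lincomb r F = lincomb u U"
    using unit_expansion_in_weight_ideal[OF l] by meson
  have disj: "F1 \<inter> U = {}" using U(3) by (force simp: F1_def)
  define s where "s B = (if B \<in> F1 then r B else u B)" for B
  have su: "s B \<in> Units R" if "B \<in> F1 \<union> U" for B using that unit U(2) by (auto simp: s_def)
  have "lincomb s (F1 \<union> U) = lincomb s F1 \<oplus> lincomb s U"
    by (rule lincomb_Un) (use F1(1) U(1) disj su Units_closed in auto)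
  also have "lincomb s F1 = lincomb r F1" by (rule lincomb_cong) (use unit Units_closed in \<open>auto simp: s_def\<close>)
  also have "lincomb s U = lincomb u U" by (rule lincomb_cong) (use U(2) disj Units_closed in \<open>auto simp: s_def\<close>)
  also have "lincomb r F1 \<oplus> lincomb u U = \<zero>"
    unfolding U(4)[symmetric] eq using c1 c2 by (rule add_diff_add_eq_zero)
  finally have "F1 \<union> U = {}" using lincomb_units_eq_zero[of "F1 \<union> U" s] F1 U su by auto
  then show False using F1(2) by auto
qed

end

section \<open>The completion\<close>

lemma positive_weight_axis:
  assumes "0 < weight l A"
  shows "\<exists>i. axis i 1 \<le> A"
proof -
  have "\<exists>i. A $ i \<noteq> 0"
  proof (rule ccontr)
    assume "\<nexists>i. A $ i \<noteq> 0"
    then have "weight l A = 0" by simp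
    then show False using assms by linarith
  qed
  then obtain i where "A $ i \<noteq> 0" by blast
  then have "axis i 1 \<le> A" by (auto simp: less_eq_vec_def axis_def)
  then show ?thesis by blast
qed

section \<open>Powers of the maximal ideal, and elements of the completion as limits\<close>

context parameter_ring
begin

abbreviation mpow :: "nat \<Rightarrow> 'a set" where "mpow \<equiv> weight_ideal (\<lambda>_. 1)"

abbreviation Rhat :: "(nat \<Rightarrow> 'a set) ring" where "Rhat \<equiv> adic_completion R"

lemma ideal_mpow: "ideal (mpow k) R"
  by (rule weight_ideal_is_ideal)

lemma max_ideal_eq: "max_ideal R = mm"
  unfolding max_ideal_def using maximal_iff by (intro the_equality) auto

lemma mpow_Suc_0: "mpow (Suc 0) = mm"
proof
  show "mpow (Suc 0) \<subseteq> mm" unfolding weight_ideal_def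
  proof (rule monomial_ideal_least[OF ideal_mm])
    fix A :: "nat ^ 'n"
    assume "A \<in> {A. Suc 0 \<le> weight (\<lambda>_. 1) A}"
    then have "0 < weight (\<lambda>_. 1) A" by (simp only: mem_Collect_eq Suc_le_eq)
    then obtain i where "axis i 1 \<le> A" using positive_weight_axis[of "\<lambda>_. 1" A] by blast
    moreover have "pp (axis i 1) \<in> mm" using x_in_mm by (simp only: pp_axis)
    ultimately show "pp A \<in> mm" using pp_in_ideal_of_le[OF ideal_mm] by blast
  qed
  show "mm \<subseteq> mpow (Suc 0)" unfolding genideal_range_x weight_ideal_def
    by (rule monomial_ideal_mono, rule image_subsetI, unfold mem_Collect_eq weight_axis[of "\<lambda>_. 1"]) simp
qed

lemma max_ideal_pow_eq: "max_ideal_pow R k = mpow k"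
proof (induction k)
  case 0
  show ?case unfolding nat_pow_def weight_ideal_zero by (simp add: ideals_set_def)
next
  case (Suc k)
  have "max_ideal_pow R (Suc k) = ideal_prod R (max_ideal_pow R k) (max_ideal R)"
    unfolding nat_pow_def by (simp add: ideals_set_def)
  also have "\<dots> = ideal_prod R (mpow k) mm" by (simp only: Suc) (simp only: max_ideal_eq)
  also have "\<dots> = mpow (Suc k)"
  proof
    show "ideal_prod R (mpow k) mm \<subseteq> mpow (Suc k)"
    proof
      fix z assume "z \<in> ideal_prod R (mpow k) mm"
      then show "z \<in> mpow (Suc k)"
      proof (induction rule: ideal_prod.induct)
        case (prod i j)
        then have "i \<otimes> j \<in> mpow (k + Suc 0)" unfolding mpow_Suc_0[symmetric] by (intro weight_ideal_mult)
        then show ?case by simp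
      next
        case (sum a b)
        then show ?case using ideal_facts(4)[OF ideal_mpow] by blast
      qed
    qed
    show "mpow (Suc k) \<subseteq> ideal_prod R (mpow k) mm" unfolding weight_ideal_def[of _ "Suc k"]
    proof (rule monomial_ideal_least[OF ideal_prod_is_ideal[OF ideal_mpow ideal_mm]])
      fix A :: "nat ^ 'n"
      assume "A \<in> {A. Suc k \<le> weight (\<lambda>_. 1) A}"
      then have A: "Suc k \<le> weight (\<lambda>_. 1) A" by (simp only: mem_Collect_eq)
      then have "0 < weight (\<lambda>_. 1) A" by linarith
      then obtain i where "axis i 1 \<le> A" using positive_weight_axis[of "\<lambda>_. 1" A] by blast
      from exponent_split[OF this] obtain B where B: "A = axis i 1 + B" by blast
      have "k \<le> weight (\<lambda>_. 1) B" using A unfolding B weight_add weight_axis by simp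
      then have "pp B \<in> mpow k" by (rule pp_in_weight_ideal)
      then have "pp B \<otimes> x i \<in> ideal_prod R (mpow k) mm" using x_in_mm by (rule ideal_prod.prod)
      then show "pp A \<in> ideal_prod R (mpow k) mm" unfolding B pp_add pp_axis by (simp add: m_comm)
    qed
  qed
  finally show ?case .
qed

text \<open>The difference at \<open>k\<close> lies in the power of exponent \<open>k\<close>,
  exactly what compatible cosets need. The power of exponent 0 is the whole ring, so entry 0 carries
  no information and residue classes are read at index 1.\<close>

definition adic_cauchy :: "(nat \<Rightarrow> 'a) \<Rightarrow> bool" where
  "adic_cauchy r \<longleftrightarrow> (\<forall>k. r k \<in> carrier R \<and> r (Suc k) \<ominus> r k \<in> mpow k)"

definition adic_limit :: "(nat \<Rightarrow> 'a) \<Rightarrow> nat \<Rightarrow> 'a set" where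
  "adic_limit r = (\<lambda>k. mpow k +> r k)"

lemma adic_cauchy_closed: "adic_cauchy r \<Longrightarrow> r k \<in> carrier R"
  by (simp add: adic_cauchy_def)

lemma coset_eq_iff:
  assumes "ideal I R" "a \<in> carrier R" "b \<in> carrier R"
  shows "I +> a = I +> b \<longleftrightarrow> a \<ominus> b \<in> I"
  using quotient_eq_iff_same_a_r_cos[OF assms] by simp

lemma coset_mem_iff:
  assumes "ideal I R" "a \<in> carrier R"
  shows "b \<in> I +> a \<longleftrightarrow> b \<in> carrier R \<and> b \<ominus> a \<in> I"
proof
  note I = ideal_facts[OF assms(1)]
  {
    assume "b \<in> I +> a"
    then obtain h where h: "h \<in> I" "b = h \<oplus> a" by (auto simp: a_r_coset_def')
    have "h \<oplus> a \<ominus> a = h" using I(3)[OF h(1)] assms(2) by algebra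
    then show "b \<in> carrier R \<and> b \<ominus> a \<in> I" using h I(3) assms(2) by auto
  next
    assume b: "b \<in> carrier R \<and> b \<ominus> a \<in> I"
    then have "b = (b \<ominus> a) \<oplus> a" using assms(2) by (simp add: diff_add_cancel')
    then show "b \<in> I +> a" using b by (auto simp: a_r_coset_def')
  }
qed

text \<open>Choosing representatives presents every element of the inverse limit as a limit, so that
  ring laws and estimates in the completion are verified on sequences in the ring.\<close>

lemma completion_carrier:
  "s \<in> carrier Rhat \<longleftrightarrow> (\<exists>r. adic_cauchy r \<and> s = adic_limit r)"
proof
  assume "s \<in> carrier Rhat"
  then have s: "\<And>k. s k \<in> carrier (R Quot mpow k)" "\<And>k. s (Suc k) \<subseteq> s k"
    by (auto simp: adic_completion_def max_ideal_pow_eq)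
  have "\<exists>a. a \<in> carrier R \<and> s k = mpow k +> a" for k
    using s(1)[of k] by (auto simp: FactRing_def A_RCOSETS_def')
  then obtain r where r: "\<And>k. r k \<in> carrier R" "\<And>k. s k = mpow k +> r k" by metis
  have "r (Suc k) \<ominus> r k \<in> mpow k" for k
  proof -
    have "r (Suc k) \<in> s (Suc k)" unfolding r(2)
      using coset_mem_iff[OF ideal_mpow r(1)] r(1) ideal_facts(2)[OF ideal_mpow] by (simp add: diff_self)
    then have "r (Suc k) \<in> mpow k +> r k" using s(2)[of k] r(2) by auto
    then show ?thesis using coset_mem_iff[OF ideal_mpow r(1)] by blast
  qed
  then show "\<exists>r. adic_cauchy r \<and> s = adic_limit r"
    using r by (intro exI[of _ r]) (auto simp: adic_cauchy_def adic_limit_def)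
next
  assume "\<exists>r. adic_cauchy r \<and> s = adic_limit r"
  then obtain r where r: "\<And>k. r k \<in> carrier R" "\<And>k. r (Suc k) \<ominus> r k \<in> mpow k" "s = adic_limit r"
    by (auto simp: adic_cauchy_def)
  have "s k \<in> carrier (R Quot mpow k)" for k
    using r by (auto simp: adic_limit_def FactRing_def A_RCOSETS_def')
  moreover have "s (Suc k) \<subseteq> s k" for k
  proof
    fix b assume "b \<in> s (Suc k)"
    then have b: "b \<in> carrier R" "b \<ominus> r (Suc k) \<in> mpow (Suc k)"
      using r coset_mem_iff[OF ideal_mpow r(1)] by (auto simp: adic_limit_def)
    then have "b \<ominus> r (Suc k) \<in> mpow k" using weight_ideal_antimono[of k "Suc k" "\<lambda>_. 1"] by auto
    from ideal_facts(4)[OF ideal_mpow this r(2)] have "b \<ominus> r k \<in> mpow k"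
      using diff_trans[OF b(1) r(1) r(1)] by simp
    then show "b \<in> s k" using r coset_mem_iff[OF ideal_mpow r(1)] b by (auto simp: adic_limit_def)
  qed
  ultimately show "s \<in> carrier Rhat" by (auto simp: adic_completion_def max_ideal_pow_eq)
qed

lemma adic_limit_in_carrier: "adic_cauchy r \<Longrightarrow> adic_limit r \<in> carrier Rhat"
  using completion_carrier by blast

lemma adic_limit_eq_iff:
  assumes "\<And>k. r k \<in> carrier R" "\<And>k. s k \<in> carrier R"
  shows "adic_limit r = adic_limit s \<longleftrightarrow> (\<forall>k. r k \<ominus> s k \<in> mpow k)"
  using coset_eq_iff[OF ideal_mpow assms] by (auto simp: adic_limit_def fun_eq_iff)

lemma adic_cauchy_const: "c \<in> carrier R \<Longrightarrow> adic_cauchy (\<lambda>_. c)"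
  using ideal_facts(2)[OF ideal_mpow] by (simp add: adic_cauchy_def diff_self)

lemma adic_cauchy_add:
  assumes "adic_cauchy r" "adic_cauchy s"
  shows "adic_cauchy (\<lambda>k. r k \<oplus> s k)"
proof -
  have c: "r k \<in> carrier R" "s k \<in> carrier R" for k using assms by (auto simp: adic_cauchy_def)
  have "(r (Suc k) \<oplus> s (Suc k)) \<ominus> (r k \<oplus> s k) = (r (Suc k) \<ominus> r k) \<oplus> (s (Suc k) \<ominus> s k)" for k
    using c[of k] c[of "Suc k"] by algebra
  then show ?thesis using assms c ideal_facts(4)[OF ideal_mpow] by (simp add: adic_cauchy_def)
qed

lemma adic_cauchy_mult:
  assumes "adic_cauchy r" "adic_cauchy s"
  shows "adic_cauchy (\<lambda>k. r k \<otimes> s k)"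
  using assms cong_mult[OF ideal_mpow] by (simp add: adic_cauchy_def)

lemma adic_cauchy_uminus:
  assumes "adic_cauchy r"
  shows "adic_cauchy (\<lambda>k. \<ominus> r k)"
proof -
  have c: "r k \<in> carrier R" for k using assms by (auto simp: adic_cauchy_def)
  have "(\<ominus> r (Suc k)) \<ominus> (\<ominus> r k) = \<ominus> (r (Suc k) \<ominus> r k)" for k
    using c[of k] c[of "Suc k"] by algebra
  then show ?thesis using assms c ideal_facts(5)[OF ideal_mpow] by (simp add: adic_cauchy_def)
qed

lemma adic_limit_mult:
  assumes "adic_cauchy r" "adic_cauchy s"
  shows "adic_limit r \<otimes>\<^bsub>Rhat\<^esub> adic_limit s = adic_limit (\<lambda>k. r k \<otimes> s k)"
  using ideal.rcoset_mult_add[OF ideal_mpow] assms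
  by (simp add: adic_completion_def adic_limit_def FactRing_def max_ideal_pow_eq adic_cauchy_def)

lemma adic_limit_add:
  assumes "adic_cauchy r" "adic_cauchy s"
  shows "adic_limit r \<oplus>\<^bsub>Rhat\<^esub> adic_limit s = adic_limit (\<lambda>k. r k \<oplus> s k)"
  using ideal.a_rcos_sum[OF ideal_mpow] assms
  by (simp add: adic_completion_def adic_limit_def FactRing_def max_ideal_pow_eq adic_cauchy_def)

lemma completion_one: "\<one>\<^bsub>Rhat\<^esub> = adic_limit (\<lambda>_. \<one>)"
  by (simp add: adic_completion_def adic_limit_def FactRing_def max_ideal_pow_eq)

lemma completion_zero: "\<zero>\<^bsub>Rhat\<^esub> = adic_limit (\<lambda>_. \<zero>)"
  using a_coset_add_zero[OF ideal_facts(1)[OF ideal_mpow]]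
  by (simp add: adic_completion_def adic_limit_def FactRing_def max_ideal_pow_eq)

lemma cring_completion: "cring Rhat"
proof (rule cringI)
  note lim = completion_carrier adic_limit_mult adic_limit_add adic_cauchy_mult adic_cauchy_add
    adic_cauchy_const adic_cauchy_uminus completion_one completion_zero adic_cauchy_closed
  show "abelian_group Rhat"
  proof (rule abelian_groupI)
    fix a b c assume a: "a \<in> carrier Rhat" and b: "b \<in> carrier Rhat"
    obtain r where r: "adic_cauchy r" "a = adic_limit r" using a completion_carrier by blast
    obtain s where s: "adic_cauchy s" "b = adic_limit s" using b completion_carrier by blast
    show "a \<oplus>\<^bsub>Rhat\<^esub> b \<in> carrier Rhat"
      using r s by (auto simp: adic_limit_add intro!: adic_limit_in_carrier adic_cauchy_add)
    show "a \<oplus>\<^bsub>Rhat\<^esub> b = b \<oplus>\<^bsub>Rhat\<^esub> a"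
      using r s a_comm by (simp add: adic_limit_add adic_cauchy_def)
    assume c: "c \<in> carrier Rhat"
    obtain t where t: "adic_cauchy t" "c = adic_limit t" using c completion_carrier by blast
    have "a \<oplus>\<^bsub>Rhat\<^esub> b \<oplus>\<^bsub>Rhat\<^esub> c = adic_limit (\<lambda>k. r k \<oplus> s k \<oplus> t k)"
      using r s t by (simp add: adic_limit_add adic_cauchy_add)
    also have "\<dots> = adic_limit (\<lambda>k. r k \<oplus> (s k \<oplus> t k))"
      using r s t by (simp add: a_assoc adic_cauchy_def)
    also have "\<dots> = a \<oplus>\<^bsub>Rhat\<^esub> (b \<oplus>\<^bsub>Rhat\<^esub> c)"
      using r s t by (simp add: adic_limit_add adic_cauchy_add)
    finally show "a \<oplus>\<^bsub>Rhat\<^esub> b \<oplus>\<^bsub>Rhat\<^esub> c = a \<oplus>\<^bsub>Rhat\<^esub> (b \<oplus>\<^bsub>Rhat\<^esub> c)" .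
  next
    show "\<zero>\<^bsub>Rhat\<^esub> \<in> carrier Rhat"
      unfolding completion_zero by (intro adic_limit_in_carrier adic_cauchy_const) simp
    fix a assume a: "a \<in> carrier Rhat"
    obtain r where r: "adic_cauchy r" "a = adic_limit r" using a completion_carrier by blast
    show "\<zero>\<^bsub>Rhat\<^esub> \<oplus>\<^bsub>Rhat\<^esub> a = a"
      using r by (simp add: completion_zero adic_limit_add adic_cauchy_const) (simp add: adic_cauchy_def)
    have "adic_limit (\<lambda>k. \<ominus> r k) \<oplus>\<^bsub>Rhat\<^esub> a = \<zero>\<^bsub>Rhat\<^esub>"
      using r by (simp add: completion_zero adic_limit_add adic_cauchy_uminus)
        (simp add: adic_cauchy_def l_neg)
    then show "\<exists>b\<in>carrier Rhat. b \<oplus>\<^bsub>Rhat\<^esub> a = \<zero>\<^bsub>Rhat\<^esub>"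
      using adic_limit_in_carrier[OF adic_cauchy_uminus[OF r(1)]] by blast
  qed
  show "comm_monoid Rhat"
  proof (rule comm_monoidI)
    show "\<one>\<^bsub>Rhat\<^esub> \<in> carrier Rhat"
      unfolding completion_one by (intro adic_limit_in_carrier adic_cauchy_const) simp
    fix a assume a: "a \<in> carrier Rhat"
    obtain r where r: "adic_cauchy r" "a = adic_limit r" using a completion_carrier by blast
    show "\<one>\<^bsub>Rhat\<^esub> \<otimes>\<^bsub>Rhat\<^esub> a = a"
      using r by (simp add: completion_one adic_limit_mult adic_cauchy_const) (simp add: adic_cauchy_def)
    fix b assume b: "b \<in> carrier Rhat"
    obtain s where s: "adic_cauchy s" "b = adic_limit s" using b completion_carrier by blast
    show "a \<otimes>\<^bsub>Rhat\<^esub> b \<in> carrier Rhat"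
      using r s by (auto simp: adic_limit_mult intro!: adic_limit_in_carrier adic_cauchy_mult)
    show "a \<otimes>\<^bsub>Rhat\<^esub> b = b \<otimes>\<^bsub>Rhat\<^esub> a"
      using r s m_comm by (simp add: adic_limit_mult adic_cauchy_def)
    fix c assume c: "c \<in> carrier Rhat"
    obtain t where t: "adic_cauchy t" "c = adic_limit t" using c completion_carrier by blast
    have "a \<otimes>\<^bsub>Rhat\<^esub> b \<otimes>\<^bsub>Rhat\<^esub> c = adic_limit (\<lambda>k. r k \<otimes> s k \<otimes> t k)"
      using r s t by (simp add: adic_limit_mult adic_cauchy_mult)
    also have "\<dots> = adic_limit (\<lambda>k. r k \<otimes> (s k \<otimes> t k))"
      using r s t by (simp add: m_assoc adic_cauchy_def)
    also have "\<dots> = a \<otimes>\<^bsub>Rhat\<^esub> (b \<otimes>\<^bsub>Rhat\<^esub> c)"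
      using r s t by (simp add: adic_limit_mult adic_cauchy_mult)
    finally show "a \<otimes>\<^bsub>Rhat\<^esub> b \<otimes>\<^bsub>Rhat\<^esub> c = a \<otimes>\<^bsub>Rhat\<^esub> (b \<otimes>\<^bsub>Rhat\<^esub> c)" .
  qed
  fix a b c assume a: "a \<in> carrier Rhat" and b: "b \<in> carrier Rhat" and c: "c \<in> carrier Rhat"
  obtain r where r: "adic_cauchy r" "a = adic_limit r" using a completion_carrier by blast
  obtain s where s: "adic_cauchy s" "b = adic_limit s" using b completion_carrier by blast
  obtain t where t: "adic_cauchy t" "c = adic_limit t" using c completion_carrier by blast
  have "(a \<oplus>\<^bsub>Rhat\<^esub> b) \<otimes>\<^bsub>Rhat\<^esub> c = adic_limit (\<lambda>k. (r k \<oplus> s k) \<otimes> t k)"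
    using r s t by (simp add: adic_limit_mult adic_limit_add adic_cauchy_add)
  also have "\<dots> = adic_limit (\<lambda>k. r k \<otimes> t k \<oplus> s k \<otimes> t k)"
    using r s t by (simp add: l_distr adic_cauchy_def)
  also have "\<dots> = a \<otimes>\<^bsub>Rhat\<^esub> c \<oplus>\<^bsub>Rhat\<^esub> b \<otimes>\<^bsub>Rhat\<^esub> c"
    using r s t by (simp add: adic_limit_mult adic_limit_add adic_cauchy_mult)
  finally show "(a \<oplus>\<^bsub>Rhat\<^esub> b) \<otimes>\<^bsub>Rhat\<^esub> c = a \<otimes>\<^bsub>Rhat\<^esub> c \<oplus>\<^bsub>Rhat\<^esub> b \<otimes>\<^bsub>Rhat\<^esub> c" .
qed

text \<open>From index 1 on all entries are congruent modulo the maximal ideal and hence units.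
  Their inverses are again Cauchy, because the difference of two inverses is a multiple of the
  difference of the elements.\<close>

lemma adic_limit_unit:
  assumes r: "adic_cauchy r" and u: "r 1 \<notin> mm"
  shows "adic_limit r \<in> Units Rhat"
proof -
  have rc: "r k \<in> carrier R" for k using r by (simp add: adic_cauchy_def)
  have runit: "r (Suc k) \<in> Units R" for k
  proof (induction k)
    case 0
    then show ?case using u rc Units_iff by auto
  next
    case (Suc k)
    have "r (Suc (Suc k)) \<ominus> r (Suc k) \<in> mpow (Suc k)" using r by (simp add: adic_cauchy_def)
    then have d: "r (Suc (Suc k)) \<ominus> r (Suc k) \<in> mm"
      using weight_ideal_antimono[of "Suc 0" "Suc k" "\<lambda>_. 1"] mpow_Suc_0 by auto
    have "r (Suc k) \<oplus> (r (Suc (Suc k)) \<ominus> r (Suc k)) = r (Suc (Suc k))"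
      using rc[of "Suc k"] rc[of "Suc (Suc k)"] by algebra
    then show ?case using Units_add_mm[OF Suc d] by simp
  qed
  \<comment> \<open>Entry 0 of \<open>r\<close> need not be invertible; the placeholder is harmless
    since congruences at index 0 are void.\<close>
  define q where "q k = (if k = 0 then \<one> else inv (r k))" for k
  have qc: "q k \<in> carrier R" for k using runit[of "k - 1"] by (cases k) (auto simp: q_def)
  have "q (Suc k) \<ominus> q k \<in> mpow k" for k
  proof (cases k)
    case 0
    then show ?thesis using qc weight_ideal_zero by simp
  next
    case (Suc j)
    define a b where "a = r k" and "b = r (Suc k)"
    have ab: "a \<in> Units R" "b \<in> Units R" using runit Suc by (auto simp: a_def b_def)
    define a' b' where "a' = inv a" and "b' = inv b"
    have c: "a \<in> carrier R" "b \<in> carrier R" "a' \<in> carrier R" "b' \<in> carrier R"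
      using ab by (auto simp: a'_def b'_def)
    have i: "a \<otimes> a' = \<one>" "b \<otimes> b' = \<one>" using ab by (auto simp: a'_def b'_def)
    have "b \<ominus> a \<in> mpow k" using r by (simp add: adic_cauchy_def a_def b_def)
    then have "(\<ominus> (a' \<otimes> b')) \<otimes> (b \<ominus> a) \<in> mpow k" using ideal_facts(7)[OF ideal_mpow] c by simp
    moreover have "(\<ominus> (a' \<otimes> b')) \<otimes> (b \<ominus> a) = b' \<otimes> (a \<otimes> a') \<ominus> a' \<otimes> (b \<otimes> b')" using c by algebra
    ultimately have "b' \<ominus> a' \<in> mpow k" using i c by simp
    then show ?thesis using Suc by (simp add: q_def a'_def b'_def a_def b_def)
  qed
  then have q: "adic_cauchy q" using qc by (simp add: adic_cauchy_def)
  have "r k \<otimes> q k \<ominus> \<one> \<in> mpow k" for k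
  proof (cases k)
    case 0
    then show ?thesis using qc rc weight_ideal_zero by simp
  next
    case (Suc j)
    then have "r k \<otimes> q k = \<one>" using runit[of j] by (simp add: q_def)
    then show ?thesis using ideal_facts(2)[OF ideal_mpow] by (simp add: diff_self)
  qed
  then have "adic_limit r \<otimes>\<^bsub>Rhat\<^esub> adic_limit q = \<one>\<^bsub>Rhat\<^esub>"
    unfolding adic_limit_mult[OF r q] completion_one using qc rc by (subst adic_limit_eq_iff) auto
  then show ?thesis
    using comm_monoid.m_comm[OF cring.axioms(2)[OF cring_completion]] adic_limit_in_carrier q r
    unfolding Units_def by fastforce
qed

lemma adic_limit_in_mhat_iff:
  assumes "adic_cauchy r" "adic_cauchy s" "adic_limit r = adic_limit s"
  shows "r 1 \<in> mm \<longleftrightarrow> s 1 \<in> mm"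
proof -
  have c: "r 1 \<in> carrier R" "s 1 \<in> carrier R" using assms by (auto simp: adic_cauchy_def)
  have d: "r 1 \<ominus> s 1 \<in> mm"
    using assms(3) adic_limit_eq_iff[of r s] assms(1,2) mpow_Suc_0 by (auto simp: adic_cauchy_def)
  have e: "(r 1 \<ominus> s 1) \<oplus> s 1 = r 1" "r 1 \<ominus> (r 1 \<ominus> s 1) = s 1" using c by algebra+
  show ?thesis using ideal_facts(4)[OF ideal_mm d, of "s 1"] ideal_facts(6)[OF ideal_mm _ d, of "r 1"] e by auto
qed

text \<open>Every limit outside this ideal is a unit, so each ideal not contained in it is the whole
  completion. This gives maximality and uniqueness together.\<close>

lemma max_ideal_completion:
  shows "max_ideal Rhat = {adic_limit r | r. adic_cauchy r \<and> r 1 \<in> mm}"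
    and "maximalideal (max_ideal Rhat) Rhat"
proof -
  interpret C: cring Rhat by (rule cring_completion)
  define mh where "mh = {adic_limit r | r. adic_cauchy r \<and> r 1 \<in> mm}"
  note m = ideal_facts[OF ideal_mm]
  have "ideal mh Rhat"
  proof (rule C.ideal_intro)
    show "mh \<subseteq> carrier Rhat" using adic_limit_in_carrier by (auto simp: mh_def)
    show "\<zero>\<^bsub>Rhat\<^esub> \<in> mh" unfolding completion_zero mh_def using adic_cauchy_const[of \<zero>] m(2) by auto
    fix a assume "a \<in> mh"
    then obtain r where r: "adic_cauchy r" "r 1 \<in> mm" "a = adic_limit r" by (auto simp: mh_def)
    show "c \<otimes>\<^bsub>Rhat\<^esub> a \<in> mh" if "c \<in> carrier Rhat" for c
    proof -
      obtain t where t: "adic_cauchy t" "c = adic_limit t" using \<open>c \<in> carrier Rhat\<close> completion_carrier by blast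
      have "c \<otimes>\<^bsub>Rhat\<^esub> a = adic_limit (\<lambda>k. t k \<otimes> r k)" using t r by (simp add: adic_limit_mult)
      then show ?thesis unfolding mh_def
        using adic_cauchy_mult[OF t(1) r(1)] m(7)[OF r(2)] adic_cauchy_closed[OF t(1)]
        by (intro CollectI exI[of _ "\<lambda>k. t k \<otimes> r k"]) auto
    qed
    fix b assume "b \<in> mh"
    then obtain s where s: "adic_cauchy s" "s 1 \<in> mm" "b = adic_limit s" by (auto simp: mh_def)
    have "a \<oplus>\<^bsub>Rhat\<^esub> b = adic_limit (\<lambda>k. r k \<oplus> s k)" using s r by (simp add: adic_limit_add)
    then show "a \<oplus>\<^bsub>Rhat\<^esub> b \<in> mh" unfolding mh_def
      using adic_cauchy_add[OF r(1) s(1)] m(4)[OF r(2) s(2)]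
      by (intro CollectI exI[of _ "\<lambda>k. r k \<oplus> s k"]) auto
  qed
  moreover have one: "\<one>\<^bsub>Rhat\<^esub> \<notin> mh"
  proof
    assume "\<one>\<^bsub>Rhat\<^esub> \<in> mh"
    then obtain r where "adic_cauchy r" "r 1 \<in> mm" "adic_limit (\<lambda>_. \<one>) = adic_limit r"
      by (auto simp: mh_def completion_one)
    then have "\<one> \<in> mm" using adic_limit_in_mhat_iff[of "\<lambda>_. \<one>" r] adic_cauchy_const[of \<one>] by auto
    then show False using prime_facts(2)[OF prime_mm] by simp
  qed
  moreover have big: "J = carrier Rhat" if J: "ideal J Rhat" "\<not> J \<subseteq> mh" for J
  proof -
    obtain a where a: "a \<in> J" "a \<notin> mh" using J(2) by auto
    have ac: "a \<in> carrier Rhat" using a C.ideal_facts(3)[OF J(1)] by simp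
    then obtain r where r: "adic_cauchy r" "a = adic_limit r" using completion_carrier by blast
    then have "a \<in> Units Rhat" using adic_limit_unit[of r] a by (auto simp: mh_def)
    then have "\<one>\<^bsub>Rhat\<^esub> \<in> J" using C.ideal_facts(7)[OF J(1) a(1), of "inv\<^bsub>Rhat\<^esub> a"] by simp
    then show ?thesis using ideal.one_imp_carrier[OF J(1)] by simp
  qed
  ultimately have mx: "maximalideal mh Rhat"
    by (intro maximalidealI) (use C.one_closed in blast)+
  moreover have "M = mh" if M: "maximalideal M Rhat" for M
  proof -
    have Mi: "ideal M Rhat" "carrier Rhat \<noteq> M"
      using M by (auto simp: maximalideal_def maximalideal_axioms_def)
    then have "M \<subseteq> mh" using big by blast
    then show ?thesis
      using maximalideal.I_maximal[OF M \<open>ideal mh Rhat\<close>] C.ideal_facts(1)[OF \<open>ideal mh Rhat\<close>] one by auto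
  qed
  ultimately show "max_ideal Rhat = {adic_limit r | r. adic_cauchy r \<and> r 1 \<in> mm}"
    unfolding max_ideal_def mh_def[symmetric] by (intro the_equality)
  then show "maximalideal (max_ideal Rhat) Rhat" using mx by (simp add: mh_def)
qed

end

lemma (in cring) diff_diff_diff:
  "a \<in> carrier R \<Longrightarrow> b \<in> carrier R \<Longrightarrow> c \<in> carrier R \<Longrightarrow> b \<ominus> c = (a \<ominus> c) \<ominus> (a \<ominus> b)"
  by algebra

section \<open>Residues and finite unit expansions in the completion\<close>

context parameter_ring
begin

abbreviation yhat :: "'n \<Rightarrow> nat \<Rightarrow> 'a set" where "yhat \<equiv> to_completion R \<circ> x"

lemma to_completion_eq: "to_completion R c = adic_limit (\<lambda>_. c)"
  by (simp add: to_completion_def adic_limit_def max_ideal_pow_eq)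

lemma adic_cauchy_finsum:
  assumes "finite F" "\<And>A. A \<in> F \<Longrightarrow> adic_cauchy (r A)"
  shows "adic_cauchy (\<lambda>k. \<Oplus>A\<in>F. r A k)"
  using assms
proof (induction F)
  case empty
  then show ?case using adic_cauchy_const[of \<zero>] by simp
next
  case (insert A F)
  have "(\<Oplus>B\<in>insert A F. r B k) = r A k \<oplus> (\<Oplus>B\<in>F. r B k)" for k
    by (rule finsum_insert) (use insert adic_cauchy_closed in auto)
  then show ?case using insert adic_cauchy_add[of "r A"] by simp
qed

lemma completion_finsum:
  assumes "finite F" "\<And>A. A \<in> F \<Longrightarrow> adic_cauchy (r A)"
  shows "(\<Oplus>\<^bsub>Rhat\<^esub>A\<in>F. adic_limit (r A)) = adic_limit (\<lambda>k. \<Oplus>A\<in>F. r A k)"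
proof -
  interpret C: cring Rhat by (rule cring_completion)
  show ?thesis using assms
  proof (induction F)
    case empty
    then show ?case by (simp add: completion_zero)
  next
    case (insert A F)
    have "(\<Oplus>B\<in>insert A F. r B k) = r A k \<oplus> (\<Oplus>B\<in>F. r B k)" for k
      by (rule finsum_insert) (use insert adic_cauchy_closed in auto)
    moreover have "(\<Oplus>\<^bsub>Rhat\<^esub>B\<in>insert A F. adic_limit (r B)) =
        adic_limit (r A) \<oplus>\<^bsub>Rhat\<^esub> (\<Oplus>\<^bsub>Rhat\<^esub>B\<in>F. adic_limit (r B))"
      by (rule C.finsum_insert) (use insert adic_limit_in_carrier in auto)
    ultimately show ?case
      using insert adic_limit_add[of "r A" "\<lambda>k. \<Oplus>B\<in>F. r B k"] adic_cauchy_finsum[of F r] by simp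
  qed
qed

lemma to_completion_hom: "ring_hom_cring R Rhat (to_completion R)"
proof (intro ring_hom_cring.intro ring_hom_cring_axioms.intro cring_completion)
  show "cring R" ..
  show "to_completion R \<in> ring_hom R Rhat"
  proof (rule ring_hom_memI)
    fix a b assume ab: "a \<in> carrier R" "b \<in> carrier R"
    show "to_completion R a \<in> carrier Rhat"
      unfolding to_completion_eq by (intro adic_limit_in_carrier adic_cauchy_const ab)
    show "to_completion R (a \<otimes> b) = to_completion R a \<otimes>\<^bsub>Rhat\<^esub> to_completion R b"
      "to_completion R (a \<oplus> b) = to_completion R a \<oplus>\<^bsub>Rhat\<^esub> to_completion R b"
      unfolding to_completion_eq using ab
      by (simp_all add: adic_limit_mult adic_limit_add adic_cauchy_const)
  qed (simp add: to_completion_eq completion_one)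
qed

lemma pp_completion: "power_product Rhat yhat A = adic_limit (\<lambda>_. pp A)"
proof -
  interpret h: ring_hom_cring R Rhat "to_completion R" by (rule to_completion_hom)
  have "to_completion R (pp A) = (\<Otimes>\<^bsub>Rhat\<^esub>i\<in>UNIV. (to_completion R \<circ> (\<lambda>i. x i [^] (A $ i))) i)"
    unfolding power_product_def by (rule h.hom_finprod) auto
  also have "\<dots> = power_product Rhat yhat A"
    unfolding power_product_def by (rule h.S.finprod_cong') auto
  finally show ?thesis by (simp add: to_completion_eq)
qed

lemma completion_lincomb:
  assumes "finite F" "\<And>A. A \<in> F \<Longrightarrow> adic_cauchy (r A)"
  shows "(\<Oplus>\<^bsub>Rhat\<^esub>A\<in>F. adic_limit (r A) \<otimes>\<^bsub>Rhat\<^esub> power_product Rhat yhat A) =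
    adic_limit (\<lambda>k. lincomb (\<lambda>A. r A k) F)"
proof -
  interpret C: cring Rhat by (rule cring_completion)
  have c: "adic_cauchy (\<lambda>k. r A k \<otimes> pp A)" if "A \<in> F" for A
    using adic_cauchy_mult[OF assms(2)[OF that] adic_cauchy_const[of "pp A"]] by simp
  have "(\<Oplus>\<^bsub>Rhat\<^esub>A\<in>F. adic_limit (r A) \<otimes>\<^bsub>Rhat\<^esub> power_product Rhat yhat A) =
      (\<Oplus>\<^bsub>Rhat\<^esub>A\<in>F. adic_limit (\<lambda>k. r A k \<otimes> pp A))"
    by (rule C.finsum_cong')
      (use assms c in \<open>auto simp: pp_completion adic_limit_mult adic_cauchy_const intro: adic_limit_in_carrier\<close>)
  also have "\<dots> = adic_limit (\<lambda>k. lincomb (\<lambda>A. r A k) F)"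
    unfolding lincomb_def by (rule completion_finsum) (use assms c in auto)
  finally show ?thesis .
qed

lemma adic_cauchy_mod_mm:
  assumes "adic_cauchy r"
  shows "r (Suc k) \<ominus> r 1 \<in> mm"
proof (induction k)
  case 0
  then show ?case using ideal_facts(2)[OF ideal_mm] adic_cauchy_closed[OF assms] by (simp add: diff_self)
next
  case (Suc k)
  have "r (Suc (Suc k)) \<ominus> r (Suc k) \<in> mpow (Suc k)" using assms by (simp add: adic_cauchy_def)
  then have d: "r (Suc (Suc k)) \<ominus> r (Suc k) \<in> mm"
    using weight_ideal_antimono[of "Suc 0" "Suc k" "\<lambda>_. 1"] mpow_Suc_0 by auto
  from ideal_facts(4)[OF ideal_mm d Suc] show ?case
    using adic_cauchy_closed[OF assms] by (simp only: diff_trans)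
qed

lemma adic_limit_unit_iff:
  assumes "adic_cauchy r"
  shows "adic_limit r \<in> Units Rhat \<longleftrightarrow> r 1 \<notin> mm"
proof
  interpret C: cring Rhat by (rule cring_completion)
  assume u: "adic_limit r \<in> Units Rhat"
  show "r 1 \<notin> mm"
  proof
    assume "r 1 \<in> mm"
    then have "adic_limit r \<in> max_ideal Rhat" using assms max_ideal_completion(1) by blast
    moreover have "primeideal (max_ideal Rhat) Rhat" by (rule C.maximalideal_prime[OF max_ideal_completion(2)])
    ultimately show False
      using C.prime_facts(1,2) C.ideal_facts(7) C.Units_l_inv[OF u] C.Units_inv_closed[OF u] by metis
  qed
qed (rule adic_limit_unit[OF assms])

lemma coset_max_ideal_completion_eq_iff:
  assumes "adic_cauchy r" "adic_cauchy s"
  shows "max_ideal Rhat +>\<^bsub>Rhat\<^esub> adic_limit r = max_ideal Rhat +>\<^bsub>Rhat\<^esub> adic_limit s \<longleftrightarrow> r 1 \<ominus> s 1 \<in> mm"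
proof -
  interpret C: cring Rhat by (rule cring_completion)
  have id: "ideal (max_ideal Rhat) Rhat" using max_ideal_completion(2) by (simp add: maximalideal_def)
  have c: "adic_limit r \<in> carrier Rhat" "adic_limit s \<in> carrier Rhat" using assms adic_limit_in_carrier by auto
  define d where "d k = r k \<oplus> \<ominus> s k" for k
  have d: "adic_cauchy d" unfolding d_def by (intro adic_cauchy_add adic_cauchy_uminus assms)
  have "adic_limit d \<oplus>\<^bsub>Rhat\<^esub> adic_limit s = adic_limit r"
  proof -
    have "d k \<oplus> s k = r k" for k
      using adic_cauchy_closed[OF assms(1), of k] adic_cauchy_closed[OF assms(2), of k] unfolding d_def by algebra
    then show ?thesis using adic_limit_add[OF d assms(2)] by simp
  qed
  moreover have dc: "adic_limit d \<in> carrier Rhat" by (rule adic_limit_in_carrier[OF d])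
  moreover have "(adic_limit d \<oplus>\<^bsub>Rhat\<^esub> adic_limit s) \<ominus>\<^bsub>Rhat\<^esub> adic_limit s = adic_limit d"
    using dc c by (simp add: a_minus_def C.a_assoc C.r_neg)
  ultimately have eq: "adic_limit r \<ominus>\<^bsub>Rhat\<^esub> adic_limit s = adic_limit d" by simp
  have "adic_limit d \<in> max_ideal Rhat \<longleftrightarrow> d 1 \<in> mm"
    unfolding max_ideal_completion(1) using d adic_limit_in_mhat_iff by blast
  then show ?thesis
    using C.quotient_eq_iff_same_a_r_cos[OF id c] eq by (simp add: d_def a_minus_def)
qed

lemma residue_to_completion_coset:
  assumes "c \<in> carrier R"
  shows "residue_to_completion R (max_ideal R +> c) = max_ideal Rhat +>\<^bsub>Rhat\<^esub> to_completion R c"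
proof -
  have "max_ideal Rhat +>\<^bsub>Rhat\<^esub> to_completion R b = max_ideal Rhat +>\<^bsub>Rhat\<^esub> to_completion R c"
    if "b \<in> max_ideal R +> c" for b
  proof -
    have b: "b \<in> carrier R" "b \<ominus> c \<in> mm"
      using coset_mem_iff[OF ideal_mm assms] \<open>b \<in> max_ideal R +> c\<close> by (auto simp: max_ideal_eq)
    then show ?thesis unfolding to_completion_eq
      by (subst coset_max_ideal_completion_eq_iff) (auto intro: adic_cauchy_const assms)
  qed
  moreover have "c \<in> max_ideal R +> c"
    using coset_mem_iff[OF ideal_mm assms, of c] ideal_facts(2)[OF ideal_mm] assms
    by (simp add: max_ideal_eq diff_self)
  ultimately have "(\<lambda>r. max_ideal Rhat +>\<^bsub>Rhat\<^esub> to_completion R r) ` (max_ideal R +> c) =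
      {max_ideal Rhat +>\<^bsub>Rhat\<^esub> to_completion R c}" by blast
  then show ?thesis unfolding residue_to_completion_def by simp
qed

text \<open>The terms of an infinite power series expansion with unit coefficients are collected along
  the finitely many minimal exponents of its support.\<close>

lemma completion_expansion_exists:
  assumes "g \<in> carrier Rhat"
  shows "\<exists>\<rho>. is_expansion Rhat yhat g \<rho>"
proof -
  interpret C: cring Rhat by (rule cring_completion)
  let ?w = "weight (\<lambda>_ :: 'n. 1)"
  obtain s where s: "adic_cauchy s" "g = adic_limit s" using assms completion_carrier by blast
  have sc: "s k \<in> carrier R" for k by (rule adic_cauchy_closed[OF s(1)])
  have "\<exists>u. (\<forall>A. u A \<in> Units R \<union> {\<zero>}) \<and> (\<forall>A. ?w A < 0 \<longrightarrow> u A = \<zero>) \<and>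
    (\<forall>w\<ge>0. s w \<ominus> lincomb u {A. ?w A < w} \<in> mpow w)"
    by (rule weight_expansion_sequence) (use s sc in \<open>auto simp: adic_cauchy_def weight_ideal_zero\<close>)
  then obtain u where u': "\<forall>A. u A \<in> Units R \<union> {\<zero>}"
    "\<forall>w\<ge>0. s w \<ominus> lincomb u {A. ?w A < w} \<in> mpow w" by (elim exE conjE)
  have u: "u A \<in> Units R \<union> {\<zero>}" "s w \<ominus> lincomb u {A. ?w A < w} \<in> mpow w" for A w
    using spec[OF u'(1), of A] mp[OF spec[OF u'(2), of w]] by auto
  have uc: "u A \<in> carrier R" for A using u(1) by (metis UnE Units_closed singletonD zero_closed)
  define S where "S = {A. u A \<noteq> \<zero>}"
  define U where "U = minimal_exponents S"
  have finU: "finite U" unfolding U_def by (rule finite_minimal_exponents)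
  have US: "U \<subseteq> S" by (auto simp: U_def minimal_exponents_def)
  have "\<exists>\<phi>. \<forall>B\<in>S. \<phi> B \<in> U \<and> \<phi> B \<le> B" unfolding U_def
    by (rule bchoice) (use minimal_exponent_below in blast)
  then obtain \<phi> where \<phi>: "\<And>B. B \<in> S \<Longrightarrow> \<phi> B \<in> U" "\<And>B. B \<in> S \<Longrightarrow> \<phi> B \<le> B" by blast
  have \<phi>U: "\<phi> A = A" if "A \<in> U" for A
    using that \<phi>[of A] US by (auto simp: U_def minimal_exponents_def)
  \<comment> \<open>The cut-off is shifted by the weight of \<open>A\<close>, so that the cofactor
    monomials of degree below \<open>k\<close> are collected: \<open>v A k\<close> is the
    coefficient of \<open>A\<close> to precision \<open>k\<close>.\<close>
  define D where "D A k = {B \<in> S. ?w B < k + ?w A \<and> \<phi> B = A}" for A k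
  have finw: "finite {B. ?w B < k}" for k
    by (rule finite_subset[OF _ finite_weight_le[of "\<lambda>_. 1" k]]) auto
  have finD: "finite (D A k)" for A k
    by (rule finite_subset[OF _ finw[of "k + ?w A"]]) (auto simp: D_def)
  define q where "q A B = u B \<otimes> pp (\<chi> i. B $ i - A $ i)" for A B :: "nat ^ 'n"
  have qc: "q A B \<in> carrier R" for A B using uc by (simp add: q_def)
  define v where "v A k = (\<Oplus>B\<in>D A k. q A B)" for A k
  have vc: "v A k \<in> carrier R" for A k unfolding v_def using qc by (intro finsum_closed) auto
  have vcauchy: "adic_cauchy (v A)" for A
  proof -
    have "v A (Suc k) \<ominus> v A k \<in> mpow k" for k
    proof -
      define D' where "D' = {B \<in> S. ?w B = k + ?w A \<and> \<phi> B = A}"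
      have "finite D'" unfolding D'_def by (rule finite_subset[OF _ finD[of A "Suc k"]]) (auto simp: D_def)
      have "v A (Suc k) = finsum R (q A) (D' \<union> D A k)"
        unfolding v_def by (rule finsum_cong') (use qc in \<open>auto simp: D_def D'_def\<close>)
      also have "\<dots> = finsum R (q A) D' \<oplus> v A k" unfolding v_def
        by (rule finsum_Un_disjoint) (use \<open>finite D'\<close> finD qc in \<open>auto simp: D_def D'_def\<close>)
      finally have eq: "v A (Suc k) = finsum R (q A) D' \<oplus> v A k" .
      have in_mpow: "finsum R (q A) D' \<in> mpow k"
      proof (rule ideal_finsum[OF ideal_mpow])
        fix B assume "B \<in> D'"
        then have B: "B \<in> S" "?w B = k + ?w A" "A \<le> B" using \<phi>(2)[of B] by (auto simp: D'_def)
        have "?w B = ?w (A + (\<chi> i. B $ i - A $ i))" using exponent_split[OF B(3)] by simp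
        then have "k \<le> ?w (\<chi> i. B $ i - A $ i)" using B(2) unfolding weight_add by linarith
        then show "q A B \<in> mpow k"
          unfolding q_def by (intro ideal_facts(7)[OF ideal_mpow] pp_in_weight_ideal uc)
      qed
      have "finsum R (q A) D' \<in> carrier R" using qc by (intro finsum_closed) auto
      then have "v A (Suc k) \<ominus> v A k = finsum R (q A) D'"
        unfolding eq using vc[of A k] by (simp add: a_minus_def a_assoc r_neg)
      then show ?thesis using in_mpow by simp
    qed
    then show ?thesis using vc by (simp add: adic_cauchy_def)
  qed
  \<comment> \<open>At precision 1 only the cofactor 1 occurs, so the collected coefficient starts
    with the unit \<open>u A\<close> and its limit is a unit.\<close>
  have v1: "v A 1 = u A" if A: "A \<in> U" for A
  proof -
    have "D A 1 = {A}"
    proof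
      show "{A} \<subseteq> D A 1" using A US \<phi>U by (auto simp: D_def)
      show "D A 1 \<subseteq> {A}"
      proof
        fix B assume "B \<in> D A 1"
        then have B: "?w B < 1 + ?w A" "A \<le> B" using \<phi>(2)[of B] by (auto simp: D_def)
        define C where "C = (\<chi> i. B $ i - A $ i)"
        have BC: "B = A + C" using exponent_split[OF B(2)] by (simp add: C_def)
        have "\<not> 0 < ?w C" using B(1) unfolding BC weight_add by linarith
        then have "C = 0" using component_le_weight[of "\<lambda>_. 1" _ C] by (auto simp: vec_eq_iff)
        then show "B \<in> {A}" using BC by simp
      qed
    qed
    moreover have "(\<chi> i. A $ i - A $ i) = 0" by (simp add: vec_eq_iff)
    ultimately show ?thesis using uc[of A] by (simp add: v_def q_def pp_zero)
  qed
  have vunit: "adic_limit (v A) \<in> Units Rhat" if "A \<in> U" for A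
    unfolding adic_limit_unit_iff[OF vcauchy] v1[OF that]
    using u(1)[of A] that US Units_iff by (auto simp: S_def)
  have vpp: "v A k \<otimes> pp A = lincomb u (D A k)" for A k
  proof -
    have "v A k \<otimes> pp A = (\<Oplus>B\<in>D A k. q A B \<otimes> pp A)"
      unfolding v_def by (rule finsum_ldistr) (use finD qc in auto)
    also have "\<dots> = lincomb u (D A k)" unfolding lincomb_def
    proof (rule finsum_cong')
      fix B assume "B \<in> D A k"
      then have "A \<le> B" using \<phi>(2)[of B] by (auto simp: D_def)
      then have "pp B = pp (\<chi> i. B $ i - A $ i) \<otimes> pp A"
        using exponent_split[of A B] pp_add[of A "\<chi> i. B $ i - A $ i"] by (simp add: m_comm)
      then show "q A B \<otimes> pp A = u B \<otimes> pp B" using uc by (simp add: q_def m_assoc)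
    qed (use uc in auto)
    finally show ?thesis .
  qed
  have lim: "s k \<ominus> lincomb (\<lambda>A. v A k) U \<in> mpow k" for k
  proof -
    \<comment> \<open>The grouped truncation \<open>E\<close> contains the plain truncation
      \<open>L\<close>; the surplus terms have degree at least \<open>k\<close> and do not matter
      modulo the power of exponent \<open>k\<close>.\<close>
    define E where "E = (\<Union>A\<in>U. D A k)"
    have finE: "finite E" unfolding E_def using finU finD by auto
    have "lincomb (\<lambda>A. v A k) U = (\<Oplus>A\<in>U. \<Oplus>B\<in>D A k. u B \<otimes> pp B)"
      unfolding lincomb_def using vpp by (simp add: lincomb_def)
    also have "\<dots> = lincomb u E" unfolding lincomb_def E_def
      by (rule add.finprod_UN_disjoint[symmetric])
        (use finU finD uc in \<open>auto simp: pairwise_def disjnt_def D_def\<close>)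
    finally have 1: "lincomb (\<lambda>A. v A k) U = lincomb u E" .
    define L where "L = {A. ?w A < k} \<inter> S"
    have finL: "finite L" unfolding L_def using finw by auto
    have "lincomb u {A. ?w A < k} = lincomb u L"
      by (rule lincomb_neutral[OF finw]) (use uc in \<open>auto simp: L_def S_def\<close>)
    moreover have LE: "L \<subseteq> E" using \<phi> by (auto simp: L_def E_def D_def)
    then have "lincomb u E = lincomb u (L \<union> (E - L))" by (simp add: Un_absorb1)
    then have "lincomb u E = lincomb u L \<oplus> lincomb u (E - L)"
      using lincomb_Un[of L "E - L" u] finL finE uc by simp
    moreover have "lincomb u (E - L) \<in> mpow k"
      by (rule lincomb_in_weight_ideal) (use uc in \<open>auto simp: L_def E_def D_def\<close>)
    moreover have "s k \<ominus> (lincomb u L \<oplus> lincomb u (E - L)) = (s k \<ominus> lincomb u L) \<ominus> lincomb u (E - L)"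
      by (rule diff_add_eq_diff_diff) (use sc uc in auto)
    ultimately show ?thesis using u(2)[of k] ideal_facts(6)[OF ideal_mpow] unfolding 1 by simp
  qed
  have "g = adic_limit (\<lambda>k. lincomb (\<lambda>A. v A k) U)"
    unfolding s(2) by (subst adic_limit_eq_iff) (use lim sc vc in auto)
  also have "\<dots> = (\<Oplus>\<^bsub>Rhat\<^esub>A\<in>U. adic_limit (v A) \<otimes>\<^bsub>Rhat\<^esub> power_product Rhat yhat A)"
    by (rule completion_lincomb[symmetric, OF finU vcauchy])
  finally have g: "g = (\<Oplus>\<^bsub>Rhat\<^esub>A\<in>U. adic_limit (v A) \<otimes>\<^bsub>Rhat\<^esub> power_product Rhat yhat A)" .
  have "\<zero>\<^bsub>Rhat\<^esub> \<notin> Units Rhat"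
    using adic_limit_unit_iff[OF adic_cauchy_const[of \<zero>]] ideal_facts(2)[OF ideal_mm]
    by (simp add: completion_zero)
  then have "adic_limit (v A) \<noteq> \<zero>\<^bsub>Rhat\<^esub>" if "A \<in> U" for A using vunit[OF that] by metis
  then have supp: "{A. (if A \<in> U then adic_limit (v A) else \<zero>\<^bsub>Rhat\<^esub>) \<noteq> \<zero>\<^bsub>Rhat\<^esub>} = U" by auto
  have ppc: "power_product Rhat yhat A \<in> carrier Rhat" for A
    unfolding pp_completion by (intro adic_limit_in_carrier adic_cauchy_const) simp
  have "is_expansion Rhat yhat g (\<lambda>A. if A \<in> U then adic_limit (v A) else \<zero>\<^bsub>Rhat\<^esub>)"
    unfolding is_expansion_def supp
  proof (intro conjI allI)
    show "g = (\<Oplus>\<^bsub>Rhat\<^esub>A\<in>U. (if A \<in> U then adic_limit (v A) else \<zero>\<^bsub>Rhat\<^esub>) \<otimes>\<^bsub>Rhat\<^esub> power_product Rhat yhat A)"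
      unfolding g by (rule C.finsum_cong') (use vcauchy adic_limit_in_carrier ppc in auto)
  qed (use vunit finU in auto)
  then show ?thesis by blast
qed

lemma is_expansion_completion_expansion:
  "g \<in> carrier Rhat \<Longrightarrow> is_expansion Rhat yhat g (expansion Rhat yhat g)"
  using someI_ex[OF completion_expansion_exists] by (simp add: expansion_def)

text \<open>The expansion \<open>\<rho>\<close> and a lift \<open>p\<close> concentrated in weight
  \<open>w\<close> are compared inside the ring, at one late stage of the representing sequences.
  There the difference of coefficients gives a combination of weight above \<open>w\<close>, and
  uniqueness of leading coefficients puts those of weight at most \<open>w\<close> into the maximal
  ideal.\<close>

lemma completion_leading_coefficients:
  assumes l: "\<And>i. 0 < l i" and s: "adic_cauchy s"
    and p: "finite F" "\<And>A. p A \<in> carrier R" "\<And>A. A \<notin> F \<Longrightarrow> p A = \<zero>" "\<And>A. A \<in> F \<Longrightarrow> weight l A = w"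
    and sp: "\<And>k. k0 \<le> k \<Longrightarrow> s k \<ominus> lincomb p F \<in> weight_ideal l (Suc w)"
    and rho: "is_expansion Rhat yhat (adic_limit s) \<rho>"
  shows "weight l A < w \<Longrightarrow> \<rho> A = \<zero>\<^bsub>Rhat\<^esub>"
    and "weight l A = w \<Longrightarrow>
      max_ideal Rhat +>\<^bsub>Rhat\<^esub> \<rho> A = max_ideal Rhat +>\<^bsub>Rhat\<^esub> to_completion R (p A)"
proof -
  interpret C: cring Rhat by (rule cring_completion)
  note Wf = ideal_facts[OF weight_ideal_is_ideal[of l]]
  define S where "S = {A. \<rho> A \<noteq> \<zero>\<^bsub>Rhat\<^esub>}"
  have S: "finite S" "\<And>A. \<rho> A \<in> Units Rhat \<union> {\<zero>\<^bsub>Rhat\<^esub>}"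
    "adic_limit s = (\<Oplus>\<^bsub>Rhat\<^esub>A\<in>S. \<rho> A \<otimes>\<^bsub>Rhat\<^esub> power_product Rhat yhat A)"
    using rho by (auto simp: is_expansion_def S_def)
  \<comment> \<open>A zero coefficient is represented by the constant zero sequence, so the
    representatives have no terms outside \<open>S\<close> at any stage.\<close>
  have "\<exists>r. adic_cauchy r \<and> \<rho> A = adic_limit r \<and> (\<rho> A = \<zero>\<^bsub>Rhat\<^esub> \<longrightarrow> r = (\<lambda>_. \<zero>))" for A
  proof (cases "\<rho> A = \<zero>\<^bsub>Rhat\<^esub>")
    case True
    then show ?thesis using adic_cauchy_const[of \<zero>] by (auto simp: completion_zero)
  next
    case False
    then have "\<rho> A \<in> carrier Rhat" using S(2)[of A] by auto
    then show ?thesis using False completion_carrier by blast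
  qed
  then obtain r where r: "\<And>A. adic_cauchy (r A)" "\<And>A. \<rho> A = adic_limit (r A)"
    "\<And>A. \<rho> A = \<zero>\<^bsub>Rhat\<^esub> \<Longrightarrow> r A = (\<lambda>_. \<zero>)" by metis
  have rc: "r A k \<in> carrier R" for A k by (rule adic_cauchy_closed[OF r(1)])
  have sc: "s k \<in> carrier R" for k by (rule adic_cauchy_closed[OF s])
  \<comment> \<open>At least \<open>k0\<close>, so that \<open>sp\<close> applies; above
    \<open>w\<close>, so that the power of the maximal ideal lies beyond weight \<open>w\<close>;
    and a successor, so that entries agree with entry 1 modulo the maximal ideal.\<close>
  define K where "K = Suc (k0 + w)"
  have "adic_limit s = adic_limit (\<lambda>k. lincomb (\<lambda>A. r A k) S)"
    unfolding S(3) r(2) by (rule completion_lincomb[OF S(1) r(1)])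
  then have "s K \<ominus> lincomb (\<lambda>A. r A K) S \<in> mpow K"
    using adic_limit_eq_iff[of s "\<lambda>k. lincomb (\<lambda>A. r A k) S"] sc rc by simp
  moreover have "mpow K \<subseteq> weight_ideal l (Suc w)" unfolding weight_ideal_def
  proof (rule monomial_ideal_mono, rule Collect_mono, rule impI)
    fix A assume "K \<le> weight (\<lambda>_ :: 'n. 1) A"
    moreover have "weight (\<lambda>_. 1) A \<le> weight l A"
    proof (rule sum_mono)
      show "1 * A $ i \<le> l i * A $ i" for i using l[of i] by simp
    qed
    ultimately show "Suc w \<le> weight l A" unfolding K_def by linarith
  qed
  ultimately have a: "s K \<ominus> lincomb (\<lambda>A. r A K) S \<in> weight_ideal l (Suc w)" by auto
  have b: "s K \<ominus> lincomb p F \<in> weight_ideal l (Suc w)" by (rule sp) (simp add: K_def)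
  define T where "T = S \<union> F"
  have T: "finite T" using S(1) p(1) by (simp add: T_def)
  define q where "q A = r A K \<ominus> p A" for A
  have qc: "q A \<in> carrier R" for A using rc p(2) by (simp add: q_def)
  have "lincomb q T = lincomb (\<lambda>A. r A K) T \<ominus> lincomb p T"
    unfolding q_def by (rule lincomb_diff[OF T]) (use rc p in auto)
  also have "lincomb (\<lambda>A. r A K) T = lincomb (\<lambda>A. r A K) S"
    by (rule lincomb_neutral[OF T]) (use rc r(3) in \<open>auto simp: T_def S_def\<close>)
  also have "lincomb p T = lincomb p F"
    by (rule lincomb_neutral[OF T]) (use p in \<open>auto simp: T_def\<close>)
  also have "lincomb (\<lambda>A. r A K) S \<ominus> lincomb p F =
      (s K \<ominus> lincomb p F) \<ominus> (s K \<ominus> lincomb (\<lambda>A. r A K) S)"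
    by (rule diff_diff_diff) (use rc p sc in auto)
  also have "\<dots> \<in> weight_ideal l (Suc w)" by (rule Wf(6)[OF b a])
  finally have qT: "lincomb q T \<in> weight_ideal l (Suc w)" .
  have rK: "r A K \<ominus> r A 1 \<in> mm" for A unfolding K_def by (rule adic_cauchy_mod_mm[OF r(1)])
  have runit: "r A K \<in> Units R" if "\<rho> A \<noteq> \<zero>\<^bsub>Rhat\<^esub>" for A
  proof -
    have "\<rho> A \<in> Units Rhat" using S(2)[of A] that by auto
    then have "r A 1 \<notin> mm" using r(2) adic_limit_unit_iff[OF r(1)] by metis
    then have "r A 1 \<in> Units R" using rc Units_iff by auto
    from Units_add_mm[OF this rK[of A]] show ?thesis
      using diff_add_cancel'[of "r A K" "r A 1"] rc by (simp add: a_comm)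
  qed
  have low: "q A \<in> Units R \<union> {\<zero>}" "q A = r A K" if "weight l A < w" for A
  proof -
    have "p A = \<zero>" using p(3,4)[of A] that by auto
    then show "q A = r A K" using rc by (simp add: q_def diff_zero)
    then show "q A \<in> Units R \<union> {\<zero>}"
      using runit[of A] r(3)[of A] by (cases "\<rho> A = \<zero>\<^bsub>Rhat\<^esub>") auto
  qed
  have qm: "q A \<in> mm" if "weight l A \<le> w" for A
  proof (cases "A \<in> T")
    case True
    then show ?thesis using leading_coefficients_in_mm[OF l T qc low(1) qT True that] by blast
  next
    case False
    then have "q A = \<zero>" using r(3)[of A] p(3)[of A] by (simp add: q_def T_def S_def diff_self)
    then show ?thesis using ideal_facts(2)[OF ideal_mm] by simp
  qed
  show "\<rho> A = \<zero>\<^bsub>Rhat\<^esub>" if "weight l A < w"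
    using runit[of A] qm[of A] low(2)[OF that] that Units_iff by auto
  show "max_ideal Rhat +>\<^bsub>Rhat\<^esub> \<rho> A = max_ideal Rhat +>\<^bsub>Rhat\<^esub> to_completion R (p A)"
    if "weight l A = w"
  proof -
    have "r A K \<ominus> p A \<in> mm" using qm[of A] that by (simp add: q_def)
    from ideal_facts(6)[OF ideal_mm this rK[of A]] have "(r A K \<ominus> p A) \<ominus> (r A K \<ominus> r A 1) \<in> mm" .
    then have "r A 1 \<ominus> p A \<in> mm" using diff_diff_diff[of "r A K" "r A 1" "p A"] rc p(2) by simp
    then show ?thesis unfolding r(2) to_completion_eq
      by (subst coset_max_ideal_completion_eq_iff[OF r(1) adic_cauchy_const[OF p(2)]])
  qed
qed

end

section \<open>Newton polyhedra of finite sets of exponents\<close>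

definition newton_hull :: "(nat ^ 'n::finite) set \<Rightarrow> (real ^ 'n) set" where
  "newton_hull S = (\<lambda>C. closed C \<and> convex C) hull
     {real_exponent A + v | A v. A \<in> S \<and> (\<forall>i. 0 \<le> v $ i)}"

lemma newton_polyhedron_eq:
  "newton_polyhedron R x f = newton_hull {A. expansion R x f A \<noteq> \<zero>\<^bsub>R\<^esub>}"
  by (simp add: newton_polyhedron_def newton_hull_def)

lemma newton_hull_least:
  assumes "closed C" "convex C" "\<And>A v. A \<in> S \<Longrightarrow> (\<And>i. 0 \<le> v $ i) \<Longrightarrow> real_exponent A + v \<in> C"
  shows "newton_hull S \<subseteq> C"
  unfolding newton_hull_def by (rule hull_minimal) (use assms in auto)

lemma newton_hull_closed_convex: "closed (newton_hull S)" "convex (newton_hull S)"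
proof -
  have "closed (newton_hull S) \<and> convex (newton_hull S)" unfolding newton_hull_def
    by (rule hull_in) (auto intro: closed_Inter convex_Inter)
  then show "closed (newton_hull S)" "convex (newton_hull S)" by auto
qed

lemma newton_hull_empty: "newton_hull {} = {}"
  using newton_hull_least[of "{}" "{}"] by auto

lemma convex_hull_subset_newton_hull:
  fixes S :: "(nat ^ 'n::finite) set"
  shows "convex hull (real_exponent ` S) \<subseteq> newton_hull S"
proof (rule hull_minimal)
  show "real_exponent ` S \<subseteq> newton_hull S"
  proof
    fix y assume "y \<in> real_exponent ` S"
    then obtain A where "A \<in> S" "y = real_exponent A + 0" by auto
    then show "y \<in> newton_hull S" unfolding newton_hull_def
      by - (rule hull_inc, intro CollectI exI[of _ A] exI[of _ "0 :: real ^ 'n"], auto)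
  qed
qed (rule newton_hull_closed_convex)

text \<open>The sum of a compact convex set and the closed orthant is closed and convex, so taking
  the closed hull adds nothing to it. Finiteness of \<open>S\<close> provides the
  compactness.\<close>

lemma newton_hull_subset_sum:
  fixes S :: "(nat ^ 'n::finite) set"
  assumes "finite S"
  shows "newton_hull S \<subseteq> {s + v | s v. s \<in> convex hull (real_exponent ` S) \<and> v \<in> {v. \<forall>i. 0 \<le> v $ i}}"
proof (rule newton_hull_least)
  have cl: "closed {v :: real ^ 'n. \<forall>i. 0 \<le> v $ i}"
    unfolding Collect_all_eq by (intro closed_INT ballI closed_Collect_le continuous_intros)
  have cv: "convex {v :: real ^ 'n. \<forall>i. 0 \<le> v $ i}" unfolding convex_def by auto
  have "{s + v | s v. s \<in> convex hull (real_exponent ` S) \<and> v \<in> {v. \<forall>i. 0 \<le> v $ i}} =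
      (\<Union>s\<in>convex hull (real_exponent ` S). \<Union>v\<in>{v. \<forall>i. 0 \<le> v $ i}. {s + v})" by auto
  then show "closed {s + v | s v. s \<in> convex hull (real_exponent ` S) \<and> v \<in> {v. \<forall>i. 0 \<le> v $ i}}"
    using compact_closed_sums[OF compact_convex_hull[OF finite_imp_compact] cl, of "real_exponent ` S"] assms by simp
  show "convex {s + v | s v. s \<in> convex hull (real_exponent ` S) \<and> v \<in> {v. \<forall>i. 0 \<le> v $ i}}"
    using convex_sums[OF convex_convex_hull cv, of "real_exponent ` S"]
    by (auto elim!: back_subst[of convex])
next
  fix A :: "nat ^ 'n" and v :: "real ^ 'n"
  assume A: "A \<in> S" "\<And>i. 0 \<le> v $ i"
  have "real_exponent A \<in> convex hull (real_exponent ` S)" using A(1) by (intro hull_inc) auto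
  then show "real_exponent A + v \<in> {s + v | s v. s \<in> convex hull (real_exponent ` S) \<and> v \<in> {v. \<forall>i. 0 \<le> v $ i}}"
    using A(2) by blast
qed

lemma inner_nonneg:
  fixes l v :: "real ^ 'n::finite"
  assumes "\<And>i. 0 \<le> l $ i" "\<And>i. 0 \<le> v $ i"
  shows "0 \<le> l \<bullet> v"
  unfolding inner_vec_def using assms by (auto intro!: sum_nonneg)

lemma newton_hull_lower_bound:
  assumes "\<And>i. 0 \<le> l $ i" "\<And>A. A \<in> S \<Longrightarrow> m \<le> l \<bullet> real_exponent A" "v \<in> newton_hull S"
  shows "m \<le> l \<bullet> v"
proof -
  have "newton_hull S \<subseteq> {v. m \<le> l \<bullet> v}"
  proof (rule newton_hull_least)
    show "closed {v. m \<le> l \<bullet> v}" using closed_halfspace_ge[of m l] by simp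
    show "convex {v. m \<le> l \<bullet> v}" using convex_halfspace_ge[of m l] by simp
    show "real_exponent A + v \<in> {v. m \<le> l \<bullet> v}" if "A \<in> S" "\<And>i. 0 \<le> v $ i" for A v
      using assms(2)[OF that(1)] inner_nonneg[OF assms(1) that(2)] by (simp add: inner_right_distrib)
  qed
  then show ?thesis using assms(3) by auto
qed

text \<open>In a convex combination attaining the lower bound, all points above the bound must have
  weight zero.\<close>

lemma convex_hull_face:
  fixes l :: "'v::euclidean_space"
  assumes "finite P" "\<And>y. y \<in> P \<Longrightarrow> m \<le> l \<bullet> y" "s \<in> convex hull P" "l \<bullet> s = m"
  shows "s \<in> convex hull {y \<in> P. l \<bullet> y = m}"
proof -
  obtain u where u: "\<And>y. y \<in> P \<Longrightarrow> 0 \<le> u y" "sum u P = 1" "(\<Sum>y\<in>P. u y *\<^sub>R y) = s"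
    using assms(3) unfolding convex_hull_finite[OF assms(1)] by auto
  have "(\<Sum>y\<in>P. u y * (l \<bullet> y - m)) = l \<bullet> s - m * sum u P"
    unfolding u(3)[symmetric] by (simp add: inner_sum_right right_diff_distrib sum_subtractf sum_distrib_left mult.commute)
  also have "\<dots> = 0" using u(2) assms(4) by simp
  finally have "\<forall>y\<in>P. u y * (l \<bullet> y - m) = 0"
    by (subst (asm) sum_nonneg_eq_0_iff[OF assms(1)]) (use u(1) assms(2) in auto)
  then have z: "u y = 0" if "y \<in> P - {y \<in> P. l \<bullet> y = m}" for y using that by auto
  have "sum u {y \<in> P. l \<bullet> y = m} = 1"
    using sum.mono_neutral_right[OF assms(1), of "{y \<in> P. l \<bullet> y = m}" u] z u(2) by auto
  moreover have "(\<Sum>y\<in>{y \<in> P. l \<bullet> y = m}. u y *\<^sub>R y) = s"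
    using sum.mono_neutral_right[OF assms(1), of "{y \<in> P. l \<bullet> y = m}" "\<lambda>y. u y *\<^sub>R y"] z u(3) by auto
  ultimately show ?thesis using u(1) assms(1) by (subst convex_hull_finite) auto
qed

text \<open>A positive form vanishes on the nonnegative orthant only at the origin, so a minimiser
  has no orthant component and lies in the hull of the exponents themselves.\<close>

lemma newton_hull_face:
  assumes S: "finite S" and l: "\<And>i. 0 < l $ i"
    and m: "\<And>A. A \<in> S \<Longrightarrow> m \<le> l \<bullet> real_exponent A" "A0 \<in> S" "l \<bullet> real_exponent A0 = m"
  shows "{v \<in> newton_hull S. \<forall>w\<in>newton_hull S. l \<bullet> v \<le> l \<bullet> w} =
    convex hull (real_exponent ` {A \<in> S. l \<bullet> real_exponent A = m})" (is "?F = ?H")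
proof
  have l0: "0 \<le> l $ i" for i using l[of i] by simp
  have A0: "real_exponent A0 \<in> newton_hull S"
    using convex_hull_subset_newton_hull[of S] m(2) hull_inc[of "real_exponent A0" "real_exponent ` S" convex] by auto
  show "?F \<subseteq> ?H"
  proof
    fix v assume v: "v \<in> ?F"
    then have "l \<bullet> v \<le> m" using A0 m(3) by auto
    moreover obtain s p where sp: "v = s + p" "s \<in> convex hull (real_exponent ` S)" "\<And>i. 0 \<le> p $ i"
      using newton_hull_subset_sum[OF S] v by fast
    moreover have "m \<le> l \<bullet> s"
      using newton_hull_lower_bound[OF l0 m(1)] convex_hull_subset_newton_hull[of S] sp(2) by blast
    moreover have "0 \<le> l \<bullet> p" by (rule inner_nonneg[OF l0 sp(3)])
    ultimately have ls: "l \<bullet> s = m" and lp: "l \<bullet> p = 0" by (auto simp: inner_right_distrib)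
    have "\<forall>i\<in>UNIV. l $ i * p $ i = 0"
      using lp sum_nonneg_eq_0_iff[of UNIV "\<lambda>i. l $ i * p $ i"] l0 sp(3) by (simp add: inner_vec_def)
    then have "p = 0" using l by (simp add: vec_eq_iff) (metis less_irrefl)
    have "s \<in> convex hull {y \<in> real_exponent ` S. l \<bullet> y = m}"
      by (rule convex_hull_face) (use S m(1) sp(2) ls in auto)
    moreover have "{y \<in> real_exponent ` S. l \<bullet> y = m} = real_exponent ` {A \<in> S. l \<bullet> real_exponent A = m}" by auto
    ultimately show "v \<in> ?H" using sp(1) \<open>p = 0\<close> by simp
  qed
  show "?H \<subseteq> ?F"
  proof
    fix v assume v: "v \<in> ?H"
    have "?H \<subseteq> convex hull (real_exponent ` S)" by (rule hull_mono) auto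
    then have "v \<in> newton_hull S" using v convex_hull_subset_newton_hull by auto
    moreover have "?H \<subseteq> {v. l \<bullet> v = m}" by (rule hull_minimal) (auto intro: convex_hyperplane)
    ultimately show "v \<in> ?F" using v newton_hull_lower_bound[OF l0 m(1)] by auto
  qed
qed

lemma compact_face_newton_hullI:
  assumes "finite S" "\<And>i. 0 < l $ i"
    "\<And>A. A \<in> S \<Longrightarrow> m \<le> l \<bullet> real_exponent A" "A0 \<in> S" "l \<bullet> real_exponent A0 = m"
  shows "compact_face (newton_hull S) (convex hull (real_exponent ` {A \<in> S. l \<bullet> real_exponent A = m}))"
  unfolding compact_face_def
proof (intro conjI exI allI)
  show "0 < l $ i" for i by fact
  show "convex hull (real_exponent ` {A \<in> S. l \<bullet> real_exponent A = m}) =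
      {v \<in> newton_hull S. \<forall>w\<in>newton_hull S. l \<bullet> v \<le> l \<bullet> w}"
    using newton_hull_face[OF assms] by simp
  show "convex hull (real_exponent ` {A \<in> S. l \<bullet> real_exponent A = m}) \<noteq> {}" using assms(4,5) by auto
qed

lemma compact_face_newton_hullD:
  assumes "finite S" "compact_face (newton_hull S) F"
  shows "\<exists>l m A0. (\<forall>i. 0 < l $ i) \<and> (\<forall>A\<in>S. m \<le> l \<bullet> real_exponent A) \<and>
    A0 \<in> S \<and> l \<bullet> real_exponent A0 = m \<and>
    F = convex hull (real_exponent ` {A \<in> S. l \<bullet> real_exponent A = m})"
proof -
  obtain l where l: "\<And>i. 0 < l $ i" "F = {v \<in> newton_hull S. \<forall>w\<in>newton_hull S. l \<bullet> v \<le> l \<bullet> w}" "F \<noteq> {}"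
    using assms(2) by (auto simp: compact_face_def)
  have ne: "S \<noteq> {}" using l(2,3) newton_hull_empty by auto
  define A0 where "A0 = arg_min_on (\<lambda>A. l \<bullet> real_exponent A) S"
  have A0: "A0 \<in> S" "\<And>A. A \<in> S \<Longrightarrow> l \<bullet> real_exponent A0 \<le> l \<bullet> real_exponent A"
    using arg_min_if_finite(1)[OF assms(1) ne] arg_min_least[OF assms(1) ne] by (auto simp: A0_def)
  show ?thesis
    by (intro exI[of _ l] exI[of _ "l \<bullet> real_exponent A0"] exI[of _ A0] conjI)
      (use newton_hull_face[OF assms(1) l(1) A0(2) A0(1) refl] l(1,2) A0 in auto)
qed

section \<open>Loose edges\<close>

text \<open>For an edge with direction \<open>c\<close>, looseness means that every nonnegative linear form
  orthogonal to \<open>c\<close> attains its minimum along the edge.  The cone of these forms is spanned by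
  the coordinates at which \<open>c\<close> vanishes and by the forms \<open>- c j * v i + c i * v j\<close>
  with \<open>c j < 0 < c i\<close>.\<close>

definition loose_cone :: "('n \<Rightarrow> int) \<Rightarrow> nat ^ 'n::finite \<Rightarrow> (nat ^ 'n) set" where
  "loose_cone c a = {B. (\<forall>i. c i = 0 \<longrightarrow> a $ i \<le> B $ i) \<and>
     (\<forall>i j. 0 < c i \<longrightarrow> c j < 0 \<longrightarrow>
        0 \<le> - c j * (int (B $ i) - int (a $ i)) + c i * (int (B $ j) - int (a $ j)))}"

definition on_line :: "('n \<Rightarrow> int) \<Rightarrow> nat ^ 'n::finite \<Rightarrow> nat ^ 'n \<Rightarrow> bool" where
  "on_line c a B \<longleftrightarrow> (\<exists>k. \<forall>i. int (B $ i) = int (a $ i) + k * c i)"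

text \<open>Entries of both signs occur because a positive form is constant along a compact edge.
  The last clause makes every integral vector parallel to \<open>c\<close> an integral multiple of
  it, so \<open>on_line\<close> describes all lattice points of the line.\<close>

definition primitive_direction :: "('n \<Rightarrow> int) \<Rightarrow> bool" where
  "primitive_direction c \<longleftrightarrow> (\<exists>i. 0 < c i) \<and> (\<exists>j. c j < 0) \<and>
     (\<forall>v. (\<forall>i j. v i * c j = v j * c i) \<longrightarrow> (\<exists>k. \<forall>i. v i = k * c i))"

text \<open>The sum of the spanning forms of the cone: \<open>v i\<close> where \<open>c\<close>
  vanishes, and \<open>- c j * v i + c i * v j\<close> over all pairs of opposite sign. Collecting
  coefficients gives the total negative part of \<open>c\<close> at positive entries and the total
  positive part at negative entries.\<close>

definition edge_weight :: "('n::finite \<Rightarrow> int) \<Rightarrow> 'n \<Rightarrow> nat" where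
  "edge_weight c i = (if c i = 0 then 1
     else if 0 < c i then nat (\<Sum>j | c j < 0. - c j) else nat (\<Sum>j | 0 < c j. c j))"

lemma loose_cone_add:
  assumes "B \<in> loose_cone c a" "C \<in> loose_cone c b"
  shows "B + C \<in> loose_cone c (a + b)"
  unfolding loose_cone_def
proof (intro CollectI conjI allI impI)
  fix i assume "c i = 0"
  then show "(a + b) $ i \<le> (B + C) $ i" using assms by (auto simp: loose_cone_def intro: add_mono)
next
  fix i j assume ij: "0 < c i" "c j < 0"
  have "0 \<le> - c j * (int (B $ i) - int (a $ i)) + c i * (int (B $ j) - int (a $ j))"
    "0 \<le> - c j * (int (C $ i) - int (b $ i)) + c i * (int (C $ j) - int (b $ j))"
    using assms ij unfolding loose_cone_def by blast+
  then show "0 \<le> - c j * (int ((B + C) $ i) - int ((a + b) $ i)) + c i * (int ((B + C) $ j) - int ((a + b) $ j))"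
    by (simp add: algebra_simps)
qed

lemma loose_cone_upward:
  assumes "B \<in> loose_cone c a"
  shows "B + D \<in> loose_cone c a"
  unfolding loose_cone_def
proof (intro CollectI conjI allI impI)
  fix i assume "c i = 0"
  then have "a $ i \<le> B $ i" using assms unfolding loose_cone_def by blast
  then show "a $ i \<le> (B + D) $ i" by simp
next
  fix i j assume ij: "0 < c i" "c j < 0"
  have "0 \<le> - c j * (int (B $ i) - int (a $ i)) + c i * (int (B $ j) - int (a $ j))"
    using assms ij unfolding loose_cone_def by blast
  moreover have "0 \<le> - c j * int (D $ i)" "0 \<le> c i * int (D $ j)" using ij by (simp_all add: mult_nonpos_nonneg)
  ultimately show "0 \<le> - c j * (int ((B + D) $ i) - int (a $ i)) + c i * (int ((B + D) $ j) - int (a $ j))"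
    by (simp add: algebra_simps)
qed

text \<open>The defining inequalities see only the displacement from the base point, and this only
  modulo multiples of \<open>c\<close>.\<close>

lemma loose_cone_translate:
  assumes "B \<in> loose_cone c a" "\<And>i. int (B' $ i) - int (a' $ i) = int (B $ i) - int (a $ i) + k * c i"
  shows "B' \<in> loose_cone c a'"
  unfolding loose_cone_def
proof (intro CollectI conjI allI impI)
  fix i assume "c i = 0"
  then have "a $ i \<le> B $ i" using assms(1) unfolding loose_cone_def by blast
  then show "a' $ i \<le> B' $ i" using assms(2)[of i] \<open>c i = 0\<close> by simp
next
  fix i j assume ij: "0 < c i" "c j < 0"
  have "0 \<le> - c j * (int (B $ i) - int (a $ i)) + c i * (int (B $ j) - int (a $ j))"
    using assms(1) ij unfolding loose_cone_def by blast
  then show "0 \<le> - c j * (int (B' $ i) - int (a' $ i)) + c i * (int (B' $ j) - int (a' $ j))"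
    unfolding assms(2) by (simp add: algebra_simps)
qed

lemma edge_weight_pos:
  assumes "0 < c p" "c q < 0"
  shows "0 < edge_weight c i"
proof -
  have "- c q \<le> (\<Sum>j | c j < 0. - c j)" by (rule member_le_sum) (use assms in auto)
  moreover have "c p \<le> (\<Sum>j | 0 < c j. c j)" by (rule member_le_sum) (use assms in auto)
  ultimately show ?thesis using assms by (auto simp: edge_weight_def)
qed

lemma edge_weight_sum:
  fixes c :: "'n::finite \<Rightarrow> int"
  shows "(\<Sum>i\<in>UNIV. int (edge_weight c i) * d i) =
    (\<Sum>i | c i = 0. d i) + (\<Sum>i | 0 < c i. \<Sum>j | c j < 0. - c j * d i + c i * d j)"
proof -
  define N where "N = (\<Sum>j | c j < 0. - c j)"
  define P where "P = (\<Sum>j | 0 < c j. c j)"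
  have NP: "0 \<le> N" "0 \<le> P" unfolding N_def P_def by (auto intro!: sum_nonneg)
  have U: "UNIV = {i. c i = 0} \<union> {i. 0 < c i} \<union> {i. c i < 0}" by auto
  have "(\<Sum>i\<in>UNIV. int (edge_weight c i) * d i) =
      (\<Sum>i | c i = 0. int (edge_weight c i) * d i) + (\<Sum>i | 0 < c i. int (edge_weight c i) * d i)
      + (\<Sum>i | c i < 0. int (edge_weight c i) * d i)"
    by (subst U, subst sum.union_disjoint, (auto)[3], subst sum.union_disjoint) auto
  also have "(\<Sum>i | c i = 0. int (edge_weight c i) * d i) = (\<Sum>i | c i = 0. d i)"
    by (rule sum.cong) (auto simp: edge_weight_def)
  also have "(\<Sum>i | 0 < c i. int (edge_weight c i) * d i) = (\<Sum>i | 0 < c i. N * d i)"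
    by (rule sum.cong) (use NP in \<open>auto simp: edge_weight_def N_def\<close>)
  also have "(\<Sum>i | c i < 0. int (edge_weight c i) * d i) = (\<Sum>i | c i < 0. P * d i)"
    by (rule sum.cong) (use NP in \<open>auto simp: edge_weight_def P_def\<close>)
  also have "(\<Sum>i | 0 < c i. N * d i) = (\<Sum>i | 0 < c i. \<Sum>j | c j < 0. - c j * d i)"
    unfolding N_def sum_distrib_right ..
  also have "(\<Sum>j | c j < 0. P * d j) = (\<Sum>i | 0 < c i. \<Sum>j | c j < 0. c i * d j)"
    unfolding P_def sum_distrib_right by (rule sum.swap)
  finally show ?thesis by (simp only: sum.distrib add.assoc)
qed

lemma edge_weight_orthogonal: "(\<Sum>i\<in>UNIV. int (edge_weight c i) * c i) = 0"
  unfolding edge_weight_sum by (simp add: mult.commute)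

lemma int_weight: "int (weight l A) = (\<Sum>i\<in>UNIV. int (l i) * int (A $ i))"
  by simp

lemma weight_edge_translate:
  assumes "\<And>i. int (B $ i) = int (a $ i) + k * c i"
  shows "weight (edge_weight c) B = weight (edge_weight c) a"
proof -
  have "int (weight (edge_weight c) B) =
      (\<Sum>i\<in>UNIV. int (edge_weight c i) * int (a $ i)) + k * (\<Sum>i\<in>UNIV. int (edge_weight c i) * c i)"
    unfolding int_weight assms by (simp add: distrib_left sum.distrib sum_distrib_left mult.left_commute)
  then have "int (weight (edge_weight c) B) = int (weight (edge_weight c) a)"
    unfolding edge_weight_orthogonal int_weight by simp
  then show ?thesis by linarith
qed

text \<open>By \<open>edge_weight_sum\<close> the excess weight is the sum of all the quantities
  required to be nonnegative in the cone. If it vanishes, each of them does, so the displacement is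
  parallel to \<open>c\<close>, and primitivity makes the factor an integer.\<close>

lemma loose_cone_weight:
  assumes "B \<in> loose_cone c a"
  shows "weight (edge_weight c) a \<le> weight (edge_weight c) B"
    and "primitive_direction c \<Longrightarrow> weight (edge_weight c) B = weight (edge_weight c) a \<Longrightarrow> on_line c a B"
proof -
  define d where "d i = int (B $ i) - int (a $ i)" for i
  have d0: "0 \<le> d i" if "c i = 0" for i using assms that by (auto simp: loose_cone_def d_def)
  have d1: "0 \<le> - c j * d i + c i * d j" if "0 < c i" "c j < 0" for i j
    using assms that unfolding loose_cone_def d_def by blast
  have eq: "int (weight (edge_weight c) B) - int (weight (edge_weight c) a) =
      (\<Sum>i | c i = 0. d i) + (\<Sum>i | 0 < c i. \<Sum>j | c j < 0. - c j * d i + c i * d j)"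
    unfolding edge_weight_sum[symmetric] int_weight d_def by (simp add: right_diff_distrib sum_subtractf)
  have n0: "0 \<le> (\<Sum>i | c i = 0. d i)" using d0 by (auto intro!: sum_nonneg)
  have n1: "0 \<le> (\<Sum>i | 0 < c i. \<Sum>j | c j < 0. - c j * d i + c i * d j)"
    by (intro sum_nonneg) (use d1 in auto)
  show "weight (edge_weight c) a \<le> weight (edge_weight c) B" using eq n0 n1 by linarith
  assume c: "primitive_direction c" and w: "weight (edge_weight c) B = weight (edge_weight c) a"
  have z0: "(\<Sum>i | c i = 0. d i) = 0" and z1: "(\<Sum>i | 0 < c i. \<Sum>j | c j < 0. - c j * d i + c i * d j) = 0"
    using eq n0 n1 w by linarith+
  have e0: "d i = 0" if "c i = 0" for i
    using z0 that d0 sum_nonneg_eq_0_iff[of "{i. c i = 0}" d] by auto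
  have e1: "- c j * d i + c i * d j = 0" if ij: "0 < c i" "c j < 0" for i j
  proof -
    have nn: "0 \<le> (\<Sum>j | c j < 0. - c j * d i + c i * d j)" if "i \<in> {i. 0 < c i}" for i
      by (intro sum_nonneg) (use d1 that in blast)
    have "\<forall>i\<in>{i. 0 < c i}. (\<Sum>j | c j < 0. - c j * d i + c i * d j) = 0"
      using z1 by (subst (asm) sum_nonneg_eq_0_iff[OF _ nn]) (rule finite)
    then have "(\<Sum>j | c j < 0. - c j * d i + c i * d j) = 0" using ij(1) by blast
    then have "\<forall>j\<in>{j. c j < 0}. - c j * d i + c i * d j = 0"
      by (subst (asm) sum_nonneg_eq_0_iff) (use d1[OF ij(1)] in auto)
    then show ?thesis using ij(2) by blast
  qed
  obtain p q where pq: "0 < c p" "c q < 0" using c by (auto simp: primitive_direction_def)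
  have par: "d i * c p = d p * c i" for i
  proof -
    consider "c i = 0" | "0 < c i" | "c i < 0" by linarith
    then show ?thesis
    proof cases
      case 1
      then show ?thesis using e0 by simp
    next
      case 2
      have a: "c q * d i = c i * d q" "c q * d p = c p * d q" using e1[OF 2 pq(2)] e1[OF pq] by auto
      have "c q * (d i * c p) = c q * (d p * c i)" using a by (metis mult.assoc mult.commute mult.left_commute)
      then show ?thesis using pq(2) by simp
    next
      case 3
      then show ?thesis using e1[OF pq(1) 3] by (simp add: algebra_simps)
    qed
  qed
  have "d i * c j = d j * c i" for i j
  proof -
    have "c p * (d i * c j) = c p * (d j * c i)" using par[of i] par[of j] by (metis mult.assoc mult.commute mult.left_commute)
    then show ?thesis using pq(1) by simp
  qed
  then obtain k where "\<forall>i. d i = k * c i" using c unfolding primitive_direction_def by blast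
  then show "on_line c a B" unfolding on_line_def d_def by (metis add.commute diff_add_cancel)
qed

text \<open>Take an integral vector parallel to \<open>c0\<close> with least positive entry at
  \<open>p\<close>. Division with remainder at \<open>p\<close> shows that it generates all the
  others.\<close>

lemma exists_primitive_direction:
  fixes c0 :: "'n::finite \<Rightarrow> int"
  assumes "0 < c0 p" "c0 q < 0"
  shows "\<exists>c. primitive_direction c \<and>
    (\<forall>v. (\<forall>i j. v i * c0 j = v j * c0 i) \<longrightarrow> (\<exists>k. \<forall>i. v i = k * c i)) \<and> (\<exists>k. \<forall>i. c0 i = k * c i)"
proof -
  define Q where "Q n \<longleftrightarrow> 0 < n \<and> (\<exists>v. (\<forall>i j. v i * c0 j = v j * c0 i) \<and> v p = int n)" for n
  have "Q (nat (c0 p))" unfolding Q_def using assms(1) by (auto intro!: exI[of _ c0])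
  then have Qn: "Q (LEAST n. Q n)" by (rule LeastI)
  then obtain c where c: "\<And>i j. c i * c0 j = c j * c0 i" "c p = int (LEAST n. Q n)" unfolding Q_def by blast
  have cp: "0 < c p" using Qn c(2) by (simp add: Q_def)
  have mult: "\<exists>k. \<forall>i. v i = k * c i" if v: "\<And>i j. v i * c0 j = v j * c0 i" for v
  proof -
    define r where "r i = v i - (v p div c p) * c i" for i
    have r: "r i * c0 j = r j * c0 i" for i j
    proof -
      have "r i * c0 j = v i * c0 j - (v p div c p) * (c i * c0 j)" by (simp add: r_def algebra_simps)
      also have "\<dots> = v j * c0 i - (v p div c p) * (c j * c0 i)" using v[of i j] c(1)[of i j] by simp
      also have "\<dots> = r j * c0 i" by (simp add: r_def algebra_simps)
      finally show ?thesis .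
    qed
    have rp: "r p = v p mod c p" by (simp add: r_def minus_div_mult_eq_mod)
    have "r p = 0"
    proof (rule ccontr)
      assume "r p \<noteq> 0"
      then have "0 < r p" "r p < c p" using rp cp pos_mod_sign[OF cp, of "v p"] pos_mod_bound[OF cp, of "v p"] by auto
      then have "Q (nat (r p))" unfolding Q_def using r by (auto intro!: exI[of _ r])
      then have "(LEAST n. Q n) \<le> nat (r p)" by (rule Least_le)
      then show False using \<open>r p < c p\<close> c(2) \<open>0 < r p\<close> by linarith
    qed
    then have r0: "r i = 0" for i using r[of i p] assms(1) by simp
    have "v i = (v p div c p) * c i" for i using r0[of i] unfolding r_def by simp
    then show ?thesis by blast
  qed
  have par: "v i * c0 j = v j * c0 i" if "\<And>i j. v i * c j = v j * c i" for v i j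
  proof -
    have "c p * (v i * c0 j) = v i * (c p * c0 j)" by simp
    also have "\<dots> = (v i * c j) * c0 p" using c(1)[of p j] by simp
    also have "\<dots> = v j * (c i * c0 p)" using that[of i j] by simp
    also have "\<dots> = c p * (v j * c0 i)" using c(1)[of i p] by simp
    finally show ?thesis using cp by simp
  qed
  have "c q * c0 p = c p * c0 q" by (rule c(1))
  then have "c q * c0 p < 0" using cp assms by (simp add: mult_pos_neg)
  then have "c q < 0" using assms(1) by (simp add: mult_less_0_iff)
  then have "primitive_direction c" unfolding primitive_direction_def using cp mult par by blast
  moreover have "\<exists>k. \<forall>i. c0 i = k * c i" by (rule mult) (rule mult.commute)
  ultimately show ?thesis using mult by (intro exI[of _ c]) blast
qed

lemma real_exponent_diff: "(real_exponent B - real_exponent A) $ i = real_of_int (int (B $ i) - int (A $ i))"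
  by (simp add: real_exponent_def)

lemma inner_real_exponent_translate:
  assumes "\<And>i. int (B $ i) = int (a $ i) + k * c i"
  shows "l \<bullet> (real_exponent B - real_exponent a) = real_of_int k * (\<Sum>i\<in>UNIV. l $ i * real_of_int (c i))"
  unfolding inner_vec_def real_exponent_diff using assms by (simp add: sum_distrib_left mult.left_commute)

text \<open>A support exponent outside the cone provides a nonnegative form \<open>mu\<close> that
  is constant along the edge and smaller at that exponent. Tilting the supporting form
  \<open>l\<close> by multiples of \<open>mu\<close> until a further exponent first reaches the
  value of the edge gives a compact face that contains the edge and has dimension at least 2,
  against looseness.\<close>

lemma loose_edge_structure:
  fixes S :: "(nat ^ 'n::finite) set"
  assumes S: "finite S" and E: "loose_edge (newton_hull S) E"
  shows "\<exists>c SE. primitive_direction c \<and> SE \<subseteq> S \<and> SE \<noteq> {} \<and> E = convex hull (real_exponent ` SE) \<and>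
    (\<forall>A\<in>S. real_exponent A \<in> E \<longleftrightarrow> A \<in> SE) \<and>
    (\<forall>a\<in>SE. \<forall>A\<in>S. A \<in> loose_cone c a \<and> (on_line c a A \<longleftrightarrow> A \<in> SE))"
proof -
  have face: "compact_face (newton_hull S) E" "aff_dim E = 1"
    and loose: "\<And>F. compact_face (newton_hull S) F \<Longrightarrow> 2 \<le> aff_dim F \<Longrightarrow> \<not> E \<subseteq> F"
    using E by (auto simp: loose_edge_def)
  obtain l m A0 where lm: "\<forall>i. 0 < l $ i" "\<forall>A\<in>S. m \<le> l \<bullet> real_exponent A"
    "A0 \<in> S" "l \<bullet> real_exponent A0 = m"
    and Eq: "E = convex hull (real_exponent ` {A \<in> S. l \<bullet> real_exponent A = m})"
    using compact_face_newton_hullD[OF S face(1)] by (elim exE conjE)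
  have l: "0 < l $ i" for i using lm(1) by blast
  have m: "\<And>A. A \<in> S \<Longrightarrow> m \<le> l \<bullet> real_exponent A" "A0 \<in> S" "l \<bullet> real_exponent A0 = m"
    using lm by auto
  define SE where "SE = {A \<in> S. l \<bullet> real_exponent A = m}"
  have E': "E = convex hull (real_exponent ` SE)" using Eq by (simp add: SE_def)
  have A0: "A0 \<in> SE" using m by (simp add: SE_def)
  have dim: "aff_dim (real_exponent ` SE) = 1" using face(2) aff_dim_convex_hull[of "real_exponent ` SE"] unfolding E' by simp
  have "\<not> SE \<subseteq> {A0}"
  proof
    assume "SE \<subseteq> {A0}"
    then have "real_exponent ` SE = {real_exponent A0}" using A0 by auto
    then show False using dim by simp
  qed
  then obtain A1 where A1: "A1 \<in> SE" "A1 \<noteq> A0" by auto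
  have "collinear (real_exponent ` SE)" using dim collinear_aff_dim[of "real_exponent ` SE"] by simp
  then obtain u where u: "\<And>A B. A \<in> SE \<Longrightarrow> B \<in> SE \<Longrightarrow> \<exists>t. real_exponent A - real_exponent B = t *\<^sub>R u"
    unfolding collinear_def by blast
  define c0 where "c0 i = int (A1 $ i) - int (A0 $ i)" for i
  obtain t0 where t0: "real_exponent A1 - real_exponent A0 = t0 *\<^sub>R u" using u[OF A1(1) A0] by auto
  have c0u: "real_of_int (c0 i) = t0 * u $ i" for i
    using arg_cong[OF t0, of "\<lambda>v. v $ i"] unfolding real_exponent_diff c0_def by simp
  obtain r where r: "c0 r \<noteq> 0" using A1(2) by (auto simp: c0_def vec_eq_iff)
  then have t0nz: "t0 \<noteq> 0" using c0u[of r] by auto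
  have par0: "(int (A $ i) - int (B $ i)) * c0 j = (int (A $ j) - int (B $ j)) * c0 i"
    if AB: "A \<in> SE" "B \<in> SE" for A B i j
  proof -
    obtain t where t: "real_exponent A - real_exponent B = t *\<^sub>R u" using u[OF AB] by auto
    have ti: "real_of_int (int (A $ i) - int (B $ i)) = t * u $ i" for i
      using arg_cong[OF t, of "\<lambda>v. v $ i"] unfolding real_exponent_diff by simp
    have "real_of_int ((int (A $ i) - int (B $ i)) * c0 j) = real_of_int ((int (A $ j) - int (B $ j)) * c0 i)"
      unfolding of_int_mult ti c0u by simp
    then show ?thesis by linarith
  qed
  \<comment> \<open>Both exponents minimise \<open>l\<close>, so their difference is orthogonal to
    it; since \<open>l\<close> is positive, the difference must have entries of both signs.\<close>
  have lc0: "(\<Sum>i\<in>UNIV. l $ i * real_of_int (c0 i)) = 0"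
    using A1(1) A0 inner_real_exponent_translate[of A1 A0 1 c0 l]
    by (simp add: SE_def c0_def inner_diff_right)
  have "\<exists>p. 0 < c0 p"
  proof (rule ccontr)
    assume "\<nexists>p. 0 < c0 p"
    then have n: "l $ i * real_of_int (c0 i) \<le> 0" for i using l[of i] by (simp add: mult_nonneg_nonpos not_less)
    have "c0 r < 0" using r \<open>\<nexists>p. 0 < c0 p\<close> by (metis linorder_neqE_linordered_idom)
    then have "l $ r * real_of_int (c0 r) < 0" using l[of r] by (simp add: mult_pos_neg)
    then have "(\<Sum>i\<in>UNIV. l $ i * real_of_int (c0 i)) < (\<Sum>i\<in>(UNIV :: 'n set). 0)"
      using n by (intro sum_strict_mono_ex1) auto
    then show False using lc0 by simp
  qed
  then obtain p where p: "0 < c0 p" by auto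
  have "\<exists>q. c0 q < 0"
  proof (rule ccontr)
    assume "\<nexists>q. c0 q < 0"
    then have n: "0 \<le> l $ i * real_of_int (c0 i)" for i using l[of i] by (simp add: not_less)
    have "0 < l $ p * real_of_int (c0 p)" using l[of p] p by simp
    then have "(\<Sum>i\<in>(UNIV :: 'n set). 0) < (\<Sum>i\<in>UNIV. l $ i * real_of_int (c0 i))"
      using n by (intro sum_strict_mono_ex1) auto
    then show False using lc0 by simp
  qed
  then obtain q where q: "c0 q < 0" by auto
  obtain c where c: "primitive_direction c"
    "\<forall>v. (\<forall>i j. v i * c0 j = v j * c0 i) \<longrightarrow> (\<exists>k. \<forall>i. v i = k * c i)" "\<exists>k. \<forall>i. c0 i = k * c i"
    using exists_primitive_direction[of c0, OF p q] by (elim exE[of "\<lambda>c. primitive_direction c \<and> _ c"] conjE)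
  have line: "on_line c a A" if aA: "a \<in> SE" "A \<in> SE" for a A
  proof -
    obtain k where "\<forall>i. int (A $ i) - int (a $ i) = k * c i"
      using mp[OF spec[OF c(2), of "\<lambda>i. int (A $ i) - int (a $ i)"]] par0[OF aA(2,1)] by blast
    then show ?thesis unfolding on_line_def by (metis add.commute diff_add_cancel)
  qed
  obtain k0 where k0: "\<And>i. c0 i = k0 * c i" using c(3) by blast
  then have k0nz: "k0 \<noteq> 0" using p by auto
  have lc: "(\<Sum>i\<in>UNIV. l $ i * real_of_int (c i)) = 0"
  proof -
    have "real_of_int k0 * (\<Sum>i\<in>UNIV. l $ i * real_of_int (c i)) = 0"
      using lc0 unfolding k0 by (simp add: sum_distrib_left mult.left_commute)
    then show ?thesis using k0nz by simp
  qed
  have line_SE: "A \<in> SE" if a: "a \<in> SE" "A \<in> S" "on_line c a A" for a A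
  proof -
    obtain k where "\<And>i. int (A $ i) = int (a $ i) + k * c i" using a(3) by (auto simp: on_line_def)
    from inner_real_exponent_translate[OF this, of l] show ?thesis
      using a(1,2) lc by (simp add: SE_def inner_diff_right)
  qed
  have cone: "A \<in> loose_cone c a" if a: "a \<in> SE" and A: "A \<in> S" for a A
  proof (rule ccontr)
    assume nc: "A \<notin> loose_cone c a"
    \<comment> \<open>The violated inequality itself supplies the form: a coordinate where
      \<open>c\<close> vanishes, or a combination of two coordinates with coefficients taken
      crosswise from \<open>c\<close>.\<close>
    have "\<exists>mu :: real ^ 'n. (\<forall>i. 0 \<le> mu $ i) \<and> (\<Sum>i\<in>UNIV. mu $ i * real_of_int (c i)) = 0 \<and>
      mu \<bullet> (real_exponent A - real_exponent a) < 0"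
    proof -
      from nc consider (zero) i where "c i = 0" "A $ i < a $ i"
        | (pair) i j where "0 < c i" "c j < 0"
          "- c j * (int (A $ i) - int (a $ i)) + c i * (int (A $ j) - int (a $ j)) < 0"
        unfolding loose_cone_def by (auto simp: not_le)
      then show ?thesis
      proof cases
        case zero
        show ?thesis
        proof (intro exI[of _ "axis i 1"] conjI allI)
          show "0 \<le> axis i (1::real) $ k" for k by (simp add: axis_def)
          have "(\<Sum>k\<in>UNIV. axis i (1::real) $ k * real_of_int (c k)) = (\<Sum>k\<in>UNIV. if k = i then real_of_int (c i) else 0)"
            by (rule sum.cong) (auto simp: axis_def)
          then show "(\<Sum>k\<in>UNIV. axis i (1::real) $ k * real_of_int (c k)) = 0" using zero by simp
          have "axis i 1 \<bullet> (real_exponent A - real_exponent a) = real (A $ i) - real (a $ i)"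
            by (simp add: inner_axis' real_exponent_def)
          then show "axis i 1 \<bullet> (real_exponent A - real_exponent a) < 0" using zero by simp
        qed
      next
        case pair
        define mu :: "real ^ 'n" where "mu = axis i (real_of_int (- c j)) + axis j (real_of_int (c i))"
        have mu: "mu \<bullet> v = real_of_int (- c j) * v $ i + real_of_int (c i) * v $ j" for v
          unfolding mu_def inner_add_left inner_axis' by simp
        show ?thesis
        proof (intro exI[of _ mu] conjI allI)
          show "0 \<le> mu $ k" for k using pair(1,2) by (auto simp: mu_def axis_def)
          have "(\<Sum>k\<in>UNIV. mu $ k * real_of_int (c k)) = mu \<bullet> (\<chi> k. real_of_int (c k))"
            by (simp add: inner_vec_def)
          then show "(\<Sum>k\<in>UNIV. mu $ k * real_of_int (c k)) = 0" unfolding mu by (simp add: mult.commute)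
          have "mu \<bullet> (real_exponent A - real_exponent a) =
              real_of_int (- c j * (int (A $ i) - int (a $ i)) + c i * (int (A $ j) - int (a $ j)))"
            unfolding mu real_exponent_diff by simp
          then show "mu \<bullet> (real_exponent A - real_exponent a) < 0" using pair(3) by linarith
        qed
      qed
    qed
    then obtain mu :: "real ^ 'n" where mu: "\<And>i. 0 \<le> mu $ i" "(\<Sum>i\<in>UNIV. mu $ i * real_of_int (c i)) = 0"
      "mu \<bullet> (real_exponent A - real_exponent a) < 0" by blast
    define D where "D B = real_exponent B - real_exponent a" for B :: "nat ^ 'n"
    have lD: "0 \<le> l \<bullet> D B" if "B \<in> S" for B
      using m(1)[OF that] a by (simp add: D_def inner_diff_right SE_def)
    have onSE: "mu \<bullet> D B = 0" "l \<bullet> D B = 0" if BSE: "B \<in> SE" for B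
    proof -
      obtain k where "\<And>i. int (B $ i) = int (a $ i) + k * c i" using line[OF a BSE] by (auto simp: on_line_def)
      from inner_real_exponent_translate[OF this] show "mu \<bullet> D B = 0" "l \<bullet> D B = 0"
        using mu(2) lc by (auto simp: D_def)
    qed
    have lD0: "0 < l \<bullet> D B" if "B \<in> S" "mu \<bullet> D B < 0" for B
    proof -
      have "B \<notin> SE" using onSE(1)[of B] that by auto
      then have "l \<bullet> D B \<noteq> 0" using a that(1) by (auto simp: SE_def D_def inner_diff_right)
      then show ?thesis using lD[OF that(1)] by simp
    qed
    define N where "N = {B \<in> S. mu \<bullet> D B < 0}"
    have N: "finite N" "N \<noteq> {}" using S A mu(3) by (auto simp: N_def D_def)
    \<comment> \<open>The multiple of \<open>mu\<close> at which the tilted form takes the same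
      value at \<open>B\<close> as on the edge. Its minimiser \<open>B0\<close> is reached before
      the form drops below that value anywhere on the support.\<close>
    define ratio where "ratio B = (l \<bullet> D B) / (- (mu \<bullet> D B))" for B
    define B0 where "B0 = arg_min_on ratio N"
    have B0: "B0 \<in> N" "\<And>B. B \<in> N \<Longrightarrow> ratio B0 \<le> ratio B"
      using arg_min_if_finite(1)[OF N] arg_min_least[OF N] by (auto simp: B0_def)
    have B0S: "B0 \<in> S" "mu \<bullet> D B0 < 0" using B0(1) by (auto simp: N_def)
    define t where "t = ratio B0"
    have t: "0 < t" unfolding t_def ratio_def using lD0[OF B0S] B0S(2) by (simp add: divide_pos_neg)
    define l' where "l' = l + t *\<^sub>R mu"
    have l'D: "l' \<bullet> D B = l \<bullet> D B + t * (mu \<bullet> D B)" for B by (simp add: l'_def inner_add_left)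
    have l'pos: "0 < l' $ i" for i using l[of i] mu(1)[of i] t by (simp add: l'_def add_pos_nonneg)
    have l'nonneg: "0 \<le> l' \<bullet> D B" if "B \<in> S" for B
    proof (cases "mu \<bullet> D B < 0")
      case True
      then have "t \<le> ratio B" using B0(2)[of B] that by (simp add: N_def t_def)
      then have "t \<le> (l \<bullet> D B) / (- (mu \<bullet> D B))" by (simp only: ratio_def)
      moreover have "0 < - (mu \<bullet> D B)" using True by simp
      ultimately have "t * (- (mu \<bullet> D B)) \<le> l \<bullet> D B" by (simp only: pos_le_divide_eq)
      then show ?thesis unfolding l'D by simp
    next
      case False
      then show ?thesis unfolding l'D using lD[OF that] t by simp
    qed
    have l'B0: "l' \<bullet> D B0 = 0" unfolding l'D t_def ratio_def using B0S(2) by (simp add: field_simps)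
    define F where "F = convex hull (real_exponent ` {B \<in> S. l' \<bullet> real_exponent B = l' \<bullet> real_exponent a})"
    have aS: "a \<in> S" using a by (simp add: SE_def)
    have F: "compact_face (newton_hull S) F" unfolding F_def
      by (rule compact_face_newton_hullI[OF S l'pos _ aS refl])
        (use l'nonneg in \<open>auto simp: D_def inner_diff_right\<close>)
    have SEF: "SE \<subseteq> {B \<in> S. l' \<bullet> real_exponent B = l' \<bullet> real_exponent a}"
    proof
      fix B assume B: "B \<in> SE"
      then have "l' \<bullet> D B = 0" unfolding l'D using onSE[OF B] by simp
      then show "B \<in> {B \<in> S. l' \<bullet> real_exponent B = l' \<bullet> real_exponent a}"
        using B by (simp add: D_def inner_diff_right SE_def)
    qed
    then have EF: "E \<subseteq> F" unfolding E' F_def by (intro hull_mono image_mono)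
    have B0F: "real_exponent B0 \<in> F" unfolding F_def
      by (rule hull_inc) (use B0S(1) l'B0 in \<open>auto simp: D_def inner_diff_right\<close>)
    have SEF': "real_exponent B \<in> F" if "B \<in> SE" for B
      using EF hull_inc[of "real_exponent B" "real_exponent ` SE" convex] that unfolding E' by auto
    \<comment> \<open>If \<open>F\<close> were collinear, its line would be spanned by two exponents
      of the edge. The form \<open>mu\<close> vanishes on that direction but is negative on the
      displacement to \<open>B0\<close>.\<close>
    have "\<not> aff_dim F \<le> 1"
    proof
      assume "aff_dim F \<le> 1"
      then have "collinear F" by (simp add: collinear_aff_dim)
      then obtain u where u: "\<And>v w. v \<in> F \<Longrightarrow> w \<in> F \<Longrightarrow> \<exists>t. v - w = t *\<^sub>R u"
        unfolding collinear_def by blast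
      obtain t1 where t1: "real_exponent A1 - real_exponent A0 = t1 *\<^sub>R u"
        using u[OF SEF'[OF A1(1)] SEF'[OF A0]] by auto
      obtain t2 where t2: "D B0 = t2 *\<^sub>R u" using u[OF B0F SEF'[OF a]] by (auto simp: D_def)
      have "t1 \<noteq> 0"
      proof
        assume "t1 = 0"
        then have "(real_exponent A1 - real_exponent A0) $ r = 0" using t1 by simp
        then show False using r unfolding real_exponent_diff c0_def by simp
      qed
      moreover have "mu \<bullet> (real_exponent A1 - real_exponent A0) = 0"
        using onSE(1)[OF A1(1)] onSE(1)[OF A0] by (simp add: D_def inner_diff_right)
      ultimately have "mu \<bullet> u = 0" unfolding t1 by simp
      then show False using B0S(2) unfolding t2 by simp
    qed
    then show False using loose[OF F] EF by auto
  qed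
  have memE: "real_exponent A \<in> E \<longleftrightarrow> A \<in> SE" if "A \<in> S" for A
  proof
    have "E \<subseteq> {v. l \<bullet> v = m}" unfolding E' by (rule hull_minimal) (auto simp: SE_def intro: convex_hyperplane)
    then show "real_exponent A \<in> E \<Longrightarrow> A \<in> SE" using that by (auto simp: SE_def)
    show "A \<in> SE \<Longrightarrow> real_exponent A \<in> E" unfolding E' by (rule hull_inc) auto
  qed
  have "SE \<subseteq> S" "SE \<noteq> {}" using A0 by (auto simp: SE_def)
  moreover have "\<forall>a\<in>SE. \<forall>A\<in>S. A \<in> loose_cone c a \<and> (on_line c a A \<longleftrightarrow> A \<in> SE)"
    using cone line line_SE by blast
  ultimately show ?thesis using c(1) E' memE by (intro exI[of _ c] exI[of _ SE]) blast
qed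

section \<open>Univariate polynomials over a field\<close>

locale UP_field = UP_domain R P + field R for R (structure) and P (structure)
begin

text \<open>Pseudo-division leaves a power of the leading coefficient in front of \<open>f\<close>;
  over a field this power is invertible.\<close>

lemma UP_divide:
  assumes g: "g \<in> carrier P" "g \<noteq> \<zero>\<^bsub>P\<^esub>" and f: "f \<in> carrier P"
  shows "\<exists>q\<in>carrier P. \<exists>r\<in>carrier P. f = g \<otimes>\<^bsub>P\<^esub> q \<oplus>\<^bsub>P\<^esub> r \<and> (r = \<zero>\<^bsub>P\<^esub> \<or> deg R r < deg R g)"
proof -
  obtain q r and k :: nat where qr: "q \<in> carrier P" "r \<in> carrier P"
    "coeff P g (deg R g) [^] k \<odot>\<^bsub>P\<^esub> f = g \<otimes>\<^bsub>P\<^esub> q \<oplus>\<^bsub>P\<^esub> r" "r = \<zero>\<^bsub>P\<^esub> \<or> deg R r < deg R g"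
    using long_div_theorem[OF g(1) f g(2)] by blast
  define u where "u = coeff P g (deg R g) [^] k"
  have lc: "coeff P g (deg R g) \<in> Units R"
    using lcoeff_nonzero[OF g(2,1)] g(1) field_Units coeff_closed by auto
  have u: "u \<in> Units R" unfolding u_def by (rule R.Units_pow_closed[OF lc])
  define v where "v = inv u"
  have v: "v \<in> carrier R" "v \<otimes> u = \<one>" "v \<noteq> \<zero>" "u \<in> carrier R"
    using u Units_inv_Units field_Units by (auto simp: v_def)
  have "f = v \<odot>\<^bsub>P\<^esub> (u \<odot>\<^bsub>P\<^esub> f)" using v f by (simp add: smult_assoc1[symmetric])
  also have "\<dots> = v \<odot>\<^bsub>P\<^esub> (g \<otimes>\<^bsub>P\<^esub> q \<oplus>\<^bsub>P\<^esub> r)" using qr(3) by (simp add: u_def)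
  also have "\<dots> = v \<odot>\<^bsub>P\<^esub> (g \<otimes>\<^bsub>P\<^esub> q) \<oplus>\<^bsub>P\<^esub> v \<odot>\<^bsub>P\<^esub> r" using v g qr by (simp add: smult_r_distr)
  also have "v \<odot>\<^bsub>P\<^esub> (g \<otimes>\<^bsub>P\<^esub> q) = g \<otimes>\<^bsub>P\<^esub> (v \<odot>\<^bsub>P\<^esub> q)"
    using v g qr smult_assoc2[of v q g] by (simp add: P.m_comm)
  finally have "f = g \<otimes>\<^bsub>P\<^esub> (v \<odot>\<^bsub>P\<^esub> q) \<oplus>\<^bsub>P\<^esub> v \<odot>\<^bsub>P\<^esub> r" .
  moreover have "v \<odot>\<^bsub>P\<^esub> r = \<zero>\<^bsub>P\<^esub> \<or> deg R (v \<odot>\<^bsub>P\<^esub> r) < deg R g"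
    using qr v by auto
  ultimately show ?thesis using v qr by (intro bexI[of _ "v \<odot>\<^bsub>P\<^esub> q"] bexI[of _ "v \<odot>\<^bsub>P\<^esub> r"]) auto
qed

lemma constant_unit:
  assumes "D \<in> carrier P" "D \<noteq> \<zero>\<^bsub>P\<^esub>" "deg R D = 0"
  shows "\<exists>E\<in>carrier P. D \<otimes>\<^bsub>P\<^esub> E = \<one>\<^bsub>P\<^esub>"
proof -
  define a where "a = coeff P D 0"
  have D: "D = monom P a 0" unfolding a_def by (rule deg_zero_impl_monom[OF assms(1,3)])
  have "a \<noteq> \<zero>" using lcoeff_nonzero[OF assms(2,1)] assms(3) by (simp add: a_def)
  then have a: "a \<in> Units R" using field_Units assms(1) by (simp add: a_def)
  have "monom P (a \<otimes> inv a) (0 + 0) = D \<otimes>\<^bsub>P\<^esub> monom P (inv a) 0"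
    unfolding D by (rule monom_mult) (use a in auto)
  moreover have "a \<otimes> inv a = \<one>" using a by (rule R.Units_r_inv)
  ultimately have "D \<otimes>\<^bsub>P\<^esub> monom P (inv a) 0 = \<one>\<^bsub>P\<^esub>" by (simp only: add_0 monom_one)
  then show ?thesis using a by (intro bexI[of _ "monom P (inv a) 0"]) auto
qed

text \<open>A nonzero combination of least degree divides every combination, in particular
  \<open>f\<close> and \<open>g\<close>. Coprimality is stated through degrees because that is what
  the transfer from several variables delivers.\<close>

lemma UP_bezout:
  assumes f: "f \<in> carrier P" "f \<noteq> \<zero>\<^bsub>P\<^esub>" and g: "g \<in> carrier P"
    and cop: "\<And>D. D \<in> carrier P \<Longrightarrow> D divides\<^bsub>P\<^esub> f \<Longrightarrow> D divides\<^bsub>P\<^esub> g \<Longrightarrow> deg R D = 0"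
  shows "\<exists>a\<in>carrier P. \<exists>b\<in>carrier P. f \<otimes>\<^bsub>P\<^esub> a \<oplus>\<^bsub>P\<^esub> g \<otimes>\<^bsub>P\<^esub> b = \<one>\<^bsub>P\<^esub>"
proof -
  define J where "J = {f \<otimes>\<^bsub>P\<^esub> a \<oplus>\<^bsub>P\<^esub> g \<otimes>\<^bsub>P\<^esub> b | a b. a \<in> carrier P \<and> b \<in> carrier P}"
  have JI: "f \<otimes>\<^bsub>P\<^esub> a \<oplus>\<^bsub>P\<^esub> g \<otimes>\<^bsub>P\<^esub> b \<in> J" if "a \<in> carrier P" "b \<in> carrier P" for a b
    using that by (auto simp: J_def)
  have Jc: "J \<subseteq> carrier P" using f g by (auto simp: J_def)
  have fJ: "f \<in> J" using JI[of "\<one>\<^bsub>P\<^esub>" "\<zero>\<^bsub>P\<^esub>"] f g by simp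
  have gJ: "g \<in> J" using JI[of "\<zero>\<^bsub>P\<^esub>" "\<one>\<^bsub>P\<^esub>"] f g by simp
  have Jideal: "z \<ominus>\<^bsub>P\<^esub> D \<otimes>\<^bsub>P\<^esub> q \<in> J" if zD: "z \<in> J" "D \<in> J" and q: "q \<in> carrier P" for z D q
  proof -
    obtain a b where z: "z = f \<otimes>\<^bsub>P\<^esub> a \<oplus>\<^bsub>P\<^esub> g \<otimes>\<^bsub>P\<^esub> b" "a \<in> carrier P" "b \<in> carrier P"
      using zD(1) by (auto simp: J_def)
    obtain c d where D: "D = f \<otimes>\<^bsub>P\<^esub> c \<oplus>\<^bsub>P\<^esub> g \<otimes>\<^bsub>P\<^esub> d" "c \<in> carrier P" "d \<in> carrier P"
      using zD(2) by (auto simp: J_def)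
    have "z \<ominus>\<^bsub>P\<^esub> D \<otimes>\<^bsub>P\<^esub> q = f \<otimes>\<^bsub>P\<^esub> (a \<ominus>\<^bsub>P\<^esub> c \<otimes>\<^bsub>P\<^esub> q) \<oplus>\<^bsub>P\<^esub> g \<otimes>\<^bsub>P\<^esub> (b \<ominus>\<^bsub>P\<^esub> d \<otimes>\<^bsub>P\<^esub> q)"
      unfolding z(1) D(1) using z(2,3) D(2,3) f g q by algebra
    then show ?thesis using JI z D q by simp
  qed
  obtain D where D: "D \<in> J" "D \<noteq> \<zero>\<^bsub>P\<^esub>" "\<And>z. z \<in> J \<Longrightarrow> z \<noteq> \<zero>\<^bsub>P\<^esub> \<Longrightarrow> deg R D \<le> deg R z"
  proof -
    define n where "n = (LEAST n. \<exists>z\<in>J. z \<noteq> \<zero>\<^bsub>P\<^esub> \<and> deg R z = n)"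
    have "\<exists>z\<in>J. z \<noteq> \<zero>\<^bsub>P\<^esub> \<and> deg R z = n" unfolding n_def by (rule LeastI_ex) (use fJ f in auto)
    then obtain D where "D \<in> J" "D \<noteq> \<zero>\<^bsub>P\<^esub>" "deg R D = n" by auto
    moreover have "n \<le> deg R z" if "z \<in> J" "z \<noteq> \<zero>\<^bsub>P\<^esub>" for z
      unfolding n_def by (rule Least_le) (use that in auto)
    ultimately show ?thesis using that by blast
  qed
  have Dc: "D \<in> carrier P" using D Jc by auto
  have dvd: "D divides\<^bsub>P\<^esub> z" if z: "z \<in> J" for z
  proof -
    have zc: "z \<in> carrier P" using z Jc by auto
    obtain q r where qr: "q \<in> carrier P" "r \<in> carrier P" "z = D \<otimes>\<^bsub>P\<^esub> q \<oplus>\<^bsub>P\<^esub> r" "r = \<zero>\<^bsub>P\<^esub> \<or> deg R r < deg R D"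
      using UP_divide[OF Dc D(2) zc] by blast
    have "r = z \<ominus>\<^bsub>P\<^esub> D \<otimes>\<^bsub>P\<^esub> q" unfolding qr(3) using qr(1,2) Dc by algebra
    then have "r \<in> J" using Jideal[OF z D(1) qr(1)] by simp
    then have "r = \<zero>\<^bsub>P\<^esub>" using D(3)[of r] qr(4) by (meson leD)
    then show ?thesis using qr Dc by (auto intro!: dividesI)
  qed
  have "deg R D = 0" by (rule cop[OF Dc dvd[OF fJ] dvd[OF gJ]])
  then obtain E where E: "E \<in> carrier P" "D \<otimes>\<^bsub>P\<^esub> E = \<one>\<^bsub>P\<^esub>" using constant_unit[OF Dc D(2)] by blast
  obtain c d where cd: "D = f \<otimes>\<^bsub>P\<^esub> c \<oplus>\<^bsub>P\<^esub> g \<otimes>\<^bsub>P\<^esub> d" "c \<in> carrier P" "d \<in> carrier P"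
    using D(1) by (auto simp: J_def)
  have "f \<otimes>\<^bsub>P\<^esub> (c \<otimes>\<^bsub>P\<^esub> E) \<oplus>\<^bsub>P\<^esub> g \<otimes>\<^bsub>P\<^esub> (d \<otimes>\<^bsub>P\<^esub> E) = D \<otimes>\<^bsub>P\<^esub> E"
    unfolding cd(1) using cd(2,3) E(1) f g by algebra
  then show ?thesis using E cd by (intro bexI[of _ "c \<otimes>\<^bsub>P\<^esub> E"] bexI[of _ "d \<otimes>\<^bsub>P\<^esub> E"]) auto
qed

text \<open>A nonzero constant coefficient makes \<open>f\<close> comaximal with the variable, and
  comaximality is preserved when one more factor of the variable is put on \<open>g\<close>.\<close>

lemma UP_bezout_shift:
  assumes f: "f \<in> carrier P" "coeff P f 0 \<noteq> \<zero>" and g: "g \<in> carrier P"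
    and bez: "\<exists>a\<in>carrier P. \<exists>b\<in>carrier P. f \<otimes>\<^bsub>P\<^esub> a \<oplus>\<^bsub>P\<^esub> g \<otimes>\<^bsub>P\<^esub> b = \<one>\<^bsub>P\<^esub>"
  shows "\<exists>a\<in>carrier P. \<exists>b\<in>carrier P. f \<otimes>\<^bsub>P\<^esub> a \<oplus>\<^bsub>P\<^esub> (monom P \<one> j \<otimes>\<^bsub>P\<^esub> g) \<otimes>\<^bsub>P\<^esub> b = \<one>\<^bsub>P\<^esub>"
proof -
  define t where "t = monom P \<one> 1"
  have t: "t \<in> carrier P" "t \<noteq> \<zero>\<^bsub>P\<^esub>" "deg R t = 1"
  proof -
    show "t \<in> carrier P" by (simp add: t_def)
    show d: "deg R t = 1" unfolding t_def by (rule deg_monom) auto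
    show "t \<noteq> \<zero>\<^bsub>P\<^esub>" using d by auto
  qed
  obtain q r where qr: "q \<in> carrier P" "r \<in> carrier P" "f = t \<otimes>\<^bsub>P\<^esub> q \<oplus>\<^bsub>P\<^esub> r" "r = \<zero>\<^bsub>P\<^esub> \<or> deg R r < deg R t"
    using UP_divide[OF t(1,2) f(1)] by blast
  have "coeff P (t \<otimes>\<^bsub>P\<^esub> q) 0 = \<zero>" using qr t by (simp add: t_def)
  then have "coeff P f 0 = coeff P r 0" unfolding qr(3) using qr t by simp
  then have "r \<noteq> \<zero>\<^bsub>P\<^esub>" "deg R r = 0" using f(2) qr(4) t(3) by auto
  then obtain E where E: "E \<in> carrier P" "r \<otimes>\<^bsub>P\<^esub> E = \<one>\<^bsub>P\<^esub>" using constant_unit[OF qr(2)] by blast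
  define s where "s = \<ominus>\<^bsub>P\<^esub> (q \<otimes>\<^bsub>P\<^esub> E)"
  have s: "s \<in> carrier P" using qr E by (simp add: s_def)
  have "f \<otimes>\<^bsub>P\<^esub> E \<oplus>\<^bsub>P\<^esub> t \<otimes>\<^bsub>P\<^esub> s = r \<otimes>\<^bsub>P\<^esub> E"
    unfolding qr(3) s_def using qr(1,2) t(1) E(1) by algebra
  then have one: "f \<otimes>\<^bsub>P\<^esub> E \<oplus>\<^bsub>P\<^esub> t \<otimes>\<^bsub>P\<^esub> s = \<one>\<^bsub>P\<^esub>" using E by simp
  show ?thesis
  proof (induction j)
    case 0
    then show ?case using bez g by (simp add: monom_one)
  next
    case (Suc j)
    define h where "h = monom P \<one> j \<otimes>\<^bsub>P\<^esub> g"
    have h: "h \<in> carrier P" using g by (simp add: h_def)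
    have "monom P \<one> (Suc j) = t \<otimes>\<^bsub>P\<^esub> monom P \<one> j" unfolding t_def
      using monom_mult[of \<one> \<one> 1 j] by simp
    then have ht: "monom P \<one> (Suc j) \<otimes>\<^bsub>P\<^esub> g = t \<otimes>\<^bsub>P\<^esub> h" using g t by (simp add: h_def P.m_assoc)
    obtain a b where ab: "a \<in> carrier P" "b \<in> carrier P" "f \<otimes>\<^bsub>P\<^esub> a \<oplus>\<^bsub>P\<^esub> h \<otimes>\<^bsub>P\<^esub> b = \<one>\<^bsub>P\<^esub>"
      using Suc by (auto simp: h_def)
    have "f \<otimes>\<^bsub>P\<^esub> (a \<oplus>\<^bsub>P\<^esub> h \<otimes>\<^bsub>P\<^esub> b \<otimes>\<^bsub>P\<^esub> E) \<oplus>\<^bsub>P\<^esub> (t \<otimes>\<^bsub>P\<^esub> h) \<otimes>\<^bsub>P\<^esub> (b \<otimes>\<^bsub>P\<^esub> s) =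
        f \<otimes>\<^bsub>P\<^esub> a \<oplus>\<^bsub>P\<^esub> h \<otimes>\<^bsub>P\<^esub> b \<otimes>\<^bsub>P\<^esub> (f \<otimes>\<^bsub>P\<^esub> E \<oplus>\<^bsub>P\<^esub> t \<otimes>\<^bsub>P\<^esub> s)"
      using f(1) h ab(1,2) E(1) s t(1) by algebra
    also have "\<dots> = \<one>\<^bsub>P\<^esub>" unfolding one using ab h by simp
    finally show ?case unfolding ht using f h ab E s
      by (intro bexI[of _ "a \<oplus>\<^bsub>P\<^esub> h \<otimes>\<^bsub>P\<^esub> b \<otimes>\<^bsub>P\<^esub> E"] bexI[of _ "b \<otimes>\<^bsub>P\<^esub> s"]) auto
  qed
qed

text \<open>Reducing the cofactor of the shifted \<open>g\<close> modulo \<open>f\<close> bounds it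
  by \<open>deg R f\<close>; the bound on the other cofactor follows since degrees add in a domain.
  The bounds will keep exponents on a line within the admissible segment. The condition on
  \<open>j\<close> is void for constant \<open>f\<close>, where \<open>B\<close> vanishes.\<close>

lemma UP_bezout_degree:
  assumes f: "f \<in> carrier P" "coeff P f 0 \<noteq> \<zero>" and g: "g \<in> carrier P"
    and bez: "\<exists>a\<in>carrier P. \<exists>b\<in>carrier P. f \<otimes>\<^bsub>P\<^esub> a \<oplus>\<^bsub>P\<^esub> g \<otimes>\<^bsub>P\<^esub> b = \<one>\<^bsub>P\<^esub>"
    and F: "F \<in> carrier P" "deg R F \<le> K"
    and j: "0 < deg R f \<Longrightarrow> j + deg R g + deg R f \<le> Suc K"
  shows "\<exists>C\<in>carrier P. \<exists>B\<in>carrier P. F = f \<otimes>\<^bsub>P\<^esub> C \<oplus>\<^bsub>P\<^esub> (monom P \<one> j \<otimes>\<^bsub>P\<^esub> g) \<otimes>\<^bsub>P\<^esub> B \<and>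
    (\<forall>i. coeff P B i \<noteq> \<zero> \<longrightarrow> i < deg R f) \<and> (\<forall>i. coeff P C i \<noteq> \<zero> \<longrightarrow> i + deg R f \<le> K)"
proof -
  define h where "h = monom P \<one> j \<otimes>\<^bsub>P\<^esub> g"
  have h: "h \<in> carrier P" using g by (simp add: h_def)
  have fnz: "f \<noteq> \<zero>\<^bsub>P\<^esub>" using f(2) by auto
  obtain a b where ab: "a \<in> carrier P" "b \<in> carrier P" "f \<otimes>\<^bsub>P\<^esub> a \<oplus>\<^bsub>P\<^esub> h \<otimes>\<^bsub>P\<^esub> b = \<one>\<^bsub>P\<^esub>"
    using UP_bezout_shift[OF f g bez] unfolding h_def by blast
  obtain q B where qB: "q \<in> carrier P" "B \<in> carrier P" "b \<otimes>\<^bsub>P\<^esub> F = f \<otimes>\<^bsub>P\<^esub> q \<oplus>\<^bsub>P\<^esub> B"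
    "B = \<zero>\<^bsub>P\<^esub> \<or> deg R B < deg R f"
    using UP_divide[OF f(1) fnz, of "b \<otimes>\<^bsub>P\<^esub> F"] ab F by auto
  define C where "C = a \<otimes>\<^bsub>P\<^esub> F \<oplus>\<^bsub>P\<^esub> h \<otimes>\<^bsub>P\<^esub> q"
  have C: "C \<in> carrier P" using ab F h qB by (simp add: C_def)
  have "F = (f \<otimes>\<^bsub>P\<^esub> a \<oplus>\<^bsub>P\<^esub> h \<otimes>\<^bsub>P\<^esub> b) \<otimes>\<^bsub>P\<^esub> F" using ab(3) F by simp
  also have "\<dots> = f \<otimes>\<^bsub>P\<^esub> (a \<otimes>\<^bsub>P\<^esub> F) \<oplus>\<^bsub>P\<^esub> h \<otimes>\<^bsub>P\<^esub> (b \<otimes>\<^bsub>P\<^esub> F)" using f(1) ab(1,2) h F(1) by algebra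
  also have "\<dots> = f \<otimes>\<^bsub>P\<^esub> C \<oplus>\<^bsub>P\<^esub> h \<otimes>\<^bsub>P\<^esub> B"
    unfolding qB(3) C_def using f(1) ab(1,2) h F(1) qB(1,2) by algebra
  finally have eq: "F = f \<otimes>\<^bsub>P\<^esub> C \<oplus>\<^bsub>P\<^esub> h \<otimes>\<^bsub>P\<^esub> B" .
  have Bdeg: "i < deg R f" if "coeff P B i \<noteq> \<zero>" for i
  proof -
    have "B \<noteq> \<zero>\<^bsub>P\<^esub>" using that by auto
    moreover have "\<not> deg R B < i" using deg_aboveD[of B i] qB(2) that by auto
    ultimately show ?thesis using qB(4) by auto
  qed
  have hB: "coeff P (h \<otimes>\<^bsub>P\<^esub> B) i = \<zero>" if i: "K < i" for i
  proof (cases "B = \<zero>\<^bsub>P\<^esub>")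
    case True
    then show ?thesis using h by simp
  next
    case False
    then have lt: "deg R B < deg R f" using qB(4) by auto
    have "deg R (h \<otimes>\<^bsub>P\<^esub> B) \<le> deg R h + deg R B" by (rule deg_mult_ring[OF h qB(2)])
    moreover have "deg R h \<le> j + deg R g"
      unfolding h_def using deg_mult_ring[of "monom P \<one> j" g] g deg_monom_le[of \<one> j] by simp
    ultimately have "deg R (h \<otimes>\<^bsub>P\<^esub> B) < i" using j lt i by linarith
    then show ?thesis using deg_aboveD h qB(2) by simp
  qed
  have "f \<otimes>\<^bsub>P\<^esub> C = F \<ominus>\<^bsub>P\<^esub> h \<otimes>\<^bsub>P\<^esub> B"
  proof -
    have "f \<otimes>\<^bsub>P\<^esub> C = (f \<otimes>\<^bsub>P\<^esub> C \<oplus>\<^bsub>P\<^esub> h \<otimes>\<^bsub>P\<^esub> B) \<ominus>\<^bsub>P\<^esub> h \<otimes>\<^bsub>P\<^esub> B" using f(1) C h qB(2) by algebra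
    then show ?thesis using eq by simp
  qed
  then have "coeff P (f \<otimes>\<^bsub>P\<^esub> C) i = \<zero>" if "K < i" for i
    using hB[OF that] deg_aboveD[of F i] F that h qB(2) by (simp add: a_minus_def)
  then have degfC: "deg R (f \<otimes>\<^bsub>P\<^esub> C) \<le> K" using f C by (intro deg_aboveI) auto
  have Cdeg: "i + deg R f \<le> K" if "coeff P C i \<noteq> \<zero>" for i
  proof -
    have "C \<noteq> \<zero>\<^bsub>P\<^esub>" using that by auto
    then have "deg R f + deg R C \<le> K" using degfC deg_mult[OF fnz _ f(1) C] by simp
    moreover have "\<not> deg R C < i" using deg_aboveD[of C i] C that by auto
    ultimately show ?thesis by linarith
  qed
  show ?thesis using eq C qB(2) Bdeg Cdeg unfolding h_def by blast
qed

end

section \<open>Polynomials supported on parallel lines\<close>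

text \<open>Integer polynomials form an ordered additive group, the sign being that of the leading
  coefficient. The embedding thus provides a total order on exponents compatible with
  addition.\<close>

lemma exists_injective_additive:
  "\<exists>\<iota> :: nat ^ 'n::finite \<Rightarrow> int poly. inj \<iota> \<and> (\<forall>A B. \<iota> (A + B) = \<iota> A + \<iota> B)"
proof -
  obtain idx :: "'n \<Rightarrow> nat" where "bij_betw idx UNIV {0..<CARD('n)}"
    using ex_bij_betw_finite_nat[of "UNIV :: 'n set"] by auto
  then have inj: "inj idx" by (auto simp: bij_betw_def)
  define \<iota> where "\<iota> A = (\<Sum>i\<in>UNIV. Polynomial.monom (int (A $ i)) (idx i))" for A :: "nat ^ 'n"
  have co: "Polynomial.coeff (\<iota> A) (idx i) = int (A $ i)" for A i
  proof -
    have "Polynomial.coeff (\<iota> A) (idx i) = (\<Sum>j\<in>UNIV. if j = i then int (A $ i) else 0)"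
      unfolding \<iota>_def coeff_sum by (rule sum.cong) (use inj in \<open>auto simp: inj_def\<close>)
    then show ?thesis by simp
  qed
  have "inj \<iota>"
  proof (rule injI)
    fix A B assume "\<iota> A = \<iota> B"
    then have "int (A $ i) = int (B $ i)" for i using co[of A i] co[of B i] by simp
    then show "A = B" by (simp add: vec_eq_iff)
  qed
  moreover have "\<iota> (A + B) = \<iota> A + \<iota> B" for A B
    by (simp add: \<iota>_def add_monom[symmetric] sum.distrib)
  ultimately show ?thesis by blast
qed

lemma lexicographic_maximum:
  fixes f :: "'a \<Rightarrow> 'b::linorder" and g :: "'a \<Rightarrow> 'c::linorder"
  assumes "finite S" "S \<noteq> {}"
  shows "\<exists>A\<in>S. (\<forall>A'\<in>S. f A' \<le> f A) \<and> (\<forall>A'\<in>S. f A' = f A \<longrightarrow> g A' \<le> g A)"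
proof -
  define S' where "S' = {A \<in> S. f A = Max (f ` S)}"
  have "Max (f ` S) \<in> f ` S" using assms by (intro Max_in) auto
  then obtain A0 where "A0 \<in> S" "f A0 = Max (f ` S)" by (metis imageE)
  then have S': "finite S'" "S' \<noteq> {}" using assms by (auto simp: S'_def)
  have "Max (g ` S') \<in> g ` S'" using S' by (intro Max_in) auto
  then obtain A where A: "A \<in> S'" "g A = Max (g ` S')" by auto
  have "f A' \<le> f A" if "A' \<in> S" for A' using that A(1) assms by (auto simp: S'_def)
  moreover have "g A' \<le> g A" if "A' \<in> S" "f A' = f A" for A'
    using that A S' by (auto simp: S'_def)
  moreover have "A \<in> S" using A(1) by (simp add: S'_def)
  ultimately show ?thesis by blast
qed

text \<open>Maximise \<open>\<phi>\<close> on each set and break ties by a total order compatible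
  with addition. The sum of the two maxima has no other decomposition, so the corresponding
  coefficient of a product cannot cancel.\<close>

lemma extremal_pair:
  fixes S T :: "(nat ^ 'n::finite) set" and \<phi> :: "nat ^ 'n \<Rightarrow> int"
  assumes S: "finite S" "S \<noteq> {}" and T: "finite T" "T \<noteq> {}" and add: "\<And>A B. \<phi> (A + B) = \<phi> A + \<phi> B"
  shows "\<exists>A\<in>S. \<exists>B\<in>T. (\<forall>A'\<in>S. \<phi> A' \<le> \<phi> A) \<and> (\<forall>B'\<in>T. \<phi> B' \<le> \<phi> B) \<and>
    (\<forall>A'\<in>S. \<forall>B'\<in>T. A' + B' = A + B \<longrightarrow> A' = A \<and> B' = B)"
proof -
  obtain \<iota> :: "nat ^ 'n \<Rightarrow> int poly" where \<iota>: "inj \<iota>" "\<forall>A B. \<iota> (A + B) = \<iota> A + \<iota> B"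
    using exists_injective_additive by (elim exE conjE)
  obtain A where A: "A \<in> S" "\<forall>A'\<in>S. \<phi> A' \<le> \<phi> A" "\<forall>A'\<in>S. \<phi> A' = \<phi> A \<longrightarrow> \<iota> A' \<le> \<iota> A"
    using lexicographic_maximum[OF S, of \<phi> \<iota>] by (elim bexE conjE)
  obtain B where B: "B \<in> T" "\<forall>A'\<in>T. \<phi> A' \<le> \<phi> B" "\<forall>A'\<in>T. \<phi> A' = \<phi> B \<longrightarrow> \<iota> A' \<le> \<iota> B"
    using lexicographic_maximum[OF T, of \<phi> \<iota>] by (elim bexE conjE)
  have "A' = A \<and> B' = B" if AB: "A' \<in> S" "B' \<in> T" "A' + B' = A + B" for A' B'
  proof -
    have "\<phi> A' + \<phi> B' = \<phi> A + \<phi> B" using arg_cong[OF AB(3), of \<phi>] unfolding add .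
    moreover have "\<phi> A' \<le> \<phi> A" "\<phi> B' \<le> \<phi> B" using A(2) B(2) AB by auto
    ultimately have "\<phi> A' = \<phi> A" "\<phi> B' = \<phi> B" by linarith+
    then have "\<iota> A' \<le> \<iota> A" "\<iota> B' \<le> \<iota> B" using A(3) B(3) AB by auto
    moreover have "\<iota> A' + \<iota> B' = \<iota> A + \<iota> B" using arg_cong[OF AB(3), of \<iota>] \<iota>(2) by simp
    ultimately have "\<iota> A' = \<iota> A" "\<iota> B' = \<iota> B"
      using add_le_cancel_left[of "\<iota> A" "\<iota> B" "\<iota> B'"] add_right_mono[of "\<iota> A'" "\<iota> A" "\<iota> B'"]
      by (metis add_left_mono add_right_cancel antisym add_le_cancel_right add_le_cancel_left)+
    then show ?thesis using \<iota>(1) by (auto dest: injD)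
  qed
  then show ?thesis using A B by blast
qed

section \<open>Convolution of coefficient functions, and polynomials carried by a line\<close>

context cring
begin

lemma mpoly_mult_apply:
  "(p \<otimes>\<^bsub>mpoly_ring R\<^esub> q) A = (\<Oplus>z\<in>{(B, C). B + C = A}. p (fst z) \<otimes> q (snd z))"
  by (simp add: mpoly_ring_def)

lemma mpoly_mult_closed:
  assumes "\<And>A. p A \<in> carrier R" "\<And>A. q A \<in> carrier R"
  shows "(p \<otimes>\<^bsub>mpoly_ring R\<^esub> q) A \<in> carrier R"
  unfolding mpoly_mult_apply using assms by (intro finsum_closed) auto

lemma mpoly_mult_eq_single:
  assumes p: "\<And>A. p A \<in> carrier R" "\<And>A. q A \<in> carrier R"
    and "B + C = A" "\<And>B' C'. B' + C' = A \<Longrightarrow> p B' \<noteq> \<zero> \<Longrightarrow> q C' \<noteq> \<zero> \<Longrightarrow> B' = B \<and> C' = C"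
  shows "(p \<otimes>\<^bsub>mpoly_ring R\<^esub> q) A = p B \<otimes> q C"
proof -
  have "(p \<otimes>\<^bsub>mpoly_ring R\<^esub> q) A = (\<Oplus>z\<in>{(B, C)}. p (fst z) \<otimes> q (snd z))"
    unfolding mpoly_mult_apply
  proof (rule add.finprod_mono_neutral_cong_right[OF finite_sum_decompositions])
    show "p (fst z) \<otimes> q (snd z) = \<zero>" if z: "z \<in> {(B, C). B + C = A} - {(B, C)}" for z
    proof -
      have "p (fst z) = \<zero> \<or> q (snd z) = \<zero>" using assms(4)[of "fst z" "snd z"] z by (cases z) auto
      then show ?thesis using p by auto
    qed
  qed (use assms in auto)
  then show ?thesis using p by simp
qed

lemma mpoly_mult_nonzeroD:
  assumes p: "\<And>A. p A \<in> carrier R" "\<And>A. q A \<in> carrier R"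
    and "(p \<otimes>\<^bsub>mpoly_ring R\<^esub> q) A \<noteq> \<zero>"
  shows "\<exists>B C. B + C = A \<and> p B \<noteq> \<zero> \<and> q C \<noteq> \<zero>"
proof (rule ccontr)
  assume n: "\<nexists>B C. B + C = A \<and> p B \<noteq> \<zero> \<and> q C \<noteq> \<zero>"
  have "(\<Oplus>z\<in>{(B, C). B + C = A}. p (fst z) \<otimes> q (snd z)) = \<zero>"
  proof (rule add.finprod_one_eqI)
    fix z assume z: "z \<in> {(B, C). B + C = A}"
    then have "p (fst z) = \<zero> \<or> q (snd z) = \<zero>" using n by (cases z) auto
    then show "p (fst z) \<otimes> q (snd z) = \<zero>" using p by auto
  qed
  then show False using assms(3) unfolding mpoly_mult_apply by simp
qed

lemma mpoly_carrierD:
  "p \<in> carrier (mpoly_ring R) \<Longrightarrow> p A \<in> carrier R"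
  "p \<in> carrier (mpoly_ring R) \<Longrightarrow> finite {A. p A \<noteq> \<zero>}"
  by (auto simp: mpoly_ring_def)

text \<open>If every exponent had a positive entry at \<open>i\<close>, shifting all exponents down
  by one there would give the quotient.\<close>

lemma mpoly_not_divisible_by_var:
  assumes G: "G \<in> carrier (mpoly_ring R)" and n: "\<not> mpoly_var R i divides\<^bsub>mpoly_ring R\<^esub> G"
  shows "\<exists>A. G A \<noteq> \<zero> \<and> A $ i = 0"
proof (rule ccontr)
  assume neg: "\<nexists>A. G A \<noteq> \<zero> \<and> A $ i = 0"
  note Gc = mpoly_carrierD[OF G]
  define Q where "Q B = G (B + axis i 1)" for B
  have "{B. Q B \<noteq> \<zero>} = (\<lambda>B. B + axis i 1) -` {A. G A \<noteq> \<zero>}" by (auto simp: Q_def)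
  moreover have "finite \<dots>" by (rule finite_vimageI[OF Gc(2)]) (auto simp: inj_def)
  ultimately have Q: "Q \<in> carrier (mpoly_ring R)" using Gc(1) by (auto simp: mpoly_ring_def Q_def)
  have var: "mpoly_var R i A \<in> carrier R" "mpoly_var R i A \<noteq> \<zero> \<Longrightarrow> A = axis i 1" for A
    by (auto simp: mpoly_var_def split: if_splits)
  have "(mpoly_var R i \<otimes>\<^bsub>mpoly_ring R\<^esub> Q) A = G A" for A
  proof (cases "A $ i = 0")
    case True
    have "(mpoly_var R i \<otimes>\<^bsub>mpoly_ring R\<^esub> Q) A = \<zero>"
    proof (rule ccontr)
      assume "(mpoly_var R i \<otimes>\<^bsub>mpoly_ring R\<^esub> Q) A \<noteq> \<zero>"
      then obtain B C where "B + C = A" "mpoly_var R i B \<noteq> \<zero>"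
        using mpoly_mult_nonzeroD[of "mpoly_var R i" Q A] var(1) mpoly_carrierD(1)[OF Q] by blast
      then have "axis i 1 + C = A" using var(2) by auto
      then have "A $ i = 1 + C $ i" by (auto simp del: One_nat_def)
      then show False using True by simp
    qed
    then show ?thesis using neg True by metis
  next
    case False
    then have "axis i 1 \<le> A" by (auto simp: less_eq_vec_def axis_def)
    from exponent_split[OF this] obtain C where C: "A = axis i 1 + C" by blast
    have "(mpoly_var R i \<otimes>\<^bsub>mpoly_ring R\<^esub> Q) A = mpoly_var R i (axis i 1) \<otimes> Q C"
    proof (rule mpoly_mult_eq_single)
      fix B' C' assume "B' + C' = A" "mpoly_var R i B' \<noteq> \<zero>"
      then show "B' = axis i 1 \<and> C' = C" using var(2)[of B'] C by auto
    qed (use var mpoly_carrierD(1)[OF Q] C in auto)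
    then show ?thesis using Gc(1) by (simp add: mpoly_var_def Q_def C add.commute)
  qed
  then have "G = mpoly_var R i \<otimes>\<^bsub>mpoly_ring R\<^esub> Q" by auto
  then show False using n Q by (auto simp: factor_def)
qed

text \<open>The polynomial \<open>X ^ \<delta> * F (X ^ c)\<close>; coefficients of \<open>F\<close> at indices for which the
  exponent \<open>\<delta> + k * c\<close> has a negative entry are discarded.\<close>

definition line_poly :: "('n::finite \<Rightarrow> int) \<Rightarrow> ('n \<Rightarrow> int) \<Rightarrow> (nat \<Rightarrow> 'a) \<Rightarrow> nat ^ 'n \<Rightarrow> 'a" where
  "line_poly c \<delta> F A = (if \<exists>k::nat. \<forall>i. int (A $ i) = \<delta> i + int k * c i
     then F (THE k. \<forall>i. int (A $ i) = \<delta> i + int k * c i) else \<zero>)"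

lemma line_poly_at:
  assumes "c p \<noteq> 0" "\<And>i. int (A $ i) = \<delta> i + int k * c i"
  shows "line_poly c \<delta> F A = F k"
proof -
  have "(THE k. \<forall>i. int (A $ i) = \<delta> i + int k * c i) = k"
  proof (rule the_equality)
    fix k' assume "\<forall>i. int (A $ i) = \<delta> i + int k' * c i"
    then have "int k' * c p = int k * c p" using assms(2)[of p] by (metis add_left_cancel)
    then show "k' = k" using assms(1) by simp
  qed (use assms in auto)
  then show ?thesis using assms(2) by (auto simp: line_poly_def)
qed

lemma line_poly_off: "(\<And>k::nat. \<exists>i. int (A $ i) \<noteq> \<delta> i + int k * c i) \<Longrightarrow> line_poly c \<delta> F A = \<zero>"
  by (auto simp: line_poly_def)

lemma line_poly_nonzeroD:
  assumes "c p \<noteq> 0" "line_poly c \<delta> F A \<noteq> \<zero>"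
  shows "\<exists>k. F k \<noteq> \<zero> \<and> (\<forall>i. int (A $ i) = \<delta> i + int k * c i)"
proof -
  obtain k :: nat where k: "\<And>i. int (A $ i) = \<delta> i + int k * c i"
    using assms(2) line_poly_off[of A \<delta> c F] by blast
  then show ?thesis using assms line_poly_at[of c p A \<delta> k F] by auto
qed

lemma line_poly_in_carrier:
  assumes c: "c p \<noteq> 0" and F: "F \<in> carrier (UP R)"
  shows "line_poly c \<delta> F \<in> carrier (mpoly_ring R)"
proof -
  have Fc: "F k \<in> carrier R" for k using F by (auto simp: UP_def up_def)
  obtain n where n: "bound \<zero> n F" using F by (auto simp: UP_def up_def)
  have "{A. line_poly c \<delta> F A \<noteq> \<zero>} \<subseteq> (\<lambda>k. \<chi> i. nat (\<delta> i + int k * c i)) ` {..n}"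
  proof
    fix A assume "A \<in> {A. line_poly c \<delta> F A \<noteq> \<zero>}"
    then obtain k where k: "F k \<noteq> \<zero>" "\<And>i. int (A $ i) = \<delta> i + int k * c i"
      using line_poly_nonzeroD[where c=c and p=p, OF c] by blast
    have "k \<le> n" using n k(1) unfolding bound_def by (meson not_le)
    moreover have "A = (\<chi> i. nat (\<delta> i + int k * c i))" unfolding k(2)[symmetric] by (simp add: vec_eq_iff)
    ultimately show "A \<in> (\<lambda>k. \<chi> i. nat (\<delta> i + int k * c i)) ` {..n}" by blast
  qed
  then have "finite {A. line_poly c \<delta> F A \<noteq> \<zero>}" by (rule finite_subset) auto
  moreover have "line_poly c \<delta> F A \<in> carrier R" for A using Fc by (simp add: line_poly_def)
  ultimately show ?thesis by (simp add: mpoly_ring_def)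
qed

text \<open>The assumptions \<open>valid\<close> guarantee that \<open>line_poly\<close> discards no
  nonzero coefficient of either factor. Adding exponents then means adding indices along the line,
  so both sides are the same univariate convolution.\<close>

lemma line_poly_mult:
  assumes c: "c p \<noteq> 0" and F: "F \<in> carrier (UP R)" "F' \<in> carrier (UP R)"
    and valid: "\<And>k i. F k \<noteq> \<zero> \<Longrightarrow> 0 \<le> \<delta> i + int k * c i" "\<And>k i. F' k \<noteq> \<zero> \<Longrightarrow> 0 \<le> \<delta>' i + int k * c i"
  shows "line_poly c \<delta> F \<otimes>\<^bsub>mpoly_ring R\<^esub> line_poly c \<delta>' F' =
    line_poly c (\<lambda>i. \<delta> i + \<delta>' i) (F \<otimes>\<^bsub>UP R\<^esub> F')"
proof
  fix A
  have Fc: "F k \<in> carrier R" "F' k \<in> carrier R" for k using F by (auto simp: UP_def up_def)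
  have lc: "line_poly c \<delta> F B \<in> carrier R" "line_poly c \<delta>' F' B \<in> carrier R" for B
    using line_poly_in_carrier[where c=c and p=p, OF c F(1)] line_poly_in_carrier[where c=c and p=p, OF c F(2)] by (auto simp: mpoly_ring_def)
  show "(line_poly c \<delta> F \<otimes>\<^bsub>mpoly_ring R\<^esub> line_poly c \<delta>' F') A = line_poly c (\<lambda>i. \<delta> i + \<delta>' i) (F \<otimes>\<^bsub>UP R\<^esub> F') A"
  proof (cases "\<exists>k::nat. \<forall>i. int (A $ i) = \<delta> i + \<delta>' i + int k * c i")
    case False
    have "(line_poly c \<delta> F \<otimes>\<^bsub>mpoly_ring R\<^esub> line_poly c \<delta>' F') A = \<zero>"
    proof (rule ccontr)
      assume "(line_poly c \<delta> F \<otimes>\<^bsub>mpoly_ring R\<^esub> line_poly c \<delta>' F') A \<noteq> \<zero>"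
      then obtain B C where BC: "B + C = A" "line_poly c \<delta> F B \<noteq> \<zero>" "line_poly c \<delta>' F' C \<noteq> \<zero>"
        using mpoly_mult_nonzeroD[of "line_poly c \<delta> F" "line_poly c \<delta>' F'" A] lc by blast
      obtain k where k: "\<forall>i. int (B $ i) = \<delta> i + int k * c i" using line_poly_nonzeroD[where c=c and p=p, OF c BC(2)] by blast
      obtain k' where k': "\<forall>i. int (C $ i) = \<delta>' i + int k' * c i" using line_poly_nonzeroD[where c=c and p=p, OF c BC(3)] by blast
      have "int (A $ i) = \<delta> i + \<delta>' i + int (k + k') * c i" for i
        using k k' unfolding BC(1)[symmetric] by (simp add: distrib_right)
      then show False using False by blast
    qed
    moreover have "line_poly c (\<lambda>i. \<delta> i + \<delta>' i) (F \<otimes>\<^bsub>UP R\<^esub> F') A = \<zero>"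
      by (rule line_poly_off) (use False in blast)
    ultimately show ?thesis by simp
  next
    case True
    then obtain k :: nat where k: "\<And>i. int (A $ i) = \<delta> i + \<delta>' i + int k * c i" by blast
    \<comment> \<open>Only indices with two nonzero coefficients are kept: for these
      \<open>b\<close> and \<open>b'\<close> are true exponents, not affected by the truncation in
      \<open>nat\<close>.\<close>
    define I where "I = {j \<in> {..k}. F j \<noteq> \<zero> \<and> F' (k - j) \<noteq> \<zero>}"
    define b where "b j = (\<chi> i. nat (\<delta> i + int j * c i))" for j :: nat
    define b' where "b' j = (\<chi> i. nat (\<delta>' i + int j * c i))" for j :: nat
    have b: "int (b j $ i) = \<delta> i + int j * c i" if "F j \<noteq> \<zero>" for j i using valid(1)[OF that, of i] by (simp add: b_def)
    have b': "int (b' j $ i) = \<delta>' i + int j * c i" if "F' j \<noteq> \<zero>" for j i using valid(2)[OF that, of i] by (simp add: b'_def)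
    have lb: "line_poly c \<delta> F (b j) = F j" if "F j \<noteq> \<zero>" for j by (rule line_poly_at[where c=c and p=p, OF c b[OF that]])
    have lb': "line_poly c \<delta>' F' (b' j) = F' j" if "F' j \<noteq> \<zero>" for j by (rule line_poly_at[where c=c and p=p, OF c b'[OF that]])
    define h where "h j = (b j, b' (k - j))" for j
    have sum: "b j + b' (k - j) = A" if j: "j \<in> I" for j
    proof -
      have "int ((b j + b' (k - j)) $ i) = int (A $ i)" for i
      proof -
        have "int ((b j + b' (k - j)) $ i) = (\<delta> i + int j * c i) + (\<delta>' i + int (k - j) * c i)"
          using b[of j i] b'[of "k - j" i] j by (simp add: I_def)
        also have "\<dots> = int (A $ i)" unfolding k using j by (simp add: I_def of_nat_diff algebra_simps)
        finally show ?thesis .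
      qed
      then have "(b j + b' (k - j)) $ i = A $ i" for i by (simp only: of_nat_eq_iff)
      then show ?thesis by (simp only: vec_eq_iff) blast
    qed
    have inj: "inj_on h I"
    proof (rule inj_onI)
      fix j j' assume j: "j \<in> I" "j' \<in> I" "h j = h j'"
      then have "int (b j $ p) = int (b j' $ p)" by (simp add: h_def)
      moreover have "F j \<noteq> \<zero>" "F j' \<noteq> \<zero>" using j by (auto simp: I_def)
      ultimately have "int j * c p = int j' * c p" using b[of j p] b[of j' p] by linarith
      then show "j = j'" using c by simp
    qed
    have "(line_poly c \<delta> F \<otimes>\<^bsub>mpoly_ring R\<^esub> line_poly c \<delta>' F') A =
        (\<Oplus>z\<in>h ` I. line_poly c \<delta> F (fst z) \<otimes> line_poly c \<delta>' F' (snd z))"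
      unfolding mpoly_mult_apply
    proof (rule add.finprod_mono_neutral_cong_right[OF finite_sum_decompositions])
      show "h ` I \<subseteq> {(B, C). B + C = A}" using sum by (auto simp: h_def)
      fix z assume z: "z \<in> {(B, C). B + C = A} - h ` I"
      show "line_poly c \<delta> F (fst z) \<otimes> line_poly c \<delta>' F' (snd z) = \<zero>"
      proof (rule ccontr)
        assume nz: "line_poly c \<delta> F (fst z) \<otimes> line_poly c \<delta>' F' (snd z) \<noteq> \<zero>"
        have "line_poly c \<delta> F (fst z) \<noteq> \<zero>" "line_poly c \<delta>' F' (snd z) \<noteq> \<zero>" using nz lc by auto
        then obtain j j' where j: "F j \<noteq> \<zero>" "\<forall>i. int (fst z $ i) = \<delta> i + int j * c i"
          and j': "F' j' \<noteq> \<zero>" "\<forall>i. int (snd z $ i) = \<delta>' i + int j' * c i"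
          using line_poly_nonzeroD[where c=c and p=p, OF c] by meson
        have "int (fst z $ p) + int (snd z $ p) = int (A $ p)" using z by auto
        then have "(int j + int j') * c p = int k * c p" using j(2) j'(2) k[of p] by (simp add: algebra_simps)
        then have "int j + int j' = int k" using c by simp
        then have jj: "j + j' = k" by linarith
        have "fst z $ i = b j $ i" "snd z $ i = b' j' $ i" for i
          using j(2) j'(2) b[OF j(1), of i] b'[OF j'(1), of i] by (metis of_nat_eq_iff)+
        then have "fst z = b j" "snd z = b' j'" by (simp_all add: vec_eq_iff)
        moreover have "j \<in> I" using jj j j' by (auto simp: I_def)
        moreover have "j' = k - j" using jj by simp
        ultimately have "z \<in> h ` I" by (auto simp: h_def prod_eq_iff intro!: image_eqI[of _ _ j])
        then show False using z by auto
      qed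
    qed (use lc in auto)
    also have "\<dots> = (\<Oplus>j\<in>I. line_poly c \<delta> F (b j) \<otimes> line_poly c \<delta>' F' (b' (k - j)))"
      by (subst finsum_reindex[OF _ inj]) (use lc in \<open>auto simp: h_def\<close>)
    also have "\<dots> = (\<Oplus>j\<in>I. F j \<otimes> F' (k - j))"
      by (rule finsum_cong') (use Fc lb lb' in \<open>auto simp: I_def\<close>)
    also have "\<dots> = (\<Oplus>j\<in>{..k}. F j \<otimes> F' (k - j))"
      by (rule add.finprod_mono_neutral_cong_left) (use Fc in \<open>auto simp: I_def\<close>)
    also have "\<dots> = (F \<otimes>\<^bsub>UP R\<^esub> F') k" using F by (simp add: UP_def)
    also have "\<dots> = line_poly c (\<lambda>i. \<delta> i + \<delta>' i) (F \<otimes>\<^bsub>UP R\<^esub> F') A"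
      by (rule line_poly_at[symmetric, OF c k])
    finally show ?thesis .
  qed
qed

lemma line_poly_add:
  assumes c: "c p \<noteq> 0" and F: "F \<in> carrier (UP R)" "F' \<in> carrier (UP R)"
  shows "line_poly c \<delta> (F \<oplus>\<^bsub>UP R\<^esub> F') A = line_poly c \<delta> F A \<oplus> line_poly c \<delta> F' A"
proof (cases "\<exists>k::nat. \<forall>i. int (A $ i) = \<delta> i + int k * c i")
  case True
  then obtain k :: nat where k: "\<And>i. int (A $ i) = \<delta> i + int k * c i" by blast
  show ?thesis unfolding line_poly_at[where c=c and p=p, OF c k] using F by (simp add: UP_def)
next
  case False
  then have "line_poly c \<delta> h A = \<zero>" for h by (intro line_poly_off) blast
  then show ?thesis by simp
qed

end

lemma (in domain) mpoly_mult_extremal: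
  fixes \<phi> :: "nat ^ 'n::finite \<Rightarrow> int"
  assumes p: "p \<in> carrier (mpoly_ring R)" "\<exists>A. p A \<noteq> \<zero>" and q: "q \<in> carrier (mpoly_ring R)" "\<exists>A. q A \<noteq> \<zero>"
    and add: "\<And>A B. \<phi> (A + B) = \<phi> A + \<phi> B"
  shows "\<exists>A B. p A \<noteq> \<zero> \<and> q B \<noteq> \<zero> \<and> (\<forall>A'. p A' \<noteq> \<zero> \<longrightarrow> \<phi> A' \<le> \<phi> A) \<and> (\<forall>B'. q B' \<noteq> \<zero> \<longrightarrow> \<phi> B' \<le> \<phi> B) \<and>
    (p \<otimes>\<^bsub>mpoly_ring R\<^esub> q) (A + B) \<noteq> \<zero>"
proof -
  have ne: "{A. p A \<noteq> \<zero>} \<noteq> {}" "{A. q A \<noteq> \<zero>} \<noteq> {}" using p(2) q(2) by auto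
  obtain A B where AB: "p A \<noteq> \<zero>" "q B \<noteq> \<zero>" "\<And>A'. p A' \<noteq> \<zero> \<Longrightarrow> \<phi> A' \<le> \<phi> A" "\<And>B'. q B' \<noteq> \<zero> \<Longrightarrow> \<phi> B' \<le> \<phi> B"
    "\<And>A' B'. p A' \<noteq> \<zero> \<Longrightarrow> q B' \<noteq> \<zero> \<Longrightarrow> A' + B' = A + B \<Longrightarrow> A' = A \<and> B' = B"
    using extremal_pair[OF mpoly_carrierD(2)[OF p(1)] ne(1) mpoly_carrierD(2)[OF q(1)] ne(2) add] by auto
  have "(p \<otimes>\<^bsub>mpoly_ring R\<^esub> q) (A + B) = p A \<otimes> q B"
    by (rule mpoly_mult_eq_single) (use AB(5) mpoly_carrierD(1)[OF p(1)] mpoly_carrierD(1)[OF q(1)] in auto)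
  also have "\<dots> \<noteq> \<zero>" using AB(1,2) mpoly_carrierD(1)[OF p(1)] mpoly_carrierD(1)[OF q(1)] integral_iff by auto
  finally show ?thesis using AB by (intro exI[of _ A] exI[of _ B]) auto
qed

text \<open>Let an additive function be constant along the direction \<open>c\<close>. Because
  extremal coefficients do not cancel, its one value on the support of the product is both the sum
  of its maxima and the sum of its minima on the factors, so it is constant on each factor. Applied
  to coordinates, pair forms and the edge weight, this determines the line.\<close>

lemma (in domain) factor_supports_on_line:
  fixes c :: "'n::finite \<Rightarrow> int"
  assumes c: "primitive_direction c"
    and p: "p \<in> carrier (mpoly_ring R)" "\<exists>A. p A \<noteq> \<zero>" and q: "q \<in> carrier (mpoly_ring R)" "\<exists>A. q A \<noteq> \<zero>"
    and line: "\<And>A B. (p \<otimes>\<^bsub>mpoly_ring R\<^esub> q) A \<noteq> \<zero> \<Longrightarrow> (p \<otimes>\<^bsub>mpoly_ring R\<^esub> q) B \<noteq> \<zero> \<Longrightarrow> on_line c A B"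
  shows "p A \<noteq> \<zero> \<Longrightarrow> p B \<noteq> \<zero> \<Longrightarrow> on_line c A B"
    and "q A \<noteq> \<zero> \<Longrightarrow> q B \<noteq> \<zero> \<Longrightarrow> on_line c A B"
proof -
  have const: "(\<forall>A B. p A \<noteq> \<zero> \<longrightarrow> p B \<noteq> \<zero> \<longrightarrow> \<phi> A = \<phi> B) \<and> (\<forall>A B. q A \<noteq> \<zero> \<longrightarrow> q B \<noteq> \<zero> \<longrightarrow> \<phi> A = \<phi> B)"
    if add: "\<And>A B. \<phi> (A + B) = \<phi> A + \<phi> B" and inv: "\<And>A B. on_line c A B \<Longrightarrow> \<phi> A = \<phi> B"
    for \<phi> :: "nat ^ 'n \<Rightarrow> int"
  proof -
    obtain A1 B1 where 1: "p A1 \<noteq> \<zero>" "q B1 \<noteq> \<zero>" "\<forall>A'. p A' \<noteq> \<zero> \<longrightarrow> \<phi> A' \<le> \<phi> A1"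
      "\<forall>B'. q B' \<noteq> \<zero> \<longrightarrow> \<phi> B' \<le> \<phi> B1" "(p \<otimes>\<^bsub>mpoly_ring R\<^esub> q) (A1 + B1) \<noteq> \<zero>"
      using mpoly_mult_extremal[of p q \<phi>, OF p q add] by blast
    have add': "- \<phi> (A + B) = - \<phi> A + - \<phi> B" for A B using add by simp
    obtain A2 B2 where 2: "p A2 \<noteq> \<zero>" "q B2 \<noteq> \<zero>" "\<forall>A'. p A' \<noteq> \<zero> \<longrightarrow> - \<phi> A' \<le> - \<phi> A2"
      "\<forall>B'. q B' \<noteq> \<zero> \<longrightarrow> - \<phi> B' \<le> - \<phi> B2" "(p \<otimes>\<^bsub>mpoly_ring R\<^esub> q) (A2 + B2) \<noteq> \<zero>"
      using mpoly_mult_extremal[of p q "\<lambda>A. - \<phi> A", OF p q add'] by blast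
    have "\<phi> A1 + \<phi> B1 = \<phi> A2 + \<phi> B2" using inv[OF line[OF 1(5) 2(5)]] add by simp
    moreover have "\<phi> A2 \<le> \<phi> A1" "\<phi> B2 \<le> \<phi> B1" using 1 2 by auto
    ultimately have eq: "\<phi> A1 = \<phi> A2" "\<phi> B1 = \<phi> B2" by linarith+
    have "\<phi> A = \<phi> A1" if "p A \<noteq> \<zero>" for A
    proof -
      have "\<phi> A \<le> \<phi> A1" "- \<phi> A \<le> - \<phi> A2" using 1(3) 2(3) that by blast+
      then show ?thesis using eq by linarith
    qed
    moreover have "\<phi> B = \<phi> B1" if "q B \<noteq> \<zero>" for B
    proof -
      have "\<phi> B \<le> \<phi> B1" "- \<phi> B \<le> - \<phi> B2" using 1(4) 2(4) that by blast+
      then show ?thesis using eq by linarith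
    qed
    ultimately show ?thesis by simp
  qed
  have coord: "(\<forall>A B. p A \<noteq> \<zero> \<longrightarrow> p B \<noteq> \<zero> \<longrightarrow> int (A $ i) = int (B $ i)) \<and>
      (\<forall>A B. q A \<noteq> \<zero> \<longrightarrow> q B \<noteq> \<zero> \<longrightarrow> int (A $ i) = int (B $ i))" if "c i = 0" for i
  proof (rule const[of "\<lambda>A. int (A $ i)"])
    fix A B assume "on_line c A B"
    then obtain k where "int (B $ i) = int (A $ i) + k * c i" unfolding on_line_def by blast
    then show "int (A $ i) = int (B $ i)" using that by simp
  qed simp
  have pair: "(\<forall>A B. p A \<noteq> \<zero> \<longrightarrow> p B \<noteq> \<zero> \<longrightarrow>
        - c j * int (A $ i) + c i * int (A $ j) = - c j * int (B $ i) + c i * int (B $ j)) \<and>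
      (\<forall>A B. q A \<noteq> \<zero> \<longrightarrow> q B \<noteq> \<zero> \<longrightarrow>
        - c j * int (A $ i) + c i * int (A $ j) = - c j * int (B $ i) + c i * int (B $ j))" for i j
    by (rule const[of "\<lambda>A. - c j * int (A $ i) + c i * int (A $ j)"])
      (auto simp: on_line_def algebra_simps)
  have wt: "(\<forall>A B. p A \<noteq> \<zero> \<longrightarrow> p B \<noteq> \<zero> \<longrightarrow> int (weight (edge_weight c) A) = int (weight (edge_weight c) B)) \<and>
      (\<forall>A B. q A \<noteq> \<zero> \<longrightarrow> q B \<noteq> \<zero> \<longrightarrow> int (weight (edge_weight c) A) = int (weight (edge_weight c) B))"
  proof (rule const)
    show "int (weight (edge_weight c) (A + B)) = int (weight (edge_weight c) A) + int (weight (edge_weight c) B)" for A B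
      by (simp only: weight_add of_nat_add)
    show "int (weight (edge_weight c) A) = int (weight (edge_weight c) B)" if "on_line c A B" for A B
      using that weight_edge_translate[of B A _ c] unfolding on_line_def by metis
  qed
  have concl: "on_line c A B"
    if "\<And>i. c i = 0 \<Longrightarrow> int (A $ i) = int (B $ i)"
      "\<And>i j. - c j * int (A $ i) + c i * int (A $ j) = - c j * int (B $ i) + c i * int (B $ j)"
      "int (weight (edge_weight c) A) = int (weight (edge_weight c) B)" for A B
  proof (rule loose_cone_weight(2)[OF _ c])
    show "B \<in> loose_cone c A" unfolding loose_cone_def
    proof (intro CollectI conjI allI impI)
      show "A $ i \<le> B $ i" if "c i = 0" for i using \<open>\<And>i. c i = 0 \<Longrightarrow> int (A $ i) = int (B $ i)\<close>[OF that] by simp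
      show "0 \<le> - c j * (int (B $ i) - int (A $ i)) + c i * (int (B $ j) - int (A $ j))" for i j
        using that(2)[of j i] by (simp add: algebra_simps)
    qed
    show "weight (edge_weight c) B = weight (edge_weight c) A" using that(3) by linarith
  qed
  show "p A \<noteq> \<zero> \<Longrightarrow> p B \<noteq> \<zero> \<Longrightarrow> on_line c A B"
    by (rule concl) (use coord pair wt in blast)+
  show "q A \<noteq> \<zero> \<Longrightarrow> q B \<noteq> \<zero> \<Longrightarrow> on_line c A B"
    by (rule concl) (use coord pair wt in blast)+
qed

text \<open>Measured from the exponent lowest in a coordinate where \<open>c\<close> is positive,
  all line parameters are natural numbers bounded by that of the highest exponent.\<close>

lemma on_line_endpoints:
  fixes c :: "'n::finite \<Rightarrow> int"
  assumes c: "0 < c p" and S: "finite S" "S \<noteq> {}" and line: "\<And>A B. A \<in> S \<Longrightarrow> B \<in> S \<Longrightarrow> on_line c A B"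
  shows "\<exists>\<alpha>\<in>S. \<exists>\<omega>\<in>S. \<exists>d::nat. (\<forall>i. int (\<omega> $ i) = int (\<alpha> $ i) + int d * c i) \<and>
    (\<forall>A\<in>S. \<exists>k\<le>d. \<forall>i. int (A $ i) = int (\<alpha> $ i) + int k * c i)"
proof -
  define \<alpha> where "\<alpha> = arg_min_on (\<lambda>A. A $ p) S"
  have \<alpha>: "\<alpha> \<in> S" "\<And>A. A \<in> S \<Longrightarrow> \<alpha> $ p \<le> A $ p"
    using arg_min_if_finite(1)[OF S, of "\<lambda>A. A $ p"] arg_min_least[OF S, of _ "\<lambda>A. A $ p"] by (auto simp: \<alpha>_def)
  obtain \<omega> where \<omega>: "\<omega> \<in> S" "\<forall>A\<in>S. A $ p \<le> \<omega> $ p"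
    using lexicographic_maximum[OF S, of "\<lambda>A. A $ p" "\<lambda>_. 0::nat"] by blast
  have k: "\<exists>k::nat. \<forall>i. int (A $ i) = int (\<alpha> $ i) + int k * c i" if A: "A \<in> S" for A
  proof -
    obtain k where k: "\<forall>i. int (A $ i) = int (\<alpha> $ i) + k * c i" using line[OF \<alpha>(1) A] by (auto simp: on_line_def)
    have "0 \<le> k * c p" using k \<alpha>(2)[OF A] by (metis add_le_cancel_left add.right_neutral of_nat_le_iff)
    then have "0 \<le> k" using c by (simp add: zero_le_mult_iff)
    then show ?thesis using k by (intro exI[of _ "nat k"]) simp
  qed
  obtain d :: nat where d: "\<forall>i. int (\<omega> $ i) = int (\<alpha> $ i) + int d * c i" using k[OF \<omega>(1)] by blast
  have "\<exists>k\<le>d. \<forall>i. int (A $ i) = int (\<alpha> $ i) + int k * c i" if A: "A \<in> S" for A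
  proof -
    obtain j :: nat where j: "\<forall>i. int (A $ i) = int (\<alpha> $ i) + int j * c i" using k[OF A] by blast
    have "int (A $ p) \<le> int (\<omega> $ p)" using \<omega>(2) A by auto
    then have "int j * c p \<le> int d * c p" using j d by simp
    then have "j \<le> d" using c by simp
    then show ?thesis using j by blast
  qed
  then show ?thesis using \<alpha>(1) \<omega>(1) d by blast
qed

lemma segment_nonneg:
  fixes a c :: int
  assumes "0 \<le> a" "0 \<le> a + int d * c" "k \<le> d"
  shows "0 \<le> a + int k * c"
proof (cases "0 \<le> c")
  case False
  then have "int d * c \<le> int k * c" using assms(3) by (simp add: mult_right_mono_neg)
  then show ?thesis using assms(2) by linarith
qed (use assms in simp)

lemma (in cring) line_poly_representation:
  assumes c: "c p \<noteq> 0" and G: "G \<in> carrier (mpoly_ring R)"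
    and line: "\<And>A. G A \<noteq> \<zero> \<Longrightarrow> \<exists>k\<le>d. \<forall>i. int (A $ i) = int (\<alpha> $ i) + int k * c i"
    and nonneg: "\<And>i. 0 \<le> int (\<alpha> $ i) + int d * c i"
  shows "\<exists>F\<in>carrier (UP R). G = line_poly c (\<lambda>i. int (\<alpha> $ i)) F \<and> (\<forall>k>d. F k = \<zero>)"
proof -
  define b where "b k = (\<chi> i. nat (int (\<alpha> $ i) + int k * c i))" for k :: nat
  have b: "int (b k $ i) = int (\<alpha> $ i) + int k * c i" if "k \<le> d" for k i
    using segment_nonneg[OF _ nonneg that, of i] by (simp add: b_def)
  define F where "F k = (if k \<le> d then G (b k) else \<zero>)" for k
  have "F \<in> carrier (UP R)"
    using mpoly_carrierD(1)[OF G] by (auto simp: UP_def up_def F_def bound_def intro!: exI[of _ d])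
  moreover have "G A = line_poly c (\<lambda>i. int (\<alpha> $ i)) F A" for A
  proof (cases "\<exists>k\<le>d. \<forall>i. int (A $ i) = int (\<alpha> $ i) + int k * c i")
    case True
    then obtain k where k: "k \<le> d" "\<And>i. int (A $ i) = int (\<alpha> $ i) + int k * c i" by blast
    have "A $ i = b k $ i" for i using k(2)[of i] b[OF k(1), of i] by linarith
    then have "A = b k" by (simp add: vec_eq_iff)
    then show ?thesis using line_poly_at[where c=c and p=p, OF c k(2), of F] k(1) by (simp add: F_def)
  next
    case False
    then have "G A = \<zero>" using line by blast
    moreover have "line_poly c (\<lambda>i. int (\<alpha> $ i)) F A = \<zero>"
    proof (rule ccontr)
      assume "line_poly c (\<lambda>i. int (\<alpha> $ i)) F A \<noteq> \<zero>"
      then obtain k where "F k \<noteq> \<zero>" "\<forall>i. int (A $ i) = int (\<alpha> $ i) + int k * c i"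
        using line_poly_nonzeroD[where c=c and p=p, OF c] by blast
      then show False using False by (auto simp: F_def split: if_splits)
    qed
    ultimately show ?thesis by simp
  qed
  ultimately show ?thesis by (intro bexI[of _ F]) (auto simp: F_def)
qed

section \<open>Coprimality and the shifted Bezout identity on a line\<close>

context UP_field
begin

lemma coeff_apply: "f \<in> carrier P \<Longrightarrow> coeff P f k = f k"
  by (simp add: P_def UP_def)

lemma coeff_nonzero_le_deg: "f \<in> carrier P \<Longrightarrow> f k \<noteq> \<zero> \<Longrightarrow> k \<le> deg R f"
  using deg_aboveD[of f k] coeff_apply[of f k] by (cases "deg R f < k") auto

text \<open>A factor becomes a polynomial on the line only after multiplication by a monomial. The
  exponent used is zero where \<open>c i\<close> is not negative, and otherwise just large enough
  for \<open>deg R D\<close> steps downwards. The rest of \<open>\<alpha>\<close> suffices for the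
  cofactor because degrees add.\<close>

lemma line_poly_divides:
  assumes c: "0 < c p" "c q < 0" and D: "D \<in> carrier P" "D \<noteq> \<zero>\<^bsub>P\<^esub>"
    and f: "f \<in> carrier P" "f \<noteq> \<zero>\<^bsub>P\<^esub>" "D divides\<^bsub>P\<^esub> f"
    and \<alpha>: "\<And>i. 0 \<le> \<alpha> i" "\<And>i. 0 \<le> \<alpha> i + int (deg R f) * c i"
  shows "R.line_poly c (\<lambda>i. if c i < 0 then - int (deg R D) * c i else 0) D divides\<^bsub>mpoly_ring R\<^esub> R.line_poly c \<alpha> f"
proof -
  define a where "a i = (if c i < 0 then - int (deg R D) * c i else 0)" for i
  obtain Q where Q: "Q \<in> carrier P" "f = D \<otimes>\<^bsub>P\<^esub> Q" using f(3) by (auto simp: factor_def)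
  have Q0: "Q \<noteq> \<zero>\<^bsub>P\<^esub>" using Q f(2) D(1) by auto
  have deg: "deg R f = deg R D + deg R Q" unfolding Q(2) by (rule deg_mult[OF D(2) Q0 D(1) Q(1)])
  have cp: "c p \<noteq> 0" using c by simp
  have v1: "0 \<le> a i + int k * c i" if "D k \<noteq> \<zero>" for k i
  proof (rule segment_nonneg[OF _ _ coeff_nonzero_le_deg[OF D(1) that]])
    show "0 \<le> a i" by (auto simp: a_def mult_nonneg_nonpos)
    show "0 \<le> a i + int (deg R D) * c i" by (auto simp: a_def)
  qed
  have v2: "0 \<le> \<alpha> i - a i + int k * c i" if "Q k \<noteq> \<zero>" for k i
  proof (cases "c i < 0")
    case True
    have k: "deg R D + k \<le> deg R f" using coeff_nonzero_le_deg[OF Q(1) that] deg by simp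
    show ?thesis using segment_nonneg[OF \<alpha>(1) \<alpha>(2) k, of i] True by (simp add: a_def distrib_right)
  next
    case False
    then show ?thesis using \<alpha>(1)[of i] by (simp add: a_def)
  qed
  have "R.line_poly c a D \<otimes>\<^bsub>mpoly_ring R\<^esub> R.line_poly c (\<lambda>i. \<alpha> i - a i) Q = R.line_poly c (\<lambda>i. a i + (\<alpha> i - a i)) (D \<otimes>\<^bsub>UP R\<^esub> Q)"
    by (rule R.line_poly_mult[where c=c and p=p, OF cp]) (use D(1) Q(1) v1 v2 in \<open>simp_all add: P_def\<close>)
  then have "R.line_poly c \<alpha> f = R.line_poly c a D \<otimes>\<^bsub>mpoly_ring R\<^esub> R.line_poly c (\<lambda>i. \<alpha> i - a i) Q"
    using Q(2) by (simp add: P_def)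
  moreover have "R.line_poly c (\<lambda>i. \<alpha> i - a i) Q \<in> carrier (mpoly_ring R)"
    by (rule R.line_poly_in_carrier[where c=c and p=p, OF cp]) (use Q(1) in \<open>simp add: P_def\<close>)
  ultimately show ?thesis unfolding a_def[symmetric, abs_def] factor_def by blast
qed

text \<open>A common factor of positive degree would lift to a common factor whose support avoids the
  exponent \<open>0\<close>.\<close>

lemma coprime_line_polys_bezout:
  assumes c: "0 < c p" "c q < 0"
    and f: "f \<in> carrier P" "coeff P f 0 \<noteq> \<zero>" and \<alpha>: "\<And>i. 0 \<le> \<alpha> i" "\<And>i. 0 \<le> \<alpha> i + int (deg R f) * c i"
    and g: "g \<in> carrier P" "g \<noteq> \<zero>\<^bsub>P\<^esub>" and \<beta>: "\<And>i. 0 \<le> \<beta> i" "\<And>i. 0 \<le> \<beta> i + int (deg R g) * c i"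
    and cop: "coprime_elements (mpoly_ring R) (R.line_poly c \<alpha> f) (R.line_poly c \<beta> g)"
  shows "\<exists>a\<in>carrier P. \<exists>b\<in>carrier P. f \<otimes>\<^bsub>P\<^esub> a \<oplus>\<^bsub>P\<^esub> g \<otimes>\<^bsub>P\<^esub> b = \<one>\<^bsub>P\<^esub>"
proof (rule UP_bezout[OF f(1) _ g(1)])
  show fnz: "f \<noteq> \<zero>\<^bsub>P\<^esub>" using f(2) by auto
  fix D assume D: "D \<in> carrier P" "D divides\<^bsub>P\<^esub> f" "D divides\<^bsub>P\<^esub> g"
  have cp: "c p \<noteq> 0" using c by simp
  have D0: "D \<noteq> \<zero>\<^bsub>P\<^esub>" using D(2) fnz by (auto simp: factor_def)
  define a where "a i = (if c i < 0 then - int (deg R D) * c i else 0)" for i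
  define D' where "D' = R.line_poly c a D"
  have D'c: "D' \<in> carrier (mpoly_ring R)" unfolding D'_def
    by (rule R.line_poly_in_carrier[where c=c and p=p, OF cp]) (use D(1) in \<open>simp add: P_def\<close>)
  have "D' divides\<^bsub>mpoly_ring R\<^esub> R.line_poly c \<alpha> f" unfolding D'_def a_def[abs_def]
    by (rule line_poly_divides[where c=c and p=p, OF c D(1) D0 f(1) fnz D(2) \<alpha>])
  moreover have "D' divides\<^bsub>mpoly_ring R\<^esub> R.line_poly c \<beta> g" unfolding D'_def a_def[abs_def]
    by (rule line_poly_divides[where c=c and p=p, OF c D(1) D0 g D(3) \<beta>])
  ultimately have "D' \<in> Units (mpoly_ring R)" using cop D'c by (auto simp: coprime_elements_def)
  then obtain E where E: "E \<in> carrier (mpoly_ring R)" "D' \<otimes>\<^bsub>mpoly_ring R\<^esub> E = \<one>\<^bsub>mpoly_ring R\<^esub>"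
    by (auto simp: Units_def)
  \<comment> \<open>Compare coefficients at exponent 0: the unit \<open>D'\<close> must have 0 in
    its support. The entry at \<open>p\<close> forces index 0, and then the base exponent at
    \<open>q\<close>, which is \<open>deg R D\<close> times \<open>- c q\<close>, must
    vanish.\<close>
  have "(D' \<otimes>\<^bsub>mpoly_ring R\<^esub> E) 0 \<noteq> \<zero>" unfolding E(2) by (simp add: mpoly_ring_def)
  then have "\<exists>B C. B + C = 0 \<and> D' B \<noteq> \<zero> \<and> E C \<noteq> \<zero>"
    by (rule R.mpoly_mult_nonzeroD[OF R.mpoly_carrierD(1)[OF D'c] R.mpoly_carrierD(1)[OF E(1)]])
  then obtain B C where BC: "B + C = 0" "D' B \<noteq> \<zero>" by blast
  obtain k where k: "\<And>i. int (B $ i) = a i + int k * c i"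
    using R.line_poly_nonzeroD[where c=c and p=p, OF cp BC(2)[unfolded D'_def]] by blast
  have B0: "B $ i = 0" for i
  proof -
    have "(B + C) $ i = 0" unfolding BC(1) by simp
    then show ?thesis by simp
  qed
  have "k = 0" using k[of p] B0[of p] c by (simp add: a_def)
  then have "a q = 0" using k[of q] B0[of q] by simp
  then show "deg R D = 0" using c by (simp add: a_def)
qed

text \<open>Multiplying by a power of the parameter of the line shifts the Bezout identity to the
  exponent \<open>\<gamma>\<close>.  The shift \<open>j0\<close> is the least one for which the exponents of \<open>V\<close> are
  nonnegative at the coordinates where \<open>c\<close> is positive; since \<open>V\<close> may be reduced to fewer than
  \<open>deg R f\<close> terms, \<open>\<gamma>\<close> lying in the cone makes them nonnegative at the other coordinates too.\<close>

lemma line_combination: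
  fixes \<gamma> :: "nat ^ 'n::finite"
  assumes c: "0 < c p" "c q < 0"
    and f: "f \<in> carrier P" "coeff P f 0 \<noteq> \<zero>"
    and \<alpha>: "\<And>i. 0 \<le> c i \<Longrightarrow> \<alpha> i = 0" "\<And>i. c i < 0 \<Longrightarrow> \<alpha> i = - int (deg R f) * c i"
    and g: "g \<in> carrier P" and \<beta>: "\<And>i. 0 \<le> \<beta> i" "\<And>i. 0 \<le> \<beta> i + int (deg R g) * c i"
    and bez: "\<exists>a\<in>carrier P. \<exists>b\<in>carrier P. f \<otimes>\<^bsub>P\<^esub> a \<oplus>\<^bsub>P\<^esub> g \<otimes>\<^bsub>P\<^esub> b = \<one>\<^bsub>P\<^esub>"
    and \<gamma>0: "\<And>i. c i = 0 \<Longrightarrow> \<beta> i \<le> int (\<gamma> $ i)"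
    and \<gamma>: "\<And>i j. 0 < c i \<Longrightarrow> c j < 0 \<Longrightarrow>
      0 \<le> - c j * (int (\<gamma> $ i) - \<beta> i) + c i * (int (\<gamma> $ j) - \<alpha> j - \<beta> j)"
  shows "\<exists>U\<in>carrier (mpoly_ring R). \<exists>V\<in>carrier (mpoly_ring R).
    (\<forall>A. (R.line_poly c \<alpha> f \<otimes>\<^bsub>mpoly_ring R\<^esub> U) A \<oplus> (R.line_poly c \<beta> g \<otimes>\<^bsub>mpoly_ring R\<^esub> V) A = (if A = \<gamma> then \<one> else \<zero>)) \<and>
    (\<forall>A. U A \<noteq> \<zero> \<longrightarrow> (\<exists>k. \<forall>i. int (A $ i) + \<alpha> i = int (\<gamma> $ i) + k * c i)) \<and>
    (\<forall>A. V A \<noteq> \<zero> \<longrightarrow> (\<exists>k. \<forall>i. int (A $ i) + \<beta> i = int (\<gamma> $ i) + k * c i))"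
proof -
  define d where "d = deg R f"
  define e where "e = deg R g"
  \<comment> \<open>For a coordinate with \<open>c i\<close> positive, the least shift making the
    exponent of the second cofactor nonnegative there: a rounded-up quotient, written as the
    negative of a rounded-down one.\<close>
  define T where "T = (\<lambda>i. - ((int (\<gamma> $ i) - \<beta> i) div c i)) ` {i. 0 < c i}"
  have T: "finite T" "T \<noteq> {}" using c by (auto simp: T_def)
  define j0 where "j0 = (if d = 0 then 0 else Max T)"
  \<comment> \<open>Positions on the line are counted from \<open>\<gamma>\<close> at 0. The product
    with the second cofactor occupies positions from \<open>j0\<close> to at most
    \<open>j0 + int d - 1 + int e\<close>, so everything lies between \<open>lo\<close> and
    \<open>hi\<close>. For \<open>d = 0\<close> that cofactor vanishes and 0 is the default for both
    bounds.\<close>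
  define lo where "lo = min 0 j0"
  define hi where "hi = (if d = 0 then 0 else max 0 (j0 + int d - 1 + int e))"
  have j0_pos: "0 \<le> int (\<gamma> $ i) - \<beta> i + j0 * c i" if d: "d \<noteq> 0" and i: "0 < c i" for i
  proof -
    have "- ((int (\<gamma> $ i) - \<beta> i) div c i) \<le> j0" using T i d by (auto simp: j0_def T_def)
    then have "- ((int (\<gamma> $ i) - \<beta> i) div c i) * c i \<le> j0 * c i" by (rule mult_right_mono) (use i in simp)
    moreover have "(int (\<gamma> $ i) - \<beta> i) div c i * c i \<le> int (\<gamma> $ i) - \<beta> i"
      using div_mult_mod_eq[of "int (\<gamma> $ i) - \<beta> i" "c i"] pos_mod_sign[OF i, of "int (\<gamma> $ i) - \<beta> i"] by linarith
    ultimately show ?thesis by linarith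
  qed
  \<comment> \<open>The maximum \<open>j0\<close> comes from some coordinate \<open>i\<close>, where
    rounding leaves a remainder below \<open>c i\<close>. The cone inequality for \<open>i\<close>
    and \<open>j\<close> would give nonnegativity with remainder; the bound on the remainder pays
    for ending at position \<open>d - 1\<close> instead of \<open>d\<close>.\<close>
  have j0_neg: "0 \<le> int (\<gamma> $ j) - \<beta> j + (j0 + int d - 1) * c j" if d: "d \<noteq> 0" and j: "c j < 0" for j
  proof -
    have "j0 \<in> T" using T d by (simp add: j0_def)
    then obtain i where i: "0 < c i" "j0 = - ((int (\<gamma> $ i) - \<beta> i) div c i)" by (auto simp: T_def)
    define r where "r = (int (\<gamma> $ i) - \<beta> i) mod c i"
    have r: "int (\<gamma> $ i) - \<beta> i = - j0 * c i + r" "r < c i"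
      using div_mult_mod_eq[of "int (\<gamma> $ i) - \<beta> i" "c i"] pos_mod_bound[OF i(1)] by (auto simp: r_def i(2))
    have "0 \<le> - c j * (- j0 * c i + r) + c i * (int (\<gamma> $ j) - \<alpha> j - \<beta> j)" using \<gamma>[OF i(1) j] r(1) by simp
    moreover have "- c j * r \<le> - c j * c i" by (rule mult_left_mono) (use r j in auto)
    ultimately have "0 \<le> c i * (int (\<gamma> $ j) - \<beta> j + (j0 + int d - 1) * c j)"
      unfolding \<alpha>(2)[OF j] d_def by (simp add: algebra_simps)
    then show ?thesis using i(1) by (simp add: zero_le_mult_iff)
  qed
  \<comment> \<open>Subtracting \<open>lo\<close> turns positions into polynomial degrees:
    \<open>K\<close> bounds all degrees, \<open>j\<close> is the shift of \<open>g\<close>, and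
    \<open>s\<close> is the degree representing \<open>\<gamma>\<close>.\<close>
  define K where "K = nat (hi - lo)"
  define j where "j = nat (j0 - lo)"
  define s where "s = nat (- lo)"
  have ints: "int K = hi - lo" "int j = j0 - lo" "int s = - lo" by (auto simp: K_def j_def s_def lo_def hi_def)
  define F where "F = monom P \<one> s"
  have F: "F \<in> carrier P" by (simp add: F_def)
  have "deg R F \<le> s" unfolding F_def using deg_monom_le[of \<one> s] by simp
  also have "s \<le> K" using ints by (simp add: hi_def split: if_splits)
  finally have FK: "deg R F \<le> K" .
  have jK: "j + deg R g + deg R f \<le> Suc K" if "0 < deg R f"
    using ints that by (simp add: hi_def d_def e_def split: if_splits)
  obtain C B where CB: "C \<in> carrier P" "B \<in> carrier P" "F = f \<otimes>\<^bsub>P\<^esub> C \<oplus>\<^bsub>P\<^esub> (monom P \<one> j \<otimes>\<^bsub>P\<^esub> g) \<otimes>\<^bsub>P\<^esub> B"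
    "\<And>i. coeff P B i \<noteq> \<zero> \<Longrightarrow> i < d" "\<And>i. coeff P C i \<noteq> \<zero> \<Longrightarrow> i + d \<le> K"
    using UP_bezout_degree[OF f g bez F FK jK] unfolding d_def by blast
  define B' where "B' = monom P \<one> j \<otimes>\<^bsub>P\<^esub> B"
  have B': "B' \<in> carrier P" using CB by (simp add: B'_def)
  have B'k: "\<exists>t<d. k = t + j" if "B' k \<noteq> \<zero>" for k
  proof -
    have "coeff P B' k \<noteq> \<zero>" using that coeff_apply[OF B'] by simp
    then have nz: "(\<Oplus>i\<in>{..k}. coeff P (monom P \<one> j) i \<otimes> coeff P B (k - i)) \<noteq> \<zero>"
      using CB(2) coeff_mult[of "monom P \<one> j" B k] by (simp add: B'_def)
    have "\<exists>i\<le>k. coeff P (monom P \<one> j) i \<otimes> coeff P B (k - i) \<noteq> \<zero>"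
      using R.add.finprod_one_eqI[of "{..k}" "\<lambda>i. coeff P (monom P \<one> j) i \<otimes> coeff P B (k - i)"] nz by blast
    then obtain i where i: "i \<le> k" "coeff P (monom P \<one> j) i \<otimes> coeff P B (k - i) \<noteq> \<zero>" by blast
    then have "i = j" "coeff P B (k - i) \<noteq> \<zero>" using CB(2) by (auto split: if_splits)
    then show ?thesis using CB(4) i(1) by (intro exI[of _ "k - j"]) auto
  qed
  have Feq: "F = f \<otimes>\<^bsub>P\<^esub> C \<oplus>\<^bsub>P\<^esub> g \<otimes>\<^bsub>P\<^esub> B'"
    unfolding CB(3) B'_def using f(1) g CB(1,2) by (simp add: P.m_ac)
  have cp: "c p \<noteq> 0" using c by simp
  define \<delta>U where "\<delta>U i = int (\<gamma> $ i) + lo * c i - \<alpha> i" for i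
  define \<delta>V where "\<delta>V i = int (\<gamma> $ i) + lo * c i - \<beta> i" for i
  have vU: "0 \<le> \<delta>U i + int k * c i" if nz: "C k \<noteq> \<zero>" for k i
  proof -
    have k: "int k \<le> hi - lo - int d" using CB(5)[of k] nz coeff_apply[OF CB(1)] ints(1) by simp
    consider "c i = 0" | "0 < c i" | "c i < 0" by linarith
    then show ?thesis
    proof cases
      case 1
      then show ?thesis using \<alpha>(1)[of i] by (simp add: \<delta>U_def)
    next
      case 2
      have "0 \<le> int (\<gamma> $ i) + lo * c i"
        using j0_pos[OF _ 2] \<beta>(1)[of i] by (auto simp: lo_def min_def j0_def split: if_splits)
      then show ?thesis using 2 \<alpha>(1)[of i] by (simp add: \<delta>U_def)
    next
      case 3
      have "hi * c i \<le> (lo + int k + int d) * c i" by (rule mult_right_mono_neg) (use k 3 in auto)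
      \<comment> \<open>The exponent at the top position is the sum of the last exponent allowed for
        the second cofactor and the last exponent of the line polynomial of \<open>g\<close>, both
        nonnegative.\<close>
      moreover have "0 \<le> int (\<gamma> $ i) + hi * c i"
      proof (cases "hi = 0")
        case False
        then have dh: "d \<noteq> 0" "hi = j0 + int d - 1 + int e" by (auto simp: hi_def max_def split: if_splits)
        show ?thesis using j0_neg[OF dh(1) 3] \<beta>(2)[of i] unfolding dh(2) e_def by (simp add: algebra_simps)
      qed simp
      ultimately show ?thesis unfolding \<delta>U_def \<alpha>(2)[OF 3] d_def by (simp add: algebra_simps)
    qed
  qed
  have vV: "0 \<le> \<delta>V i + int k * c i" if nz: "B' k \<noteq> \<zero>" for k i
  proof -
    obtain t where t: "t < d" "k = t + j" using B'k[OF nz] by blast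
    have "j0 = lo + int j" using ints(2) by simp
    then have k: "\<delta>V i + int k * c i = int (\<gamma> $ i) - \<beta> i + (j0 + int t) * c i"
      using t(2) by (simp add: \<delta>V_def algebra_simps)
    have d: "d \<noteq> 0" using t by simp
    consider "c i = 0" | "0 < c i" | "c i < 0" by linarith
    then show ?thesis
    proof cases
      case 1
      then show ?thesis unfolding k using \<gamma>0[of i] by simp
    next
      case 2
      have "0 \<le> int t * c i" using 2 by simp
      then show ?thesis unfolding k using j0_pos[OF d 2] by (simp add: distrib_right)
    next
      case 3
      have "(j0 + int d - 1) * c i \<le> (j0 + int t) * c i" by (rule mult_right_mono_neg) (use t 3 in auto)
      then show ?thesis unfolding k using j0_neg[OF d 3] by linarith
    qed
  qed
  define U where "U = R.line_poly c \<delta>U C"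
  define V where "V = R.line_poly c \<delta>V B'"
  have UV: "U \<in> carrier (mpoly_ring R)" "V \<in> carrier (mpoly_ring R)" unfolding U_def V_def
    by (rule R.line_poly_in_carrier[where c=c and p=p, OF cp]; use CB(1) B' in \<open>simp add: P_def\<close>)+
  have v\<alpha>: "0 \<le> \<alpha> i + int k * c i" if "f k \<noteq> \<zero>" for k i
  proof (rule segment_nonneg[OF _ _ coeff_nonzero_le_deg[OF f(1) that]])
    show "0 \<le> \<alpha> i" using \<alpha>[of i] by (cases "0 \<le> c i") (auto simp: mult_nonneg_nonpos)
    show "0 \<le> \<alpha> i + int (deg R f) * c i" using \<alpha>[of i] by (cases "0 \<le> c i") auto
  qed
  have v\<beta>: "0 \<le> \<beta> i + int k * c i" if "g k \<noteq> \<zero>" for k i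
    by (rule segment_nonneg[OF \<beta> coeff_nonzero_le_deg[OF g that]])
  define \<delta> where "\<delta> i = int (\<gamma> $ i) + lo * c i" for i
  have GU: "R.line_poly c \<alpha> f \<otimes>\<^bsub>mpoly_ring R\<^esub> U = R.line_poly c (\<lambda>i. \<alpha> i + \<delta>U i) (f \<otimes>\<^bsub>UP R\<^esub> C)" unfolding U_def
    by (rule R.line_poly_mult[where c=c and p=p, OF cp]) (use f(1) CB(1) v\<alpha> vU in \<open>simp_all add: P_def\<close>)
  have HV: "R.line_poly c \<beta> g \<otimes>\<^bsub>mpoly_ring R\<^esub> V = R.line_poly c (\<lambda>i. \<beta> i + \<delta>V i) (g \<otimes>\<^bsub>UP R\<^esub> B')" unfolding V_def
    by (rule R.line_poly_mult[where c=c and p=p, OF cp]) (use g B' v\<beta> vV in \<open>simp_all add: P_def\<close>)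
  have base: "(\<lambda>i. \<alpha> i + \<delta>U i) = \<delta>" "(\<lambda>i. \<beta> i + \<delta>V i) = \<delta>" by (auto simp: \<delta>U_def \<delta>V_def \<delta>_def)
  have prods: "f \<otimes>\<^bsub>UP R\<^esub> C \<in> carrier (UP R)" "g \<otimes>\<^bsub>UP R\<^esub> B' \<in> carrier (UP R)"
    using P.m_closed[OF f(1) CB(1)] P.m_closed[OF g B'] by (simp_all only: P_def)
  have sum: "(R.line_poly c \<alpha> f \<otimes>\<^bsub>mpoly_ring R\<^esub> U) A \<oplus> (R.line_poly c \<beta> g \<otimes>\<^bsub>mpoly_ring R\<^esub> V) A = R.line_poly c \<delta> F A" for A
    unfolding GU HV base Feq using R.line_poly_add[where c=c and p=p, OF cp prods, of \<delta> A] by (simp add: P_def)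
  have Fk: "F k = (if k = s then \<one> else \<zero>)" for k
    using coeff_apply[OF F, of k] coeff_monom[of \<one> s k] unfolding F_def by auto
  have "R.line_poly c \<delta> F A = (if A = \<gamma> then \<one> else \<zero>)" for A
  proof (cases "A = \<gamma>")
    case True
    have "R.line_poly c \<delta> F \<gamma> = F s"
      by (rule R.line_poly_at[where c=c and p=p, OF cp]) (simp add: \<delta>_def ints(3))
    then show ?thesis using True Fk by simp
  next
    case False
    have "R.line_poly c \<delta> F A = \<zero>"
    proof (rule ccontr)
      assume "R.line_poly c \<delta> F A \<noteq> \<zero>"
      then obtain k where k: "F k \<noteq> \<zero>" "\<And>i. int (A $ i) = \<delta> i + int k * c i"
        using R.line_poly_nonzeroD[where c=c and p=p, OF cp] by blast
      have "k = s" using k(1) Fk by (auto split: if_splits)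
      then have "int (A $ i) = int (\<gamma> $ i)" for i using k(2)[of i] ints(3) by (simp add: \<delta>_def)
      then show False using False by (simp add: vec_eq_iff)
    qed
    then show ?thesis using False by simp
  qed
  moreover have "\<exists>k. \<forall>i. int (A $ i) + \<alpha> i = int (\<gamma> $ i) + k * c i" if nz: "U A \<noteq> \<zero>" for A
  proof -
    obtain k :: nat where "\<And>i. int (A $ i) = \<delta>U i + int k * c i"
      using R.line_poly_nonzeroD[where c=c and p=p, OF cp nz[unfolded U_def]] by blast
    then show ?thesis by (intro exI[of _ "lo + int k"]) (simp add: \<delta>U_def algebra_simps)
  qed
  moreover have "\<exists>k. \<forall>i. int (A $ i) + \<beta> i = int (\<gamma> $ i) + k * c i" if nz: "V A \<noteq> \<zero>" for A
  proof -
    obtain k :: nat where "\<And>i. int (A $ i) = \<delta>V i + int k * c i"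
      using R.line_poly_nonzeroD[where c=c and p=p, OF cp nz[unfolded V_def]] by blast
    then show ?thesis by (intro exI[of _ "lo + int k"]) (simp add: \<delta>V_def algebra_simps)
  qed
  ultimately show ?thesis using UV sum by (intro bexI[of _ U] bexI[of _ V]) auto
qed

end

text \<open>The univariate statement is based at endpoints of the supports, this one at arbitrary
  support exponents \<open>\<alpha>\<close> and \<open>\<beta>\<close>. The change is harmless
  because the cone and the conclusions depend on displacements modulo multiples of \<open>c\<close>
  only.\<close>

lemma (in field) coprime_line_support_combination:
  fixes c :: "'n::finite \<Rightarrow> int" and \<gamma> :: "nat ^ 'n"
  assumes c: "primitive_direction c"
    and G: "G \<in> carrier (mpoly_ring R)" and H: "H \<in> carrier (mpoly_ring R)"
    and line: "\<And>A B. (G \<otimes>\<^bsub>mpoly_ring R\<^esub> H) A \<noteq> \<zero> \<Longrightarrow> (G \<otimes>\<^bsub>mpoly_ring R\<^esub> H) B \<noteq> \<zero> \<Longrightarrow> on_line c A B"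
    and cop: "coprime_elements (mpoly_ring R) G H"
    and var: "\<And>i. \<not> mpoly_var R i divides\<^bsub>mpoly_ring R\<^esub> G"
    and \<alpha>: "G \<alpha> \<noteq> \<zero>" and \<beta>: "H \<beta> \<noteq> \<zero>" and \<gamma>: "\<gamma> \<in> loose_cone c (\<alpha> + \<beta>)"
  shows "\<exists>U\<in>carrier (mpoly_ring R). \<exists>V\<in>carrier (mpoly_ring R).
    (\<forall>A. (G \<otimes>\<^bsub>mpoly_ring R\<^esub> U) A \<oplus> (H \<otimes>\<^bsub>mpoly_ring R\<^esub> V) A = (if A = \<gamma> then \<one> else \<zero>)) \<and>
    (\<forall>A. U A \<noteq> \<zero> \<longrightarrow> (\<exists>k. \<forall>i. int (A $ i) + int (\<alpha> $ i) = int (\<gamma> $ i) + k * c i)) \<and>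
    (\<forall>A. V A \<noteq> \<zero> \<longrightarrow> (\<exists>k. \<forall>i. int (A $ i) + int (\<beta> $ i) = int (\<gamma> $ i) + k * c i))"
proof -
  interpret UP: UP_field R "UP R" by unfold_locales simp
  obtain p q where pq: "0 < c p" "c q < 0" using c by (auto simp: primitive_direction_def)
  have cp: "c p \<noteq> 0" using pq by simp
  note supp = factor_supports_on_line[OF c G _ H _ line]
  have lineG: "on_line c A B" if "G A \<noteq> \<zero>" "G B \<noteq> \<zero>" for A B using supp(1) that \<beta> by blast
  have lineH: "on_line c A B" if "H A \<noteq> \<zero>" "H B \<noteq> \<zero>" for A B using supp(2) that \<alpha> by blast
  have "\<exists>\<alpha>\<in>{A. G A \<noteq> \<zero>}. \<exists>\<omega>\<in>{A. G A \<noteq> \<zero>}. \<exists>d::nat. (\<forall>i. int (\<omega> $ i) = int (\<alpha> $ i) + int d * c i) \<and>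
    (\<forall>A\<in>{A. G A \<noteq> \<zero>}. \<exists>k\<le>d. \<forall>i. int (A $ i) = int (\<alpha> $ i) + int k * c i)"
    by (rule on_line_endpoints[where c=c and p=p, OF pq(1) mpoly_carrierD(2)[OF G]]) (use lineG \<alpha> in auto)
  then obtain \<alpha>0 \<omega> d where G0': "\<alpha>0 \<in> {A. G A \<noteq> \<zero>}" "\<omega> \<in> {A. G A \<noteq> \<zero>}"
    "\<forall>i. int (\<omega> $ i) = int (\<alpha>0 $ i) + int d * c i"
    "\<forall>A\<in>{A. G A \<noteq> \<zero>}. \<exists>k\<le>d. \<forall>i. int (A $ i) = int (\<alpha>0 $ i) + int k * c i" by blast
  have G0: "G \<alpha>0 \<noteq> \<zero>" "G \<omega> \<noteq> \<zero>" "\<And>i. int (\<omega> $ i) = int (\<alpha>0 $ i) + int d * c i"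
    "\<And>A. G A \<noteq> \<zero> \<Longrightarrow> \<exists>k\<le>d. \<forall>i. int (A $ i) = int (\<alpha>0 $ i) + int k * c i"
    using G0' by blast+
  have "\<exists>\<alpha>\<in>{A. H A \<noteq> \<zero>}. \<exists>\<omega>\<in>{A. H A \<noteq> \<zero>}. \<exists>d::nat. (\<forall>i. int (\<omega> $ i) = int (\<alpha> $ i) + int d * c i) \<and>
    (\<forall>A\<in>{A. H A \<noteq> \<zero>}. \<exists>k\<le>d. \<forall>i. int (A $ i) = int (\<alpha> $ i) + int k * c i)"
    by (rule on_line_endpoints[where c=c and p=p, OF pq(1) mpoly_carrierD(2)[OF H]]) (use lineH \<beta> in auto)
  then obtain \<beta>0 \<omega>' e where H0': "\<beta>0 \<in> {A. H A \<noteq> \<zero>}" "\<omega>' \<in> {A. H A \<noteq> \<zero>}"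
    "\<forall>i. int (\<omega>' $ i) = int (\<beta>0 $ i) + int e * c i"
    "\<forall>A\<in>{A. H A \<noteq> \<zero>}. \<exists>k\<le>e. \<forall>i. int (A $ i) = int (\<beta>0 $ i) + int k * c i" by blast
  have H0: "H \<beta>0 \<noteq> \<zero>" "H \<omega>' \<noteq> \<zero>" "\<And>i. int (\<omega>' $ i) = int (\<beta>0 $ i) + int e * c i"
    "\<And>A. H A \<noteq> \<zero> \<Longrightarrow> \<exists>k\<le>e. \<forall>i. int (A $ i) = int (\<beta>0 $ i) + int k * c i"
    using H0' by blast+
  have nonneg: "0 \<le> int (\<alpha>0 $ i) + int d * c i" "0 \<le> int (\<beta>0 $ i) + int e * c i" for i
    unfolding G0(3)[symmetric] H0(3)[symmetric] by simp_all
  obtain F where F: "F \<in> carrier (UP R)" "G = line_poly c (\<lambda>i. int (\<alpha>0 $ i)) F" "\<forall>k>d. F k = \<zero>"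
    using line_poly_representation[where c=c and p=p, OF cp G G0(4) nonneg(1)] by blast
  obtain F' where F': "F' \<in> carrier (UP R)" "H = line_poly c (\<lambda>i. int (\<beta>0 $ i)) F'" "\<forall>k>e. F' k = \<zero>"
    using line_poly_representation[where c=c and p=p, OF cp H H0(4) nonneg(2)] by blast
  have "G \<alpha>0 = F 0" "G \<omega> = F d" "H \<omega>' = F' e" unfolding F(2) F'(2)
    by (rule line_poly_at[where c=c and p=p, OF cp]; simp add: G0(3) H0(3))+
  then have nz: "F 0 \<noteq> \<zero>" "F d \<noteq> \<zero>" "F' e \<noteq> \<zero>" using G0(1,2) H0(2) by simp_all
  have co: "up_ring.coeff (UP R) F k = F k" "up_ring.coeff (UP R) F' k = F' k" for k
    using UP.coeff_apply F(1) F'(1) by blast+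
  have deg: "deg R F = d" "deg R F' = e"
    by (intro antisym UP.deg_aboveI UP.coeff_nonzero_le_deg F(1) F'(1) nz; use F(3) F'(3) co in simp)+
  have F'nz: "F' \<noteq> \<zero>\<^bsub>UP R\<^esub>" using nz(3) by (auto simp: UP_def)
  have cF: "up_ring.coeff (UP R) F 0 \<noteq> \<zero>" using co nz by simp
  have bez: "\<exists>a\<in>carrier (UP R). \<exists>b\<in>carrier (UP R). F \<otimes>\<^bsub>UP R\<^esub> a \<oplus>\<^bsub>UP R\<^esub> F' \<otimes>\<^bsub>UP R\<^esub> b = \<one>\<^bsub>UP R\<^esub>"
    by (rule UP.coprime_line_polys_bezout[where c=c and p=p and q=q, OF pq F(1) cF _ _ F'(1) F'nz _ _ cop[unfolded F(2) F'(2)]])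
      (use nonneg deg in auto)
  \<comment> \<open>No variable divides \<open>G\<close>, so for each coordinate some support
    exponent vanishes there. On a segment this can only pin down an end: the initial one where
    \<open>c i\<close> is not negative, the final one where it is negative.\<close>
  have \<alpha>0: "int (\<alpha>0 $ i) = (if 0 \<le> c i then 0 else - int d * c i)" for i
  proof -
    obtain A where A: "G A \<noteq> \<zero>" "A $ i = 0" using mpoly_not_divisible_by_var[OF G var] by blast
    obtain k where k: "k \<le> d" "int (A $ i) = int (\<alpha>0 $ i) + int k * c i" using G0(4)[OF A(1)] by blast
    show ?thesis
    proof (cases "0 \<le> c i")
      case True
      then have "0 \<le> int k * c i" by simp
      then have "int (\<alpha>0 $ i) = 0" using k(2) A(2) by linarith
      then show ?thesis using True by simp
    next
      case False
      then have "int d * c i \<le> int k * c i" using k(1) by (simp add: mult_right_mono_neg)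
      then have "int (\<alpha>0 $ i) = - (int d * c i)" using k(2) A(2) nonneg(1)[of i] by linarith
      then show ?thesis using False by simp
    qed
  qed
  obtain k1 where k1: "\<And>i. int (\<alpha> $ i) = int (\<alpha>0 $ i) + k1 * c i" using lineG[OF G0(1) \<alpha>] unfolding on_line_def by blast
  obtain k2 where k2: "\<And>i. int (\<beta> $ i) = int (\<beta>0 $ i) + k2 * c i" using lineH[OF H0(1) \<beta>] unfolding on_line_def by blast
  have \<gamma>': "\<gamma> \<in> loose_cone c (\<alpha>0 + \<beta>0)"
    by (rule loose_cone_translate[OF \<gamma>, of _ _ "k1 + k2"]) (simp add: k1 k2 distrib_right)
  have "\<exists>U\<in>carrier (mpoly_ring R). \<exists>V\<in>carrier (mpoly_ring R).
    (\<forall>A. (line_poly c (\<lambda>i. int (\<alpha>0 $ i)) F \<otimes>\<^bsub>mpoly_ring R\<^esub> U) A \<oplus> (line_poly c (\<lambda>i. int (\<beta>0 $ i)) F' \<otimes>\<^bsub>mpoly_ring R\<^esub> V) A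
      = (if A = \<gamma> then \<one> else \<zero>)) \<and>
    (\<forall>A. U A \<noteq> \<zero> \<longrightarrow> (\<exists>k. \<forall>i. int (A $ i) + int (\<alpha>0 $ i) = int (\<gamma> $ i) + k * c i)) \<and>
    (\<forall>A. V A \<noteq> \<zero> \<longrightarrow> (\<exists>k. \<forall>i. int (A $ i) + int (\<beta>0 $ i) = int (\<gamma> $ i) + k * c i))"
  proof (rule UP.line_combination[where c=c and p=p and q=q, OF pq F(1) cF _ _ F'(1) _ _ bez])
    show "0 \<le> c i \<Longrightarrow> int (\<alpha>0 $ i) = 0" "c i < 0 \<Longrightarrow> int (\<alpha>0 $ i) = - int (deg R F) * c i" for i
      using \<alpha>0[of i] deg by auto
    show "0 \<le> int (\<beta>0 $ i) + int (deg R F') * c i" for i using nonneg(2) deg by simp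
    show "int (\<beta>0 $ i) \<le> int (\<gamma> $ i)" if "c i = 0" for i
      using \<gamma>' that \<alpha>0[of i] unfolding loose_cone_def by auto
    show "0 \<le> - c j * (int (\<gamma> $ i) - int (\<beta>0 $ i)) + c i * (int (\<gamma> $ j) - int (\<alpha>0 $ j) - int (\<beta>0 $ j))"
      if ij: "0 < c i" "c j < 0" for i j
    proof -
      have "0 \<le> - c j * (int (\<gamma> $ i) - int ((\<alpha>0 + \<beta>0) $ i)) + c i * (int (\<gamma> $ j) - int ((\<alpha>0 + \<beta>0) $ j))"
        using \<gamma>' ij unfolding loose_cone_def by blast
      moreover have "int ((\<alpha>0 + \<beta>0) $ i) = int (\<beta>0 $ i)" using \<alpha>0[of i] ij by simp
      ultimately show ?thesis by (simp add: algebra_simps)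
    qed
  qed simp
  then obtain U V where UV: "U \<in> carrier (mpoly_ring R)" "V \<in> carrier (mpoly_ring R)"
    "\<And>A. (G \<otimes>\<^bsub>mpoly_ring R\<^esub> U) A \<oplus> (H \<otimes>\<^bsub>mpoly_ring R\<^esub> V) A = (if A = \<gamma> then \<one> else \<zero>)"
    "\<And>A. U A \<noteq> \<zero> \<Longrightarrow> \<exists>k. \<forall>i. int (A $ i) + int (\<alpha>0 $ i) = int (\<gamma> $ i) + k * c i"
    "\<And>A. V A \<noteq> \<zero> \<Longrightarrow> \<exists>k. \<forall>i. int (A $ i) + int (\<beta>0 $ i) = int (\<gamma> $ i) + k * c i"
    unfolding F(2)[symmetric] F'(2)[symmetric] by blast
  have "\<exists>k. \<forall>i. int (A $ i) + int (\<alpha> $ i) = int (\<gamma> $ i) + k * c i" if nz: "U A \<noteq> \<zero>" for A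
  proof -
    obtain k where k: "\<forall>i. int (A $ i) + int (\<alpha>0 $ i) = int (\<gamma> $ i) + k * c i" using UV(4)[OF nz] by blast
    have "int (A $ i) + int (\<alpha> $ i) = int (\<gamma> $ i) + (k + k1) * c i" for i
      using k[rule_format, of i] k1[of i] by (simp only: distrib_right)
    then show ?thesis by blast
  qed
  moreover have "\<exists>k. \<forall>i. int (A $ i) + int (\<beta> $ i) = int (\<gamma> $ i) + k * c i" if nz: "V A \<noteq> \<zero>" for A
  proof -
    obtain k where k: "\<forall>i. int (A $ i) + int (\<beta>0 $ i) = int (\<gamma> $ i) + k * c i" using UV(5)[OF nz] by blast
    have "int (A $ i) + int (\<beta> $ i) = int (\<gamma> $ i) + (k + k2) * c i" for i
      using k[rule_format, of i] k2[of i] by (simp only: distrib_right)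
    then show ?thesis by blast
  qed
  ultimately show ?thesis using UV(1,2,3) by (intro bexI[of _ U] bexI[of _ V]) auto
qed

section \<open>Lifting the factorization along the edge\<close>

context cring_vars
begin

text \<open>A filtration relative to the base point \<open>a\<close>: \<open>w\<close> counts the
  weight in excess of \<open>a\<close>. The restriction to the cone guarantees that every monomial
  in it is accessible to the shifted Bezout identity, which a plain weight ideal would not.\<close>

definition cone_ideal :: "('n \<Rightarrow> int) \<Rightarrow> nat ^ 'n \<Rightarrow> nat \<Rightarrow> 'a set" where
  "cone_ideal c a w = monomial_ideal
     {B \<in> loose_cone c a. weight (edge_weight c) a + w \<le> weight (edge_weight c) B}"

lemma ideal_cone_ideal: "ideal (cone_ideal c a w) R"
  unfolding cone_ideal_def by (rule monomial_ideal_is_ideal)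

lemma pp_in_cone_ideal:
  "B \<in> loose_cone c a \<Longrightarrow> weight (edge_weight c) a + w \<le> weight (edge_weight c) B \<Longrightarrow> pp B \<in> cone_ideal c a w"
  unfolding cone_ideal_def by (intro pp_in_monomial_ideal CollectI conjI)

lemma cone_ideal_antimono: "w \<le> w' \<Longrightarrow> cone_ideal c a w' \<subseteq> cone_ideal c a w"
  unfolding cone_ideal_def by (rule monomial_ideal_mono) auto

lemma cone_ideal_mult:
  assumes "y \<in> cone_ideal c a v" "z \<in> cone_ideal c b w"
  shows "y \<otimes> z \<in> cone_ideal c (a + b) (v + w)"
proof (rule monomial_ideal_mult[OF ideal_cone_ideal _ assms[unfolded cone_ideal_def]])
  fix A B
  assume "A \<in> {B \<in> loose_cone c a. weight (edge_weight c) a + v \<le> weight (edge_weight c) B}"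
    "B \<in> {B \<in> loose_cone c b. weight (edge_weight c) b + w \<le> weight (edge_weight c) B}"
  then have AB: "A \<in> loose_cone c a" "B \<in> loose_cone c b" "weight (edge_weight c) a + v \<le> weight (edge_weight c) A"
    "weight (edge_weight c) b + w \<le> weight (edge_weight c) B" by blast+
  show "pp (A + B) \<in> cone_ideal c (a + b) (v + w)"
    by (rule pp_in_cone_ideal[OF loose_cone_add[OF AB(1,2)]], unfold weight_add, insert AB(3,4), linarith)
qed

lemma cone_ideal_subset_weight_ideal:
  "cone_ideal c a w \<subseteq> weight_ideal (edge_weight c) (weight (edge_weight c) a + w)"
  unfolding cone_ideal_def weight_ideal_def by (rule monomial_ideal_mono) auto

text \<open>An error in the residue class of a coefficient costs at least one more variable. The
  cone is closed upwards and every variable has positive weight, so the excess grows.\<close>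

lemma scaled_pp_in_cone_ideal:
  assumes c: "0 < c p" "c q < 0" and m: "m \<in> Idl (range x)"
    and B: "B \<in> loose_cone c a" "weight (edge_weight c) a + w \<le> weight (edge_weight c) B"
  shows "m \<otimes> pp B \<in> cone_ideal c a (Suc w)"
proof (rule scaled_pp_in_ideal[OF ideal_cone_ideal m])
  fix i
  have "0 < edge_weight c i" by (rule edge_weight_pos[where p=p and q=q, OF c])
  then have "weight (edge_weight c) a + Suc w \<le> weight (edge_weight c) B + weight (edge_weight c) (axis i 1)"
    unfolding weight_axis using B(2) by linarith
  then show "pp (B + axis i 1) \<in> cone_ideal c a (Suc w)"
    unfolding weight_add[symmetric] by (rule pp_in_cone_ideal[OF loose_cone_upward[OF B(1)]])
qed

end

section \<open>The correction step and the Hensel iteration\<close>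

context parameter_ring
begin

lemma field_residue: "field (R Quot mm)"
  by (rule maximalideal.quotient_is_field[OF maximal_mm is_cring])

lemma residue_hom: "ring_hom_cring R (R Quot mm) ((+>) mm)"
  by (rule ideal.rcos_ring_hom_cring[OF ideal_mm is_cring])

lemma residue_closed: "a \<in> carrier R \<Longrightarrow> mm +> a \<in> carrier (R Quot mm)"
  by (auto simp: FactRing_def A_RCOSETS_def')

lemma residue_zero_iff: "a \<in> carrier R \<Longrightarrow> mm +> a = \<zero>\<^bsub>R Quot mm\<^esub> \<longleftrightarrow> a \<in> mm"
  using coset_eq_iff[OF ideal_mm, of a \<zero>] a_coset_add_zero[OF ideal_facts(1)[OF ideal_mm]]
  by (simp add: FactRing_def diff_zero)

lemma residue_mpoly_mult:
  assumes "\<And>A. p A \<in> carrier R" "\<And>A. q A \<in> carrier R"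
  shows "mm +> (p \<otimes>\<^bsub>mpoly_ring R\<^esub> q) A =
    ((\<lambda>A. mm +> p A) \<otimes>\<^bsub>mpoly_ring (R Quot mm)\<^esub> (\<lambda>A. mm +> q A)) A"
proof -
  interpret h: ring_hom_cring R "R Quot mm" "(+>) mm" by (rule residue_hom)
  have "mm +> (p \<otimes>\<^bsub>mpoly_ring R\<^esub> q) A =
      (\<Oplus>\<^bsub>R Quot mm\<^esub>z\<in>{(B, C). B + C = A}. mm +> (p (fst z) \<otimes> q (snd z)))"
    unfolding mpoly_mult_apply by (subst h.hom_finsum) (use assms in \<open>auto simp: o_def\<close>)
  also have "\<dots> = (\<Oplus>\<^bsub>R Quot mm\<^esub>z\<in>{(B, C). B + C = A}. (mm +> p (fst z)) \<otimes>\<^bsub>R Quot mm\<^esub> (mm +> q (snd z)))"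
    by (rule h.S.finsum_cong') (use assms residue_closed in auto)
  finally show ?thesis by (simp add: h.S.mpoly_mult_apply)
qed

text \<open>Zero coefficients are lifted to zero, so the lift has the same, finite, support.\<close>

lemma mpoly_residue_lift:
  assumes G: "G \<in> carrier (mpoly_ring (R Quot mm))"
  shows "\<exists>p. (\<forall>A. p A \<in> carrier R) \<and> (\<forall>A. p A = \<zero> \<longleftrightarrow> G A = \<zero>\<^bsub>R Quot mm\<^esub>) \<and> (\<forall>A. mm +> p A = G A)"
proof -
  have "\<exists>a. a \<in> carrier R \<and> mm +> a = G A" for A
  proof -
    have "G A \<in> carrier (R Quot mm)" using G by (simp add: mpoly_ring_def)
    then show ?thesis by (auto simp: FactRing_def A_RCOSETS_def')
  qed
  then obtain s where s: "\<And>A. s A \<in> carrier R" "\<And>A. mm +> s A = G A" by metis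
  have z: "mm +> \<zero> = \<zero>\<^bsub>R Quot mm\<^esub>" using residue_zero_iff[of \<zero>] ideal_facts(2)[OF ideal_mm] by simp
  have z': "s A = \<zero> \<Longrightarrow> G A = \<zero>\<^bsub>R Quot mm\<^esub>" for A using s(2)[of A] z by metis
  show ?thesis
    by (rule exI[of _ "\<lambda>A. if G A = \<zero>\<^bsub>R Quot mm\<^esub> then \<zero> else s A"]) (use s z in \<open>auto dest: z'\<close>)
qed

text \<open>Elements that can be corrected form an ideal, so monomials suffice. A monomial of excess
  exactly \<open>w\<close> is corrected by lifting the Bezout identity over the residue field; the
  lifted identity fails only by coefficients in the maximal ideal, which raise the excess.\<close>

lemma cone_ideal_step:
  assumes c: "primitive_direction c"
    and p: "\<And>A. p A \<in> carrier R" "finite {A. p A \<noteq> \<zero>}" "\<And>A. p A \<noteq> \<zero> \<Longrightarrow> on_line c \<alpha> A"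
    and q: "\<And>A. q A \<in> carrier R" "finite {A. q A \<noteq> \<zero>}" "\<And>A. q A \<noteq> \<zero> \<Longrightarrow> on_line c \<beta> A"
    and comb: "\<And>\<gamma>. \<gamma> \<in> loose_cone c (\<alpha> + \<beta>) \<Longrightarrow>
      \<exists>U\<in>carrier (mpoly_ring (R Quot mm)). \<exists>V\<in>carrier (mpoly_ring (R Quot mm)).
      (\<forall>A. ((\<lambda>A. mm +> p A) \<otimes>\<^bsub>mpoly_ring (R Quot mm)\<^esub> U) A \<oplus>\<^bsub>R Quot mm\<^esub>
         ((\<lambda>A. mm +> q A) \<otimes>\<^bsub>mpoly_ring (R Quot mm)\<^esub> V) A = (if A = \<gamma> then \<one>\<^bsub>R Quot mm\<^esub> else \<zero>\<^bsub>R Quot mm\<^esub>)) \<and>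
      (\<forall>A. U A \<noteq> \<zero>\<^bsub>R Quot mm\<^esub> \<longrightarrow> (\<exists>k. \<forall>i. int (A $ i) + int (\<alpha> $ i) = int (\<gamma> $ i) + k * c i)) \<and>
      (\<forall>A. V A \<noteq> \<zero>\<^bsub>R Quot mm\<^esub> \<longrightarrow> (\<exists>k. \<forall>i. int (A $ i) + int (\<beta> $ i) = int (\<gamma> $ i) + k * c i))"
    and z: "z \<in> cone_ideal c (\<alpha> + \<beta>) w"
  shows "\<exists>u\<in>cone_ideal c \<beta> w. \<exists>v\<in>cone_ideal c \<alpha> w.
    z \<ominus> (lincomb p {A. p A \<noteq> \<zero>} \<otimes> u \<oplus> lincomb q {A. q A \<noteq> \<zero>} \<otimes> v) \<in> cone_ideal c (\<alpha> + \<beta>) (Suc w)"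
proof -
  define S where "S = {A. p A \<noteq> \<zero>}"
  define T where "T = {A. q A \<noteq> \<zero>}"
  define g where "g = lincomb p S"
  define h where "h = lincomb q T"
  have gh: "g \<in> carrier R" "h \<in> carrier R" unfolding g_def h_def using p(1) q(1) by auto
  obtain r r' where rr: "0 < c r" "c r' < 0" using c by (auto simp: primitive_direction_def)
  note lpos = edge_weight_pos[where p=r and q=r', OF rr]
  define J where "J = {z \<in> carrier R. \<exists>u\<in>cone_ideal c \<beta> w. \<exists>v\<in>cone_ideal c \<alpha> w.
    z \<ominus> (g \<otimes> u \<oplus> h \<otimes> v) \<in> cone_ideal c (\<alpha> + \<beta>) (Suc w)}"
  note I\<alpha> = ideal_facts[OF ideal_cone_ideal[of c \<alpha> w]] and I\<beta> = ideal_facts[OF ideal_cone_ideal[of c \<beta> w]]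
    and I = ideal_facts[OF ideal_cone_ideal[of c "\<alpha> + \<beta>" "Suc w"]]
  have JI: "z \<in> J" if "z \<in> carrier R" "u \<in> cone_ideal c \<beta> w" "v \<in> cone_ideal c \<alpha> w"
    "z \<ominus> (g \<otimes> u \<oplus> h \<otimes> v) \<in> cone_ideal c (\<alpha> + \<beta>) (Suc w)" for z u v using that unfolding J_def by blast
  have J: "ideal J R"
  proof (rule ideal_intro)
    show "J \<subseteq> carrier R" by (auto simp: J_def)
    show "\<zero> \<in> J" by (rule JI[of _ \<zero> \<zero>]) (use I I\<alpha> I\<beta> gh in \<open>auto simp: diff_zero\<close>)
    show "y \<oplus> z \<in> J" if yz: "y \<in> J" "z \<in> J" for y z
    proof -
      obtain u v where uv: "y \<in> carrier R" "u \<in> cone_ideal c \<beta> w" "v \<in> cone_ideal c \<alpha> w"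
        "y \<ominus> (g \<otimes> u \<oplus> h \<otimes> v) \<in> cone_ideal c (\<alpha> + \<beta>) (Suc w)" using yz(1) by (auto simp: J_def)
      obtain u' v' where uv': "z \<in> carrier R" "u' \<in> cone_ideal c \<beta> w" "v' \<in> cone_ideal c \<alpha> w"
        "z \<ominus> (g \<otimes> u' \<oplus> h \<otimes> v') \<in> cone_ideal c (\<alpha> + \<beta>) (Suc w)" using yz(2) by (auto simp: J_def)
      have carr: "u \<in> carrier R" "v \<in> carrier R" "u' \<in> carrier R" "v' \<in> carrier R"
        using uv uv' I\<alpha>(3) I\<beta>(3) by blast+
      have "(y \<oplus> z) \<ominus> (g \<otimes> (u \<oplus> u') \<oplus> h \<otimes> (v \<oplus> v')) =
          (y \<ominus> (g \<otimes> u \<oplus> h \<otimes> v)) \<oplus> (z \<ominus> (g \<otimes> u' \<oplus> h \<otimes> v'))"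
        using uv(1) uv'(1) carr gh by algebra
      then show ?thesis using uv uv' I(4) I\<alpha>(4) I\<beta>(4) by (intro JI[of _ "u \<oplus> u'" "v \<oplus> v'"]) auto
    qed
    show "y \<otimes> z \<in> J" if yz: "z \<in> J" "y \<in> carrier R" for z y
    proof -
      obtain u v where uv: "z \<in> carrier R" "u \<in> cone_ideal c \<beta> w" "v \<in> cone_ideal c \<alpha> w"
        "z \<ominus> (g \<otimes> u \<oplus> h \<otimes> v) \<in> cone_ideal c (\<alpha> + \<beta>) (Suc w)" using yz(1) by (auto simp: J_def)
      have carr: "u \<in> carrier R" "v \<in> carrier R" using uv I\<alpha>(3) I\<beta>(3) by blast+
      have "(y \<otimes> z) \<ominus> (g \<otimes> (y \<otimes> u) \<oplus> h \<otimes> (y \<otimes> v)) = y \<otimes> (z \<ominus> (g \<otimes> u \<oplus> h \<otimes> v))"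
        using uv(1) carr gh yz(2) by algebra
      then show ?thesis using uv yz(2) I(7) I\<alpha>(7) I\<beta>(7) by (intro JI[of _ "y \<otimes> u" "y \<otimes> v"]) auto
    qed
  qed
  have "cone_ideal c (\<alpha> + \<beta>) w \<subseteq> J" unfolding cone_ideal_def
  proof (rule monomial_ideal_least[OF J])
    fix \<gamma> assume "\<gamma> \<in> {B \<in> loose_cone c (\<alpha> + \<beta>). weight (edge_weight c) (\<alpha> + \<beta>) + w \<le> weight (edge_weight c) B}"
    then have \<gamma>: "\<gamma> \<in> loose_cone c (\<alpha> + \<beta>)" "weight (edge_weight c) (\<alpha> + \<beta>) + w \<le> weight (edge_weight c) \<gamma>" by blast+
    show "pp \<gamma> \<in> J"
    proof (cases "weight (edge_weight c) (\<alpha> + \<beta>) + Suc w \<le> weight (edge_weight c) \<gamma>")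
      case True
      then have "pp \<gamma> \<in> cone_ideal c (\<alpha> + \<beta>) (Suc w)" by (rule pp_in_cone_ideal[OF \<gamma>(1)])
      then show ?thesis using I\<alpha>(2) I\<beta>(2) gh by (intro JI[of _ \<zero> \<zero>]) (auto simp: diff_zero)
    next
      case False
      then have w\<gamma>: "weight (edge_weight c) \<gamma> = weight (edge_weight c) \<alpha> + weight (edge_weight c) \<beta> + w"
        using \<gamma>(2) unfolding weight_add by linarith
      from comb[OF \<gamma>(1)] obtain U V where U: "U \<in> carrier (mpoly_ring (R Quot mm))" and V: "V \<in> carrier (mpoly_ring (R Quot mm))"
        and UV: "\<And>A. ((\<lambda>A. mm +> p A) \<otimes>\<^bsub>mpoly_ring (R Quot mm)\<^esub> U) A \<oplus>\<^bsub>R Quot mm\<^esub>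
         ((\<lambda>A. mm +> q A) \<otimes>\<^bsub>mpoly_ring (R Quot mm)\<^esub> V) A = (if A = \<gamma> then \<one>\<^bsub>R Quot mm\<^esub> else \<zero>\<^bsub>R Quot mm\<^esub>)"
        and Us: "\<And>A. U A \<noteq> \<zero>\<^bsub>R Quot mm\<^esub> \<Longrightarrow> \<exists>k. \<forall>i. int (A $ i) + int (\<alpha> $ i) = int (\<gamma> $ i) + k * c i"
        and Vs: "\<And>A. V A \<noteq> \<zero>\<^bsub>R Quot mm\<^esub> \<Longrightarrow> \<exists>k. \<forall>i. int (A $ i) + int (\<beta> $ i) = int (\<gamma> $ i) + k * c i"
        by blast
      obtain u where u: "\<And>A. u A \<in> carrier R" "\<And>A. u A = \<zero> \<longleftrightarrow> U A = \<zero>\<^bsub>R Quot mm\<^esub>" "\<And>A. mm +> u A = U A"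
        using mpoly_residue_lift[OF U] by blast
      obtain v where v: "\<And>A. v A \<in> carrier R" "\<And>A. v A = \<zero> \<longleftrightarrow> V A = \<zero>\<^bsub>R Quot mm\<^esub>" "\<And>A. mm +> v A = V A"
        using mpoly_residue_lift[OF V] by blast
      define SU where "SU = {A. u A \<noteq> \<zero>}"
      define SV where "SV = {A. v A \<noteq> \<zero>}"
      have fin: "finite S" "finite T" "finite SU" "finite SV"
        using p(2) q(2) U V u(2) v(2) by (auto simp: S_def T_def SU_def SV_def mpoly_ring_def)
      \<comment> \<open>Adding \<open>a\<close> brings the exponents to the line through
        \<open>\<gamma>\<close>. Hence, modulo \<open>c\<close>, their displacement from
        \<open>b\<close> is that of \<open>\<gamma>\<close> from \<open>\<alpha> + \<beta>\<close>:
        same cone condition and same excess.\<close>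
      have supp: "lincomb f F \<in> cone_ideal c b w"
        if f: "\<And>A. f A \<in> carrier R" and F: "\<And>A. A \<in> F \<Longrightarrow> \<exists>k. \<forall>i. int (A $ i) + int (a $ i) = int (\<gamma> $ i) + k * c i"
          and ab: "a + b = \<alpha> + \<beta>" for f F a b
      proof (rule lincomb_in_ideal[OF ideal_cone_ideal])
        fix A assume A: "A \<in> F"
        obtain k where k: "\<And>i. int (A $ i) + int (a $ i) = int (\<gamma> $ i) + k * c i" using F[OF A] by blast
        have "int (A $ i) - int (b $ i) = int (\<gamma> $ i) - int ((\<alpha> + \<beta>) $ i) + k * c i" for i
          unfolding ab[symmetric] using k[of i] by simp
        then have 1: "A \<in> loose_cone c b" by (rule loose_cone_translate[OF \<gamma>(1)])
        have "int ((A + a) $ i) = int (\<gamma> $ i) + k * c i" for i using k[of i] by simp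
        from weight_edge_translate[OF this] have "weight (edge_weight c) A + weight (edge_weight c) a = weight (edge_weight c) \<gamma>"
          unfolding weight_add .
        moreover have "weight (edge_weight c) a + weight (edge_weight c) b = weight (edge_weight c) \<alpha> + weight (edge_weight c) \<beta>"
          unfolding weight_add[symmetric] ab ..
        ultimately have "weight (edge_weight c) b + w \<le> weight (edge_weight c) A" using w\<gamma> by linarith
        from pp_in_cone_ideal[OF 1 this] show "f A \<otimes> pp A \<in> cone_ideal c b w"
          by (rule ideal_facts(7)[OF ideal_cone_ideal _ f])
      qed
      have uI: "lincomb u SU \<in> cone_ideal c \<beta> w" by (rule supp[OF u(1), of _ \<alpha>]) (use Us u(2) in \<open>auto simp: SU_def\<close>)
      have vI: "lincomb v SV \<in> cone_ideal c \<alpha> w" by (rule supp[OF v(1), of _ \<beta>]) (use Vs v(2) in \<open>auto simp: SV_def add.commute\<close>)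
      \<comment> \<open>All exponents on the line through \<open>\<gamma>\<close>, which carries
        both products and the target; it is finite because a positive weight is constant on
        it.\<close>
      define W where "W = {A. on_line c \<gamma> A}"
      have weightW: "weight (edge_weight c) A = weight (edge_weight c) \<gamma>" if "A \<in> W" for A
        using that weight_edge_translate[of A \<gamma> _ c] unfolding W_def on_line_def by blast
      have finW: "finite W"
        by (rule finite_subset[OF _ finite_weight_le[of "edge_weight c" "weight (edge_weight c) \<gamma>", OF lpos]])
          (use weightW in auto)
      have WI: "A \<in> loose_cone c (\<alpha> + \<beta>)" if "A \<in> W" for A
      proof -
        obtain k where "\<And>i. int (A $ i) = int (\<gamma> $ i) + k * c i" using \<open>A \<in> W\<close> unfolding W_def on_line_def by blast
        then show ?thesis by (intro loose_cone_translate[OF \<gamma>(1), of _ _ k]) simp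
      qed
      have sumW: "B + C \<in> W"
        if B: "on_line c a B" and C: "\<exists>k. \<forall>i. int (C $ i) + int (a $ i) = int (\<gamma> $ i) + k * c i" for a B C
      proof -
        obtain k where k: "\<And>i. int (B $ i) = int (a $ i) + k * c i" using B unfolding on_line_def by blast
        obtain k' where k': "\<And>i. int (C $ i) + int (a $ i) = int (\<gamma> $ i) + k' * c i" using C by blast
        have "int ((B + C) $ i) = int (\<gamma> $ i) + (k + k') * c i" for i using k[of i] k'[of i] by (simp add: distrib_right)
        then show ?thesis unfolding W_def on_line_def by blast
      qed
      have gu: "g \<otimes> lincomb u SU = lincomb (p \<otimes>\<^bsub>mpoly_ring R\<^esub> u) W" unfolding g_def
        by (rule lincomb_mult[OF fin(1,3) finW])
          (use sumW[of \<alpha>] p u(1,2) Us in \<open>auto simp: S_def SU_def\<close>)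
      have hv: "h \<otimes> lincomb v SV = lincomb (q \<otimes>\<^bsub>mpoly_ring R\<^esub> v) W" unfolding h_def
        by (rule lincomb_mult[OF fin(2,4) finW])
          (use sumW[of \<beta>] q v(1,2) Vs in \<open>auto simp: T_def SV_def\<close>)
      define e where "e A = (if A = \<gamma> then \<one> else \<zero>)" for A
      have \<gamma>W: "\<gamma> \<in> W" unfolding W_def on_line_def by (intro CollectI exI[of _ 0]) simp
      have pp\<gamma>: "pp \<gamma> = lincomb e W"
        using lincomb_indicator[OF finW \<gamma>W, of \<one>] unfolding e_def by simp
      define s where "s A = (p \<otimes>\<^bsub>mpoly_ring R\<^esub> u) A \<oplus> (q \<otimes>\<^bsub>mpoly_ring R\<^esub> v) A" for A
      have cl: "(p \<otimes>\<^bsub>mpoly_ring R\<^esub> u) A \<in> carrier R" "(q \<otimes>\<^bsub>mpoly_ring R\<^esub> v) A \<in> carrier R" "e A \<in> carrier R" for A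
        using mpoly_mult_closed[OF p(1) u(1)] mpoly_mult_closed[OF q(1) v(1)] by (auto simp: e_def)
      then have sc: "s A \<in> carrier R" for A by (simp add: s_def)
      have "pp \<gamma> \<ominus> (g \<otimes> lincomb u SU \<oplus> h \<otimes> lincomb v SV) = lincomb e W \<ominus> lincomb s W"
        unfolding pp\<gamma> gu hv s_def using lincomb_add[of W "p \<otimes>\<^bsub>mpoly_ring R\<^esub> u" "q \<otimes>\<^bsub>mpoly_ring R\<^esub> v"] cl by simp
      also have "\<dots> = lincomb (\<lambda>A. e A \<ominus> s A) W" by (rule lincomb_diff[symmetric, OF finW cl(3) sc])
      also have "\<dots> \<in> cone_ideal c (\<alpha> + \<beta>) (Suc w)"
      proof (rule lincomb_in_ideal[OF ideal_cone_ideal])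
        fix A assume A: "A \<in> W"
        interpret h: ring_hom_cring R "R Quot mm" "(+>) mm" by (rule residue_hom)
        have "mm +> s A = (mm +> (p \<otimes>\<^bsub>mpoly_ring R\<^esub> u) A) \<oplus>\<^bsub>R Quot mm\<^esub> (mm +> (q \<otimes>\<^bsub>mpoly_ring R\<^esub> v) A)"
          unfolding s_def using cl by (simp add: h.hom_add)
        also have "\<dots> = (if A = \<gamma> then \<one>\<^bsub>R Quot mm\<^esub> else \<zero>\<^bsub>R Quot mm\<^esub>)"
          unfolding residue_mpoly_mult[OF p(1) u(1)] residue_mpoly_mult[OF q(1) v(1)] u(3) v(3) using UV .
        also have "\<dots> = mm +> e A" by (simp add: e_def h.hom_one h.hom_zero)
        finally have "e A \<ominus> s A \<in> mm" using coset_eq_iff[OF ideal_mm cl(3) sc, of A A] by metis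
        moreover have "weight (edge_weight c) (\<alpha> + \<beta>) + w \<le> weight (edge_weight c) A" using weightW[OF A] \<gamma>(2) by simp
        ultimately show "(e A \<ominus> s A) \<otimes> pp A \<in> cone_ideal c (\<alpha> + \<beta>) (Suc w)"
          by (intro scaled_pp_in_cone_ideal[where p=r and q=r', OF rr _ WI[OF A]])
      qed
      finally show ?thesis by (intro JI[OF _ uI vI]) auto
    qed
  qed
  then show ?thesis using z unfolding J_def g_def h_def S_def T_def by blast
qed

text \<open>The weight of an exponent is at most \<open>d\<close> times its degree, so high weight
  forces high degree. This converts convergence in weight into adic convergence.\<close>

lemma weight_ideal_subset_mpow:
  assumes "\<And>i. l i \<le> d" "0 < d"
  shows "weight_ideal l (d * j) \<subseteq> mpow j"
  unfolding weight_ideal_def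
proof (rule monomial_ideal_mono, rule subsetI)
  fix A assume "A \<in> {A. d * j \<le> weight l A}"
  then have "d * j \<le> weight l A" by simp
  also have "\<dots> \<le> (\<Sum>i\<in>UNIV. d * (1 * A $ i))" by (rule sum_mono) (use assms(1) in \<open>simp add: mult_right_mono\<close>)
  also have "\<dots> = d * (\<Sum>i\<in>UNIV. 1 * A $ i)" by (simp only: sum_distrib_left)
  finally have "j \<le> (\<Sum>i\<in>UNIV. 1 * A $ i)" using assms(2) by (simp only: mult_le_cancel1)
  then show "A \<in> {A. j \<le> (\<Sum>i\<in>UNIV. 1 * A $ i)}" by blast
qed

text \<open>The corrections \<open>u\<close> and \<open>v\<close> solve the equation linearised at
  the initial \<open>g\<close> and \<open>h\<close>. The invariant that both factors differ from
  these by positive excess makes the difference to a linearisation at the current factors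
  negligible.\<close>

lemma hensel_sequence:
  assumes f: "f \<in> carrier R" and g: "g \<in> cone_ideal c \<alpha> 0" and h: "h \<in> cone_ideal c \<beta> 0"
    and start: "f \<ominus> g \<otimes> h \<in> cone_ideal c (\<alpha> + \<beta>) 1"
    and step: "\<And>z w. z \<in> cone_ideal c (\<alpha> + \<beta>) w \<Longrightarrow> \<exists>u\<in>cone_ideal c \<beta> w. \<exists>v\<in>cone_ideal c \<alpha> w.
      z \<ominus> (g \<otimes> u \<oplus> h \<otimes> v) \<in> cone_ideal c (\<alpha> + \<beta>) (Suc w)"
  shows "\<exists>G H. G 0 = g \<and> H 0 = h \<and> (\<forall>k. G k \<in> carrier R \<and> H k \<in> carrier R \<and> f \<ominus> G k \<otimes> H k \<in> cone_ideal c (\<alpha> + \<beta>) (Suc k) \<and>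
    G (Suc k) \<ominus> G k \<in> cone_ideal c \<alpha> (Suc k) \<and> H (Suc k) \<ominus> H k \<in> cone_ideal c \<beta> (Suc k))"
proof -
  note I\<alpha> = ideal_facts[OF ideal_cone_ideal[of c \<alpha>]] and I\<beta> = ideal_facts[OF ideal_cone_ideal[of c \<beta>]]
    and I = ideal_facts[OF ideal_cone_ideal[of c "\<alpha> + \<beta>"]]
  have gh: "g \<in> carrier R" "h \<in> carrier R" using g h I\<alpha>(3) I\<beta>(3) by blast+
  \<comment> \<open>The last conjunct fixes the starting pair, which the choice principle by itself
    would leave open.\<close>
  define Q where "Q k z \<longleftrightarrow> fst z \<in> carrier R \<and> snd z \<in> carrier R \<and> fst z \<ominus> g \<in> cone_ideal c \<alpha> 1 \<and>
    snd z \<ominus> h \<in> cone_ideal c \<beta> 1 \<and> f \<ominus> fst z \<otimes> snd z \<in> cone_ideal c (\<alpha> + \<beta>) (Suc k) \<and> (k = 0 \<longrightarrow> z = (g, h))" for k :: nat and z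
  have "\<exists>z. \<forall>k. Q k (z k) \<and> (fst (z (Suc k)) \<ominus> fst (z k) \<in> cone_ideal c \<alpha> (Suc k) \<and>
    snd (z (Suc k)) \<ominus> snd (z k) \<in> cone_ideal c \<beta> (Suc k))"
  proof (rule dependent_nat_choice)
    show "\<exists>z. Q 0 z" by (rule exI[of _ "(g, h)"]) (use gh start I\<alpha>(2) I\<beta>(2) in \<open>simp add: Q_def diff_self\<close>)
    fix z k assume z: "Q k z"
    define a where "a = fst z"
    define b where "b = snd z"
    have ab: "a \<in> carrier R" "b \<in> carrier R" "a \<ominus> g \<in> cone_ideal c \<alpha> 1" "b \<ominus> h \<in> cone_ideal c \<beta> 1"
      "f \<ominus> a \<otimes> b \<in> cone_ideal c (\<alpha> + \<beta>) (Suc k)" using z by (auto simp: Q_def a_def b_def)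
    obtain u v where u: "u \<in> cone_ideal c \<beta> (Suc k)" and v: "v \<in> cone_ideal c \<alpha> (Suc k)"
      and uv: "(f \<ominus> a \<otimes> b) \<ominus> (g \<otimes> u \<oplus> h \<otimes> v) \<in> cone_ideal c (\<alpha> + \<beta>) (Suc (Suc k))"
      using step[OF ab(5)] by blast
    have carr: "u \<in> carrier R" "v \<in> carrier R" using u v I\<alpha>(3) I\<beta>(3) by blast+
    have u1: "u \<in> cone_ideal c \<beta> 1" and v1: "v \<in> cone_ideal c \<alpha> 1"
      using u v cone_ideal_antimono[of 1 "Suc k" c \<alpha>] cone_ideal_antimono[of 1 "Suc k" c \<beta>] by auto
    \<comment> \<open>The three products left over by the linear correction each combine excess
      \<open>Suc k\<close> with excess 1.\<close>
    have "(a \<ominus> g) \<otimes> u \<in> cone_ideal c (\<alpha> + \<beta>) (Suc (Suc k))" using cone_ideal_mult[OF ab(3) u] by simp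
    moreover have "v \<otimes> (b \<ominus> h) \<in> cone_ideal c (\<alpha> + \<beta>) (Suc (Suc k))" using cone_ideal_mult[OF v ab(4)] by simp
    moreover have "v \<otimes> u \<in> cone_ideal c (\<alpha> + \<beta>) (Suc (Suc k))" using cone_ideal_mult[OF v u1] by simp
    moreover have "f \<ominus> (a \<oplus> v) \<otimes> (b \<oplus> u) = (f \<ominus> a \<otimes> b) \<ominus> (g \<otimes> u \<oplus> h \<otimes> v) \<ominus> ((a \<ominus> g) \<otimes> u \<oplus> v \<otimes> (b \<ominus> h) \<oplus> v \<otimes> u)"
      using f ab(1,2) gh carr by algebra
    ultimately have "f \<ominus> (a \<oplus> v) \<otimes> (b \<oplus> u) \<in> cone_ideal c (\<alpha> + \<beta>) (Suc (Suc k))"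
      using uv by (simp add: I(4,6))
    moreover have "(a \<oplus> v) \<ominus> g = (a \<ominus> g) \<oplus> v" "(b \<oplus> u) \<ominus> h = (b \<ominus> h) \<oplus> u"
      "(a \<oplus> v) \<ominus> a = v" "(b \<oplus> u) \<ominus> b = u"
      using ab(1,2) gh carr by algebra+
    ultimately show "\<exists>y. Q (Suc k) y \<and> (fst y \<ominus> fst z \<in> cone_ideal c \<alpha> (Suc k) \<and> snd y \<ominus> snd z \<in> cone_ideal c \<beta> (Suc k))"
      using ab carr u v u1 v1 I\<alpha>(4) I\<beta>(4)
      by (intro exI[of _ "(a \<oplus> v, b \<oplus> u)"]) (simp add: Q_def a_def[symmetric] b_def[symmetric])
  qed
  then obtain z where z: "\<And>k. Q k (z k)" "\<And>k. fst (z (Suc k)) \<ominus> fst (z k) \<in> cone_ideal c \<alpha> (Suc k)"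
    "\<And>k. snd (z (Suc k)) \<ominus> snd (z k) \<in> cone_ideal c \<beta> (Suc k)" by blast
  have "z 0 = (g, h)" using z(1)[of 0] by (simp add: Q_def)
  then show ?thesis using z
    by (intro exI[of _ "\<lambda>k. fst (z k)"] exI[of _ "\<lambda>k. snd (z k)"]) (auto simp: Q_def)
qed

lemma telescope_ideal:
  assumes I: "\<And>k. ideal (I k) R" "\<And>k. I (Suc k) \<subseteq> I k" and a: "\<And>k. a k \<in> carrier R" "\<And>k. a (Suc k) \<ominus> a k \<in> I k"
  shows "a (k + n) \<ominus> a k \<in> I k"
proof (induction n)
  case 0
  then show ?case using ideal_facts(2)[OF I(1)] a(1) by (simp add: diff_self)
next
  case (Suc n)
  have "I (k + n) \<subseteq> I k" by (rule lift_Suc_antimono_le[of I]) (use I(2) in auto)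
  then have "a (Suc (k + n)) \<ominus> a (k + n) \<in> I k" using a(2) by blast
  from ideal_facts(4)[OF I(1) this Suc] show ?case using diff_trans[of "a (Suc (k + n))" "a (k + n)" "a k"] a(1) by simp
qed

text \<open>One iteration gains a unit of weight, not of degree. Reading the sequences at multiples
  of \<open>d\<close>, the sum of the variable weights, gives Cauchy sequences for the powers of the
  maximal ideal.\<close>

lemma hensel_limit:
  assumes c: "0 < c p" "c q < 0"
    and f: "f \<in> carrier R" and g: "g \<in> cone_ideal c \<alpha> 0" and h: "h \<in> cone_ideal c \<beta> 0"
    and start: "f \<ominus> g \<otimes> h \<in> cone_ideal c (\<alpha> + \<beta>) 1"
    and step: "\<And>z w. z \<in> cone_ideal c (\<alpha> + \<beta>) w \<Longrightarrow> \<exists>u\<in>cone_ideal c \<beta> w. \<exists>v\<in>cone_ideal c \<alpha> w.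
      z \<ominus> (g \<otimes> u \<oplus> h \<otimes> v) \<in> cone_ideal c (\<alpha> + \<beta>) (Suc w)"
  shows "\<exists>s t. adic_cauchy s \<and> adic_cauchy t \<and> to_completion R f = adic_limit s \<otimes>\<^bsub>Rhat\<^esub> adic_limit t \<and>
    (\<forall>k. s k \<ominus> g \<in> weight_ideal (edge_weight c) (Suc (weight (edge_weight c) \<alpha>))) \<and>
    (\<forall>k. t k \<ominus> h \<in> weight_ideal (edge_weight c) (Suc (weight (edge_weight c) \<beta>)))"
proof -
  obtain G H where GH0: "G 0 = g" "H 0 = h"
    and GH: "\<And>k. f \<ominus> G k \<otimes> H k \<in> cone_ideal c (\<alpha> + \<beta>) (Suc k)"
      "\<And>k. G (Suc k) \<ominus> G k \<in> cone_ideal c \<alpha> (Suc k)" "\<And>k. H (Suc k) \<ominus> H k \<in> cone_ideal c \<beta> (Suc k)"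
      "\<And>k. G k \<in> carrier R" "\<And>k. H k \<in> carrier R"
    using hensel_sequence[OF f g h start step] by blast
  define d where "d = (\<Sum>i\<in>UNIV. edge_weight c i)"
  have ld: "edge_weight c i \<le> d" for i unfolding d_def by (rule member_le_sum) auto
  have "0 < d" using ld[of p] edge_weight_pos[where p=p and q=q, OF c, of p] by simp
  note mp = weight_ideal_subset_mpow[of "edge_weight c", OF ld this]
  have wi: "cone_ideal c a (Suc w) \<subseteq> weight_ideal (edge_weight c) w" for a w
    using cone_ideal_subset_weight_ideal[of c a "Suc w"]
      weight_ideal_antimono[of w "weight (edge_weight c) a + Suc w" "edge_weight c"] by auto
  have limit: "adic_cauchy (\<lambda>j. F (d * j)) \<and> (\<forall>j. F j \<in> carrier R \<and> F j \<ominus> F 0 \<in> weight_ideal (edge_weight c) (Suc (weight (edge_weight c) a)))"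
    if Fc: "\<And>k. F k \<in> carrier R" and F: "\<And>k. F (Suc k) \<ominus> F k \<in> cone_ideal c a (Suc k)" for F a
  proof -
    have tel: "F (k + n) \<ominus> F k \<in> cone_ideal c a (Suc k)" for k n
      by (rule telescope_ideal[of "\<lambda>k. cone_ideal c a (Suc k)"]) (use ideal_cone_ideal cone_ideal_antimono Fc F in auto)
    have "F (d * Suc j) \<ominus> F (d * j) \<in> mpow j" for j
      using tel[of "d * j" d] wi[of a "d * j"] mp[of j] by (auto simp: add.commute)
    moreover have "F j \<ominus> F 0 \<in> weight_ideal (edge_weight c) (Suc (weight (edge_weight c) a))" for j
      using tel[of 0 j] cone_ideal_subset_weight_ideal[of c a "Suc 0"] by auto
    ultimately show ?thesis using Fc by (simp add: adic_cauchy_def)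
  qed
  note s = limit[of G, OF GH(4) GH(2)] and t = limit[of H, OF GH(5) GH(3)]
  have "f \<ominus> G (d * j) \<otimes> H (d * j) \<in> mpow j" for j using GH(1)[of "d * j"] wi[of "\<alpha> + \<beta>" "d * j"] mp[of j] by blast
  then have "adic_limit (\<lambda>_. f) = adic_limit (\<lambda>j. G (d * j) \<otimes> H (d * j))"
    using adic_limit_eq_iff[of "\<lambda>_. f" "\<lambda>j. G (d * j) \<otimes> H (d * j)"] f s t by blast
  also have "\<dots> = adic_limit (\<lambda>j. G (d * j)) \<otimes>\<^bsub>Rhat\<^esub> adic_limit (\<lambda>j. H (d * j))"
    using adic_limit_mult[of "\<lambda>j. G (d * j)" "\<lambda>j. H (d * j)"] s t by simp
  finally show ?thesis using s t GH0 unfolding to_completion_eq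
    by (intro exI[of _ "\<lambda>j. G (d * j)"] exI[of _ "\<lambda>j. H (d * j)"]) auto
qed

end

section \<open>The Minkowski sum of two parallel segments of exponents\<close>

lemma aff_dim_line_support:
  assumes "\<And>A B. A \<in> S \<Longrightarrow> B \<in> S \<Longrightarrow> on_line c A B"
  shows "aff_dim (convex hull (real_exponent ` S)) \<le> 1"
proof -
  have "collinear (real_exponent ` S)" unfolding collinear_def
  proof (intro exI[of _ "\<chi> i. real_of_int (c i)"] ballI)
    fix v w assume "v \<in> real_exponent ` S" "w \<in> real_exponent ` S"
    then obtain A B where AB: "A \<in> S" "B \<in> S" "v = real_exponent A" "w = real_exponent B" by blast
    obtain k where k: "\<And>i. int (A $ i) = int (B $ i) + k * c i" using assms[OF AB(2,1)] unfolding on_line_def by blast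
    have "real (A $ i) = real (B $ i) + real_of_int k * real_of_int (c i)" for i
      using arg_cong[OF k[of i], of real_of_int] by simp
    then have "v - w = real_of_int k *\<^sub>R (\<chi> i. real_of_int (c i))"
      unfolding AB(3,4) by (simp add: vec_eq_iff real_exponent_def)
    then show "\<exists>b. v - w = b *\<^sub>R (\<chi> i. real_of_int (c i))" by blast
  qed
  then show ?thesis by (simp add: aff_dim_convex_hull collinear_aff_dim)
qed

lemma real_exponent_add: "real_exponent (A + B) = real_exponent A + real_exponent B"
  by (simp add: real_exponent_def vec_eq_iff)

text \<open>Both hulls are segments in the direction \<open>c\<close>, possibly points, so their sum
  is the segment between the sums of the endpoints. Each end sum has a single decomposition;
  \<open>unique\<close> says that such sums belong to \<open>U\<close>, as they do for a product
  support, where they cannot cancel.\<close>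

lemma edge_minkowski_sum:
  fixes c :: "'n::finite \<Rightarrow> int"
  assumes c: "0 < c p" and S: "finite S" "S \<noteq> {}" "\<And>A B. A \<in> S \<Longrightarrow> B \<in> S \<Longrightarrow> on_line c A B"
    and T: "finite T" "T \<noteq> {}" "\<And>A B. A \<in> T \<Longrightarrow> B \<in> T \<Longrightarrow> on_line c A B"
    and U: "\<And>A. A \<in> U \<Longrightarrow> \<exists>B\<in>S. \<exists>C\<in>T. A = B + C"
    and unique: "\<And>B C. B \<in> S \<Longrightarrow> C \<in> T \<Longrightarrow>
      (\<And>B' C'. B' \<in> S \<Longrightarrow> C' \<in> T \<Longrightarrow> B' + C' = B + C \<Longrightarrow> B' = B \<and> C' = C) \<Longrightarrow> B + C \<in> U"
  shows "convex hull (real_exponent ` U) =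
    {a + b | a b. a \<in> convex hull (real_exponent ` S) \<and> b \<in> convex hull (real_exponent ` T)}"
proof -
  obtain \<alpha> \<omega> and d :: nat where \<alpha>: "\<alpha> \<in> S" "\<omega> \<in> S" "\<forall>i. int (\<omega> $ i) = int (\<alpha> $ i) + int d * c i"
    "\<forall>A\<in>S. \<exists>k\<le>d. \<forall>i. int (A $ i) = int (\<alpha> $ i) + int k * c i"
    using on_line_endpoints[where c=c and p=p, OF c S] by blast
  obtain \<beta> \<omega>' and e :: nat where \<beta>: "\<beta> \<in> T" "\<omega>' \<in> T" "\<forall>i. int (\<omega>' $ i) = int (\<beta> $ i) + int e * c i"
    "\<forall>A\<in>T. \<exists>k\<le>e. \<forall>i. int (A $ i) = int (\<beta> $ i) + int k * c i"
    using on_line_endpoints[where c=c and p=p, OF c T] by blast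
  have lo: "\<alpha> + \<beta> \<in> U"
  proof (rule unique[OF \<alpha>(1) \<beta>(1)])
    fix B C assume BC: "B \<in> S" "C \<in> T" "B + C = \<alpha> + \<beta>"
    obtain k where k: "k \<le> d" "\<forall>i. int (B $ i) = int (\<alpha> $ i) + int k * c i" using \<alpha>(4) BC(1) by blast
    obtain j where j: "j \<le> e" "\<forall>i. int (C $ i) = int (\<beta> $ i) + int j * c i" using \<beta>(4) BC(2) by blast
    have "B $ p + C $ p = \<alpha> $ p + \<beta> $ p" using BC(3) by (metis vector_add_component)
    then have "(int k + int j) * c p = 0" using k(2)[rule_format, of p] j(2)[rule_format, of p] by (simp add: distrib_right)
    then have "k = 0" "j = 0" using c by auto
    then show "B = \<alpha> \<and> C = \<beta>" using k j by (simp add: vec_eq_iff)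
  qed
  have hi: "\<omega> + \<omega>' \<in> U"
  proof (rule unique[OF \<alpha>(2) \<beta>(2)])
    fix B C assume BC: "B \<in> S" "C \<in> T" "B + C = \<omega> + \<omega>'"
    obtain k where k: "k \<le> d" "\<forall>i. int (B $ i) = int (\<alpha> $ i) + int k * c i" using \<alpha>(4) BC(1) by blast
    obtain j where j: "j \<le> e" "\<forall>i. int (C $ i) = int (\<beta> $ i) + int j * c i" using \<beta>(4) BC(2) by blast
    have "B $ p + C $ p = \<omega> $ p + \<omega>' $ p" using BC(3) by (metis vector_add_component)
    then have "int (B $ p) + int (C $ p) = int (\<omega> $ p) + int (\<omega>' $ p)" by linarith
    then have "(int k + int j) * c p = (int d + int e) * c p" unfolding distrib_right
      using k(2)[rule_format, of p] j(2)[rule_format, of p] \<alpha>(3)[rule_format, of p] \<beta>(3)[rule_format, of p] by linarith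
    then have "int k + int j = int d + int e" using c by simp
    then have "k = d" "j = e" using k(1) j(1) by linarith+
    then have "int (B $ i) = int (\<omega> $ i)" "int (C $ i) = int (\<omega>' $ i)" for i using k(2) j(2) \<alpha>(3) \<beta>(3) by simp_all
    then show "B = \<omega> \<and> C = \<omega>'" by (simp add: vec_eq_iff)
  qed
  have sum: "{a + b | a b. a \<in> convex hull (real_exponent ` S) \<and> b \<in> convex hull (real_exponent ` T)} =
      convex hull (real_exponent ` S + real_exponent ` T)"
    unfolding convex_hull_set_plus by (auto simp: set_plus_def)
  have "real_exponent ` U \<subseteq> real_exponent ` S + real_exponent ` T"
    using U by (fastforce simp: set_plus_def real_exponent_add)
  moreover have "real_exponent ` S + real_exponent ` T \<subseteq> convex hull (real_exponent ` U)"
  proof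
    fix v assume "v \<in> real_exponent ` S + real_exponent ` T"
    then obtain B C where BC: "B \<in> S" "C \<in> T" "v = real_exponent B + real_exponent C" by (auto simp: set_plus_def)
    obtain k where k: "k \<le> d" "\<forall>i. int (B $ i) = int (\<alpha> $ i) + int k * c i" using \<alpha>(4) BC(1) by blast
    obtain j where j: "j \<le> e" "\<forall>i. int (C $ i) = int (\<beta> $ i) + int j * c i" using \<beta>(4) BC(2) by blast
    \<comment> \<open>The relative position on the sum segment; 0 is the default when both segments
      are points.\<close>
    define t where "t = (if d + e = 0 then 0 else real (k + j) / real (d + e))"
    have t: "0 \<le> t" "t \<le> 1" using k(1) j(1) by (auto simp: t_def divide_simps)
    have te: "t * real (d + e) = real (k + j)" using k(1) j(1) by (auto simp: t_def)
    have "v $ i = (1 - t) * real_exponent (\<alpha> + \<beta>) $ i + t * real_exponent (\<omega> + \<omega>') $ i" for i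
    proof -
      have r: "real (B $ i) = real (\<alpha> $ i) + real k * real_of_int (c i)" "real (C $ i) = real (\<beta> $ i) + real j * real_of_int (c i)"
        "real (\<omega> $ i) = real (\<alpha> $ i) + real d * real_of_int (c i)" "real (\<omega>' $ i) = real (\<beta> $ i) + real e * real_of_int (c i)"
        using arg_cong[OF k(2)[rule_format, of i], of real_of_int] arg_cong[OF j(2)[rule_format, of i], of real_of_int]
          arg_cong[OF \<alpha>(3)[rule_format, of i], of real_of_int] arg_cong[OF \<beta>(3)[rule_format, of i], of real_of_int] by simp_all
      have "(1 - t) * real_exponent (\<alpha> + \<beta>) $ i + t * real_exponent (\<omega> + \<omega>') $ i =
          real (\<alpha> $ i) + real (\<beta> $ i) + (t * real (d + e)) * real_of_int (c i)"
        by (simp add: real_exponent_def r(3,4) algebra_simps)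
      also have "\<dots> = v $ i" unfolding te BC(3) by (simp add: real_exponent_def r(1,2) algebra_simps)
      finally show ?thesis by simp
    qed
    then have v: "v = (1 - t) *\<^sub>R real_exponent (\<alpha> + \<beta>) + t *\<^sub>R real_exponent (\<omega> + \<omega>')" by (simp add: vec_eq_iff)
    show "v \<in> convex hull (real_exponent ` U)" unfolding v
      by (rule convexD[OF convex_convex_hull]) (use lo hi t in \<open>auto intro: hull_inc\<close>)
  qed
  ultimately show ?thesis unfolding sum by (meson hull_minimal convex_convex_hull hull_mono subset_antisym)
qed

lemma (in cring) sum_minus_swap:
  "a \<in> carrier R \<Longrightarrow> b \<in> carrier R \<Longrightarrow> c \<in> carrier R \<Longrightarrow> (a \<oplus> b) \<ominus> c = (a \<ominus> c) \<oplus> b"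
  by algebra

section \<open>Initial forms of the limits, and assembly of the factorization\<close>

context parameter_ring
begin

text \<open>The weight is minimal on the expansion of the limit exactly at the exponents of the
  lift, so it determines the face. Conditions are imposed on every entry of the sequence because the
  power of the maximal ideal needed for the comparison is not known in advance.\<close>

lemma completion_initial_form:
  assumes l: "\<And>i. 0 < l i" and s: "adic_cauchy s"
    and p: "\<And>A. p A \<in> carrier R" "finite {A. p A \<noteq> \<zero>}" "\<And>A. p A \<noteq> \<zero> \<Longrightarrow> mm +> p A \<noteq> \<zero>\<^bsub>R Quot mm\<^esub>"
    and ne: "p \<alpha> \<noteq> \<zero>" and w: "\<And>A. p A \<noteq> \<zero> \<Longrightarrow> weight l A = weight l \<alpha>"
    and sp: "\<And>k. s k \<ominus> lincomb p {A. p A \<noteq> \<zero>} \<in> weight_ideal l (Suc (weight l \<alpha>))"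
  shows "compact_face (newton_polyhedron Rhat yhat (adic_limit s)) (convex hull (real_exponent ` {A. p A \<noteq> \<zero>}))"
    and "initial_form Rhat yhat (adic_limit s) (convex hull (real_exponent ` {A. p A \<noteq> \<zero>})) =
      residue_to_completion R \<circ> (\<lambda>A. mm +> p A)"
proof -
  interpret C: cring Rhat by (rule cring_completion)
  define \<rho> where "\<rho> = expansion Rhat yhat (adic_limit s)"
  define S where "S = {A. \<rho> A \<noteq> \<zero>\<^bsub>Rhat\<^esub>}"
  define F where "F = {A. p A \<noteq> \<zero>}"
  have rho: "is_expansion Rhat yhat (adic_limit s) \<rho>" unfolding \<rho>_def
    by (rule is_expansion_completion_expansion[OF adic_limit_in_carrier[OF s]])
  have finS: "finite S" and units: "\<rho> A \<in> Units Rhat \<union> {\<zero>\<^bsub>Rhat\<^esub>}" for A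
    using rho by (auto simp: is_expansion_def S_def)
  have rc: "\<rho> A \<in> carrier Rhat" for A using units[of A] by auto
  note lead = completion_leading_coefficients[OF l s p(2) p(1) _ _ sp rho]
  have low: "\<rho> A = \<zero>\<^bsub>Rhat\<^esub>" if "weight l A < weight l \<alpha>" for A
    by (rule lead(1)) (use w that in auto)
  have eq: "max_ideal Rhat +>\<^bsub>Rhat\<^esub> \<rho> A = max_ideal Rhat +>\<^bsub>Rhat\<^esub> to_completion R (p A)" if "weight l A = weight l \<alpha>" for A
    by (rule lead(2)) (use w that in auto)
  have id: "ideal (max_ideal Rhat) Rhat" using max_ideal_completion(2) by (simp add: maximalideal_def)
  have zero: "to_completion R \<zero> = \<zero>\<^bsub>Rhat\<^esub>" by (simp add: to_completion_eq completion_zero)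
  have mzero: "max_ideal Rhat +>\<^bsub>Rhat\<^esub> \<zero>\<^bsub>Rhat\<^esub> = max_ideal Rhat"
    by (rule C.a_coset_add_zero[OF C.ideal_facts(1)[OF id]])
  have rtc: "residue_to_completion R (mm +> p A) = max_ideal Rhat +>\<^bsub>Rhat\<^esub> to_completion R (p A)" for A
    using residue_to_completion_coset[OF p(1)] by (simp add: max_ideal_eq)
  \<comment> \<open>At the lowest weight an expansion coefficient is a unit or zero and is congruent
    to the lifted one, whose nonzero values have nonzero residue. So both vanish at the same
    exponents.\<close>
  have supp: "A \<in> S \<longleftrightarrow> A \<in> F" if wA: "weight l A = weight l \<alpha>" for A
  proof
    assume A: "A \<in> S"
    show "A \<in> F"
    proof (rule ccontr)
      assume "A \<notin> F"
      then have "max_ideal Rhat +>\<^bsub>Rhat\<^esub> \<rho> A = max_ideal Rhat +>\<^bsub>Rhat\<^esub> \<zero>\<^bsub>Rhat\<^esub>" using eq[OF wA] zero by (simp add: F_def)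
      then have "\<rho> A \<ominus>\<^bsub>Rhat\<^esub> \<zero>\<^bsub>Rhat\<^esub> \<in> max_ideal Rhat" using C.quotient_eq_iff_same_a_r_cos[OF id rc C.zero_closed] by blast
      then have "\<rho> A \<in> max_ideal Rhat" using C.diff_zero[OF rc] by simp
      moreover have u: "\<rho> A \<in> Units Rhat" using units[of A] A by (simp add: S_def)
      ultimately have "inv\<^bsub>Rhat\<^esub> \<rho> A \<otimes>\<^bsub>Rhat\<^esub> \<rho> A \<in> max_ideal Rhat"
        by (intro C.ideal_facts(7)[OF id] C.Units_inv_closed)
      then have "max_ideal Rhat = carrier Rhat" using ideal.one_imp_carrier[OF id] C.Units_l_inv[OF u] by simp
      then show False using maximalideal.I_notcarr[OF max_ideal_completion(2)] by simp
    qed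
  next
    assume A: "A \<in> F"
    show "A \<in> S"
    proof (rule ccontr)
      assume "A \<notin> S"
      then have "max_ideal Rhat +>\<^bsub>Rhat\<^esub> adic_limit (\<lambda>_. \<zero>) = max_ideal Rhat +>\<^bsub>Rhat\<^esub> adic_limit (\<lambda>_. p A)"
        using eq[OF wA] by (simp add: S_def completion_zero to_completion_eq)
      then have "\<zero> \<ominus> p A \<in> mm"
        using coset_max_ideal_completion_eq_iff[OF adic_cauchy_const[OF zero_closed] adic_cauchy_const[OF p(1)]] by blast
      then have "mm +> \<zero> = mm +> p A" using coset_eq_iff[OF ideal_mm zero_closed p(1)] by blast
      moreover have "mm +> \<zero> = \<zero>\<^bsub>R Quot mm\<^esub>" using residue_zero_iff[of \<zero>] ideal_facts(2)[OF ideal_mm] by simp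
      ultimately show False using p(3)[of A] A by (simp add: F_def)
    qed
  qed
  define l' where "l' = (\<chi> i. real (l i))"
  have inner: "l' \<bullet> real_exponent A = real (weight l A)" for A
    by (simp add: l'_def real_exponent_def inner_vec_def)
  have FS: "{A \<in> S. l' \<bullet> real_exponent A = real (weight l \<alpha>)} = F"
    using supp w unfolding inner of_nat_eq_iff F_def by blast
  have "\<alpha> \<in> S" using supp[of \<alpha>] ne by (simp add: F_def)
  have "compact_face (newton_hull S) (convex hull (real_exponent ` {A \<in> S. l' \<bullet> real_exponent A = real (weight l \<alpha>)}))"
  proof (rule compact_face_newton_hullI[OF finS _ _ \<open>\<alpha> \<in> S\<close> inner])
    show "0 < l' $ i" for i using l by (simp add: l'_def)
    show "real (weight l \<alpha>) \<le> l' \<bullet> real_exponent A" if "A \<in> S" for A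
      unfolding inner of_nat_le_iff using low[of A] that unfolding S_def by (meson mem_Collect_eq not_le)
  qed
  moreover have "newton_polyhedron Rhat yhat (adic_limit s) = newton_hull S"
    unfolding newton_polyhedron_eq S_def \<rho>_def ..
  ultimately show "compact_face (newton_polyhedron Rhat yhat (adic_limit s)) (convex hull (real_exponent ` {A. p A \<noteq> \<zero>}))"
    unfolding FS F_def by simp
  \<comment> \<open>The initial form is defined by membership in the face. The face lies in a level
    set of the weight, so the congruence of leading coefficients holds at all its lattice
    points.\<close>
  have hull: "weight l A = weight l \<alpha>" if "real_exponent A \<in> convex hull (real_exponent ` F)" for A
  proof -
    have "convex hull (real_exponent ` F) \<subseteq> {v. l' \<bullet> v = real (weight l \<alpha>)}"
    proof (rule hull_minimal)
      show "real_exponent ` F \<subseteq> {v. l' \<bullet> v = real (weight l \<alpha>)}" unfolding image_subset_iff mem_Collect_eq inner of_nat_eq_iff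
        using w by (simp add: F_def)
    qed (rule convex_hyperplane)
    then have "l' \<bullet> real_exponent A = real (weight l \<alpha>)" using that by blast
    then show ?thesis unfolding inner of_nat_eq_iff .
  qed
  show "initial_form Rhat yhat (adic_limit s) (convex hull (real_exponent ` {A. p A \<noteq> \<zero>})) =
      residue_to_completion R \<circ> (\<lambda>A. mm +> p A)"
  proof
    fix A
    show "initial_form Rhat yhat (adic_limit s) (convex hull (real_exponent ` {A. p A \<noteq> \<zero>})) A =
      (residue_to_completion R \<circ> (\<lambda>A. mm +> p A)) A"
    proof (cases "real_exponent A \<in> convex hull (real_exponent ` F)")
      case True
      then show ?thesis using eq[OF hull[OF True]] rtc[of A] by (simp add: initial_form_def F_def[symmetric] \<rho>_def[symmetric])
    next
      case False
      then have "p A = \<zero>" using hull_inc[of "real_exponent A" "real_exponent ` F" convex] by (auto simp: F_def)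
      then show ?thesis using False rtc[of A] zero mzero
        by (simp add: initial_form_def F_def[symmetric] residue_field_def FactRing_def)
    qed
  qed
qed

text \<open>Support exponents \<open>\<alpha>\<close> of \<open>G\<close> and \<open>\<beta>\<close>
  of \<open>H\<close> with sum on the edge serve as base points: \<open>f\<close> is controlled in
  the cone at \<open>\<alpha> + \<beta>\<close>, the factors and their corrections in the cones at
  \<open>\<alpha>\<close> and \<open>\<beta>\<close>.\<close>

lemma loose_edge_factorization:
  assumes f: "f \<in> carrier R" and E: "loose_edge (newton_polyhedron R x f) E"
    and G: "G \<in> carrier (mpoly_ring (R Quot mm))" and H: "H \<in> carrier (mpoly_ring (R Quot mm))"
    and init: "initial_form R x f E = G \<otimes>\<^bsub>mpoly_ring (R Quot mm)\<^esub> H"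
    and cop: "coprime_elements (mpoly_ring (R Quot mm)) G H"
    and var: "\<And>i. \<not> mpoly_var (R Quot mm) i divides\<^bsub>mpoly_ring (R Quot mm)\<^esub> G"
  shows "\<exists>g \<in> carrier Rhat. \<exists>h \<in> carrier Rhat. to_completion R f = g \<otimes>\<^bsub>Rhat\<^esub> h \<and>
    (\<exists>E1 E2. compact_face (newton_polyhedron Rhat yhat g) E1 \<and> aff_dim E1 \<le> 1 \<and>
      compact_face (newton_polyhedron Rhat yhat h) E2 \<and> aff_dim E2 \<le> 1 \<and>
      E = {a + b | a b. a \<in> E1 \<and> b \<in> E2} \<and>
      initial_form Rhat yhat g E1 = residue_to_completion R \<circ> G \<and>
      initial_form Rhat yhat h E2 = residue_to_completion R \<circ> H)"
proof -
  interpret K: field "R Quot mm" by (rule field_residue)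
  define \<rho> where "\<rho> = expansion R x f"
  define S where "S = {A. \<rho> A \<noteq> \<zero>}"
  have rho: "is_expansion R x f \<rho>" unfolding \<rho>_def by (rule is_expansion_expansion[OF f])
  have finS: "finite S" and units: "\<rho> A \<in> Units R \<union> {\<zero>}" and fS: "f = lincomb \<rho> S" for A
    using rho by (auto simp: is_expansion_def S_def lincomb_def)
  have rc: "\<rho> A \<in> carrier R" for A using units[of A] by auto
  have "loose_edge (newton_hull S) E" using E unfolding newton_polyhedron_eq S_def \<rho>_def .
  from loose_edge_structure[OF finS this] obtain c SE where c: "primitive_direction c"
    and SE: "SE \<subseteq> S" "SE \<noteq> {}" "E = convex hull (real_exponent ` SE)"
      "\<And>A. A \<in> S \<Longrightarrow> real_exponent A \<in> E \<longleftrightarrow> A \<in> SE"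
      "\<And>a A. a \<in> SE \<Longrightarrow> A \<in> S \<Longrightarrow> A \<in> loose_cone c a"
      "\<And>a A. a \<in> SE \<Longrightarrow> A \<in> S \<Longrightarrow> on_line c a A \<longleftrightarrow> A \<in> SE"
    by (elim exE conjE) blast
  obtain r r' where rr: "0 < c r" "c r' < 0" using c by (auto simp: primitive_direction_def)
  note lpos = edge_weight_pos[where p=r and q=r', OF rr]
  have zero: "mm +> \<zero> = \<zero>\<^bsub>R Quot mm\<^esub>" using residue_zero_iff[of \<zero>] ideal_facts(2)[OF ideal_mm] by simp
  have GH: "(G \<otimes>\<^bsub>mpoly_ring (R Quot mm)\<^esub> H) A = (if A \<in> SE then mm +> \<rho> A else \<zero>\<^bsub>R Quot mm\<^esub>)" for A
  proof -
    have "(G \<otimes>\<^bsub>mpoly_ring (R Quot mm)\<^esub> H) A = (if real_exponent A \<in> E then mm +> \<rho> A else \<zero>\<^bsub>R Quot mm\<^esub>)"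
      unfolding init[symmetric] by (simp add: initial_form_def residue_field_def max_ideal_eq \<rho>_def)
    moreover have "mm +> \<rho> A = \<zero>\<^bsub>R Quot mm\<^esub>" if "A \<notin> S" using that zero by (simp add: S_def)
    ultimately show ?thesis using SE(1,4) by auto
  qed
  have nz: "(G \<otimes>\<^bsub>mpoly_ring (R Quot mm)\<^esub> H) A \<noteq> \<zero>\<^bsub>R Quot mm\<^esub> \<longleftrightarrow> A \<in> SE" for A
  proof -
    have "mm +> \<rho> A \<noteq> \<zero>\<^bsub>R Quot mm\<^esub>" if "A \<in> SE"
    proof -
      have "\<rho> A \<in> Units R" using units[of A] that SE(1) by (auto simp: S_def)
      then show ?thesis using residue_zero_iff[OF rc] Units_iff by blast
    qed
    then show ?thesis using GH[of A] by simp
  qed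
  have line: "on_line c A B" if "(G \<otimes>\<^bsub>mpoly_ring (R Quot mm)\<^esub> H) A \<noteq> \<zero>\<^bsub>R Quot mm\<^esub>"
    "(G \<otimes>\<^bsub>mpoly_ring (R Quot mm)\<^esub> H) B \<noteq> \<zero>\<^bsub>R Quot mm\<^esub>" for A B
    using that SE(1) SE(6)[of A B] unfolding nz by blast
  note Gc = K.mpoly_carrierD[OF G] and Hc = K.mpoly_carrierD[OF H]
  obtain A0 where "A0 \<in> SE" using SE(2) by blast
  then have "\<exists>B C. B + C = A0 \<and> G B \<noteq> \<zero>\<^bsub>R Quot mm\<^esub> \<and> H C \<noteq> \<zero>\<^bsub>R Quot mm\<^esub>"
    using K.mpoly_mult_nonzeroD[of G H A0] Gc(1) Hc(1) nz by blast
  then have ne: "\<exists>A. G A \<noteq> \<zero>\<^bsub>R Quot mm\<^esub>" "\<exists>A. H A \<noteq> \<zero>\<^bsub>R Quot mm\<^esub>" by blast+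
  \<comment> \<open>The zero functional imposes nothing; what is used is the pair of support
    exponents whose product coefficient does not cancel.\<close>
  obtain \<alpha> \<beta> where \<alpha>: "G \<alpha> \<noteq> \<zero>\<^bsub>R Quot mm\<^esub>" and \<beta>: "H \<beta> \<noteq> \<zero>\<^bsub>R Quot mm\<^esub>" and "\<alpha> + \<beta> \<in> SE"
    using K.mpoly_mult_extremal[OF G ne(1) H ne(2), of "\<lambda>_. 0"] nz by auto
  note supp = K.factor_supports_on_line[OF c G ne(1) H ne(2) line]
  obtain p where p: "\<And>A. p A \<in> carrier R" "\<And>A. p A = \<zero> \<longleftrightarrow> G A = \<zero>\<^bsub>R Quot mm\<^esub>" "\<And>A. mm +> p A = G A"
    using mpoly_residue_lift[OF G] by blast
  obtain q where q: "\<And>A. q A \<in> carrier R" "\<And>A. q A = \<zero> \<longleftrightarrow> H A = \<zero>\<^bsub>R Quot mm\<^esub>" "\<And>A. mm +> q A = H A"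
    using mpoly_residue_lift[OF H] by blast
  define F where "F = {A. p A \<noteq> \<zero>}"
  define F' where "F' = {A. q A \<noteq> \<zero>}"
  have fin: "finite F" "finite F'" unfolding F_def F'_def p(2) q(2) using Gc(2) Hc(2) .
  have \<alpha>F: "\<alpha> \<in> F" "\<beta> \<in> F'" using \<alpha> \<beta> p(2) q(2) by (simp_all add: F_def F'_def)
  have lineF: "on_line c A B" if "A \<in> F" "B \<in> F" for A B 
    by (rule supp(1)) (use that p(2) in \<open>simp_all add: F_def\<close>)
  have lineF': "on_line c A B" if "A \<in> F'" "B \<in> F'" for A B 
    by (rule supp(2)) (use that q(2) in \<open>simp_all add: F'_def\<close>)
  have wline: "weight (edge_weight c) B = weight (edge_weight c) A" "B \<in> loose_cone c A" if AB: "on_line c A B" for A B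
  proof -
    obtain k where k: "\<And>i. int (B $ i) = int (A $ i) + k * c i" using AB unfolding on_line_def by blast
    show "weight (edge_weight c) B = weight (edge_weight c) A" by (rule weight_edge_translate[OF k])
    have "A \<in> loose_cone c A" by (simp add: loose_cone_def)
    then show "B \<in> loose_cone c A" by (rule loose_cone_translate[of _ _ _ _ _ k]) (simp add: k)
  qed
  define g where "g = lincomb p F"
  define h where "h = lincomb q F'"
  have g: "g \<in> cone_ideal c \<alpha> 0" unfolding g_def
  proof (rule lincomb_in_ideal[OF ideal_cone_ideal])
    fix A assume "A \<in> F"
    from wline[OF lineF[OF \<alpha>F(1) this]] show "p A \<otimes> pp A \<in> cone_ideal c \<alpha> 0"
      by (intro ideal_facts(7)[OF ideal_cone_ideal _ p(1)] pp_in_cone_ideal) simp_all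
  qed
  have h: "h \<in> cone_ideal c \<beta> 0" unfolding h_def
  proof (rule lincomb_in_ideal[OF ideal_cone_ideal])
    fix A assume "A \<in> F'"
    from wline[OF lineF'[OF \<alpha>F(2) this]] show "q A \<otimes> pp A \<in> cone_ideal c \<beta> 0"
      by (intro ideal_facts(7)[OF ideal_cone_ideal _ q(1)] pp_in_cone_ideal) simp_all
  qed
  \<comment> \<open>All exponents on the line of the edge, including those absent from
    \<open>f\<close>: there the product of the lifts can have nonzero coefficients in the maximal
    ideal.\<close>
  define W where "W = {A. on_line c (\<alpha> + \<beta>) A}"
  have finW: "finite W"
    by (rule finite_subset[OF _ finite_weight_le[of "edge_weight c" "weight (edge_weight c) (\<alpha> + \<beta>)", OF lpos]])
      (use wline(1)[of "\<alpha> + \<beta>"] in \<open>auto simp: W_def\<close>)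
  have WSE: "A \<in> W \<longleftrightarrow> A \<in> SE" if "A \<in> S" for A using SE(6)[OF \<open>\<alpha> + \<beta> \<in> SE\<close> that] by (simp add: W_def)
  have gh: "g \<otimes> h = lincomb (p \<otimes>\<^bsub>mpoly_ring R\<^esub> q) W" unfolding g_def h_def
  proof (rule lincomb_mult[OF fin finW])
    fix B C assume BC: "B \<in> F" "C \<in> F'"
    obtain k where k: "\<And>i. int (B $ i) = int (\<alpha> $ i) + k * c i" using lineF[OF \<alpha>F(1) BC(1)] unfolding on_line_def by blast
    obtain k' where k': "\<And>i. int (C $ i) = int (\<beta> $ i) + k' * c i" using lineF'[OF \<alpha>F(2) BC(2)] unfolding on_line_def by blast
    have "int ((B + C) $ i) = int ((\<alpha> + \<beta>) $ i) + (k + k') * c i" for i by (simp add: k k' distrib_right)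
    then show "B + C \<in> W" unfolding W_def on_line_def by blast
  qed (use p(1) q(1) in \<open>auto simp: F_def F'_def\<close>)
  have mc: "(p \<otimes>\<^bsub>mpoly_ring R\<^esub> q) A \<in> carrier R" for A by (rule mpoly_mult_closed[OF p(1) q(1)])
  have f_split: "f = lincomb \<rho> W \<oplus> lincomb \<rho> (S - W)"
  proof -
    have "f = lincomb \<rho> (W \<union> (S - W))" unfolding fS
      by (rule lincomb_neutral[symmetric]) (use finS finW rc in \<open>auto simp: S_def\<close>)
    also have "\<dots> = lincomb \<rho> W \<oplus> lincomb \<rho> (S - W)"
      by (rule lincomb_Un) (use finS finW rc in auto)
    finally show ?thesis .
  qed
  \<comment> \<open>Terms of \<open>f\<close> off the line have strictly larger weight, since in the
    cone equality of weights means lying on the line.\<close>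
  have tail: "lincomb \<rho> (S - W) \<in> cone_ideal c (\<alpha> + \<beta>) 1"
  proof (rule lincomb_in_ideal[OF ideal_cone_ideal])
    fix A assume A: "A \<in> S - W"
    have cone: "A \<in> loose_cone c (\<alpha> + \<beta>)" using SE(5)[OF \<open>\<alpha> + \<beta> \<in> SE\<close>] A by blast
    have "weight (edge_weight c) A \<noteq> weight (edge_weight c) (\<alpha> + \<beta>)"
      using loose_cone_weight(2)[OF cone c] A unfolding W_def by blast
    then have "weight (edge_weight c) (\<alpha> + \<beta>) + 1 \<le> weight (edge_weight c) A" using loose_cone_weight(1)[OF cone] by linarith
    then show "\<rho> A \<otimes> pp A \<in> cone_ideal c (\<alpha> + \<beta>) 1"
      by (intro ideal_facts(7)[OF ideal_cone_ideal _ rc] pp_in_cone_ideal[OF cone])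
  qed
  have head: "lincomb (\<lambda>A. \<rho> A \<ominus> (p \<otimes>\<^bsub>mpoly_ring R\<^esub> q) A) W \<in> cone_ideal c (\<alpha> + \<beta>) 1"
  proof (rule lincomb_in_ideal[OF ideal_cone_ideal])
    fix A assume A: "A \<in> W"
    have "mm +> \<rho> A = (if A \<in> SE then mm +> \<rho> A else \<zero>\<^bsub>R Quot mm\<^esub>)"
    proof (cases "A \<in> SE")
      case False
      then have "\<rho> A = \<zero>" using WSE[of A] A by (auto simp: S_def)
      then show ?thesis using zero False by simp
    qed simp
    also have "\<dots> = mm +> (p \<otimes>\<^bsub>mpoly_ring R\<^esub> q) A"
      unfolding residue_mpoly_mult[OF p(1) q(1)] p(3) q(3) GH ..
    finally have "\<rho> A \<ominus> (p \<otimes>\<^bsub>mpoly_ring R\<^esub> q) A \<in> mm" using coset_eq_iff[OF ideal_mm rc mc, of A A] by metis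
    then have m: "\<rho> A \<ominus> (p \<otimes>\<^bsub>mpoly_ring R\<^esub> q) A \<in> Idl (range x)" .
    have ol: "on_line c (\<alpha> + \<beta>) A" using A unfolding W_def by blast
    have "weight (edge_weight c) (\<alpha> + \<beta>) + 0 \<le> weight (edge_weight c) A" unfolding wline(1)[OF ol] by simp
    from scaled_pp_in_cone_ideal[where p=r and q=r', OF rr m wline(2)[OF ol] this]
    show "(\<rho> A \<ominus> (p \<otimes>\<^bsub>mpoly_ring R\<^esub> q) A) \<otimes> pp A \<in> cone_ideal c (\<alpha> + \<beta>) 1" unfolding One_nat_def .
  qed
  have lc: "lincomb \<rho> W \<in> carrier R" "lincomb \<rho> (S - W) \<in> carrier R" "lincomb (p \<otimes>\<^bsub>mpoly_ring R\<^esub> q) W \<in> carrier R"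
    using rc mc by simp_all
  have "f \<ominus> g \<otimes> h = lincomb (\<lambda>A. \<rho> A \<ominus> (p \<otimes>\<^bsub>mpoly_ring R\<^esub> q) A) W \<oplus> lincomb \<rho> (S - W)"
    unfolding gh f_split lincomb_diff[OF finW rc mc] by (rule sum_minus_swap[OF lc])
  then have start: "f \<ominus> g \<otimes> h \<in> cone_ideal c (\<alpha> + \<beta>) 1"
    using ideal_facts(4)[OF ideal_cone_ideal head tail] by (simp only:)
  have step: "\<exists>u\<in>cone_ideal c \<beta> w. \<exists>v\<in>cone_ideal c \<alpha> w. z \<ominus> (g \<otimes> u \<oplus> h \<otimes> v) \<in> cone_ideal c (\<alpha> + \<beta>) (Suc w)"
    if z: "z \<in> cone_ideal c (\<alpha> + \<beta>) w" for z w
    unfolding g_def h_def F_def F'_def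
  proof (rule cone_ideal_step[OF c p(1) _ _ q(1) _ _ _ z])
    show "finite {A. p A \<noteq> \<zero>}" "finite {A. q A \<noteq> \<zero>}" using fin unfolding F_def F'_def .
    show "on_line c \<alpha> A" if "p A \<noteq> \<zero>" for A using lineF[OF \<alpha>F(1)] that by (simp add: F_def)
    show "on_line c \<beta> A" if "q A \<noteq> \<zero>" for A using lineF'[OF \<alpha>F(2)] that by (simp add: F'_def)
    fix \<gamma> assume "\<gamma> \<in> loose_cone c (\<alpha> + \<beta>)"
    from K.coprime_line_support_combination[OF c G H line cop var \<alpha> \<beta> this]
    show "\<exists>U\<in>carrier (mpoly_ring (R Quot mm)). \<exists>V\<in>carrier (mpoly_ring (R Quot mm)).
      (\<forall>A. ((\<lambda>A. mm +> p A) \<otimes>\<^bsub>mpoly_ring (R Quot mm)\<^esub> U) A \<oplus>\<^bsub>R Quot mm\<^esub>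
         ((\<lambda>A. mm +> q A) \<otimes>\<^bsub>mpoly_ring (R Quot mm)\<^esub> V) A = (if A = \<gamma> then \<one>\<^bsub>R Quot mm\<^esub> else \<zero>\<^bsub>R Quot mm\<^esub>)) \<and>
      (\<forall>A. U A \<noteq> \<zero>\<^bsub>R Quot mm\<^esub> \<longrightarrow> (\<exists>k. \<forall>i. int (A $ i) + int (\<alpha> $ i) = int (\<gamma> $ i) + k * c i)) \<and>
      (\<forall>A. V A \<noteq> \<zero>\<^bsub>R Quot mm\<^esub> \<longrightarrow> (\<exists>k. \<forall>i. int (A $ i) + int (\<beta> $ i) = int (\<gamma> $ i) + k * c i))"
      unfolding p(3) q(3) .
  qed
  obtain s t where st: "adic_cauchy s" "adic_cauchy t" "to_completion R f = adic_limit s \<otimes>\<^bsub>Rhat\<^esub> adic_limit t"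
    "\<And>k. s k \<ominus> g \<in> weight_ideal (edge_weight c) (Suc (weight (edge_weight c) \<alpha>))"
    "\<And>k. t k \<ominus> h \<in> weight_ideal (edge_weight c) (Suc (weight (edge_weight c) \<beta>))"
    using hensel_limit[where p=r and q=r', OF rr f g h start step] by blast
  have G': "(\<lambda>A. mm +> p A) = G" "(\<lambda>A. mm +> q A) = H" using p(3) q(3) by auto
  have pnz: "p A \<noteq> \<zero> \<Longrightarrow> mm +> p A \<noteq> \<zero>\<^bsub>R Quot mm\<^esub>" "q A \<noteq> \<zero> \<Longrightarrow> mm +> q A \<noteq> \<zero>\<^bsub>R Quot mm\<^esub>" for A
    using p(2,3) q(2,3) by simp_all
  have wF: "p A \<noteq> \<zero> \<Longrightarrow> weight (edge_weight c) A = weight (edge_weight c) \<alpha>"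
    "q A \<noteq> \<zero> \<Longrightarrow> weight (edge_weight c) A = weight (edge_weight c) \<beta>" for A
    using wline(1)[OF lineF[OF \<alpha>F(1)]] wline(1)[OF lineF'[OF \<alpha>F(2)]] unfolding F_def F'_def by blast+
  have p\<alpha>: "p \<alpha> \<noteq> \<zero>" "q \<beta> \<noteq> \<zero>" using \<alpha>F by (simp_all add: F_def F'_def)
  note gface = completion_initial_form[OF lpos st(1) p(1) fin(1)[unfolded F_def] pnz(1) p\<alpha>(1) wF(1) st(4)[unfolded g_def F_def],
      unfolded G', folded F_def]
  note hface = completion_initial_form[OF lpos st(2) q(1) fin(2)[unfolded F'_def] pnz(2) p\<alpha>(2) wF(2) st(5)[unfolded h_def F'_def],
      unfolded G', folded F'_def]
  have "E = {a + b | a b. a \<in> convex hull (real_exponent ` F) \<and> b \<in> convex hull (real_exponent ` F')}" unfolding SE(3)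
  proof (rule edge_minkowski_sum[where c=c and p=r, OF rr(1) fin(1) _ lineF fin(2) _ lineF'])
    show "F \<noteq> {}" "F' \<noteq> {}" using \<alpha>F by auto
    show "\<exists>B\<in>F. \<exists>C\<in>F'. A = B + C" if "A \<in> SE" for A
    proof -
      have "\<exists>B C. B + C = A \<and> G B \<noteq> \<zero>\<^bsub>R Quot mm\<^esub> \<and> H C \<noteq> \<zero>\<^bsub>R Quot mm\<^esub>"
        by (rule K.mpoly_mult_nonzeroD[of G H A]) (use Gc(1) Hc(1) nz that in simp_all)
      then show ?thesis unfolding F_def F'_def mem_Collect_eq p(2) q(2) by blast
    qed
    fix B C assume BC: "B \<in> F" "C \<in> F'"
      and uniq: "\<And>B' C'. B' \<in> F \<Longrightarrow> C' \<in> F' \<Longrightarrow> B' + C' = B + C \<Longrightarrow> B' = B \<and> C' = C"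
    have "(G \<otimes>\<^bsub>mpoly_ring (R Quot mm)\<^esub> H) (B + C) = G B \<otimes>\<^bsub>R Quot mm\<^esub> H C"
      by (rule K.mpoly_mult_eq_single[of G H B C "B + C"])
        (use Gc(1) Hc(1) uniq in \<open>unfold F_def F'_def mem_Collect_eq p(2) q(2), blast+\<close>)
    also have "\<dots> \<noteq> \<zero>\<^bsub>R Quot mm\<^esub>"
      using K.integral[of "G B" "H C"] Gc(1) Hc(1) BC unfolding F_def F'_def mem_Collect_eq p(2) q(2) by blast
    finally show "B + C \<in> SE" using nz by blast
  qed
  moreover have "aff_dim (convex hull (real_exponent ` F)) \<le> 1" by (rule aff_dim_line_support[OF lineF])
  moreover have "aff_dim (convex hull (real_exponent ` F')) \<le> 1" by (rule aff_dim_line_support[OF lineF'])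
  ultimately show ?thesis using st(3) gface hface adic_limit_in_carrier[OF st(1)] adic_limit_in_carrier[OF st(2)]
    by (intro bexI[of _ "adic_limit s"] bexI[of _ "adic_limit t"] conjI
        exI[of _ "convex hull (real_exponent ` F)"] exI[of _ "convex hull (real_exponent ` F')"])
qed

end

section \<open>From regular local rings to the working locale\<close>

lemma SUP_enat_attained:
  assumes "(SUP k\<in>K. enat k) = enat n" "0 < n"
  shows "n \<in> K"
proof (rule ccontr)
  assume n: "n \<notin> K"
  have "(SUP k\<in>K. enat k) \<le> enat (n - 1)"
  proof (rule SUP_least)
    fix k assume k: "k \<in> K"
    have "enat k \<le> enat n" unfolding assms(1)[symmetric] by (rule SUP_upper[OF k])
    then have "k \<le> n" by simp
    moreover have "k \<noteq> n" using k n by blast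
    ultimately show "enat k \<le> enat (n - 1)" by simp
  qed
  then show False using assms by simp
qed

text \<open>The Krull dimension is the number of parameters, hence finite and positive; as a
  supremum of chain lengths it is then attained, which supplies the chain of primes.\<close>

lemma regular_local_parameter_ring:
  fixes x :: "'n::finite \<Rightarrow> 'a"
  assumes R: "regular_local_ring R" and x: "regular_system_of_parameters R x"
  shows "parameter_ring R x"
proof -
  have l: "cring R" "noetherian_ring R" "\<exists>!I. maximalideal I R"
    using R by (auto simp: regular_local_ring_def noetherian_local_ring_def)
  have xs: "range x \<subseteq> carrier R" "Idl\<^bsub>R\<^esub> (range x) = max_ideal R" "enat CARD('n) = krull_dim R"
    using x by (auto simp: regular_system_of_parameters_def)
  have "maximalideal M R \<longleftrightarrow> M = max_ideal R" for M
    using the1_equality[OF l(3)] theI'[OF l(3)] unfolding max_ideal_def by blast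
  then have "maximalideal M R \<longleftrightarrow> M = Idl\<^bsub>R\<^esub> (range x)" for M by (simp add: xs(2))
  moreover have "CARD('n) \<in> {k. \<exists>P :: nat \<Rightarrow> 'a set. (\<forall>i\<le>k. primeideal (P i) R) \<and> (\<forall>i<k. P i \<subset> P (Suc i))}"
    by (rule SUP_enat_attained) (use xs(3) in \<open>simp_all add: krull_dim_def\<close>)
  ultimately show ?thesis using l(1,2) xs(1)
    by (intro parameter_ring.intro cring_vars.intro noetherian_cring.intro parameter_ring_axioms.intro cring_vars_axioms.intro) auto
qed

theorem theorem1p1:
  fixes R :: "('a, 'b) ring_scheme"
    and x :: "'n::finite \<Rightarrow> 'a"
    and f :: 'a
    and E :: "(real ^ 'n) set"
    and G H :: "nat ^ 'n \<Rightarrow> 'a set"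
  assumes "regular_local_ring R"
    and "regular_system_of_parameters R x"
    and "f \<in> carrier R"
    and "loose_edge (newton_polyhedron R x f) E"
    and "G \<in> carrier (mpoly_ring (residue_field R))"
    and "H \<in> carrier (mpoly_ring (residue_field R))"
    and "initial_form R x f E = G \<otimes>\<^bsub>mpoly_ring (residue_field R)\<^esub> H"
    and "coprime_elements (mpoly_ring (residue_field R)) G H"
    and "\<And>i. \<not> mpoly_var (residue_field R) i divides\<^bsub>mpoly_ring (residue_field R)\<^esub> G"
  shows "\<exists>g \<in> carrier (adic_completion R). \<exists>h \<in> carrier (adic_completion R).
    to_completion R f = g \<otimes>\<^bsub>adic_completion R\<^esub> h \<and>
    (\<exists>E1 E2.
      compact_face (newton_polyhedron (adic_completion R) (to_completion R \<circ> x) g) E1 \<and>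
      aff_dim E1 \<le> 1 \<and>
      compact_face (newton_polyhedron (adic_completion R) (to_completion R \<circ> x) h) E2 \<and>
      aff_dim E2 \<le> 1 \<and>
      E = {a + b | a b. a \<in> E1 \<and> b \<in> E2} \<and>
      initial_form (adic_completion R) (to_completion R \<circ> x) g E1 = residue_to_completion R \<circ> G \<and>
      initial_form (adic_completion R) (to_completion R \<circ> x) h E2 = residue_to_completion R \<circ> H)"
proof -
  interpret parameter_ring R x by (rule regular_local_parameter_ring[OF assms(1,2)])
  have "residue_field R = R Quot Idl\<^bsub>R\<^esub> (range x)" by (simp add: residue_field_def max_ideal_eq)
  from loose_edge_factorization[OF assms(3,4), folded this, OF assms(5-9)] show ?thesis .
qed

end
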